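(* Let $g\colon U\to\mathbb{C}$ be a marked map with respect to $c_1$ such that $P=\{c_n\}_{n\ge1}$, $c_n=g^{n-1}(c_1)$, is infinite and $c_n$ converges to a periodic orbit $\mathcal{O}=\{a_0,a_1,\dots,a_{q-1}\}$ of $g$ of period $q$ with multiplier $\kappa=Dg^q(a_0)$, and let $(g,G)_W$ be a local holomorphic deformation of $g$. Assume that $\mathcal{O}$ is either hyperbolic attracting or non-degenerate parabolic, and that $(g,G)_W$ satisfies the lifting property for $P_{r_0}=P\cup\Omega_{r_0}$ for some $r_0>0$. Let $Q(z)=\frac{d}{dw}G_w^q(z)\big|_{w=c_1}$. Then one has (1) either the transversality property $$D^2g^q(a_0)\,Q(a_0)\neq Q'(a_0)(\kappa-1);$$ (2) or persistency of periodic points with the same multiplier: there is a neighborhood $W_1$ of $c_1$ and holomorphic functions $a_j(w)$ defined in $W_1$ with $a_j(c_1)=a_j$ ($0\le j\le q-1$) such that for each $w\in W_1$, $G_w^q(a_j(w))=a_j(w)$ and $DG_w^q(a_0(w))=\kappa$ is constant.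
   Context: Notation: $D=\partial/\partial z$, $D^k=\partial^k/\partial z^k$; $B(a,r)=\{w\in\mathbb{C}:|w-a|<r\}$; $\mathbb{D}_r=B(0,r)$, $\mathbb{D}=\mathbb{D}_1$; $d$ is Euclidean distance. Marked map: $U\subset\mathbb{C}$ open, $g\colon U\to\mathbb{C}$ holomorphic, $c_1\in U$; $g$ is a marked map w.r.t. $c_1$ if $c_n=g^{n-1}(c_1)$ is well defined for all $n\ge1$ and $\overline{P}\subset U$ where $P=\{c_n\}_{n=1}^\infty$. Local holomorphic deformation $(g,G)_W$: $W$ is an open connected subset of $\mathbb{C}$ containing $c_1$; $G\colon W\times U\to\mathbb{C}$, $(w,z)\mapsto G_w(z)$, is holomorphic with $G_{c_1}=g$; and $DG_w(z)\ne0$ for all $z\in U$, $w\in W$. ($c_1$ is a point of both the dynamical and the parameter space.) Holomorphic motion of a set $X\subset\mathbb{C}$ over $(\Lambda,0)$, $\Lambda\subset\mathbb{C}$ a domain containing $0$: maps $h_\lambda\colon X\to\mathbb{C}$, $\lambda\in\Lambda$, with $h_0=\mathrm{id}$, each $h_\lambda$ injective, and $\lambda\mapsto h_\lambda(x)$ holomorphic for each $x\in X$. Lift: let $K$ be a bounded set with $P\subset K\subset\overline{K}\subset U$ and $g(K)\subset K$. Given a holomorphic motion $h_\lambda$ of $K$ over $(\Lambda,0)$, a holomorphic motion $\hat h_\lambda$ of $K$ over $(\Lambda_0,0)$, $\Lambda_0\subset\Lambda$, is a lift of $h_\lambda$ for $(g,G)_W$ if $G_{h_\lambda(c_1)}(\hat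 h_\lambda(x))=h_\lambda(g(x))$ for all $\lambda\in\Lambda_0$, $x\in K$. Lifting property for $K$: given any holomorphic motion $h^{(0)}_\lambda$ of $K$ over $(\Lambda,0)$, there exist $\varepsilon>0$ and holomorphic motions $h^{(n)}_\lambda$, $n=1,2,\dots$, of $K$ over $(\mathbb{D}_\varepsilon,0)$ such that for each $n\ge0$: (1) $h^{(n)}_\lambda(c_1)\in W$ for all $\lambda\in\mathbb{D}_\varepsilon$; (2) $h^{(n+1)}_\lambda$ is the lift of $h^{(n)}_\lambda$ over $(\mathbb{D}_\varepsilon,0)$ for $(g,G)_W$; (3) there is $M>0$ with $|h^{(n)}_\lambda(x)|\le M$ for all $x\in K$, $\lambda\in\mathbb{D}_\varepsilon$, $n\ge0$. $\mathcal{O}$ is hyperbolic attracting if $\kappa\in\mathbb{D}\setminus\{0\}$; it is non-degenerate parabolic if there are $l,p\in\mathbb{Z}$, $p\ge1$, $(l,p)=1$, with $\kappa=e^{2\pi il/p}$ and $D^{p+1}g^{pq}(a_0)\ne0$. $\Omega_r$ ($r>0$) is the set of $z\in U$ all of whose forward iterates under $g$ are defined, with $\sup_{n\ge0}d(g^n(z),\mathcal{O})\le r$ and $\lim_{n\to\infty}d(g^n(z),\mathcal{O})=0$. *)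

theory Defs
  imports "HOL-Complex_Analysis.Complex_Analysis"
begin

text \<open>Partially defined maps \<open>U \<rightarrow> \<complex>\<close> are represented by total functions together with the
  set \<open>U\<close>; wherever an iterate or a composition is written down, the points at which the map is
  evaluated are explicitly required to lie in its domain.\<close>

definition iterate_defined :: "complex set \<Rightarrow> (complex \<Rightarrow> complex) \<Rightarrow> nat \<Rightarrow> complex \<Rightarrow> bool" where
  "iterate_defined U f n z \<longleftrightarrow> (\<forall>k<n. (f ^^ k) z \<in> U)"

text \<open>Holomorphy in two complex variables: the derivative exists and is complex linear.\<close>

definition holomorphic2_on :: "(complex \<Rightarrow> complex \<Rightarrow> complex) \<Rightarrow> (complex \<times> complex) set \<Rightarrow> bool" where
  "holomorphic2_on F S \<longleftrightarrow>
     (\<forall>p\<in>S. \<exists>a b. ((\<lambda>(w, z). F w z) has_derivative (\<lambda>(s, t). a * s + b * t)) (at p within S))"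

text \<open>Index shift: \<open>c\<^sub>n\<^sub>+\<^sub>1\<close> is \<open>(g ^^ n) c\<^sub>1\<close>.\<close>

definition marked_orbit :: "(complex \<Rightarrow> complex) \<Rightarrow> complex \<Rightarrow> complex set" where
  "marked_orbit g c1 = range (\<lambda>n. (g ^^ n) c1)"

definition marked_map :: "complex set \<Rightarrow> (complex \<Rightarrow> complex) \<Rightarrow> complex \<Rightarrow> bool" where
  "marked_map U g c1 \<longleftrightarrow>
     open U \<and> g holomorphic_on U \<and> c1 \<in> U \<and>
     (\<forall>n. iterate_defined U g n c1) \<and> closure (marked_orbit g c1) \<subseteq> U"

definition local_holomorphic_deformation ::
  "complex set \<Rightarrow> (complex \<Rightarrow> complex) \<Rightarrow> complex \<Rightarrow> complex set \<Rightarrow> (complex \<Rightarrow> complex \<Rightarrow> complex) \<Rightarrow> bool" where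
  "local_holomorphic_deformation U g c1 W G \<longleftrightarrow>
     open W \<and> connected W \<and> c1 \<in> W \<and>
     holomorphic2_on G (W \<times> U) \<and>
     (\<forall>z\<in>U. G c1 z = g z) \<and>
     (\<forall>w\<in>W. \<forall>z\<in>U. deriv (G w) z \<noteq> 0)"

definition holomorphic_motion ::
  "complex set \<Rightarrow> complex set \<Rightarrow> (complex \<Rightarrow> complex \<Rightarrow> complex) \<Rightarrow> bool" where
  "holomorphic_motion X L h \<longleftrightarrow>
     open L \<and> connected L \<and> 0 \<in> L \<and>
     (\<forall>x\<in>X. h 0 x = x) \<and>
     (\<forall>l\<in>L. inj_on (h l) X) \<and>
     (\<forall>x\<in>X. (\<lambda>l. h l x) holomorphic_on L)"

text \<open>\<open>h'\<close>, over \<open>L0\<close>, is a lift of \<open>h\<close>, over \<open>L\<close>. The conditions involving \<open>W\<close> and \<open>U\<close> say that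
  the left-hand side of the functional equation is defined.\<close>

definition is_lift ::
  "complex set \<Rightarrow> (complex \<Rightarrow> complex) \<Rightarrow> complex \<Rightarrow> complex set \<Rightarrow> (complex \<Rightarrow> complex \<Rightarrow> complex) \<Rightarrow>
   complex set \<Rightarrow> complex set \<Rightarrow> (complex \<Rightarrow> complex \<Rightarrow> complex) \<Rightarrow>
   complex set \<Rightarrow> (complex \<Rightarrow> complex \<Rightarrow> complex) \<Rightarrow> bool" where
  "is_lift U g c1 W G K L h L0 h' \<longleftrightarrow>
     holomorphic_motion K L h \<and> holomorphic_motion K L0 h' \<and> L0 \<subseteq> L \<and>
     (\<forall>l\<in>L0. h l c1 \<in> W \<and>
       (\<forall>x\<in>K. h' l x \<in> U \<and> G (h l c1) (h' l x) = h l (g x)))"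

text \<open>The first four conjuncts are the conditions on \<open>K\<close> under which lifts are considered at all.
  The motion \<open>h 0\<close> is the given one, restricted to the disc.\<close>

definition lifting_property ::
  "complex set \<Rightarrow> (complex \<Rightarrow> complex) \<Rightarrow> complex \<Rightarrow> complex set \<Rightarrow> (complex \<Rightarrow> complex \<Rightarrow> complex) \<Rightarrow>
   complex set \<Rightarrow> bool" where
  "lifting_property U g c1 W G K \<longleftrightarrow>
     bounded K \<and> marked_orbit g c1 \<subseteq> K \<and> closure K \<subseteq> U \<and> g ` K \<subseteq> K \<and>
     (\<forall>L h0. holomorphic_motion K L h0 \<longrightarrow>
       (\<exists>\<epsilon>>0. \<exists>h :: nat \<Rightarrow> complex \<Rightarrow> complex \<Rightarrow> complex.
          ball 0 \<epsilon> \<subseteq> L \<and> h 0 = h0 \<and>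
          (\<forall>n. \<forall>l\<in>ball 0 \<epsilon>. h n l c1 \<in> W) \<and>
          (\<forall>n. is_lift U g c1 W G K (ball 0 \<epsilon>) (h n) (ball 0 \<epsilon>) (h (Suc n))) \<and>
          (\<exists>M>0. \<forall>n. \<forall>l\<in>ball 0 \<epsilon>. \<forall>x\<in>K. norm (h n l x) \<le> M)))"

text \<open>\<open>a 0, \<dots>, a (q - 1)\<close>, in dynamical order, is a periodic orbit of exact period \<open>q\<close>.\<close>

definition periodic_orbit :: "complex set \<Rightarrow> (complex \<Rightarrow> complex) \<Rightarrow> nat \<Rightarrow> (nat \<Rightarrow> complex) \<Rightarrow> bool" where
  "periodic_orbit U g q a \<longleftrightarrow>
     q \<ge> 1 \<and> a ` {..<q} \<subseteq> U \<and> inj_on a {..<q} \<and> (\<forall>j<q. g (a j) = a (Suc j mod q))"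

definition hyperbolic_attracting :: "complex \<Rightarrow> bool" where
  "hyperbolic_attracting \<kappa> \<longleftrightarrow> \<kappa> \<in> ball 0 1 - {0}"

definition nondegenerate_parabolic :: "(complex \<Rightarrow> complex) \<Rightarrow> nat \<Rightarrow> complex \<Rightarrow> complex \<Rightarrow> bool" where
  "nondegenerate_parabolic g q a0 \<kappa> \<longleftrightarrow>
     (\<exists>(l::int) (p::nat). p \<ge> 1 \<and> coprime l (int p) \<and>
        \<kappa> = exp (2 * of_real pi * \<i> * of_int l / of_nat p) \<and>
        (deriv ^^ (p + 1)) (g ^^ (p * q)) a0 \<noteq> 0)"

definition Omega :: "complex set \<Rightarrow> (complex \<Rightarrow> complex) \<Rightarrow> complex set \<Rightarrow> real \<Rightarrow> complex set" where
  "Omega U g Orb r =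
     {z\<in>U. (\<forall>n. iterate_defined U g n z) \<and>
           (\<forall>n. infdist ((g ^^ n) z) Orb \<le> r) \<and>
           (\<lambda>n. infdist ((g ^^ n) z) Orb) \<longlonglongrightarrow> 0}"

end

theory Submission
  imports Defs
begin

text \<open>Suppose that transversality fails. The implicit function theorem continues the periodic point
  \<open>a 0\<close> (if \<open>\<kappa> \<noteq> 1\<close>), respectively the point at which the return map has derivative \<open>1\<close> (if
  \<open>\<kappa> = 1\<close>), to a holomorphic function of the parameter, and failure of transversality says that
  the change of the multiplier, respectively the displacement, vanishes to order at least two. If it
  vanishes identically, the cycle persists. Otherwise it has an exact order \<open>M \<ge> 2\<close>, and lifting
  polynomial holomorphic motions which follow the parameter dependence of the orbit up to order
  \<open>M\<close> and averaging the lifts produces, up to \<open>O(1/N)\<close>, a bounded solution of the variational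
  equation along the orbit. In the parabolic case the coefficients of order \<open>M\<close> of the orbit of
  \<open>c1\<close> then stay bounded, whereas the normal form of the return map forces them to diverge. In the
  attracting case the solution is holomorphic in the Koenigs coordinate on an open set of
  \<open>Omega\<close>, and differentiating the equation at the fixed point shows that the leading coefficient
  is zero.\<close>

section \<open>Holomorphic functions of two variables\<close>

text \<open>The lifting property speaks of holomorphic motions of the whole set \<open>K\<close>, so
  what is known about the orbit has to be fed in as a motion. A polynomial in the motion parameter
  whose coefficients depend on the point is injective for small parameters once the coefficients are
  Lipschitz; this is the obstacle behind most estimates on Taylor coefficients. It is delicate in
  the parabolic case, where the orbit approaches a point of the cycle along several branches: along
  one branch increments are summed against the decrease of the modulus, and different branches are
  kept apart by their directions. The recursion for the lifts contains the unknown motion of the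
  parameter through the value at \<open>c1\<close>; it is absorbed into a multiple of the
  first-order variation, and order at least two is what makes this variation satisfy the unperturbed
  linear equation. Only the orbit itself is lifted in the parabolic case, because divergence of its
  coefficients is contradiction enough; in the attracting case the averaged solution is
  differentiated at the fixed point and therefore needs an open set, which \<open>Omega\<close>
  provides.\<close>

lemma holomorphic2_on_has_derivative:
  assumes F: "holomorphic2_on F S" and S: "open S" and wz: "(w, z) \<in> S"
  shows "((\<lambda>(w, z). F w z) has_derivative
           (\<lambda>(s, t). deriv (\<lambda>w. F w z) w * s + deriv (F w) z * t)) (at (w, z))"
proof -
  obtain a b where ab: "((\<lambda>(w, z). F w z) has_derivative (\<lambda>(s, t). a * s + b * t)) (at (w, z))"
    using F wz S unfolding holomorphic2_on_def by (metis at_within_open)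
  have "((\<lambda>x. (x, z)) has_derivative (\<lambda>h. (h, 0))) (at w)"
    by (auto intro!: derivative_eq_intros)
  from diff_chain_at[OF this ab] have "((\<lambda>w. F w z) has_field_derivative a) (at w)"
    by (simp add: o_def has_field_derivative_def)
  then have a: "deriv (\<lambda>w. F w z) w = a" by (rule DERIV_imp_deriv)
  have "((\<lambda>x. (w, x)) has_derivative (\<lambda>h. (0, h))) (at z)"
    by (auto intro!: derivative_eq_intros)
  from diff_chain_at[OF this ab] have "(F w has_field_derivative b) (at z)"
    by (simp add: o_def has_field_derivative_def)
  then have b: "deriv (F w) z = b" by (rule DERIV_imp_deriv)
  show ?thesis using ab by (simp add: a b)
qed

lemma holomorphic2_on_chain:
  assumes F: "holomorphic2_on F S" and S: "open S"
    and \<alpha>: "(\<alpha> has_field_derivative \<alpha>') (at x)" and \<beta>: "(\<beta> has_field_derivative \<beta>') (at x)"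
    and in_S: "(\<alpha> x, \<beta> x) \<in> S"
  shows "((\<lambda>x. F (\<alpha> x) (\<beta> x)) has_field_derivative
            deriv (\<lambda>w. F w (\<beta> x)) (\<alpha> x) * \<alpha>' + deriv (F (\<alpha> x)) (\<beta> x) * \<beta>') (at x)"
proof -
  have "((\<lambda>x. (\<alpha> x, \<beta> x)) has_derivative (\<lambda>h. (\<alpha>' * h, \<beta>' * h))) (at x)"
    using \<alpha> \<beta> unfolding has_field_derivative_def by (rule has_derivative_Pair)
  from diff_chain_at[OF this holomorphic2_on_has_derivative[OF F S in_S]]
  have "((\<lambda>x. F (\<alpha> x) (\<beta> x)) has_derivative
     (\<lambda>h. deriv (\<lambda>w. F w (\<beta> x)) (\<alpha> x) * (\<alpha>' * h) + deriv (F (\<alpha> x)) (\<beta> x) * (\<beta>' * h))) (at x)"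
    by (simp add: o_def)
  then show ?thesis
    unfolding has_field_derivative_def
    by (rule back_subst[of "\<lambda>d. (_ has_derivative d) _"]) (auto simp: algebra_simps)
qed

lemma holomorphic2_on_imp_continuous_on:
  "holomorphic2_on F S \<Longrightarrow> continuous_on S (\<lambda>(w, z). F w z)"
  unfolding holomorphic2_on_def
  by (meson continuous_on_eq_continuous_within has_derivative_continuous)

lemma holomorphic2_on_subset: "holomorphic2_on F S \<Longrightarrow> T \<subseteq> S \<Longrightarrow> holomorphic2_on F T"
  unfolding holomorphic2_on_def using has_derivative_subset by blast

lemma holomorphic2_on_snd:
  assumes "holomorphic2_on F S" "open S" "(w, z) \<in> S"
  shows "F w field_differentiable at z"
  using holomorphic2_on_chain[OF assms(1,2) DERIV_const[of w] DERIV_ident, of z] assms(3)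
  by (auto simp: field_differentiable_def)

lemma holomorphic2_on_fst:
  assumes "holomorphic2_on F S" "open S" "(w, z) \<in> S"
  shows "(\<lambda>w. F w z) field_differentiable at w"
  using holomorphic2_on_chain[OF assms(1,2) DERIV_ident DERIV_const[of z], of w] assms(3)
  by (auto simp: field_differentiable_def)

lemma holomorphic2_on_holomorphic_compose:
  assumes F: "holomorphic2_on F S" "open S" and A: "open A"
    and "\<alpha> holomorphic_on A" "\<beta> holomorphic_on A" "\<And>x. x \<in> A \<Longrightarrow> (\<alpha> x, \<beta> x) \<in> S"
  shows "(\<lambda>x. F (\<alpha> x) (\<beta> x)) holomorphic_on A"
proof -
  have "(\<lambda>x. F (\<alpha> x) (\<beta> x)) field_differentiable at x" if "x \<in> A" for x
    using holomorphic2_on_chain[OF F holomorphic_derivI[OF assms(4) A that]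
        holomorphic_derivI[OF assms(5) A that]] assms(6)[OF that]
    by (auto simp: field_differentiable_def)
  then show ?thesis using A by (simp add: holomorphic_on_open field_differentiable_def)
qed

lemma field_differentiable_imp_holomorphic_on:
  "(\<And>z. z \<in> S \<Longrightarrow> f field_differentiable at z) \<Longrightarrow> f holomorphic_on S"
  unfolding holomorphic_on_def using field_differentiable_at_within by blast

lemma open_Times_cball_subset:
  fixes w z :: complex
  assumes "open S" "(w, z) \<in> S"
  obtains r where "r > 0" "cball w r \<times> cball z r \<subseteq> S"
proof -
  obtain A B where AB: "open A" "open B" "(w, z) \<in> A \<times> B" "A \<times> B \<subseteq> S"
    using assms by (metis open_prod_elim)
  obtain r1 r2 where r: "r1 > 0" "cball w r1 \<subseteq> A" "r2 > 0" "cball z r2 \<subseteq> B"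
    using AB open_contains_cball by (metis mem_Sigma_iff)
  have "cball w (min r1 r2) \<times> cball z (min r1 r2) \<subseteq> S" using r AB(4) by fastforce
  with r that[of "min r1 r2"] show thesis by simp
qed

text \<open>The hypotheses are those available before joint holomorphy is known, so that the result
  can serve in Osgood's lemma. Two nearby slices differ uniformly little on a fixed disc, and
  Cauchy's inequality passes this on to their derivatives.\<close>

lemma continuous_on_deriv_snd:
  fixes F :: "complex \<Rightarrow> complex \<Rightarrow> complex"
  assumes S: "open S" and cont: "continuous_on S (\<lambda>(w, z). F w z)"
    and diff: "\<And>w z. (w, z) \<in> S \<Longrightarrow> F w field_differentiable at z"
  shows "continuous_on S (\<lambda>(w, z). deriv (F w) z)"
unfolding continuous_on_eq_continuous_at[OF S]
proof
  fix p assume "p \<in> S"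
  obtain w0 z0 where p: "p = (w0, z0)" by force
  obtain r where r: "r > 0" "cball w0 r \<times> cball z0 r \<subseteq> S"
    using \<open>p \<in> S\<close> unfolding p by (rule open_Times_cball_subset[OF S])
  have hol: "F w holomorphic_on ball z0 r" if "w \<in> cball w0 r" for w
    unfolding holomorphic_on_def
  proof
    fix z assume "z \<in> ball z0 r"
    then have "(w, z) \<in> S" by (intro subsetD[OF r(2)]) (use that in auto)
    then show "F w field_differentiable at z within ball z0 r"
      by (rule field_differentiable_at_within[OF diff])
  qed
  show "isCont (\<lambda>(w, z). deriv (F w) z) p"
    unfolding continuous_at_eps_delta
  proof (intro allI impI)
    fix e :: real assume e: "e > 0"
    have "uniformly_continuous_on (cball w0 r \<times> cball z0 r) (\<lambda>(w, z). F w z)"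
      by (intro compact_uniformly_continuous continuous_on_subset[OF cont] r compact_Times) auto
    moreover have "e * r / 8 > 0" using e r by simp
    ultimately obtain d1 where d1: "d1 > 0"
      "\<And>x y. x \<in> cball w0 r \<times> cball z0 r \<Longrightarrow> y \<in> cball w0 r \<times> cball z0 r \<Longrightarrow> dist y x < d1 \<Longrightarrow>
         dist (case y of (w, z) \<Rightarrow> F w z) (case x of (w, z) \<Rightarrow> F w z) < e * r / 8"
      unfolding uniformly_continuous_on_def by blast
    have "isCont (deriv (F w0)) z0"
    proof -
      have "continuous_on (ball z0 r) (deriv (F w0))"
        using hol[of w0] r by (intro holomorphic_on_imp_continuous_on holomorphic_deriv) auto
      then show ?thesis using r by (simp add: continuous_on_eq_continuous_at)
    qed
    then obtain d2 where d2: "d2 > 0" "\<And>z. dist z z0 < d2 \<Longrightarrow> dist (deriv (F w0) z) (deriv (F w0) z0) < e / 2"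
      unfolding continuous_at_eps_delta using e by (metis half_gt_zero)
    define d where "d = Min {d1, d2, r / 2}"
    show "\<exists>d>0. \<forall>x'. dist x' p < d \<longrightarrow>
             dist (case x' of (w, z) \<Rightarrow> deriv (F w) z) (case p of (w, z) \<Rightarrow> deriv (F w) z) < e"
    proof (intro exI[of _ d] conjI allI impI)
      show "d > 0" using d1 d2 r by (simp add: d_def)
      fix x' assume x': "dist x' p < d"
      obtain w z where wz: "x' = (w, z)" by force
      have dw: "dist w w0 < d" and dz: "dist z z0 < d"
        using x' dist_fst_le[of x' p] dist_snd_le[of x' p] by (auto simp: wz p)
      have w_in: "w \<in> cball w0 r" using dw r by (auto simp: d_def dist_commute)
      have sub: "cball z (r / 2) \<subseteq> ball z0 r"
      proof
        fix u assume "u \<in> cball z (r / 2)"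
        then show "u \<in> ball z0 r" using dz dist_triangle[of z0 u z] by (auto simp: d_def dist_commute)
      qed
      \<comment> \<open>On a circle of radius \<open>r / 2\<close> the bound
        \<open>e * r / 8\<close> for the slices becomes \<open>e / 4\<close> for the derivatives,
        which leaves room for the variation \<open>e / 2\<close> of
        \<open>deriv (F w0)\<close>.\<close>
      have "norm ((deriv ^^ 1) (\<lambda>u. F w u - F w0 u) z) \<le> fact 1 * (e * r / 8) / (r / 2) ^ 1"
      proof (rule Cauchy_inequality)
        show "(\<lambda>u. F w u - F w0 u) holomorphic_on ball z (r / 2)"
          using sub hol[OF w_in] hol[of w0] r
          by (intro holomorphic_intros) (auto elim!: holomorphic_on_subset)
        show "continuous_on (cball z (r / 2)) (\<lambda>u. F w u - F w0 u)"
          using sub hol[OF w_in] hol[of w0] r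
          by (intro continuous_intros) (auto intro!: continuous_on_subset[OF holomorphic_on_imp_continuous_on _])
        fix u assume "norm (z - u) = r / 2"
        then have "u \<in> cball z (r / 2)" by (simp add: dist_norm)
        then have "u \<in> cball z0 r" using sub ball_subset_cball by blast
        then have "dist (F w u) (F w0 u) < e * r / 8"
          using d1(2)[of "(w0, u)" "(w, u)"] w_in r dw by (auto simp: dist_Pair_Pair d_def)
        then show "norm (F w u - F w0 u) \<le> e * r / 8" by (simp add: dist_norm)
      qed (use r in auto)
      then have "norm (deriv (\<lambda>u. F w u - F w0 u) z) \<le> e / 4" using r by (simp add: field_simps)
      moreover have "deriv (\<lambda>u. F w u - F w0 u) z = deriv (F w) z - deriv (F w0) z"
      proof (rule deriv_diff)
        have z_in: "z \<in> cball z0 r" using dz r by (auto simp: d_def dist_commute)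
        show "F w field_differentiable at z" "F w0 field_differentiable at z"
          using r w_in z_in by (intro diff subsetD[OF r(2)]; simp)+
      qed
      moreover have "dist (deriv (F w0) z) (deriv (F w0) z0) < e / 2"
        using d2(2) dz by (simp add: d_def)
      ultimately have "norm (deriv (F w) z - deriv (F w0) z0) < e"
        using e norm_triangle_ineq[of "deriv (F w) z - deriv (F w0) z" "deriv (F w0) z - deriv (F w0) z0"]
        by (simp add: dist_norm)
      then show "dist (case x' of (w, z) \<Rightarrow> deriv (F w) z) (case p of (w, z) \<Rightarrow> deriv (F w) z) < e"
        by (simp add: wz p dist_norm)
    qed
  qed
qed

text \<open>Osgood's lemma.\<close>

lemma holomorphic2_onI:
  assumes S: "open S" and cont: "continuous_on S (\<lambda>(w, z). F w z)"
    and diff1: "\<And>w z. (w, z) \<in> S \<Longrightarrow> (\<lambda>w. F w z) field_differentiable at w"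
    and diff2: "\<And>w z. (w, z) \<in> S \<Longrightarrow> F w field_differentiable at z"
  shows "holomorphic2_on F S"
  unfolding holomorphic2_on_def
proof
  fix p assume "p \<in> S"
  obtain w0 z0 where p: "p = (w0, z0)" by force
  obtain r where r: "r > 0" "cball w0 r \<times> cball z0 r \<subseteq> S"
    using \<open>p \<in> S\<close> unfolding p by (rule open_Times_cball_subset[OF S])
  have "ball w0 r \<times> ball z0 r \<subseteq> cball w0 r \<times> cball z0 r" by auto
  with r have sub: "ball w0 r \<times> ball z0 r \<subseteq> S" by blast
  have "((\<lambda>(w, z). F w z) has_derivative
     (\<lambda>(tx, ty). deriv (\<lambda>w. F w z0) w0 * tx + blinfun_mult_right (deriv (F w0) z0) ty))
     (at (w0, z0) within ball w0 r \<times> ball z0 r)"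
  proof (rule has_derivative_partialsI)
    show "((\<lambda>x. F x z0) has_derivative (*) (deriv (\<lambda>w. F w z0) w0)) (at w0 within ball w0 r)"
      using diff1[of w0 z0] \<open>p \<in> S\<close> p
      by (meson DERIV_deriv_iff_field_differentiable has_derivative_at_withinI has_field_derivative_def)
    show "(F x has_derivative blinfun_apply (blinfun_mult_right (deriv (F x) y))) (at y within ball z0 r)"
      if "x \<in> ball w0 r" "y \<in> ball z0 r" for x y
      using diff2[of x y] sub that
    proof -
      have "(F x has_field_derivative deriv (F x) y) (at y)"
        unfolding DERIV_deriv_iff_field_differentiable by (intro diff2 subsetD[OF sub]) (use that in auto)
      then show ?thesis
        unfolding blinfun_mult_right.rep_eq has_field_derivative_def by (rule has_derivative_at_withinI)
    qed
    have "continuous_on S (\<lambda>x. blinfun_mult_right ((\<lambda>(w, z). deriv (F w) z) x))"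
      by (rule bounded_linear.continuous_on[OF bounded_linear_blinfun_mult_right continuous_on_deriv_snd])
         (use S cont diff2 in auto)
    then have "isCont (\<lambda>x. blinfun_mult_right ((\<lambda>(w, z). deriv (F w) z) x)) (w0, z0)"
      using S \<open>p \<in> S\<close> p by (metis continuous_on_eq_continuous_at)
    then show "continuous (at (w0, z0) within ball w0 r \<times> ball z0 r) (\<lambda>(w, z). blinfun_mult_right (deriv (F w) z))"
      by (simp add: continuous_at_imp_continuous_at_within case_prod_unfold)
  qed (use r in auto)
  then have "((\<lambda>(w, z). F w z) has_derivative
     (\<lambda>(s, t). deriv (\<lambda>w. F w z0) w0 * s + deriv (F w0) z0 * t)) (at (w0, z0))"
    using at_within_open[of "(w0, z0)" "ball w0 r \<times> ball z0 r"] r by (simp add: open_Times)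
  then show "\<exists>a b. ((\<lambda>(w, z). F w z) has_derivative (\<lambda>(s, t). a * s + b * t)) (at p within S)"
    using p has_derivative_at_withinI by blast
qed

lemma holomorphic2_on_swap:
  assumes F: "holomorphic2_on F S" and S: "open S"
  shows "holomorphic2_on (\<lambda>z w. F w z) (prod.swap ` S)" and "open (prod.swap ` S)"
proof -
  have im: "prod.swap ` S = prod.swap -` S" by force
  show o: "open (prod.swap ` S)"
    unfolding im by (intro open_vimage S continuous_on_swap)
  show "holomorphic2_on (\<lambda>z w. F w z) (prod.swap ` S)"
  proof (rule holomorphic2_onI[OF o])
    have "continuous_on (prod.swap ` S) (\<lambda>p. (\<lambda>(w, z). F w z) (prod.swap p))"
      by (rule continuous_on_compose2[OF holomorphic2_on_imp_continuous_on[OF F] continuous_on_swap]) auto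
    then show "continuous_on (prod.swap ` S) (\<lambda>(z, w). F w z)" by (simp add: case_prod_unfold)
  qed (use holomorphic2_on_fst[OF F S] holomorphic2_on_snd[OF F S] in auto)
qed

text \<open>A partial derivative is exhibited as a uniform limit of functions that are holomorphic
  in the other variable. Weierstrass' theorems then give both its holomorphy in that variable and
  the equality of the mixed derivatives.\<close>

lemma quotient_uniform_limit_deriv:
  assumes F: "holomorphic2_on F S" and S: "open S" and C: "compact C"
    and r: "r > 0" "cball w0 r \<times> C \<subseteq> S" and h: "h \<longlonglongrightarrow> 0" "\<And>n. h n \<noteq> (0::complex)"
  shows "uniform_limit C (\<lambda>n z. (F (w0 + h n) z - F w0 z) / h n) (\<lambda>z. deriv (\<lambda>w. F w z) w0) sequentially"
proof (rule uniform_limitI)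
  fix e :: real assume e: "e > 0"
  define D where "D = (\<lambda>w z. deriv (\<lambda>w. F w z) w)"
  have "continuous_on S (\<lambda>p. D (fst p) (snd p))"
  proof -
    have "continuous_on (prod.swap ` S) (\<lambda>(z, w). deriv (\<lambda>w. F w z) w)"
      by (rule continuous_on_deriv_snd)
         (use holomorphic2_on_swap[OF F S] holomorphic2_on_imp_continuous_on holomorphic2_on_snd in blast)+
    from continuous_on_compose2[OF this continuous_on_swap[of S]] show ?thesis
      by (simp add: case_prod_unfold D_def)
  qed
  then have "uniformly_continuous_on (cball w0 r \<times> C) (\<lambda>p. D (fst p) (snd p))"
    by (intro compact_uniformly_continuous compact_Times C compact_cball) (use r continuous_on_subset in blast)+
  then obtain d where d: "d > 0"
      "\<And>x y. x \<in> cball w0 r \<times> C \<Longrightarrow> y \<in> cball w0 r \<times> C \<Longrightarrow> dist y x < d \<Longrightarrow>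
         dist (D (fst y) (snd y)) (D (fst x) (snd x)) < e / 2"
    unfolding uniformly_continuous_on_def using e by (metis half_gt_zero)
  have "\<forall>\<^sub>F n in sequentially. norm (h n) < min d r"
    using tendstoD[OF h(1), of "min d r"] d r by simp
  then show "\<forall>\<^sub>F n in sequentially. \<forall>z\<in>C. dist ((F (w0 + h n) z - F w0 z) / h n) (deriv (\<lambda>w. F w z) w0) < e"
  proof eventually_elim
    case (elim n)
    show ?case
    proof
      fix z assume z: "z \<in> C"
      define B where "B = ball w0 (min d r)"
      have inS: "(w, z) \<in> S" if "w \<in> B" for w
        by (rule subsetD[OF r(2)]) (use that z in \<open>auto simp: B_def\<close>)
      \<comment> \<open>Subtracting the linear part at \<open>w0\<close> leaves a function of
        \<open>w\<close> whose derivative \<open>D w z - D w0 z\<close> is small uniformly in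
        \<open>z\<close>; the mean value inequality gives the rest.\<close>
      have "norm ((\<lambda>w. F w z - D w0 z * w) (w0 + h n) - (\<lambda>w. F w z - D w0 z * w) w0) \<le> e / 2 * norm (w0 + h n - w0)"
      proof (rule field_differentiable_bound[of B])
        fix w assume w: "w \<in> B"
        show "((\<lambda>w. F w z - D w0 z * w) has_field_derivative (D w z - D w0 z)) (at w within B)"
          using holomorphic2_on_fst[OF F S inS[OF w]]
          by (auto simp: D_def DERIV_deriv_iff_field_differentiable[symmetric]
              intro!: derivative_eq_intros intro: has_field_derivative_at_within)
        have "dist (D w z) (D w0 z) < e / 2"
          using d(2)[of "(w0, z)" "(w, z)"] w z r by (auto simp: B_def dist_Pair_Pair dist_commute)
        then show "norm (D w z - D w0 z) \<le> e / 2" by (simp add: dist_norm)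
      qed (use elim d r in \<open>auto simp: B_def dist_norm\<close>)
      then have "norm (F (w0 + h n) z - F w0 z - D w0 z * h n) \<le> e / 2 * norm (h n)"
        by (simp add: algebra_simps)
      then have "norm ((F (w0 + h n) z - F w0 z) / h n - D w0 z) \<le> e / 2"
        using h(2)[of n] by (simp add: field_simps norm_divide flip: norm_mult)
      then show "dist ((F (w0 + h n) z - F w0 z) / h n) (deriv (\<lambda>w. F w z) w0) < e"
        using e by (simp add: dist_norm D_def)
    qed
  qed
qed

lemma null_sequence_in_cball:
  assumes "r > 0"
  obtains h :: "nat \<Rightarrow> complex" where "h \<longlonglongrightarrow> 0" "\<And>n. h n \<noteq> 0" "\<And>n. norm (h n) \<le> r"
proof -
  define h :: "nat \<Rightarrow> complex" where "h = (\<lambda>n. of_real (r * inverse (real (Suc n))))"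
  have "(\<lambda>n. r * inverse (real (Suc n))) \<longlonglongrightarrow> r * 0"
    by (intro tendsto_intros LIMSEQ_inverse_real_of_nat)
  then have "h \<longlonglongrightarrow> of_real 0"
    unfolding h_def by (intro tendsto_of_real) simp
  moreover have "norm (h n) \<le> r" for n
    unfolding h_def norm_of_real abs_mult using assms by (simp add: inverse_le_1_iff mult_left_le)
  ultimately show thesis using that[of h] assms by (simp add: h_def del: of_nat_Suc)
qed

text \<open>By Osgood's lemma each variable can be treated separately; in the first one the
  derivative is a uniform limit of difference quotients taken in the second.\<close>

lemma holomorphic2_on_deriv_snd:
  assumes F: "holomorphic2_on F S" and S: "open S"
  shows "holomorphic2_on (\<lambda>w z. deriv (F w) z) S"
proof (rule holomorphic2_onI[OF S])
  show "continuous_on S (\<lambda>(w, z). deriv (F w) z)"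
    by (rule continuous_on_deriv_snd[OF S holomorphic2_on_imp_continuous_on[OF F] holomorphic2_on_snd[OF F S]])
  fix w0 z0 assume wz: "(w0, z0) \<in> S"
  obtain r where r: "r > 0" "cball w0 r \<times> cball z0 r \<subseteq> S"
    by (rule open_Times_cball_subset[OF S wz])
  have "F w0 holomorphic_on ball z0 r"
    using r
    by (intro field_differentiable_imp_holomorphic_on holomorphic2_on_snd[OF F S]) auto
  then have "deriv (F w0) holomorphic_on ball z0 r" by (intro holomorphic_deriv) auto
  then show "deriv (F w0) field_differentiable at z0"
    using r by (intro holomorphic_on_imp_differentiable_at[of _ "ball z0 r"]) auto
  obtain h :: "nat \<Rightarrow> complex" where h: "h \<longlonglongrightarrow> 0" "\<And>n. h n \<noteq> 0" "\<And>n. norm (h n) \<le> r"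
    using null_sequence_in_cball[OF r(1)] by blast
  have sub: "cball z0 r \<times> cball w0 r \<subseteq> prod.swap ` S" using r by force
  have "uniform_limit (cball w0 r) (\<lambda>n w. (F w (z0 + h n) - F w z0) / h n) (\<lambda>w. deriv (F w) z0) sequentially"
    using quotient_uniform_limit_deriv[OF holomorphic2_on_swap[OF F S] compact_cball r(1) sub h(1,2)] by simp
  moreover have "(\<lambda>w. (F w (z0 + h n) - F w z0) / h n) field_differentiable (at w)" if "w \<in> cball w0 r" for n w
    using that r h(2,3)[of n] by (intro derivative_intros holomorphic2_on_fst[OF F S]) (auto simp: dist_norm)
  then have "(\<lambda>w. (F w (z0 + h n) - F w z0) / h n) holomorphic_on cball w0 r" for n
    by (rule field_differentiable_imp_holomorphic_on)
  then have "continuous_on (cball w0 r) (\<lambda>w. (F w (z0 + h n) - F w z0) / h n) \<and>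
       (\<lambda>w. (F w (z0 + h n) - F w z0) / h n) holomorphic_on ball w0 r" for n
    by (meson ball_subset_cball holomorphic_on_imp_continuous_on holomorphic_on_subset)
  ultimately obtain "(\<lambda>w. deriv (F w) z0) holomorphic_on ball w0 r"
    using holomorphic_uniform_limit[where F=sequentially] by (metis (no_types, lifting) always_eventually trivial_limit_sequentially)
  then show "(\<lambda>w. deriv (F w) z0) field_differentiable at w0"
    using r by (intro holomorphic_on_imp_differentiable_at[of _ "ball w0 r"]) auto
qed

lemma holomorphic2_on_deriv_fst:
  assumes F: "holomorphic2_on F S" and S: "open S"
  shows "holomorphic2_on (\<lambda>w z. deriv (\<lambda>w. F w z) w) S"
proof -
  note * = holomorphic2_on_swap[OF F S]
  have "prod.swap ` prod.swap ` S = S" by force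
  then show ?thesis using holomorphic2_on_swap[OF holomorphic2_on_deriv_snd[OF *] *(2)] by simp
qed

text \<open>Differentiating the uniform limit of the quotients in \<open>w\<close> termwise with
  respect to \<open>z\<close> produces the quotients of \<open>deriv (F w) z0\<close>. The equality
  later identifies the parameter derivative of the multiplier with the derivative of
  \<open>Q\<close>.\<close>

lemma deriv_deriv_commute:
  assumes F: "holomorphic2_on F S" and S: "open S" and wz: "(w0, z0) \<in> S"
  shows "deriv (\<lambda>w. deriv (F w) z0) w0 = deriv (\<lambda>z. deriv (\<lambda>w. F w z) w0) z0"
proof -
  obtain r where r: "r > 0" "cball w0 r \<times> cball z0 r \<subseteq> S"
    by (rule open_Times_cball_subset[OF S wz])
  obtain h :: "nat \<Rightarrow> complex" where h: "h \<longlonglongrightarrow> 0" "\<And>n. h n \<noteq> 0" "\<And>n. norm (h n) \<le> r"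
    using null_sequence_in_cball[OF r(1)] by blast
  have ul: "uniform_limit (ball z0 r) (\<lambda>n z. (F (w0 + h n) z - F w0 z) / h n) (\<lambda>z. deriv (\<lambda>w. F w z) w0) sequentially"
    using quotient_uniform_limit_deriv[OF F S compact_cball r h(1,2)]
    by (rule uniform_limit_on_subset) auto
  have inS: "(w0 + h n, z) \<in> S" "(w0, z) \<in> S" if "z \<in> ball z0 r" for n z
    using that r h(3)[of n] by (auto simp: dist_norm)
  have "(\<lambda>z. (F (w0 + h n) z - F w0 z) / h n) holomorphic_on ball z0 r" for n
  proof -
    have "(\<lambda>z. (F (w0 + h n) z - F w0 z) / h n) field_differentiable (at z)" if "z \<in> ball z0 r" for z
      using inS[OF that] h(2)[of n] holomorphic2_on_snd[OF F S]
      by (intro derivative_intros) auto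
    then show ?thesis by (rule field_differentiable_imp_holomorphic_on)
  qed
  then have "(\<lambda>n. deriv (\<lambda>z. (F (w0 + h n) z - F w0 z) / h n) z0) \<longlonglongrightarrow> deriv (\<lambda>z. deriv (\<lambda>w. F w z) w0) z0"
    by (intro deriv_complex_uniform_limit[OF ul]) (use r in auto)
  moreover have "deriv (\<lambda>z. (F (w0 + h n) z - F w0 z) / h n) z0 = (deriv (F (w0 + h n)) z0 - deriv (F w0) z0) / h n" for n
  proof -
    have "F (w0 + h n) field_differentiable at z0" "F w0 field_differentiable at z0"
      using inS(1)[of z0 n] inS(2)[of z0] r holomorphic2_on_snd[OF F S] by auto
    then show ?thesis using h(2)[of n]
      by (intro DERIV_imp_deriv derivative_eq_intros) (auto simp: DERIV_deriv_iff_field_differentiable)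
  qed
  ultimately have 1: "(\<lambda>n. (deriv (F (w0 + h n)) z0 - deriv (F w0) z0) / h n) \<longlonglongrightarrow> deriv (\<lambda>z. deriv (\<lambda>w. F w z) w0) z0"
    by simp
  have "((\<lambda>w. deriv (F w) z0) has_field_derivative deriv (\<lambda>w. deriv (F w) z0) w0) (at w0)"
    using holomorphic2_on_fst[OF holomorphic2_on_deriv_snd[OF F S] S wz] by (simp add: DERIV_deriv_iff_field_differentiable)
  then have "((\<lambda>h. (deriv (F (w0 + h)) z0 - deriv (F w0) z0) / h) \<longlongrightarrow> deriv (\<lambda>w. deriv (F w) z0) w0) (at 0)"
    by (simp add: DERIV_def)
  then have "(\<lambda>n. (deriv (F (w0 + h n)) z0 - deriv (F w0) z0) / h n) \<longlonglongrightarrow> deriv (\<lambda>w. deriv (F w) z0) w0"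
    by (rule filterlim_compose) (use h in \<open>auto simp: filterlim_at\<close>)
  with 1 show ?thesis by (rule LIMSEQ_unique[rotated])
qed

text \<open>Strict differentiability: both points vary, and the error is measured by their mutual
  distance, not by the distance to the base point. Two moving curves that agree to high order can
  thus be compared.\<close>

lemma holomorphic2_on_strict_derivative:
  assumes F: "holomorphic2_on F S" and S: "open S" and wz: "(w0, z0) \<in> S" and e: "e > 0"
  obtains d where "d > 0" "ball w0 d \<times> ball z0 d \<subseteq> S"
    "\<And>w w' z z'. w \<in> ball w0 d \<Longrightarrow> w' \<in> ball w0 d \<Longrightarrow> z \<in> ball z0 d \<Longrightarrow> z' \<in> ball z0 d \<Longrightarrow>
       norm (F w' z' - F w z - (deriv (\<lambda>w. F w z0) w0 * (w' - w) + deriv (F w0) z0 * (z' - z)))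
         \<le> e * (norm (w' - w) + norm (z' - z))"
proof -
  define D1 where "D1 = (\<lambda>w z. deriv (\<lambda>w. F w z) w)"
  define D2 where "D2 = (\<lambda>w z. deriv (F w) z)"
  have "isCont (\<lambda>(w, z). D1 w z) (w0, z0)" "isCont (\<lambda>(w, z). D2 w z) (w0, z0)"
    unfolding D1_def D2_def using S wz
      holomorphic2_on_imp_continuous_on[OF holomorphic2_on_deriv_fst[OF F S]]
      holomorphic2_on_imp_continuous_on[OF holomorphic2_on_deriv_snd[OF F S]]
    by (auto simp: continuous_on_eq_continuous_at)
  then obtain d1 d2 where d1: "d1 > 0" "\<And>p. dist p (w0, z0) < d1 \<Longrightarrow> dist (case p of (w, z) \<Rightarrow> D1 w z) (D1 w0 z0) < e"
    and d2: "d2 > 0" "\<And>p. dist p (w0, z0) < d2 \<Longrightarrow> dist (case p of (w, z) \<Rightarrow> D2 w z) (D2 w0 z0) < e"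
    unfolding continuous_at_eps_delta using e by (metis case_prod_conv)
  obtain r where r: "r > 0" "cball w0 r \<times> cball z0 r \<subseteq> S"
    by (rule open_Times_cball_subset[OF S wz])
  define d where "d = Min {d1 / 2, d2 / 2, r}"
  have d: "d > 0" "d \<le> d1 / 2" "d \<le> d2 / 2" "d \<le> r" using d1 d2 r by (auto simp: d_def)
  have inS: "(w, z) \<in> S" if "w \<in> ball w0 d" "z \<in> ball z0 d" for w z using r d that by auto
  have D: "norm (D1 w z - D1 w0 z0) \<le> e" "norm (D2 w z - D2 w0 z0) \<le> e"
    if "w \<in> ball w0 d" "z \<in> ball z0 d" for w z
  proof -
    have "dist (w, z) (w0, z0) \<le> dist w w0 + dist z z0"
      unfolding dist_Pair_Pair by (rule real_sqrt_sum_squares_triangle_ineq[of _ 0 0, simplified] order_trans[OF sqrt_add_le_add_sqrt]) auto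
    then have "dist (w, z) (w0, z0) < d1" "dist (w, z) (w0, z0) < d2" using that d by (auto simp: dist_commute)
    then show "norm (D1 w z - D1 w0 z0) \<le> e" "norm (D2 w z - D2 w0 z0) \<le> e"
      using d1(2)[of "(w, z)"] d2(2)[of "(w, z)"] by (auto simp: dist_norm)
  qed
  show thesis
  proof (rule that[OF d(1)])
    show "ball w0 d \<times> ball z0 d \<subseteq> S" using inS by auto
    fix w w' z z' assume in_ball: "w \<in> ball w0 d" "w' \<in> ball w0 d" "z \<in> ball z0 d" "z' \<in> ball z0 d"
    have "norm ((F w' z' - D1 w0 z0 * w') - (F w z' - D1 w0 z0 * w)) \<le> e * norm (w' - w)"
      by (rule field_differentiable_bound[of "ball w0 d" "\<lambda>w. F w z' - D1 w0 z0 * w" "\<lambda>w. D1 w z' - D1 w0 z0"])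
         (use in_ball D holomorphic2_on_fst[OF F S inS] in \<open>auto simp: D1_def DERIV_deriv_iff_field_differentiable[symmetric]
              intro!: derivative_eq_intros intro: has_field_derivative_at_within\<close>)
    moreover have "norm ((F w z' - D2 w0 z0 * z') - (F w z - D2 w0 z0 * z)) \<le> e * norm (z' - z)"
      by (rule field_differentiable_bound[of "ball z0 d" "\<lambda>z. F w z - D2 w0 z0 * z" "\<lambda>z. D2 w z - D2 w0 z0"])
         (use in_ball D holomorphic2_on_snd[OF F S inS] in \<open>auto simp: D2_def DERIV_deriv_iff_field_differentiable[symmetric]
              intro!: derivative_eq_intros intro: has_field_derivative_at_within\<close>)
    ultimately show "norm (F w' z' - F w z - (deriv (\<lambda>w. F w z0) w0 * (w' - w) + deriv (F w0) z0 * (z' - z)))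
         \<le> e * (norm (w' - w) + norm (z' - z))"
      using norm_triangle_ineq[of "(F w' z' - D1 w0 z0 * w') - (F w z' - D1 w0 z0 * w)"
            "(F w z' - D2 w0 z0 * z') - (F w z - D2 w0 z0 * z)"]
      by (simp add: D1_def D2_def algebra_simps)
  qed
qed

text \<open>A chain rule for leading terms: with \<open>\<gamma>\<close> a power of the parameter,
  the difference of two image curves has as leading coefficient the differential applied to the
  differences of the leading coefficients. The comparisons of Taylor coefficients below rest on
  it.\<close>

lemma holomorphic2_on_strict_tendsto:
  assumes F: "holomorphic2_on F S" and S: "open S" and wz: "(w0, z0) \<in> S"
    and lim: "(\<alpha> \<longlongrightarrow> w0) L" "(\<alpha>' \<longlongrightarrow> w0) L" "(\<beta> \<longlongrightarrow> z0) L" "(\<beta>' \<longlongrightarrow> z0) L"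
    and A: "((\<lambda>x. (\<alpha>' x - \<alpha> x) / \<gamma> x) \<longlongrightarrow> A) L" and B: "((\<lambda>x. (\<beta>' x - \<beta> x) / \<gamma> x) \<longlongrightarrow> B) L"
  shows "((\<lambda>x. (F (\<alpha>' x) (\<beta>' x) - F (\<alpha> x) (\<beta> x)) / \<gamma> x) \<longlongrightarrow>
           deriv (\<lambda>w. F w z0) w0 * A + deriv (F w0) z0 * B) L"
proof -
  define D1 where "D1 = deriv (\<lambda>w. F w z0) w0"
  define D2 where "D2 = deriv (F w0) z0"
  define E where "E = (\<lambda>x. (F (\<alpha>' x) (\<beta>' x) - F (\<alpha> x) (\<beta> x)) - (D1 * (\<alpha>' x - \<alpha> x) + D2 * (\<beta>' x - \<beta> x)))"
  have "((\<lambda>x. E x / \<gamma> x) \<longlongrightarrow> 0) L"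
  proof (rule tendstoI)
    fix e :: real assume e: "e > 0"
    define e' where "e' = e / (norm A + norm B + 2)"
    have pos: "norm A + norm B + 2 > 0" by (smt (verit) norm_ge_zero)
    have e': "e' > 0" using e pos by (simp add: e'_def)
    obtain d where d: "d > 0" "\<And>w w' z z'. w \<in> ball w0 d \<Longrightarrow> w' \<in> ball w0 d \<Longrightarrow> z \<in> ball z0 d \<Longrightarrow> z' \<in> ball z0 d \<Longrightarrow>
       norm (F w' z' - F w z - (D1 * (w' - w) + D2 * (z' - z))) \<le> e' * (norm (w' - w) + norm (z' - z))"
      using holomorphic2_on_strict_derivative[OF F S wz e'] unfolding D1_def D2_def by metis
    have near: "\<forall>\<^sub>F x in L. \<alpha> x \<in> ball w0 d" "\<forall>\<^sub>F x in L. \<alpha>' x \<in> ball w0 d"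
         "\<forall>\<^sub>F x in L. \<beta> x \<in> ball z0 d" "\<forall>\<^sub>F x in L. \<beta>' x \<in> ball z0 d"
      using lim[THEN topological_tendstoD[OF _ open_ball]] d(1) by auto
    have nA: "\<forall>\<^sub>F x in L. norm ((\<alpha>' x - \<alpha> x) / \<gamma> x) < norm A + 1"
      using tendsto_norm[OF A] by (rule order_tendstoD) simp
    have nB: "\<forall>\<^sub>F x in L. norm ((\<beta>' x - \<beta> x) / \<gamma> x) < norm B + 1"
      using tendsto_norm[OF B] by (rule order_tendstoD) simp
    from near nA nB show "\<forall>\<^sub>F x in L. dist (E x / \<gamma> x) 0 < e"
    proof eventually_elim
      case (elim x)
      have "norm (E x) \<le> e' * (norm (\<alpha>' x - \<alpha> x) + norm (\<beta>' x - \<beta> x))"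
        using d(2)[OF elim(1-4)] by (simp add: E_def)
      then have "norm (E x) / norm (\<gamma> x) \<le> e' * (norm (\<alpha>' x - \<alpha> x) + norm (\<beta>' x - \<beta> x)) / norm (\<gamma> x)"
        by (intro divide_right_mono) auto
      also have "\<dots> = e' * (norm ((\<alpha>' x - \<alpha> x) / \<gamma> x) + norm ((\<beta>' x - \<beta> x) / \<gamma> x))"
        by (simp add: norm_divide add_divide_distrib distrib_left)
      also have "\<dots> < e' * (norm A + norm B + 2)" using elim e' by (intro mult_strict_left_mono) auto
      also have "\<dots> = e" using pos by (simp add: e'_def)
      finally show ?case by (simp add: norm_divide)
    qed
  qed
  moreover have "((\<lambda>x. D1 * ((\<alpha>' x - \<alpha> x) / \<gamma> x) + D2 * ((\<beta>' x - \<beta> x) / \<gamma> x)) \<longlongrightarrow> D1 * A + D2 * B) L"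
    by (intro tendsto_intros A B)
  ultimately have "((\<lambda>x. E x / \<gamma> x + (D1 * ((\<alpha>' x - \<alpha> x) / \<gamma> x) + D2 * ((\<beta>' x - \<beta> x) / \<gamma> x))) \<longlongrightarrow> 0 + (D1 * A + D2 * B)) L"
    by (rule tendsto_add)
  moreover have "(\<lambda>x. E x / \<gamma> x + (D1 * ((\<alpha>' x - \<alpha> x) / \<gamma> x) + D2 * ((\<beta>' x - \<beta> x) / \<gamma> x))) =
        (\<lambda>x. (F (\<alpha>' x) (\<beta>' x) - F (\<alpha> x) (\<beta> x)) / \<gamma> x)"
    by (auto simp: E_def divide_inverse algebra_simps fun_eq_iff)
  ultimately show ?thesis by (simp add: D1_def D2_def)
qed

section \<open>Compositions, uniform limits and local inverses in two variables\<close>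

lemma holomorphic2_on_compose:
  assumes F: "holomorphic2_on F T" and T: "open T" and S: "open S"
    and A: "holomorphic2_on A S" and B: "holomorphic2_on B S"
    and in_T: "\<And>w z. (w, z) \<in> S \<Longrightarrow> (A w z, B w z) \<in> T"
  shows "holomorphic2_on (\<lambda>w z. F (A w z) (B w z)) S"
proof (rule holomorphic2_onI[OF S])
  have cA: "continuous_on S (\<lambda>p. A (fst p) (snd p))" and cB: "continuous_on S (\<lambda>p. B (fst p) (snd p))"
    using holomorphic2_on_imp_continuous_on A B by (auto simp: case_prod_unfold)
  have cF: "continuous_on T (\<lambda>p. F (fst p) (snd p))" using holomorphic2_on_imp_continuous_on[OF F] by (simp add: case_prod_unfold)
  show "continuous_on S (\<lambda>(w, z). F (A w z) (B w z))"
    using continuous_on_compose2[OF cF continuous_on_Pair[OF cA cB]] in_T by (simp add: case_prod_unfold image_subset_iff)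
  fix w z assume wz: "(w, z) \<in> S"
  show "(\<lambda>w. F (A w z) (B w z)) field_differentiable at w"
    using holomorphic2_on_chain[OF F T, of "\<lambda>w. A w z" _ w "\<lambda>w. B w z"]
      holomorphic2_on_fst[OF A S wz] holomorphic2_on_fst[OF B S wz] in_T[OF wz]
    unfolding field_differentiable_def by blast
  show "(\<lambda>z. F (A w z) (B w z)) field_differentiable at z"
    using holomorphic2_on_chain[OF F T, of "A w" _ z "B w"]
      holomorphic2_on_snd[OF A S wz] holomorphic2_on_snd[OF B S wz] in_T[OF wz]
    unfolding field_differentiable_def by blast
qed

lemma holomorphic2_on_fst_only:
  assumes "open S" "f holomorphic_on A" "open A" "fst ` S \<subseteq> A"
  shows "holomorphic2_on (\<lambda>w z. f w) S"
proof (rule holomorphic2_onI[OF assms(1)])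
  have "continuous_on S (\<lambda>p. f (fst p))"
    using continuous_on_compose2[OF holomorphic_on_imp_continuous_on[OF assms(2)] continuous_on_fst[OF continuous_on_id]] assms(4) by auto
  then show "continuous_on S (\<lambda>(w, z). f w)" by (simp add: case_prod_unfold)
qed (use assms holomorphic_on_imp_differentiable_at in \<open>auto simp: image_subset_iff\<close>)

lemma holomorphic2_on_snd_only:
  assumes "open S" "f holomorphic_on A" "open A" "snd ` S \<subseteq> A"
  shows "holomorphic2_on (\<lambda>w z. f z) S"
proof (rule holomorphic2_onI[OF assms(1)])
  have "continuous_on S (\<lambda>p. f (snd p))"
    using continuous_on_compose2[OF holomorphic_on_imp_continuous_on[OF assms(2)] continuous_on_snd[OF continuous_on_id]] assms(4) by auto
  then show "continuous_on S (\<lambda>(w, z). f z)" by (simp add: case_prod_unfold)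
qed (use assms holomorphic_on_imp_differentiable_at in \<open>force simp: image_subset_iff\<close>)+

lemma
  assumes "open S" "holomorphic2_on F S" "holomorphic2_on G S"
  shows holomorphic2_on_add: "holomorphic2_on (\<lambda>w z. F w z + G w z) S"
    and holomorphic2_on_diff: "holomorphic2_on (\<lambda>w z. F w z - G w z) S"
    and holomorphic2_on_mult: "holomorphic2_on (\<lambda>w z. F w z * G w z) S"
  using holomorphic2_on_imp_continuous_on[OF assms(2)] holomorphic2_on_imp_continuous_on[OF assms(3)]
    holomorphic2_on_fst[OF assms(2,1)] holomorphic2_on_fst[OF assms(3,1)]
    holomorphic2_on_snd[OF assms(2,1)] holomorphic2_on_snd[OF assms(3,1)]
  by (auto intro!: holomorphic2_onI[OF assms(1)] continuous_intros derivative_intros simp: case_prod_unfold)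

text \<open>Osgood's lemma reduces this to the theorem of Weierstrass on each slice. It makes the
  Koenigs coordinate, a limit of rescaled iterates, holomorphic in the parameter as well.\<close>

lemma holomorphic2_on_uniform_limit:
  assumes S: "open S" and F: "\<And>n. holomorphic2_on (F n) S"
    and lim: "uniform_limit S (\<lambda>n (w, z). F n w z) (\<lambda>(w, z). f w z) sequentially"
  shows "holomorphic2_on f S"
proof (rule holomorphic2_onI[OF S])
  show "continuous_on S (\<lambda>(w, z). f w z)"
    by (rule uniform_limit_theorem[OF _ lim]) (use F holomorphic2_on_imp_continuous_on in auto)
  fix w z assume wz: "(w, z) \<in> S"
  obtain r where r: "r > 0" "cball w r \<times> cball z r \<subseteq> S"
    by (rule open_Times_cball_subset[OF S wz])
  have u1: "uniform_limit (cball w r) (\<lambda>n w. F n w z) (\<lambda>w. f w z) sequentially"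
    using uniform_limit_compose'[OF lim, of "\<lambda>w. (w, z)" "cball w r"] r by (auto simp: Pi_iff subset_iff)
  have u2: "uniform_limit (cball z r) (\<lambda>n. F n w) (f w) sequentially"
    using uniform_limit_compose'[OF lim, of "\<lambda>z. (w, z)" "cball z r"] r by (auto simp: Pi_iff subset_iff)
  have h1: "(\<lambda>w. F n w z) holomorphic_on cball w r" for n
    by (intro field_differentiable_imp_holomorphic_on holomorphic2_on_fst[OF F S]) (use r in auto)
  have h2: "F n w holomorphic_on cball z r" for n
    by (intro field_differentiable_imp_holomorphic_on holomorphic2_on_snd[OF F S]) (use r in auto)
  have "\<forall>n. continuous_on (cball w r) (\<lambda>w. F n w z) \<and> (\<lambda>w. F n w z) holomorphic_on ball w r"
    using h1 by (meson ball_subset_cball holomorphic_on_imp_continuous_on holomorphic_on_subset)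
  then obtain "(\<lambda>w. f w z) holomorphic_on ball w r"
    using holomorphic_uniform_limit[OF always_eventually u1] by (metis (no_types, lifting) trivial_limit_sequentially)
  then show "(\<lambda>w. f w z) field_differentiable at w"
    using r by (intro holomorphic_on_imp_differentiable_at[of _ "ball w r"]) auto
  have "\<forall>n. continuous_on (cball z r) (F n w) \<and> F n w holomorphic_on ball z r"
    using h2 by (meson ball_subset_cball holomorphic_on_imp_continuous_on holomorphic_on_subset)
  then obtain "f w holomorphic_on ball z r"
    using holomorphic_uniform_limit[OF always_eventually u2] by (metis (no_types, lifting) trivial_limit_sequentially)
  then show "f w field_differentiable at z"
    using r by (intro holomorphic_on_imp_differentiable_at[of _ "ball z r"]) auto
qed

text \<open>The real inverse function theorem is applied to the map that keeps \<open>w\<close> and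
  sends \<open>z\<close> to \<open>F w z\<close>; the derivative of the inverse is complex linear
  because it can be written down explicitly.\<close>

lemma holomorphic2_on_local_inverse:
  assumes F: "holomorphic2_on F S" and S: "open S" and wz: "(w0, z0) \<in> S" and nz: "deriv (F w0) z0 \<noteq> 0"
  obtains \<Psi> r d where "r > 0" "d > 0" "holomorphic2_on \<Psi> (ball w0 r \<times> ball (F w0 z0) r)"
    "\<And>w t. w \<in> ball w0 r \<Longrightarrow> t \<in> ball (F w0 z0) r \<Longrightarrow> (w, \<Psi> w t) \<in> S \<and> F w (\<Psi> w t) = t"
    "\<And>w z. w \<in> ball w0 d \<Longrightarrow> z \<in> ball z0 d \<Longrightarrow> w \<in> ball w0 r \<and> F w z \<in> ball (F w0 z0) r \<and> \<Psi> w (F w z) = z"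
proof -
  define f where "f = (\<lambda>(w, z). (w, F w z))"
  define D1 where "D1 = (\<lambda>p. deriv (\<lambda>w. F w (snd p)) (fst p))"
  define D2 where "D2 = (\<lambda>p. deriv (F (fst p)) (snd p))"
  define f' where "f' = (\<lambda>p. Blinfun (\<lambda>q. (fst q, D1 p * fst q + D2 p * snd q)))"
  have cD: "continuous_on S D1" "continuous_on S D2"
    using holomorphic2_on_imp_continuous_on[OF holomorphic2_on_deriv_fst[OF F S]]
      holomorphic2_on_imp_continuous_on[OF holomorphic2_on_deriv_snd[OF F S]]
    by (auto simp: D1_def D2_def case_prod_unfold)
  have bl: "bounded_linear (\<lambda>q. (fst q, D1 p * fst q + D2 p * snd q))" for p
    by (intro bounded_linear_Pair bounded_linear_add bounded_linear_const_mult bounded_linear_fst bounded_linear_snd)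
  have f'_app: "blinfun_apply (f' p) q = (fst q, D1 p * fst q + D2 p * snd q)" for p q
    unfolding f'_def by (subst bounded_linear_Blinfun_apply[OF bl]) simp
  have der: "(f has_derivative blinfun_apply (f' p)) (at p)" if "p \<in> S" for p
  proof -
    obtain w z where p: "p = (w, z)" by force
    have "((\<lambda>q. (fst q, (\<lambda>(w, z). F w z) q)) has_derivative
       (\<lambda>q. (fst q, (\<lambda>(s, t). deriv (\<lambda>w. F w z) w * s + deriv (F w) z * t) q))) (at p)"
      unfolding p using holomorphic2_on_has_derivative[OF F S] that p
      by (intro has_derivative_Pair has_derivative_fst has_derivative_ident) auto
    then show ?thesis unfolding f_def by (simp add: case_prod_unfold f'_app[abs_def] p D1_def D2_def)
  qed
  have cont: "continuous_on S f'"
    by (intro continuous_on_blinfun_componentwise) (auto simp: f'_app intro!: continuous_intros cD)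
  \<comment> \<open>The differential is triangular with diagonal entries 1 and
    \<open>D2 (w0, z0)\<close>, so its inverse is explicit.\<close>
  define invf where "invf = Blinfun (\<lambda>q. (fst q, (snd q - D1 (w0, z0) * fst q) / D2 (w0, z0)))"
  have bli: "bounded_linear (\<lambda>q::complex\<times>complex. (fst q, (snd q - D1 (w0, z0) * fst q) / D2 (w0, z0)))"
    by (intro bounded_linear_Pair bounded_linear_compose[OF bounded_linear_divide] bounded_linear_sub
        bounded_linear_const_mult bounded_linear_fst bounded_linear_snd)
  have nz': "D2 (w0, z0) \<noteq> 0" using nz by (simp add: D2_def)
  have "invf o\<^sub>L f' (w0, z0) = id_blinfun"
    by (rule blinfun_eqI) (simp add: f'_app invf_def bounded_linear_Blinfun_apply[OF bli] nz')
  from inverse_function_theorem[OF S der cont wz this]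
  obtain U' V g g' where UV: "open U'" "U' \<subseteq> S" "(w0, z0) \<in> U'" "open V" "f (w0, z0) \<in> V" "homeomorphism U' V f g"
    "\<And>y. y \<in> V \<Longrightarrow> (g has_derivative (g' y)) (at y)"
    "\<And>y. y \<in> V \<Longrightarrow> g' y = inv (blinfun_apply (f'(g y)))"
    "\<And>y. y \<in> V \<Longrightarrow> bij (blinfun_apply (f'(g y)))"
    by metis
  have fg: "f (g y) = y" "g y \<in> U'" if "y \<in> V" for y
    using UV(6) that unfolding homeomorphism_def by auto
  have gf: "g (f x) = x" "f x \<in> V" if "x \<in> U'" for x
    using UV(6) that unfolding homeomorphism_def by auto
  obtain r where r: "r > 0" "cball w0 r \<times> cball (F w0 z0) r \<subseteq> V"
    using open_Times_cball_subset[OF UV(4), of w0 "F w0 z0"] UV(5) unfolding f_def by auto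
  define \<Psi> where "\<Psi> = (\<lambda>w t. snd (g (w, t)))"
  have fst_g: "fst (g (w, t)) = w" if "(w, t) \<in> V" for w t
    using fg(1)[OF that] by (auto simp: f_def case_prod_unfold)
  have sol: "(w, \<Psi> w t) \<in> S \<and> F w (\<Psi> w t) = t" if "(w, t) \<in> V" for w t
    using fg[OF that] fst_g[OF that] UV(2) by (auto simp: f_def case_prod_unfold \<Psi>_def) (metis prod.collapse subsetD)
  have hol: "holomorphic2_on \<Psi> (ball w0 r \<times> ball (F w0 z0) r)"
    unfolding holomorphic2_on_def
  proof
    fix y assume y0: "y \<in> ball w0 r \<times> ball (F w0 z0) r"
    then have y: "y \<in> V" using r by (auto simp: subset_iff)
    have bij: "bij (blinfun_apply (f' (g y)))" using UV(9) y by auto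
    have nz2: "D2 (g y) \<noteq> 0"
    proof
      assume "D2 (g y) = 0"
      then have "blinfun_apply (f' (g y)) (0, 1) = blinfun_apply (f' (g y)) (0, 0)" by (simp add: f'_app)
      with bij show False by (metis bij_pointE prod.inject zero_neq_one)
    qed
    have "g' y (s, t) = (s, (t - D1 (g y) * s) / D2 (g y))" for s t
      unfolding UV(8)[OF y] using bij nz2 by (intro inv_f_eq) (auto simp: bij_def f'_app)
    then have g'_eq: "(\<lambda>q. snd (g' y q)) = (\<lambda>(s, t). - (D1 (g y) / D2 (g y)) * s + (1 / D2 (g y)) * t)"
      using nz2 by (auto simp: fun_eq_iff field_simps)
    have "((\<lambda>q. snd (g q)) has_derivative (\<lambda>q. snd (g' y q))) (at y)"
      using UV(7)[OF y] by (rule has_derivative_snd)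
    then have "((\<lambda>(w, z). \<Psi> w z) has_derivative (\<lambda>(s, t). - (D1 (g y) / D2 (g y)) * s + (1 / D2 (g y)) * t)) (at y)"
      unfolding g'_eq by (simp add: \<Psi>_def case_prod_unfold)
    then show "\<exists>a b. ((\<lambda>(w, z). \<Psi> w z) has_derivative (\<lambda>(s, t). a * s + b * t)) (at y within ball w0 r \<times> ball (F w0 z0) r)"
      using has_derivative_at_withinI by blast
  qed
  \<comment> \<open>Being a left inverse requires a source neighbourhood that is mapped into the
    ball on which \<open>\<Psi>\<close> lives; this is where the second radius \<open>d\<close>
    comes from.\<close>
  have "open (U' \<inter> (\<lambda>p. (fst p, F (fst p) (snd p))) -` (ball w0 r \<times> ball (F w0 z0) r))"
    by (intro continuous_open_preimage open_Times open_ball UV continuous_intros)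
       (use holomorphic2_on_imp_continuous_on[OF holomorphic2_on_subset[OF F UV(2)]] in \<open>simp add: case_prod_unfold\<close>)
  moreover have "(w0, z0) \<in> U' \<inter> (\<lambda>p. (fst p, F (fst p) (snd p))) -` (ball w0 r \<times> ball (F w0 z0) r)"
    using UV(3) r by simp
  ultimately obtain d where d: "d > 0" "cball w0 d \<times> cball z0 d \<subseteq> U' \<inter> (\<lambda>p. (fst p, F (fst p) (snd p))) -` (ball w0 r \<times> ball (F w0 z0) r)"
    by (rule open_Times_cball_subset)
  show thesis
  proof (rule that[OF r(1) d(1) hol])
    show "(w, \<Psi> w t) \<in> S \<and> F w (\<Psi> w t) = t" if "w \<in> ball w0 r" "t \<in> ball (F w0 z0) r" for w t
      using sol[of w t] r that by (auto simp: subset_iff)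
    fix w z assume *: "w \<in> ball w0 d" "z \<in> ball z0 d"
    then have "(w, z) \<in> U' \<inter> (\<lambda>p. (fst p, F (fst p) (snd p))) -` (ball w0 r \<times> ball (F w0 z0) r)"
      by (intro subsetD[OF d(2)]) auto
    then show "w \<in> ball w0 r \<and> F w z \<in> ball (F w0 z0) r \<and> \<Psi> w (F w z) = z"
      using gf[of "(w, z)"] by (auto simp: \<Psi>_def f_def)
  qed
qed

section \<open>Taylor coefficients and Lipschitz functions\<close>

text \<open>Going through \<open>fps_expansion\<close> makes the algebra of coefficients a matter of
  formal power series, while \<open>taylor_coeff_deriv\<close> recovers the analytic
  formula.\<close>

definition taylor_coeff :: "nat \<Rightarrow> (complex \<Rightarrow> complex) \<Rightarrow> complex" where
  "taylor_coeff j f = fps_nth (fps_expansion f 0) j"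

lemma taylor_coeff_eqI: "f has_fps_expansion F \<Longrightarrow> taylor_coeff j f = fps_nth F j"
  by (simp add: taylor_coeff_def fps_expansion_eqI)

lemma has_fps_expansion_taylor:
  "f analytic_on {0} \<Longrightarrow> f has_fps_expansion Abs_fps (\<lambda>j. taylor_coeff j f)"
  using analytic_at_imp_has_fps_expansion_0[of f] by (simp add: taylor_coeff_def fps_nth_inverse)

lemma taylor_coeff_deriv: "taylor_coeff j f = (deriv ^^ j) f 0 / fact j"
  by (simp add: taylor_coeff_def fps_expansion_def)

lemma taylor_coeff_0 [simp]: "taylor_coeff 0 f = f 0"
  by (simp add: taylor_coeff_deriv)

lemma taylor_coeff_1: "taylor_coeff (Suc 0) f = deriv f 0"
  by (simp add: taylor_coeff_deriv)

lemma taylor_coeff_cong: "eventually (\<lambda>x. f x = g x) (nhds 0) \<Longrightarrow> taylor_coeff j f = taylor_coeff j g"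
  unfolding taylor_coeff_deriv by (simp add: higher_deriv_cong_ev)

lemma taylor_coeff_add:
  "f analytic_on {0} \<Longrightarrow> g analytic_on {0} \<Longrightarrow> taylor_coeff j (\<lambda>x. f x + g x) = taylor_coeff j f + taylor_coeff j g"
  by (subst taylor_coeff_eqI[OF has_fps_expansion_add[OF has_fps_expansion_taylor has_fps_expansion_taylor]]) auto

lemma taylor_coeff_diff:
  "f analytic_on {0} \<Longrightarrow> g analytic_on {0} \<Longrightarrow> taylor_coeff j (\<lambda>x. f x - g x) = taylor_coeff j f - taylor_coeff j g"
  by (subst taylor_coeff_eqI[OF has_fps_expansion_diff[OF has_fps_expansion_taylor has_fps_expansion_taylor]]) auto

lemma taylor_coeff_polynomial:
  "taylor_coeff j (\<lambda>x. \<Sum>i<n. a i * x ^ i) = (if j < n then a j else 0)"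
proof -
  have "(\<lambda>x. \<Sum>i<n. a i * x ^ i) has_fps_expansion (\<Sum>i<n. fps_const (a i) * fps_X ^ i)"
    by (intro fps_expansion_intros)
  from taylor_coeff_eqI[OF this] show ?thesis
    by (simp add: fps_sum_nth fps_X_power_nth sum.delta' if_distrib[of "\<lambda>x. _ * x"] cong: if_cong)
qed

lemma taylor_coeff_tendsto:
  assumes f: "f analytic_on {0}" and z: "\<And>j. j < N \<Longrightarrow> taylor_coeff j f = 0"
  shows "((\<lambda>x. f x / x ^ N) \<longlongrightarrow> taylor_coeff N f) (at 0)"
proof -
  define F where "F = Abs_fps (\<lambda>j. taylor_coeff j f)"
  have F: "f has_fps_expansion F" unfolding F_def by (rule has_fps_expansion_taylor[OF f])
  show ?thesis
  proof (cases "F = 0")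
    case True
    have "eventually (\<lambda>x. f x = 0) (at 0)"
      using F True has_fps_expansion_0_iff eventually_nhds_conv_at by blast
    moreover have "taylor_coeff N f = 0" using True by (simp add: F_def fps_eq_iff)
    ultimately show ?thesis by (auto intro!: tendsto_eventually elim: eventually_mono)
  next
    case False
    have "N \<le> subdegree F" using False z by (intro subdegree_geI) (auto simp: F_def)
    from has_fps_expansion_shift[OF F this refl]
    have "(\<lambda>x. if x = 0 then fps_nth F N else f x / x ^ N) has_fps_expansion fps_shift N F" .
    from has_fps_expansion_imp_continuous[OF this, of UNIV]
    have "((\<lambda>x. if x = 0 then fps_nth F N else f x / x ^ N) \<longlongrightarrow> fps_nth F N) (at 0)"
      by (simp add: isCont_def)
    then have "((\<lambda>x. f x / x ^ N) \<longlongrightarrow> fps_nth F N) (at 0)"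
      by (rule Lim_transform_eventually) (auto simp: eventually_at_filter)
    then show ?thesis by (simp add: F_def)
  qed
qed

text \<open>If \<open>k\<close> below \<open>N\<close> were the first order with a nonzero
  coefficient, multiplying the quotient by \<open>x ^ (N - k)\<close> would produce both that
  coefficient and 0 as limit.\<close>

lemma taylor_coeff_zeroI:
  assumes f: "f analytic_on {0}" and lim: "((\<lambda>x. f x / x ^ N) \<longlongrightarrow> c) (at 0)"
  shows "j < N \<Longrightarrow> taylor_coeff j f = 0" and "taylor_coeff N f = c"
proof -
  have *: "taylor_coeff j f = 0" if "j < N" for j
  proof (rule ccontr)
    assume nz: "taylor_coeff j f \<noteq> 0"
    define k where "k = (LEAST k. taylor_coeff k f \<noteq> 0)"
    have k: "taylor_coeff k f \<noteq> 0" "\<And>i. i < k \<Longrightarrow> taylor_coeff i f = 0"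
      unfolding k_def using LeastI[of "\<lambda>k. taylor_coeff k f \<noteq> 0", OF nz]
        not_less_Least[of _ "\<lambda>k. taylor_coeff k f \<noteq> 0"] by auto
    have "k \<le> j" unfolding k_def by (rule Least_le[of "\<lambda>k. taylor_coeff k f \<noteq> 0", OF nz])
    with that have kN: "k < N" by simp
    have "((\<lambda>x. f x / x ^ N * x ^ (N - k)) \<longlongrightarrow> c * 0 ^ (N - k)) (at 0)"
      by (intro tendsto_intros lim)
    then have "((\<lambda>x. f x / x ^ k) \<longlongrightarrow> c * 0 ^ (N - k)) (at 0)"
    proof (rule Lim_transform_eventually)
      have "f x / x ^ N * x ^ (N - k) = f x / x ^ k" if "x \<noteq> 0" for x
        using that kN by (simp add: divide_simps flip: power_add)
      then show "\<forall>\<^sub>F x in at 0. f x / x ^ N * x ^ (N - k) = f x / x ^ k"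
        by (simp add: eventually_at_filter)
    qed
    with taylor_coeff_tendsto[OF f k(2)] have "taylor_coeff k f = c * 0 ^ (N - k)"
      by (metis LIM_unique)
    with k kN show False by simp
  qed
  then show "j < N \<Longrightarrow> taylor_coeff j f = 0" by blast
  from taylor_coeff_tendsto[OF f *] lim show "taylor_coeff N f = c" by (metis LIM_unique)
qed

text \<open>Agreement of two jets below order \<open>N\<close>, together with the difference at
  order \<open>N\<close>, is the same as one limit. This is the bridge between coefficient
  identities and \<open>holomorphic2_on_strict_tendsto\<close>.\<close>

lemma taylor_coeff_diff_tendsto_iff:
  assumes "f analytic_on {0}" "g analytic_on {0}"
  shows "((\<lambda>x. (f x - g x) / x ^ N) \<longlongrightarrow> c) (at 0) \<longleftrightarrow>
    (\<forall>j<N. taylor_coeff j f = taylor_coeff j g) \<and> taylor_coeff N f = taylor_coeff N g + c"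
proof -
  have an: "(\<lambda>x. f x - g x) analytic_on {0}" using assms by (intro analytic_intros)
  show ?thesis
  proof
    assume "((\<lambda>x. (f x - g x) / x ^ N) \<longlongrightarrow> c) (at 0)"
    from taylor_coeff_zeroI[OF an this] show "(\<forall>j<N. taylor_coeff j f = taylor_coeff j g) \<and> taylor_coeff N f = taylor_coeff N g + c"
      by (simp add: taylor_coeff_diff[OF assms] algebra_simps)
  next
    assume "(\<forall>j<N. taylor_coeff j f = taylor_coeff j g) \<and> taylor_coeff N f = taylor_coeff N g + c"
    then show "((\<lambda>x. (f x - g x) / x ^ N) \<longlongrightarrow> c) (at 0)"
      using taylor_coeff_tendsto[OF an, of N] by (simp add: taylor_coeff_diff[OF assms])
  qed
qed

lemma taylor_coeff_bigO_zero:
  assumes f: "f analytic_on {0}" and b: "\<forall>\<^sub>F x in at 0. norm (f x) \<le> C * norm x ^ N" and j: "j < N"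
  shows "taylor_coeff j f = 0"
proof -
  have "((\<lambda>x. f x / x ^ (N - 1)) \<longlongrightarrow> 0) (at 0)"
  proof (rule Lim_null_comparison)
    have "\<forall>\<^sub>F x in at 0. x \<noteq> (0::complex)" by (simp add: eventually_at_filter)
    with b show "\<forall>\<^sub>F x in at 0. norm (f x / x ^ (N - 1)) \<le> C * norm x"
    proof eventually_elim
      case (elim x)
      have "norm x ^ N = norm x * norm x ^ (N - 1)" using j by (cases N) auto
      with elim show ?case by (simp add: norm_divide norm_power field_simps)
    qed
    have "((\<lambda>x::complex. C * norm x) \<longlongrightarrow> C * norm (0::complex)) (at 0)" by (intro tendsto_intros)
    then show "((\<lambda>x::complex. C * norm x) \<longlongrightarrow> 0) (at 0)" by simp
  qed
  from taylor_coeff_zeroI[OF f this] j show ?thesis by (cases "j = N - 1") auto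
qed

lemma norm_taylor_coeff_le:
  assumes "f holomorphic_on ball 0 R" "0 < r" "r < R" "\<And>x. norm x \<le> r \<Longrightarrow> norm (f x) \<le> B"
  shows "norm (taylor_coeff j f) \<le> B / r ^ j"
proof -
  have "norm ((deriv ^^ j) f 0) \<le> fact j * B / r ^ j"
  proof (rule Cauchy_inequality)
    show "f holomorphic_on ball 0 r" using assms by (auto elim!: holomorphic_on_subset)
    have "cball 0 r \<subseteq> ball (0::complex) R" using assms by auto
    then show "continuous_on (cball 0 r) f" using assms(1)
      by (meson continuous_on_subset holomorphic_on_imp_continuous_on)
  qed (use assms in auto)
  then show ?thesis by (simp add: taylor_coeff_deriv norm_divide field_simps)
qed

text \<open>A form of Schwarz' lemma whose constants depend on \<open>f\<close> only through
  \<open>B\<close>, so that it can be applied uniformly to families of slices. Away from the centre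
  the right-hand side exceeds \<open>B\<close> anyway; near it the power series has a geometric
  majorant.\<close>

lemma zero_order_bound:
  assumes f: "f holomorphic_on ball 0 R" and R: "R > 0" and B: "\<And>z. z \<in> ball 0 R \<Longrightarrow> norm (f z) \<le> B"
    and z0: "\<And>k. k < N \<Longrightarrow> taylor_coeff k f = 0" and z: "z \<in> ball 0 R"
  shows "norm (f z) \<le> 2 * B * (4 * norm z / R) ^ N"
proof -
  have B0: "B \<ge> 0" using order_trans[OF norm_ge_zero B[of 0]] R by simp
  show ?thesis
  proof (cases "norm z < R / 4")
    case False
    then have "1 \<le> (4 * norm z / R) ^ N" using R by (intro one_le_power) (simp add: field_simps)
    then have "1 * B \<le> (2 * (4 * norm z / R) ^ N) * B" using B0 by (intro mult_right_mono) auto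
    then show ?thesis using B[OF z] by (simp add: mult_ac)
  next
    case True
    \<comment> \<open>Cauchy's estimate on radius \<open>R / 2\<close> makes \<open>x\<close> the
      ratio of the majorant series; it is at most 1/2 in this case, which bounds the tail by twice
      its first term.\<close>
    define x where "x = 2 * norm z / R"
    have x: "0 \<le> x" "x \<le> 1 / 2" using True R by (auto simp: x_def field_simps)
    have bnd: "norm (taylor_coeff k f * z ^ k) \<le> B * x ^ k" for k
    proof -
      have "norm (taylor_coeff k f) \<le> B / (R / 2) ^ k"
        by (rule norm_taylor_coeff_le[OF f]) (use R B in auto)
      then have "norm (taylor_coeff k f * z ^ k) \<le> B / (R / 2) ^ k * norm z ^ k"
        unfolding norm_mult norm_power by (intro mult_right_mono) auto
      also have "\<dots> = B * x ^ k" by (simp add: x_def power_divide power_mult_distrib field_simps)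
      finally show ?thesis .
    qed
    have "(\<lambda>k. taylor_coeff k f * z ^ k) sums f z"
      using holomorphic_power_series[OF f z] by (simp add: taylor_coeff_deriv)
    then have s: "(\<lambda>k. taylor_coeff (k + N) f * z ^ (k + N)) sums (f z)"
      by (subst sums_iff_shift) (simp add: z0)
    have g: "(\<lambda>k. B * x ^ N * (1 / 2) ^ k) sums (B * x ^ N * 2)"
      using sums_mult[OF geometric_sums[of "1 / 2 :: real"], of "B * x ^ N"] by simp
    have "norm (f z) \<le> B * x ^ N * 2"
    proof (rule norm_sums_le[OF s g])
      fix k
      have "B * x ^ (k + N) \<le> B * x ^ N * (1 / 2) ^ k"
        unfolding power_add using x B0 power_mono[of x "1/2" k]
        by (simp add: mult_ac mult_left_mono mult_mono)
      with bnd[of "k + N"] show "norm (taylor_coeff (k + N) f * z ^ (k + N)) \<le> B * x ^ N * (1 / 2) ^ k" by linarith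
    qed
    also have "x ^ N \<le> (4 * norm z / R) ^ N" using x R by (intro power_mono) (auto simp: x_def field_simps)
    then have "B * x ^ N * 2 \<le> 2 * B * (4 * norm z / R) ^ N" using B0 by (simp add: mult_left_mono mult_ac)
    finally show ?thesis .
  qed
qed

lemma holomorphic2_on_taylor_coeff:
  assumes F: "holomorphic2_on F (ball 0 r \<times> A)" and "r > 0" "open A"
  shows "(\<lambda>t. taylor_coeff j (\<lambda>l. F l t)) holomorphic_on A"
proof -
  have o: "open (ball 0 r \<times> A)" using assms by (simp add: open_Times)
  have "holomorphic2_on (\<lambda>w z. (deriv ^^ j) (\<lambda>w. F w z) w) (ball 0 r \<times> A)"
  proof (induction j)
    case (Suc j)
    from holomorphic2_on_deriv_fst[OF this o] show ?case by simp
  qed (use F in simp)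
  then have "(\<lambda>t. (deriv ^^ j) (\<lambda>w. F w t) 0) holomorphic_on A"
    using assms by (intro holomorphic2_on_holomorphic_compose[OF _ o, of "\<lambda>w z. (deriv ^^ j) (\<lambda>w. F w z) w" A "\<lambda>_. 0" "\<lambda>t. t"] holomorphic_intros) auto
  then show ?thesis unfolding taylor_coeff_deriv by (intro holomorphic_intros) auto
qed

section \<open>Extension and gluing of Lipschitz functions\<close>

text \<open>McShane's extension: the infimum of the cones of slope \<open>C\<close> erected over the
  values on \<open>X\<close>.\<close>

lemma lipschitz_on_extend_real:
  fixes f :: "'a::metric_space \<Rightarrow> real"
  assumes "C-lipschitz_on X f"
  obtains g where "C-lipschitz_on UNIV g" "\<And>x. x \<in> X \<Longrightarrow> g x = f x"
proof (cases "X = {}")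
  case True
  show ?thesis by (rule that[of "\<lambda>_. 0"]) (use True lipschitz_on_nonneg[OF assms] in \<open>auto simp: lipschitz_on_def\<close>)
next
  case False
  then obtain y0 where y0: "y0 \<in> X" by blast
  have C: "C \<ge> 0" using lipschitz_on_nonneg[OF assms] .
  have f: "f y \<le> f x + C * dist x y" if "x \<in> X" "y \<in> X" for x y
    using lipschitz_onD[OF assms that] by (auto simp: dist_real_def)
  define g where "g = (\<lambda>x. INF y\<in>X. f y + C * dist x y)"
  have bdd: "bdd_below ((\<lambda>y. f y + C * dist x y) ` X)" for x
  proof (rule bdd_belowI2)
    fix y assume y: "y \<in> X"
    have "C * dist y y0 \<le> C * (dist x y + dist x y0)"
      using C by (intro mult_left_mono) (metis dist_commute dist_triangle, simp)
    with f[OF y y0] show "f y0 - C * dist x y0 \<le> f y + C * dist x y" by (simp add: algebra_simps)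
  qed
  have g_le: "g x \<le> g x' + C * dist x x'" for x x'
  proof -
    have "g x - C * dist x x' \<le> (INF y\<in>X. f y + C * dist x' y)"
    proof (rule cINF_greatest[OF False])
      fix y assume y: "y \<in> X"
      have "g x \<le> f y + C * dist x y" unfolding g_def by (rule cINF_lower[OF bdd y])
      moreover have "C * dist x y \<le> C * (dist x x' + dist x' y)" using C by (intro mult_left_mono dist_triangle)
      ultimately show "g x - C * dist x x' \<le> f y + C * dist x' y"
        by (simp add: algebra_simps)
    qed
    then have "g x - C * dist x x' \<le> g x'" by (simp add: g_def)
    then show ?thesis by simp
  qed
  show ?thesis
  proof (rule that)
    show "C-lipschitz_on UNIV g"
    proof (rule lipschitz_onI[OF _ C])
      show "dist (g x) (g y) \<le> C * dist x y" for x y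
        using g_le[of x y] g_le[of y x] by (auto simp: dist_real_def dist_commute)
    qed
    fix x assume x: "x \<in> X"
    have "g x \<le> f x" unfolding g_def using cINF_lower[OF bdd x, of x] by simp
    moreover have "f x \<le> g x" unfolding g_def by (rule cINF_greatest[OF False]) (use f x in \<open>auto simp: dist_commute\<close>)
    ultimately show "g x = f x" by simp
  qed
qed

text \<open>Real and imaginary parts are extended separately, which costs the factor 2. An extension
  is called for because a motion must be defined on all of \<open>K\<close>, whereas its
  coefficients are prescribed on an invariant subset.\<close>

lemma lipschitz_on_extend_complex:
  fixes f :: "'a::metric_space \<Rightarrow> complex"
  assumes "C-lipschitz_on X f"
  obtains g where "(2 * C)-lipschitz_on UNIV g" "\<And>x. x \<in> X \<Longrightarrow> g x = f x"
proof -
  have C: "C \<ge> 0" using lipschitz_on_nonneg[OF assms] .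
  have "C-lipschitz_on X (\<lambda>x. Re (f x))" "C-lipschitz_on X (\<lambda>x. Im (f x))"
    using lipschitz_onD[OF assms]
    by (auto intro!: lipschitz_onI[OF _ C] order_trans[OF abs_Re_le_cmod[of "f _ - f _", simplified]]
      order_trans[OF abs_Im_le_cmod[of "f _ - f _", simplified]] simp: dist_real_def dist_complex_def)
  then obtain g h where g: "C-lipschitz_on UNIV g" "\<And>x. x \<in> X \<Longrightarrow> g x = Re (f x)"
    and h: "C-lipschitz_on UNIV h" "\<And>x. x \<in> X \<Longrightarrow> h x = Im (f x)"
    by (metis lipschitz_on_extend_real)
  show ?thesis
  proof (rule that[of "\<lambda>x. Complex (g x) (h x)"])
    show "(2 * C)-lipschitz_on UNIV (\<lambda>x. Complex (g x) (h x))"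
    proof (rule lipschitz_onI)
      fix x y
      have "dist (Complex (g x) (h x)) (Complex (g y) (h y)) \<le> dist (g x) (g y) + dist (h x) (h y)"
        using cmod_le[of "Complex (g x) (h x) - Complex (g y) (h y)"] by (simp add: dist_complex_def dist_real_def)
      then show "dist (Complex (g x) (h x)) (Complex (g y) (h y)) \<le> 2 * C * dist x y"
        using lipschitz_onD[OF g(1), of x y] lipschitz_onD[OF h(1), of x y] by simp
    qed (use C in simp)
  qed (use g h in \<open>simp add: complex_eq_iff\<close>)
qed

lemma lipschitz_on_bounded:
  fixes f :: "'a::metric_space \<Rightarrow> 'b::real_normed_vector"
  assumes "C-lipschitz_on X f" "bounded X"
  obtains B where "B > 0" "\<And>x. x \<in> X \<Longrightarrow> norm (f x) \<le> B"
proof -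
  show ?thesis
  proof (cases "X = {}")
    case False
    then obtain x0 where x0: "x0 \<in> X" by blast
    obtain e where e: "\<And>x. x \<in> X \<Longrightarrow> dist x0 x \<le> e" using bounded_any_center[of X x0] assms(2) by blast
    have C: "C \<ge> 0" using lipschitz_on_nonneg[OF assms(1)] .
    have e0: "e \<ge> 0" using e[OF x0] by simp
    have "norm (f x) \<le> norm (f x0) + C * e + 1" if "x \<in> X" for x
    proof -
      have "norm (f x) \<le> norm (f x0) + dist (f x0) (f x)" by norm
      also have "dist (f x0) (f x) \<le> C * e"
        using lipschitz_onD[OF assms(1) x0 that] mult_left_mono[OF e[OF that] C] by linarith
      finally show ?thesis by simp
    qed
    moreover have "norm (f x0) + C * e + 1 > 0" using C e0 by (intro add_nonneg_pos) auto
    ultimately show ?thesis using that by blast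
  qed (rule that[of 1], auto)
qed

text \<open>Between the pieces the positive distance of the compact sets turns a mere bound on the
  values into a Lipschitz bound. The compact supersets are separate data because the pieces, such as
  a convergent sequence without its limit, may fail to be closed.\<close>

lemma lipschitz_on_Un_separated:
  fixes f :: "'a::heine_borel \<Rightarrow> 'b::real_normed_vector"
  assumes S: "L-lipschitz_on S f" "S \<subseteq> C" "compact C" and T: "M-lipschitz_on T f" "T \<subseteq> D" "compact D"
    and disj: "C \<inter> D = {}"
  shows "\<exists>K. K-lipschitz_on (S \<union> T) f"
proof -
  obtain d where d: "d > 0" "\<And>x y. x \<in> C \<Longrightarrow> y \<in> D \<Longrightarrow> d \<le> dist x y"
    using separate_compact_closed[OF S(3) compact_imp_closed[OF T(3)] disj] by blast
  obtain B1 where B1: "B1 > 0" "\<And>x. x \<in> S \<Longrightarrow> norm (f x) \<le> B1"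
    using lipschitz_on_bounded[OF S(1) bounded_subset[OF compact_imp_bounded[OF S(3)] S(2)]] by blast
  obtain B2 where B2: "B2 > 0" "\<And>x. x \<in> T \<Longrightarrow> norm (f x) \<le> B2"
    using lipschitz_on_bounded[OF T(1) bounded_subset[OF compact_imp_bounded[OF T(3)] T(2)]] by blast
  define K where "K = L + M + (B1 + B2) / d"
  have L: "L \<ge> 0" "M \<ge> 0" using lipschitz_on_nonneg S T by auto
  have Bd: "(B1 + B2) / d \<ge> 0" using B1 B2 d by simp
  have cross: "dist (f x) (f y) \<le> K * dist x y" if "x \<in> S" "y \<in> T" for x y
  proof -
    have "dist (f x) (f y) \<le> norm (f x) + norm (f y)" unfolding dist_norm by (rule norm_triangle_ineq4)
    also have "\<dots> \<le> B1 + B2" using B1 B2 that by (intro add_mono) auto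
    also have "\<dots> = (B1 + B2) / d * d" using d by simp
    also have "\<dots> \<le> (B1 + B2) / d * dist x y" using d S T that Bd by (intro mult_left_mono) auto
    also have "\<dots> \<le> K * dist x y" using L by (intro mult_right_mono) (auto simp: K_def)
    finally show ?thesis .
  qed
  have "K-lipschitz_on (S \<union> T) f"
  proof (rule lipschitz_onI)
    show "K \<ge> 0" using L Bd by (simp add: K_def)
    fix x y assume "x \<in> S \<union> T" "y \<in> S \<union> T"
    moreover have "dist (f x) (f y) \<le> K * dist x y" if "x \<in> S" "y \<in> S"
      using lipschitz_onD[OF S(1) that] by (rule order_trans) (use L Bd in \<open>auto intro!: mult_right_mono simp: K_def\<close>)
    moreover have "dist (f x) (f y) \<le> K * dist x y" if "x \<in> T" "y \<in> T"
      using lipschitz_onD[OF T(1) that] by (rule order_trans) (use L Bd in \<open>auto intro!: mult_right_mono simp: K_def\<close>)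
    moreover have "dist (f x) (f y) \<le> K * dist x y" if "y \<in> S" "x \<in> T"
      using cross[OF that] by (simp add: dist_commute)
    ultimately show "dist (f x) (f y) \<le> K * dist x y" using cross by blast
  qed
  then show ?thesis by blast
qed

lemma lipschitz_on_UN_separated:
  fixes f :: "'a::heine_borel \<Rightarrow> 'b::real_normed_vector"
  assumes "finite I" "\<And>i. i \<in> I \<Longrightarrow> \<exists>L. L-lipschitz_on (S i) f" "\<And>i. i \<in> I \<Longrightarrow> S i \<subseteq> C i" "\<And>i. i \<in> I \<Longrightarrow> compact (C i)"
    and "\<And>i j. i \<in> I \<Longrightarrow> j \<in> I \<Longrightarrow> i \<noteq> j \<Longrightarrow> C i \<inter> C j = {}"
  shows "\<exists>K. K-lipschitz_on (\<Union>i\<in>I. S i) f"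
  using assms
proof (induction I rule: finite_induct)
  case empty
  then show ?case by (auto simp: lipschitz_on_def)
next
  case (insert i I)
  obtain L where L: "L-lipschitz_on (S i) f" using insert.prems(1)[of i] by auto
  obtain M where M: "M-lipschitz_on (\<Union>i\<in>I. S i) f" using insert.IH insert.prems by (metis insertI2)
  have "\<exists>K. K-lipschitz_on (S i \<union> (\<Union>i\<in>I. S i)) f"
  proof (rule lipschitz_on_Un_separated[OF L _ _ M, where C="C i" and D="\<Union>i\<in>I. C i"])
    show "(\<Union>i\<in>I. S i) \<subseteq> (\<Union>i\<in>I. C i)" using insert.prems(2) by blast
    show "compact (\<Union>i\<in>I. C i)" using insert.hyps insert.prems(3) by (intro compact_UN) auto
    show "C i \<inter> (\<Union>i\<in>I. C i) = {}" using insert.prems(4) insert.hyps(2) by blast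
  qed (use insert.prems in auto)
  then show ?case by simp
qed

section \<open>Averaging the lifts of polynomial motions\<close>

text \<open>The sum is a perturbation of the identity with Lipschitz constant at most
  \<open>LL * norm l\<close>, hence injective as soon as this is below 1. The Lipschitz hypotheses
  throughout the development serve this purpose.\<close>

lemma holomorphic_motion_polynomial:
  fixes a :: "nat \<Rightarrow> complex \<Rightarrow> complex"
  assumes lip: "\<And>j. 1 \<le> j \<Longrightarrow> j < M \<Longrightarrow> (L j)-lipschitz_on K (a j)" and a0: "\<And>x. a 0 x = x" and M: "M \<ge> 1"
  obtains r where "r > 0" "holomorphic_motion K (ball 0 r) (\<lambda>l x. \<Sum>j<M. a j x * l ^ j)"
proof -
  define LL where "LL = (\<Sum>j=1..<M. L j)"
  have Lj: "L j \<ge> 0" if "1 \<le> j" "j < M" for j using lipschitz_on_nonneg[OF lip[OF that]] .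
  have LL: "LL \<ge> 0" unfolding LL_def by (intro sum_nonneg) (use Lj in auto)
  \<comment> \<open>Ensures \<open>LL * r < 1\<close> and also \<open>r \<le> 1\<close>, so that
    each power of \<open>norm l\<close> of positive degree is at most \<open>norm l\<close>.\<close>
  define r where "r = 1 / (LL + 1)"
  have r: "r > 0" "r \<le> 1" using LL by (auto simp: r_def)
  have split: "(\<Sum>j<M. a j x * l ^ j) = x + (\<Sum>j=1..<M. a j x * l ^ j)" for x l
  proof -
    have "{..<M} = insert 0 {1..<M}" using M by auto
    then show ?thesis by (simp add: a0)
  qed
  have "holomorphic_motion K (ball 0 r) (\<lambda>l x. \<Sum>j<M. a j x * l ^ j)"
    unfolding holomorphic_motion_def
  proof (intro conjI ballI)
    show "(\<Sum>j<M. a j x * 0 ^ j) = x" for x using M by (simp add: a0)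
    show "(\<lambda>l. \<Sum>j<M. a j x * l ^ j) holomorphic_on ball 0 r" for x by (intro holomorphic_intros)
    fix l :: complex assume l: "l \<in> ball 0 r"
    show "inj_on (\<lambda>x. \<Sum>j<M. a j x * l ^ j) K"
    proof (rule inj_onI)
      fix x y assume xy: "x \<in> K" "y \<in> K" and eq: "(\<Sum>j<M. a j x * l ^ j) = (\<Sum>j<M. a j y * l ^ j)"
      have "y - x = (\<Sum>j=1..<M. (a j x - a j y) * l ^ j)"
      proof -
        have "y - x = p - q" if "x + p = y + q" for p q using that by (simp add: algebra_simps)
        from this[OF eq[unfolded split]] show ?thesis by (simp add: left_diff_distrib sum_subtractf)
      qed
      then have "norm (y - x) \<le> (\<Sum>j=1..<M. norm ((a j x - a j y) * l ^ j))" by (simp add: sum_norm_le)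
      also have "\<dots> \<le> (\<Sum>j=1..<M. L j * norm (x - y) * norm l)"
      proof (rule sum_mono)
        fix j assume j: "j \<in> {1..<M}"
        have "norm l ^ j \<le> norm l ^ 1" using l r j by (intro power_decreasing) auto
        moreover have "norm (a j x - a j y) \<le> L j * norm (x - y)"
          using lipschitz_onD[OF lip xy] j by (simp add: dist_norm)
        ultimately show "norm ((a j x - a j y) * l ^ j) \<le> L j * norm (x - y) * norm l"
          using Lj[of j] j unfolding norm_mult norm_power by (intro mult_mono) auto
      qed
      also have "\<dots> = LL * norm l * norm (y - x)"
        unfolding LL_def sum_distrib_right by (intro sum.cong) (auto simp: norm_minus_commute)
      finally have "norm (y - x) * (1 - LL * norm l) \<le> 0" by (simp add: algebra_simps)
      moreover have "LL * norm l \<le> LL * r" using l LL by (intro mult_left_mono) auto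
      moreover have "LL * r < 1" using LL by (simp add: r_def field_simps)
      ultimately have "norm (y - x) \<le> 0" by (smt (verit) mult_pos_pos norm_ge_zero)
      then show "x = y" by simp
    qed
  qed (use r in auto)
  with r that show thesis by blast
qed

lemma lifting_propertyD:
  assumes "lifting_property U g c1 W G K" "holomorphic_motion K L h0"
  obtains \<epsilon> h B where "\<epsilon> > 0" "h 0 = h0"
    "\<And>n. is_lift U g c1 W G K (ball 0 \<epsilon>) (h n) (ball 0 \<epsilon>) (h (Suc n))"
    "\<And>n l x. l \<in> ball 0 \<epsilon> \<Longrightarrow> x \<in> K \<Longrightarrow> norm (h n l x) \<le> B"
  using assms unfolding lifting_property_def
  apply (elim conjE)
  apply (drule spec[of _ L], drule spec[of _ h0], drule mp, assumption)
  apply (elim exE conjE)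
  subgoal for \<epsilon> h B by (rule that[of \<epsilon> h B]) simp_all
  done

text \<open>The curves \<open>\<gamma> x\<close> solve the equation of a lift up to
  \<open>\<Delta> x * l ^ M\<close>. Because \<open>deriv g x\<close> does not vanish, the equation
  determines the coefficients of a lift one after the other; those below order \<open>M\<close> are
  reproduced by lifting, and \<open>u n\<close>, the coefficient of order \<open>M\<close> of the
  n-th lift, obeys an affine recursion. Cauchy's estimates make the common bound of the motions a
  bound on \<open>u n\<close> independent of \<open>n\<close>.\<close>

lemma lifting_cohomology:
  assumes mm: "marked_map U g c1" and ld: "local_holomorphic_deformation U g c1 W G"
    and lp: "lifting_property U g c1 W G K"
    and X: "X \<subseteq> K" "c1 \<in> X" "g ` X \<subseteq> X"
    and M: "M \<ge> 2"
    and \<gamma>: "\<And>x. x \<in> X \<Longrightarrow> \<gamma> x analytic_on {0}" "\<And>x. x \<in> X \<Longrightarrow> \<gamma> x 0 = x" "\<And>l. \<gamma> c1 l = c1 + l"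
    and lip: "\<And>j. 1 \<le> j \<Longrightarrow> j < M \<Longrightarrow> \<exists>L. L-lipschitz_on X (\<lambda>x. taylor_coeff j (\<gamma> x))"
    and \<Delta>: "\<And>x. x \<in> X \<Longrightarrow> ((\<lambda>l. (G (c1 + l) (\<gamma> x l) - \<gamma> (g x) l) / l ^ M) \<longlongrightarrow> \<Delta> x) (at 0)"
  obtains C u where "\<And>n x. x \<in> X \<Longrightarrow> norm (u n x) \<le> C" "\<And>x. x \<in> X \<Longrightarrow> u 0 x = 0"
    "\<And>n x. x \<in> X \<Longrightarrow> deriv (\<lambda>w. G w x) c1 * u n c1 + deriv g x * (u (Suc n) x - taylor_coeff M (\<gamma> x))
        = u n (g x) - taylor_coeff M (\<gamma> (g x)) - \<Delta> x"
proof -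
  have U: "open U" and W: "open W" "c1 \<in> W" and G: "holomorphic2_on G (W \<times> U)"
    and Gg: "\<And>z. z \<in> U \<Longrightarrow> G c1 z = g z" and nz: "\<And>w z. w \<in> W \<Longrightarrow> z \<in> U \<Longrightarrow> deriv (G w) z \<noteq> 0"
    using mm ld unfolding marked_map_def local_holomorphic_deformation_def by auto
  have WU: "open (W \<times> U)" using U W by (simp add: open_Times)
  have "closure K \<subseteq> U" using lp by (simp add: lifting_property_def)
  then have KU: "K \<subseteq> U" using closure_subset by (rule order_trans[rotated])
  have dG: "deriv (G c1) x = deriv g x" if "x \<in> U" for x
    by (intro deriv_cong_ev eventually_nhds_in_open[OF U that, THEN eventually_mono]) (auto simp: Gg)
  have "\<forall>j. \<exists>V. 1 \<le> j \<and> j < M \<longrightarrow> (\<exists>L. L-lipschitz_on UNIV V) \<and> (\<forall>x\<in>X. V x = taylor_coeff j (\<gamma> x))"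
  proof
    fix j
    show "\<exists>V. 1 \<le> j \<and> j < M \<longrightarrow> (\<exists>L. L-lipschitz_on UNIV V) \<and> (\<forall>x\<in>X. V x = taylor_coeff j (\<gamma> x))"
    proof (cases "1 \<le> j \<and> j < M")
      case True
      then obtain L where "L-lipschitz_on X (\<lambda>x. taylor_coeff j (\<gamma> x))" using lip by blast
      then show ?thesis by (rule lipschitz_on_extend_complex) blast
    qed blast
  qed
  then obtain V where V: "\<And>j. 1 \<le> j \<Longrightarrow> j < M \<Longrightarrow> \<exists>L. L-lipschitz_on UNIV (V j)"
    "\<And>j x. 1 \<le> j \<Longrightarrow> j < M \<Longrightarrow> x \<in> X \<Longrightarrow> V j x = taylor_coeff j (\<gamma> x)" by metis
  then obtain L where L: "\<And>j. 1 \<le> j \<Longrightarrow> j < M \<Longrightarrow> (L j)-lipschitz_on UNIV (V j)" by metis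
  \<comment> \<open>Order 0 must be the identity, as a motion starts there. Truncation below order
    \<open>M\<close> is what makes \<open>u 0\<close> vanish.\<close>
  define a where "a = (\<lambda>j x. if j = 0 then x else V j x)"
  define h0 where "h0 = (\<lambda>l x. \<Sum>j<M. a j x * l ^ j)"
  have lipa: "(L j)-lipschitz_on K (a j)" if "1 \<le> j" "j < M" for j
  proof -
    have "a j = V j" using that by (simp add: a_def fun_eq_iff)
    then show ?thesis using lipschitz_on_subset[OF L[OF that]] by simp
  qed
  have a0: "a 0 x = x" for x by (simp add: a_def)
  have M1: "M \<ge> 1" using M by simp
  obtain r where r: "r > 0" "holomorphic_motion K (ball 0 r) h0"
    unfolding h0_def by (rule holomorphic_motion_polynomial[of M L K a, OF lipa a0 M1])
  obtain \<epsilon> h B where \<epsilon>: "\<epsilon> > 0" and h0: "h 0 = h0"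
    and lift: "\<And>n. is_lift U g c1 W G K (ball 0 \<epsilon>) (h n) (ball 0 \<epsilon>) (h (Suc n))"
    and B: "\<And>n l x. l \<in> ball 0 \<epsilon> \<Longrightarrow> x \<in> K \<Longrightarrow> norm (h n l x) \<le> B"
    by (rule lifting_propertyD[OF lp r(2)], rule that; assumption)
  have hol: "(\<lambda>l. h n l x) holomorphic_on ball 0 \<epsilon>" and h_0: "h n 0 x = x" if "x \<in> K" for n x
    using lift[of n] that unfolding is_lift_def holomorphic_motion_def by simp_all
  have an: "(\<lambda>l. h n l x) analytic_on {0}" if "x \<in> K" for n x
    unfolding analytic_at by (intro exI[of _ "ball 0 \<epsilon>"] conjI hol that) (use \<epsilon> in auto)
  have eq: "G (h n l c1) (h (Suc n) l x) = h n l (g x)" if "l \<in> ball 0 \<epsilon>" "x \<in> K" for n l x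
    using lift[of n] that unfolding is_lift_def by simp
  have gX: "g x \<in> X" if "x \<in> X" for x using X that by auto
  have an_id: "(\<lambda>l. c1 + l) analytic_on {0}" by (intro analytic_intros)
  have an\<gamma>1: "\<gamma> c1 analytic_on {0}" using \<gamma>(1) X by blast
  define D1 where "D1 = (\<lambda>x. deriv (\<lambda>w. G w x) c1)"
  have lim0: "((\<lambda>l. f l) \<longlongrightarrow> f 0) (at 0)" if "f analytic_on {0}" for f :: "complex \<Rightarrow> complex"
    using analytic_at_imp_isCont[OF that] by (simp add: isCont_def)
  \<comment> \<open>For \<open>i < M\<close> this is the inductive step that propagates the jets
    from one lift to the next; for \<open>i = M\<close> it is the recursion itself.\<close>
  have step: "D1 x * (taylor_coeff i (\<lambda>l. h n l c1) - taylor_coeff i (\<gamma> c1)) +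
      deriv g x * (taylor_coeff i (\<lambda>l. h (Suc n) l x) - taylor_coeff i (\<gamma> x)) =
      taylor_coeff i (\<lambda>l. h n l (g x)) - taylor_coeff i (\<gamma> (g x)) - (if i = M then \<Delta> x else 0)"
    if x: "x \<in> X" and i: "i \<le> M"
      and n: "\<And>y j. y \<in> X \<Longrightarrow> j < i \<Longrightarrow> taylor_coeff j (\<lambda>l. h n l y) = taylor_coeff j (\<gamma> y)"
      and Sn: "\<And>j. j < i \<Longrightarrow> taylor_coeff j (\<lambda>l. h (Suc n) l x) = taylor_coeff j (\<gamma> x)" for x i n
  proof -
    have K: "x \<in> K" "c1 \<in> K" "g x \<in> K" using x X by auto
    have "((\<lambda>l. (G (h n l c1) (h (Suc n) l x) - G (c1 + l) (\<gamma> x l)) / l ^ i) \<longlongrightarrow>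
           deriv (\<lambda>w. G w x) c1 * (taylor_coeff i (\<lambda>l. h n l c1) - taylor_coeff i (\<gamma> c1)) +
           deriv (G c1) x * (taylor_coeff i (\<lambda>l. h (Suc n) l x) - taylor_coeff i (\<gamma> x))) (at 0)"
    proof (rule holomorphic2_on_strict_tendsto[OF G WU])
      show "((\<lambda>l. c1 + l) \<longlongrightarrow> c1) (at 0)" using lim0[OF an_id] by simp
      show "((\<lambda>l. h n l c1) \<longlongrightarrow> c1) (at 0)" using lim0[OF an[of c1 n]] K h_0 by simp
      show "((\<lambda>l. h (Suc n) l x) \<longlongrightarrow> x) (at 0)" using lim0[OF an[of x "Suc n"]] K h_0 by simp
      show "(\<gamma> x \<longlongrightarrow> x) (at 0)" using lim0[OF \<gamma>(1)[OF x]] \<gamma>(2)[OF x] by simp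
      have "((\<lambda>l. (h n l c1 - \<gamma> c1 l) / l ^ i) \<longlongrightarrow> taylor_coeff i (\<lambda>l. h n l c1) - taylor_coeff i (\<gamma> c1)) (at 0)"
        using n[OF X(2)] by (subst taylor_coeff_diff_tendsto_iff[OF an[OF K(2)] an\<gamma>1]) auto
      then show "((\<lambda>l. (h n l c1 - (c1 + l)) / l ^ i) \<longlongrightarrow> taylor_coeff i (\<lambda>l. h n l c1) - taylor_coeff i (\<gamma> c1)) (at 0)"
        by (simp add: \<gamma>(3))
      show "((\<lambda>l. (h (Suc n) l x - \<gamma> x l) / l ^ i) \<longlongrightarrow> taylor_coeff i (\<lambda>l. h (Suc n) l x) - taylor_coeff i (\<gamma> x)) (at 0)"
        using Sn by (subst taylor_coeff_diff_tendsto_iff[OF an[OF K(1)] \<gamma>(1)[OF x]]) auto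
    qed (use K KU W in auto)
    then have 1: "((\<lambda>l. (h n l (g x) - G (c1 + l) (\<gamma> x l)) / l ^ i) \<longlongrightarrow>
           D1 x * (taylor_coeff i (\<lambda>l. h n l c1) - taylor_coeff i (\<gamma> c1)) +
           deriv g x * (taylor_coeff i (\<lambda>l. h (Suc n) l x) - taylor_coeff i (\<gamma> x))) (at 0)"
    proof (rule Lim_transform_eventually[OF tendsto_eq_rhs])
      show "\<forall>\<^sub>F l in at 0. (G (h n l c1) (h (Suc n) l x) - G (c1 + l) (\<gamma> x l)) / l ^ i = (h n l (g x) - G (c1 + l) (\<gamma> x l)) / l ^ i"
        using \<epsilon> eq K by (auto simp: eventually_at_filter intro!: eventually_mono[OF eventually_nhds_in_open[of "ball 0 \<epsilon>"]])
    qed (use dG K KU in \<open>auto simp: D1_def\<close>)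
    \<comment> \<open>Below order \<open>M\<close> the defect of the curves is invisible: the factor
      \<open>0 ^ (M - i)\<close> is 1 exactly when \<open>i = M\<close>.\<close>
    have "((\<lambda>l. (G (c1 + l) (\<gamma> x l) - \<gamma> (g x) l) / l ^ M * l ^ (M - i)) \<longlongrightarrow> \<Delta> x * 0 ^ (M - i)) (at 0)"
      by (intro tendsto_intros \<Delta> x)
    then have "((\<lambda>l. (G (c1 + l) (\<gamma> x l) - \<gamma> (g x) l) / l ^ i) \<longlongrightarrow> (if i = M then \<Delta> x else 0)) (at 0)"
    proof (rule Lim_transform_eventually[OF tendsto_eq_rhs])
      have "z / l ^ M * l ^ (M - i) = z / l ^ i" if "l \<noteq> 0" for l z :: complex
        using that i by (simp add: divide_simps flip: power_add)
      then show "\<forall>\<^sub>F l in at 0. (G (c1 + l) (\<gamma> x l) - \<gamma> (g x) l) / l ^ M * l ^ (M - i) = (G (c1 + l) (\<gamma> x l) - \<gamma> (g x) l) / l ^ i"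
        by (simp add: eventually_at_filter)
    qed (use i in auto)
    from tendsto_add[OF 1 this]
    have 2: "((\<lambda>l. (h n l (g x) - \<gamma> (g x) l) / l ^ i) \<longlongrightarrow>
           D1 x * (taylor_coeff i (\<lambda>l. h n l c1) - taylor_coeff i (\<gamma> c1)) +
           deriv g x * (taylor_coeff i (\<lambda>l. h (Suc n) l x) - taylor_coeff i (\<gamma> x)) + (if i = M then \<Delta> x else 0)) (at 0)"
      by (simp flip: add_divide_distrib)
    have "((\<lambda>l. (h n l (g x) - \<gamma> (g x) l) / l ^ i) \<longlongrightarrow>
            taylor_coeff i (\<lambda>l. h n l (g x)) - taylor_coeff i (\<gamma> (g x))) (at 0)"
      using n[OF gX[OF x]] by (subst taylor_coeff_diff_tendsto_iff[OF an[OF K(3)] \<gamma>(1)[OF gX[OF x]]]) auto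
    from LIM_unique[OF this 2] show ?thesis by (simp add: algebra_simps)
  qed
  have jets: "\<forall>x\<in>X. \<forall>j<M. taylor_coeff j (\<lambda>l. h n l x) = taylor_coeff j (\<gamma> x)" for n
  proof (induction n)
    case 0
    have "taylor_coeff j (\<lambda>l. h 0 l x) = taylor_coeff j (\<gamma> x)" if "x \<in> X" "j < M" for x j
      unfolding h0 h0_def taylor_coeff_polynomial using that V(2)[of j x] \<gamma>(2)[of x] by (auto simp: a_def)
    then show ?case by blast
  next
    case (Suc n)
    \<comment> \<open>An inner induction on the order is required, since \<open>step\<close> at
      order \<open>i\<close> presupposes that the new lift already agrees below
      \<open>i\<close>.\<close>
    have "\<forall>j<i. taylor_coeff j (\<lambda>l. h (Suc n) l x) = taylor_coeff j (\<gamma> x)" if x: "x \<in> X" and "i \<le> M" for x i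
      using that(2)
    proof (induction i)
      case (Suc i)
      have "deriv g x * (taylor_coeff i (\<lambda>l. h (Suc n) l x) - taylor_coeff i (\<gamma> x)) = 0"
        using step[OF x, of i n] Suc \<open>\<forall>x\<in>X. \<forall>j<M. taylor_coeff j (\<lambda>l. h n l x) = taylor_coeff j (\<gamma> x)\<close> X gX[OF x] by auto
      moreover have "deriv g x \<noteq> 0" using nz[of c1 x] dG[of x] W x X KU by auto
      ultimately show ?case using Suc by (auto simp: less_Suc_eq)
    qed auto
    then show ?case by blast
  qed
  define u where "u = (\<lambda>n x. taylor_coeff M (\<lambda>l. h n l x))"
  have 0: "taylor_coeff M (\<gamma> c1) = 0"
  proof -
    have "\<gamma> c1 = (\<lambda>l. \<Sum>i<2. (if i = 0 then c1 else 1) * l ^ i)" by (simp add: \<gamma>(3) fun_eq_iff numeral_2_eq_2)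
    then show ?thesis using M by (simp add: taylor_coeff_polynomial)
  qed
  show thesis
  proof (rule that[of u "B / (\<epsilon> / 2) ^ M"])
    fix n x assume x: "x \<in> X"
    show "norm (u n x) \<le> B / (\<epsilon> / 2) ^ M"
      unfolding u_def by (rule norm_taylor_coeff_le[OF hol]) (use x X \<epsilon> B in auto)
    show "u 0 x = 0" by (simp add: u_def h0 h0_def taylor_coeff_polynomial)
    show "deriv (\<lambda>w. G w x) c1 * u n c1 + deriv g x * (u (Suc n) x - taylor_coeff M (\<gamma> x))
        = u n (g x) - taylor_coeff M (\<gamma> (g x)) - \<Delta> x"
      using step[OF x, of M n] jets[of n] jets[of "Suc n"] x by (simp add: u_def D1_def 0)
  qed
qed

text \<open>The solution \<open>u n\<close> is corrected by the first-order variation and averaged over \<open>n\<close>: telescoping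
  turns the recursion into an approximate cohomological equation.\<close>

lemma lifting_average:
  assumes mm: "marked_map U g c1" and ld: "local_holomorphic_deformation U g c1 W G"
    and lp: "lifting_property U g c1 W G K"
    and X: "X \<subseteq> K" "c1 \<in> X" "g ` X \<subseteq> X"
    and M: "M \<ge> 2"
    and \<gamma>: "\<And>x. x \<in> X \<Longrightarrow> \<gamma> x analytic_on {0}" "\<And>x. x \<in> X \<Longrightarrow> \<gamma> x 0 = x" "\<And>l. \<gamma> c1 l = c1 + l"
    and lip: "\<And>j. 1 \<le> j \<Longrightarrow> j < M \<Longrightarrow> \<exists>L. L-lipschitz_on X (\<lambda>x. taylor_coeff j (\<gamma> x))"
    and \<Delta>: "\<And>x. x \<in> X \<Longrightarrow> ((\<lambda>l. (G (c1 + l) (\<gamma> x l) - \<gamma> (g x) l) / l ^ M) \<longlongrightarrow> \<Delta> x) (at 0)"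
  obtains C Y where "C \<ge> 0"
    "\<And>N x. N \<ge> 1 \<Longrightarrow> x \<in> X \<Longrightarrow> norm (Y N x + taylor_coeff M (\<gamma> x)) \<le> C"
    "\<And>N x. N \<ge> 1 \<Longrightarrow> x \<in> X \<Longrightarrow> norm (Y N (g x) - deriv g x * Y N x - \<Delta> x) \<le> C / real N"
    "\<And>N. Y N c1 = 0"
    "\<And>N D \<pi>. open D \<Longrightarrow> \<pi> ` D \<subseteq> X \<Longrightarrow> \<pi> holomorphic_on D \<Longrightarrow>
       (\<And>i j. j \<in> {1, M} \<Longrightarrow> (\<lambda>t. taylor_coeff j (\<gamma> ((g ^^ i) (\<pi> t)))) holomorphic_on D) \<Longrightarrow>
       (\<And>i. (\<lambda>t. \<Delta> ((g ^^ i) (\<pi> t))) holomorphic_on D) \<Longrightarrow> (\<lambda>t. Y N (\<pi> t)) holomorphic_on D"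
proof -
  have U: "open U" and W: "open W" "c1 \<in> W" and G: "holomorphic2_on G (W \<times> U)" and g: "g holomorphic_on U"
    and Gg: "\<And>z. z \<in> U \<Longrightarrow> G c1 z = g z" and nz: "\<And>w z. w \<in> W \<Longrightarrow> z \<in> U \<Longrightarrow> deriv (G w) z \<noteq> 0"
    using mm ld unfolding marked_map_def local_holomorphic_deformation_def by auto
  have WU: "open (W \<times> U)" using U W by (simp add: open_Times)
  have clK: "closure K \<subseteq> U" "compact (closure K)" using lp by (simp_all add: lifting_property_def)
  have KU: "K \<subseteq> U" using closure_subset clK(1) by (rule order_trans)
  have dG: "deriv (G c1) x = deriv g x" if "x \<in> U" for x
    by (intro deriv_cong_ev eventually_nhds_in_open[OF U that, THEN eventually_mono]) (auto simp: Gg)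
  have nzg: "deriv g x \<noteq> 0" if "x \<in> X" for x using nz[of c1 x] dG[of x] W that X KU by auto
  have gX: "g x \<in> X" if "x \<in> X" for x using X that by auto
  obtain C u where u: "\<And>n x. x \<in> X \<Longrightarrow> norm (u n x) \<le> C" "\<And>x. x \<in> X \<Longrightarrow> u 0 x = 0"
    "\<And>n x. x \<in> X \<Longrightarrow> deriv (\<lambda>w. G w x) c1 * u n c1 + deriv g x * (u (Suc n) x - taylor_coeff M (\<gamma> x))
        = u n (g x) - taylor_coeff M (\<gamma> (g x)) - \<Delta> x"
  proof (rule lifting_cohomology[OF assms], goal_cases)
    case (6 C u)
    show ?case by (rule 6(1)[OF 6(2-4)])
  qed
  have C: "C \<ge> 0" using u(1)[OF X(2)] norm_ge_zero order_trans by blast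
  define v where "v = (\<lambda>x. taylor_coeff 1 (\<gamma> x))"
  define e where "e = (\<lambda>x. taylor_coeff M (\<gamma> x))"
  define s where "s = (\<lambda>n. u n c1)"
  \<comment> \<open>At \<open>c1\<close> the first-order variation \<open>v\<close> is 1 and
    \<open>e\<close> is 0, so the last term normalises \<open>y n\<close> to vanish there. By
    \<open>L\<close> below, \<open>v\<close> solves the linearised equation, and the subtraction
    leaves only the increments of \<open>s\<close> in the recursion.\<close>
  define y where "y = (\<lambda>n x. u n x - e x - s n * v x)"
  have lim0: "((\<lambda>l. f l) \<longlongrightarrow> f 0) (at 0)" if "f analytic_on {0}" for f :: "complex \<Rightarrow> complex"
    using analytic_at_imp_isCont[OF that] by (simp add: isCont_def)
  have lim1: "((\<lambda>l. (\<gamma> x l - x) / l ^ 1) \<longlongrightarrow> v x) (at 0)" if "x \<in> X" for x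
  proof -
    have "((\<lambda>l. (\<gamma> x l - (\<lambda>l. x) l) / l ^ 1) \<longlongrightarrow> v x) (at 0)"
      by (subst taylor_coeff_diff_tendsto_iff) (use that \<gamma> in \<open>auto simp: v_def taylor_coeff_1\<close>)
    then show ?thesis by simp
  qed
  \<comment> \<open>This is order one of the approximate functional equation;
    \<open>M \<ge> 2\<close> keeps \<open>\<Delta>\<close> out of it.\<close>
  have L: "deriv (\<lambda>w. G w x) c1 = v (g x) - deriv g x * v x" if x: "x \<in> X" for x
  proof -
    have "((\<lambda>l. (G (c1 + l) (\<gamma> x l) - G c1 x) / l ^ 1) \<longlongrightarrow> deriv (\<lambda>w. G w x) c1 * 1 + deriv (G c1) x * v x) (at 0)"
    proof (rule holomorphic2_on_strict_tendsto[OF G WU])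
      show "((\<lambda>l. (c1 + l - c1) / l ^ 1) \<longlongrightarrow> 1) (at 0)"
        by (rule tendsto_eventually) (auto simp: eventually_at_filter)
      have "(\<lambda>l. c1 + l) analytic_on {0}" by (intro analytic_intros)
      from lim0[OF this] show "((\<lambda>l. c1 + l) \<longlongrightarrow> c1) (at 0)" by simp
      show "(\<gamma> x \<longlongrightarrow> x) (at 0)" using lim0[OF \<gamma>(1)[OF x]] \<gamma>(2)[OF x] by simp
    qed (use x X KU W lim1 in auto)
    moreover have "((\<lambda>l. (G (c1 + l) (\<gamma> x l) - \<gamma> (g x) l) / l ^ M * l ^ (M - 1) + (\<gamma> (g x) l - g x) / l ^ 1) \<longlongrightarrow> \<Delta> x * 0 ^ (M - 1) + v (g x)) (at 0)"
      by (intro tendsto_intros \<Delta> x lim1 gX)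
    then have "((\<lambda>l. (G (c1 + l) (\<gamma> x l) - G c1 x) / l ^ 1) \<longlongrightarrow> v (g x)) (at 0)"
    proof (rule Lim_transform_eventually[OF tendsto_eq_rhs])
      have *: "z / l ^ M * l ^ (M - 1) = z / l" if "l \<noteq> 0" for l z :: complex
        using that M by (cases M) (auto simp: divide_simps)
      have Gx: "G c1 x = g x" using Gg x X KU by blast
      show "\<forall>\<^sub>F l in at 0. (G (c1 + l) (\<gamma> x l) - \<gamma> (g x) l) / l ^ M * l ^ (M - 1) + (\<gamma> (g x) l - g x) / l ^ 1 = (G (c1 + l) (\<gamma> x l) - G c1 x) / l ^ 1"
        unfolding eventually_at_filter
      proof (intro always_eventually allI impI)
        fix l :: complex assume l: "l \<noteq> 0"
        have "(G (c1 + l) (\<gamma> x l) - \<gamma> (g x) l) / l ^ M * l ^ (M - 1) + (\<gamma> (g x) l - g x) / l ^ 1 =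
          (G (c1 + l) (\<gamma> x l) - \<gamma> (g x) l) / l + (\<gamma> (g x) l - g x) / l"
          by (simp only: *[OF l] power_one_right)
        also have "\<dots> = (G (c1 + l) (\<gamma> x l) - G c1 x) / l ^ 1" by (simp add: Gx flip: add_divide_distrib)
        finally show "(G (c1 + l) (\<gamma> x l) - \<gamma> (g x) l) / l ^ M * l ^ (M - 1) + (\<gamma> (g x) l - g x) / l ^ 1 = (G (c1 + l) (\<gamma> x l) - G c1 x) / l ^ 1" .
      qed
    qed (use M in auto)
    ultimately have "deriv (\<lambda>w. G w x) c1 * 1 + deriv (G c1) x * v x = v (g x)" by (rule LIM_unique)
    then show ?thesis using dG[of x] x X KU by (auto simp: algebra_simps)
  qed
  have rec: "y n (g x) = \<Delta> x + deriv g x * (y (Suc n) x + (s (Suc n) - s n) * v x)" if x: "x \<in> X" for n x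
    using u(3)[OF x, of n] L[OF x] by (simp add: y_def e_def s_def algebra_simps)
  obtain B where B: "B > 0" "\<And>x. x \<in> X \<Longrightarrow> norm (v x) \<le> B"
  proof -
    obtain L where "L-lipschitz_on X v" using lip[of 1] M by (auto simp: v_def)
    moreover have "bounded X" using lp X(1) bounded_subset by (auto simp: lifting_property_def)
    ultimately show thesis using that lipschitz_on_bounded by blast
  qed
  obtain B' where B': "B' \<ge> 0" "\<And>x. x \<in> X \<Longrightarrow> norm (deriv g x) \<le> B'"
  proof -
    have "continuous_on (closure K) (deriv g)"
      using g U clK by (meson continuous_on_subset holomorphic_deriv holomorphic_on_imp_continuous_on)
    then have "bounded (deriv g ` closure K)" using clK compact_continuous_image compact_imp_bounded by blast
    then obtain b where "\<And>x. x \<in> closure K \<Longrightarrow> norm (deriv g x) \<le> b" unfolding bounded_iff by blast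
    then show thesis using that[of "max b 0"] X closure_subset[of K] by (meson max.cobounded2 max.coboundedI1 subsetD)
  qed
  have e_c1: "e c1 = 0" "v c1 = 1"
  proof -
    have "\<gamma> c1 = (\<lambda>l. \<Sum>i<2. (if i = 0 then c1 else 1) * l ^ i)" by (simp add: \<gamma>(3) fun_eq_iff numeral_2_eq_2)
    then show "e c1 = 0" "v c1 = 1" using M by (simp_all add: taylor_coeff_polynomial e_def v_def)
  qed
  define Y where "Y = (\<lambda>N x. (\<Sum>n<N. y n x) / of_nat N)"
  define C' where "C' = C + C * B + B' * C"
  have C'nn: "C * B \<ge> 0" "B' * C \<ge> 0" using C B B' by auto
  show thesis
  proof (rule that[of C' Y])
    show "C' \<ge> 0" using C C'nn by (simp add: C'_def)
    show "Y N c1 = 0" for N by (simp add: Y_def y_def s_def e_c1)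
    fix N :: nat and x assume N: "N \<ge> 1" and x: "x \<in> X"
    have Nx: "of_nat N \<noteq> (0::complex)" using N by simp
    have "Y N x + e x = (\<Sum>n<N. y n x + e x) / of_nat N"
      using Nx by (simp add: Y_def sum.distrib field_simps)
    also have "norm \<dots> \<le> (\<Sum>n<N. C + C * B) / real N"
    proof -
      have "norm (y n x + e x) \<le> C + C * B" for n
      proof -
        have "norm (y n x + e x) \<le> norm (u n x) + norm (s n) * norm (v x)"
          using norm_triangle_ineq4[of "u n x" "s n * v x"] by (simp add: y_def norm_mult)
        also have "\<dots> \<le> C + C * B" using u(1)[OF x] u(1)[OF X(2)] B x C by (intro add_mono mult_mono) (auto simp: s_def)
        finally show ?thesis .
      qed
      then show ?thesis unfolding norm_divide norm_of_nat by (intro divide_right_mono sum_norm_le) auto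
    qed
    also have "\<dots> = C + C * B" using N by simp
    also have "\<dots> \<le> C'" using C'nn by (simp add: C'_def)
    finally show "norm (Y N x + taylor_coeff M (\<gamma> x)) \<le> C'" by (simp add: e_def)
    \<comment> \<open>The increments of \<open>y\<close> and of \<open>s * v\<close> collapse
      together to \<open>u N x - u 0 x\<close>, which is bounded. Division by \<open>N\<close>
      therefore leaves an error of order \<open>1 / N\<close>.\<close>
    have "(\<Sum>n<N. y n (g x)) = of_nat N * \<Delta> x + deriv g x * ((\<Sum>n<N. y n x) + u N x)"
    proof -
      have "(\<Sum>n<N. y n (g x)) = of_nat N * \<Delta> x + deriv g x * ((\<Sum>n<N. y n x) + (y N x - y 0 x) + (s N - s 0) * v x)" for N
        by (induction N) (auto simp: rec[OF x] algebra_simps)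
      also have "(y N x - y 0 x) + (s N - s 0) * v x = u N x"
        using u(2)[OF x] by (simp add: y_def algebra_simps)
      then have "(\<Sum>n<N. y n x) + (y N x - y 0 x) + (s N - s 0) * v x = (\<Sum>n<N. y n x) + u N x" by (simp add: algebra_simps)
      finally show ?thesis .
    qed
    then have "Y N (g x) - deriv g x * Y N x - \<Delta> x = deriv g x * u N x / of_nat N"
      using Nx by (simp add: Y_def field_simps)
    also have "norm \<dots> \<le> B' * C / real N"
      unfolding norm_divide norm_mult norm_of_nat using B' u(1)[OF x] x C by (intro divide_right_mono mult_mono) auto
    also have "\<dots> \<le> C' / real N" using C C'nn N by (intro divide_right_mono) (auto simp: C'_def)
    finally show "norm (Y N (g x) - deriv g x * Y N x - \<Delta> x) \<le> C' / real N" .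
  next
    fix N D \<pi> assume D: "open D" "\<pi> ` D \<subseteq> X" "\<pi> holomorphic_on D"
      and T: "\<And>i j. j \<in> {1, M} \<Longrightarrow> (\<lambda>t. taylor_coeff j (\<gamma> ((g ^^ i) (\<pi> t)))) holomorphic_on D"
      and \<Delta>h: "\<And>i. (\<lambda>t. \<Delta> ((g ^^ i) (\<pi> t))) holomorphic_on D"
    have inX: "(g ^^ i) (\<pi> t) \<in> X" if "t \<in> D" for i t
      using that D gX by (induction i) auto
    have XU: "X \<subseteq> U" using X KU by blast
    have orb: "(\<lambda>t. (g ^^ i) (\<pi> t)) holomorphic_on D" for i
    proof (induction i)
      case (Suc i)
      have "(g \<circ> (\<lambda>t. (g ^^ i) (\<pi> t))) holomorphic_on D"
        by (rule holomorphic_on_compose_gen[OF Suc g]) (use inX XU in auto)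
      then show ?case by (simp add: o_def)
    qed (use D in simp)
    have dg: "(\<lambda>t. deriv g ((g ^^ i) (\<pi> t))) holomorphic_on D" for i
      using holomorphic_on_compose_gen[OF orb holomorphic_deriv[OF g U], of i] inX XU by (auto simp: o_def)
    have eh: "(\<lambda>t. e ((g ^^ i) (\<pi> t))) holomorphic_on D" and vh: "(\<lambda>t. v ((g ^^ i) (\<pi> t))) holomorphic_on D" for i
      using T[of M i] T[of 1 i] by (simp_all add: e_def v_def)
    \<comment> \<open>The motions are not assumed holomorphic in the point. Solving
      \<open>rec\<close> for \<open>y (Suc n)\<close> expresses it by \<open>y n\<close> at the next
      orbit point and given holomorphic functions, starting from \<open>y 0\<close>, which is
      \<open>- e\<close>; hence all forward iterates are treated simultaneously.\<close>
    have "\<forall>i. (\<lambda>t. y n ((g ^^ i) (\<pi> t))) holomorphic_on D" for n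
    proof (induction n)
      case 0
      show ?case
      proof
        fix i
        have "(\<lambda>t. - e ((g ^^ i) (\<pi> t))) holomorphic_on D" by (intro holomorphic_intros eh)
        then show "(\<lambda>t. y 0 ((g ^^ i) (\<pi> t))) holomorphic_on D"
          by (rule holomorphic_transform) (simp add: y_def s_def u(2)[OF inX] u(2)[OF X(2)])
      qed
    next
      case (Suc n)
      show ?case
      proof
        fix i
        have "(\<lambda>t. (y n ((g ^^ (Suc i)) (\<pi> t)) - \<Delta> ((g ^^ i) (\<pi> t))) / deriv g ((g ^^ i) (\<pi> t))
             - (s (Suc n) - s n) * v ((g ^^ i) (\<pi> t))) holomorphic_on D"
          by (intro holomorphic_intros Suc[rule_format] \<Delta>h dg vh) (use nzg inX in auto)
        then show "(\<lambda>t. y (Suc n) ((g ^^ i) (\<pi> t))) holomorphic_on D"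
        proof (rule holomorphic_transform)
          fix t assume t: "t \<in> D"
          show "(y n ((g ^^ (Suc i)) (\<pi> t)) - \<Delta> ((g ^^ i) (\<pi> t))) / deriv g ((g ^^ i) (\<pi> t))
             - (s (Suc n) - s n) * v ((g ^^ i) (\<pi> t)) = y (Suc n) ((g ^^ i) (\<pi> t))"
            using rec[OF inX[OF t, of i], of n] nzg[OF inX[OF t, of i]] by (simp add: field_simps)
        qed
      qed
    qed
    from this[THEN spec[of _ 0]] show "(\<lambda>t. Y N (\<pi> t)) holomorphic_on D"
      unfolding Y_def divide_inverse by (intro holomorphic_intros) auto
  qed
qed

section \<open>Orbits of parabolic germs\<close>

text \<open>Summed increments place \<open>\<zeta>\<close> after \<open>k\<close> further steps
  within \<open>p * k / 8\<close> of a translate of \<open>- p * k\<close>; once the starting value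
  is negligible, the point lies close to the negative real axis as seen from 0.\<close>

lemma drift_imp_sector:
  fixes \<zeta> :: "nat \<Rightarrow> complex" and p :: real
  assumes p: "p > 0" and lim: "(\<lambda>n. \<zeta> (Suc n) - \<zeta> n) \<longlonglongrightarrow> - of_real p"
  shows "\<forall>\<^sub>F n in sequentially. Re (\<zeta> n) \<le> - (norm (\<zeta> n) / 2)"
proof -
  have "\<forall>\<^sub>F n in sequentially. dist (\<zeta> (Suc n) - \<zeta> n) (- of_real p) < p / 8"
    using tendstoD[OF lim, of "p / 8"] p by simp
  then obtain N where N: "\<And>n. n \<ge> N \<Longrightarrow> norm (\<zeta> (Suc n) - \<zeta> n + of_real p) \<le> p / 8"
    by (auto simp: eventually_sequentially dist_norm intro: less_imp_le)
  have dev: "norm (\<zeta> (N + k) - \<zeta> N + of_real (p * k)) \<le> p * k / 8" for k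
  proof (induction k)
    case (Suc k)
    have "\<zeta> (N + Suc k) - \<zeta> N + of_real (p * Suc k) =
       (\<zeta> (N + k) - \<zeta> N + of_real (p * k)) + (\<zeta> (Suc (N + k)) - \<zeta> (N + k) + of_real p)"
      by (simp add: algebra_simps)
    also have "norm \<dots> \<le> p * k / 8 + p / 8" by (rule norm_triangle_mono[OF Suc N]) simp
    finally show ?case by (simp add: algebra_simps)
  qed simp
  obtain k0 :: nat where k0: "real k0 \<ge> 8 * norm (\<zeta> N) / p" using real_arch_simple by blast
  have "Re (\<zeta> n) \<le> - (norm (\<zeta> n) / 2)" if "n \<ge> N + k0" for n
  proof -
    define k where "k = n - N"
    have n: "n = N + k" and "k \<ge> k0" using that by (auto simp: k_def)
    then have "8 * norm (\<zeta> N) / p \<le> real k" using k0 by linarith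
    then have "norm (\<zeta> N) \<le> p * k / 8" using p by (simp add: field_simps)
    with dev[of k] have *: "norm (\<zeta> n + of_real (p * k)) \<le> p * k / 4"
      using norm_triangle_ineq[of "\<zeta> (N + k) - \<zeta> N + of_real (p * k)" "\<zeta> N"] by (simp add: n)
    have "Re (\<zeta> n) + p * k \<le> p * k / 4" using complex_Re_le_cmod[of "\<zeta> n + of_real (p * k)"] * by simp
    moreover have "norm (\<zeta> n) \<le> p * k / 4 + p * k"
    proof -
      have "norm (of_real (p * k) :: complex) = p * k" unfolding norm_of_real using p by simp
      then show ?thesis using norm_triangle_ineq4[of "\<zeta> n + of_real (p * k)" "of_real (p * k)"] *
        by (simp del: of_real_mult)
    qed
    moreover have "p * k \<ge> 0" using p by simp
    ultimately show ?thesis by linarith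
  qed
  then show ?thesis by (auto simp: eventually_sequentially)
qed

text \<open>With \<open>x = k * norm (\<beta> n)\<close>, the squared modulus of
  \<open>1 + k * \<beta> n\<close> is at most \<open>1 - x + x ^ 2\<close>, hence at most
  \<open>1 - 3 / 4 * x\<close> for small \<open>x\<close>; the deviation of \<open>e n\<close> from
  \<open>k\<close> costs another \<open>x / 8\<close>.\<close>

lemma norm_one_plus_sector:
  fixes \<beta> :: "nat \<Rightarrow> complex" and k :: real
  assumes \<beta>: "\<beta> \<longlonglongrightarrow> 0" and Re: "\<forall>\<^sub>F n in sequentially. Re (\<beta> n) \<le> - (norm (\<beta> n) / 2)"
    and k: "k > 0" and e: "e \<longlonglongrightarrow> of_real k"
  shows "\<forall>\<^sub>F n in sequentially. norm (1 + \<beta> n * e n) \<le> 1 - k * norm (\<beta> n) / 4"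
proof -
  have small: "\<forall>\<^sub>F n in sequentially. norm (\<beta> n) < 1 / (4 * k)"
    using tendstoD[OF \<beta>, of "1 / (4 * k)"] k by simp
  have near: "\<forall>\<^sub>F n in sequentially. norm (e n - of_real k) < k / 8"
    using tendstoD[OF e, of "k / 8"] k by (simp add: dist_norm)
  from Re small near show ?thesis
  proof eventually_elim
    case (elim n)
    define x where "x = k * norm (\<beta> n)"
    have x: "0 \<le> x" "x \<le> 1 / 4" using elim k by (auto simp: x_def field_simps)
    have "(norm (1 + of_real k * \<beta> n))\<^sup>2 = 1 + 2 * (k * Re (\<beta> n)) + x\<^sup>2"
      unfolding x_def power_mult_distrib cmod_power2 by (simp add: power2_eq_square algebra_simps)
    also have "k * Re (\<beta> n) \<le> - (x / 2)" using elim(1) k mult_left_mono[OF elim(1), of k] by (simp add: x_def)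
    also have "x\<^sup>2 \<le> x / 4" using mult_left_mono[OF x(2) x(1)] by (simp add: power2_eq_square)
    finally have "(norm (1 + of_real k * \<beta> n))\<^sup>2 \<le> 1 - 3 / 4 * x" by simp
    also have "\<dots> \<le> (1 - 3 / 8 * x)\<^sup>2" by (simp add: power2_eq_square algebra_simps)
    finally have 1: "norm (1 + of_real k * \<beta> n) \<le> 1 - 3 / 8 * x"
      by (rule power2_le_imp_le) (use x in simp)
    have "norm (\<beta> n * (e n - of_real k)) \<le> norm (\<beta> n) * (k / 8)"
      unfolding norm_mult using elim by (intro mult_left_mono) auto
    also have "\<dots> = x / 8" by (simp add: x_def)
    finally have 2: "norm (\<beta> n * (e n - of_real k)) \<le> x / 8" .
    have "1 + \<beta> n * e n = (1 + of_real k * \<beta> n) + \<beta> n * (e n - of_real k)" by (simp add: algebra_simps)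
    then have "norm (1 + \<beta> n * e n) \<le> (1 - 3 / 8 * x) + x / 8"
      by (simp only: norm_triangle_mono[OF 1 2])
    then show ?case by (simp add: x_def)
  qed
qed

text \<open>\<open>C / a\<close> is the common fixed point of all the affine maps that dominate the
  steps, and each of them is monotone, so no larger bound can be crossed.\<close>

lemma contraction_sequence_bounded:
  fixes t \<theta> :: "nat \<Rightarrow> real"
  assumes step: "\<And>n. n \<ge> N \<Longrightarrow> t (Suc n) \<le> (1 - a * \<theta> n) * t n + C * \<theta> n"
    and a: "a > 0" and \<theta>: "\<And>n. n \<ge> N \<Longrightarrow> 0 \<le> \<theta> n \<and> a * \<theta> n \<le> 1" and n: "n \<ge> N"
  shows "t n \<le> max (t N) (C / a)"
  using n
proof (induction n rule: dec_induct)
  case (step n)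
  define B where "B = max (t N) (C / a)"
  have "t (Suc n) \<le> (1 - a * \<theta> n) * B + C * \<theta> n"
    using assms(1)[of n] \<theta>[of n] step mult_left_mono[of "t n" B "1 - a * \<theta> n"] by (auto simp: B_def)
  also have "C * \<theta> n \<le> a * B * \<theta> n"
  proof (intro mult_right_mono)
    have "C / a \<le> B" by (simp add: B_def)
    then show "C \<le> a * B" using a by (simp add: field_simps)
  qed (use \<theta>[of n] step in auto)
  finally show ?case by (simp add: B_def algebra_simps)
qed simp

lemma eventually_norm_le_imp_all:
  fixes f g :: "nat \<Rightarrow> real"
  assumes "\<forall>\<^sub>F n in sequentially. f n \<le> C * g n" and g: "\<And>n. g n > 0"
  obtains C' where "C' \<ge> 0" "\<And>n. f n \<le> C' * g n"
proof -
  obtain N where N: "\<And>n. n \<ge> N \<Longrightarrow> f n \<le> C * g n" using assms(1) by (auto simp: eventually_sequentially)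
  define C' where "C' = \<bar>C\<bar> + (\<Sum>n<N. \<bar>f n\<bar> / g n)"
  have s: "(\<Sum>n<N. \<bar>f n\<bar> / g n) \<ge> 0" using g by (intro sum_nonneg divide_nonneg_pos) auto
  have "f n \<le> C' * g n" for n
  proof (cases "n < N")
    case True
    have "\<bar>f n\<bar> / g n \<le> (\<Sum>n<N. \<bar>f n\<bar> / g n)" using g True by (intro member_le_sum divide_nonneg_pos) auto
    then have "\<bar>f n\<bar> / g n \<le> C'" unfolding C'_def by linarith
    then show ?thesis using g[of n] by (simp add: field_simps)
  next
    case False
    have "C * g n \<le> C' * g n" using s g[of n] unfolding C'_def by (intro mult_right_mono) auto
    then show ?thesis using N[of n] False by linarith
  qed
  then show thesis using that[of C'] s by (simp add: C'_def)
qed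

section \<open>Asymptotics of a single orbit of a parabolic germ\<close>

locale parabolic_germ =
  fixes f :: "complex \<Rightarrow> complex" and p :: nat and b :: complex and \<delta> :: real and x :: "nat \<Rightarrow> complex"
  assumes p: "p \<ge> 1" and b: "b \<noteq> 0" and \<delta>: "\<delta> > 0" and f: "f holomorphic_on ball 0 \<delta>"
    and f_lim: "((\<lambda>x. (f x - x) / x ^ (p + 1)) \<longlongrightarrow> b) (at 0)"
    and x: "x \<longlonglongrightarrow> 0" "\<And>n. x n \<noteq> 0" "\<And>n. x n \<in> ball 0 \<delta>" "\<And>n. x (Suc n) = f (x n)"
begin

text \<open>The relative displacement \<open>x (Suc n) / x n - 1\<close> is asymptotic to this
  quantity, which is the natural small parameter along the orbit.\<close>

definition \<beta> where "\<beta> n = b * x n ^ p"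

lemma \<beta>_nz: "\<beta> n \<noteq> 0" using b x by (simp add: \<beta>_def)

lemma \<beta>_lim: "\<beta> \<longlonglongrightarrow> 0"
proof -
  have "(\<lambda>n. b * x n ^ p) \<longlonglongrightarrow> b * 0 ^ p" by (intro tendsto_intros x)
  then show ?thesis using p by (simp add: \<beta>_def[abs_def] zero_power)
qed

lemma x_at: "filterlim x (at 0) sequentially"
  using x by (auto simp: filterlim_at)

text \<open>Normalised, like \<open>\<epsilon>2\<close>, so that \<open>x_Suc\<close> and
  \<open>deriv_f\<close> are identities and not asymptotics; the analysis is reduced to the limits 1
  and \<open>p + 1\<close> of the two sequences.\<close>

definition \<epsilon>1 where "\<epsilon>1 n = (x (Suc n) - x n) / (x n * \<beta> n)"
definition \<epsilon>2 where "\<epsilon>2 n = (deriv f (x n) - 1) / \<beta> n"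

lemma x_Suc: "x (Suc n) = x n * (1 + \<beta> n * \<epsilon>1 n)"
  using \<beta>_nz[of n] x(2)[of n] by (simp add: \<epsilon>1_def field_simps)

lemma deriv_f: "deriv f (x n) = 1 + \<beta> n * \<epsilon>2 n"
  using \<beta>_nz[of n] by (simp add: \<epsilon>2_def)

lemma \<epsilon>1_lim: "\<epsilon>1 \<longlonglongrightarrow> 1"
proof -
  have "(\<lambda>n. (f (x n) - x n) / x n ^ (p + 1) / b) \<longlonglongrightarrow> b / b"
    by (intro tendsto_intros filterlim_compose[OF f_lim x_at] b)
  then show ?thesis using b by (simp add: \<epsilon>1_def[abs_def] \<beta>_def x(4) field_simps)
qed

lemma \<epsilon>2_lim: "\<epsilon>2 \<longlonglongrightarrow> of_nat (p + 1)"
proof -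
  define \<phi> where "\<phi> = (\<lambda>x. f x - x)"
  have an: "\<phi> analytic_on {0}" unfolding \<phi>_def analytic_at
    by (intro exI[of _ "ball 0 \<delta>"] conjI holomorphic_intros f) (use \<delta> in auto)
  have lim: "((\<lambda>x. \<phi> x / x ^ (p + 1)) \<longlongrightarrow> b) (at 0)" using f_lim by (simp add: \<phi>_def)
  have tc: "taylor_coeff j \<phi> = 0" if "j < p + 1" for j
    using taylor_coeff_zeroI(1)[OF an lim that] by simp
  have tcb: "taylor_coeff (p + 1) \<phi> = b"
    using taylor_coeff_zeroI(2)[OF an lim] by simp
  have an': "deriv \<phi> analytic_on {0}" using an by (rule analytic_deriv)
  have tc': "taylor_coeff j (deriv \<phi>) = of_nat (j + 1) * taylor_coeff (j + 1) \<phi>" for j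
  proof -
    have "of_nat (j + 1) \<noteq> (0::complex)" by (simp only: of_nat_eq_0_iff)
    then show ?thesis by (simp add: taylor_coeff_deriv funpow_Suc_right fact_Suc del: funpow.simps of_nat_Suc of_nat_add)
  qed
  have "((\<lambda>x. deriv \<phi> x / x ^ p) \<longlongrightarrow> of_nat (p + 1) * b) (at 0)"
    using taylor_coeff_tendsto[OF an', of p] tc by (simp add: tc' tcb[simplified])
  then have "(\<lambda>n. deriv \<phi> (x n) / x n ^ p / b) \<longlonglongrightarrow> of_nat (p + 1) * b / b"
    by (intro tendsto_intros filterlim_compose[OF _ x_at] b)
  moreover have "(of_nat (p + 1) * b) / b = (of_nat (p + 1) :: complex)" using b by simp
  moreover have d\<phi>: "deriv \<phi> (x n) = deriv f (x n) - 1" for n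
  proof -
    have "f field_differentiable at (x n)" using f x(3) holomorphic_on_imp_differentiable_at by blast
    then show ?thesis unfolding \<phi>_def by (subst deriv_diff) (auto intro: derivative_intros)
  qed
  moreover have "(\<lambda>n. deriv \<phi> (x n) / x n ^ p / b) = \<epsilon>2"
    by (simp add: \<epsilon>2_def \<beta>_def d\<phi> fun_eq_iff mult.commute)
  ultimately show ?thesis by (simp only:)
qed

text \<open>The difference quotient at 1 of the power with exponent \<open>- m\<close>, along the
  increments \<open>\<beta> n * \<epsilon>1 n\<close>. With \<open>m = p\<close> it gives the drift
  of \<open>1 / \<beta>\<close>, with \<open>m = p - s\<close> the growth of the comparison sequence
  for resonant increments.\<close>

lemma ratio_power_lim:
  assumes "m \<ge> 1"
  shows "(\<lambda>n. (inverse ((1 + \<beta> n * \<epsilon>1 n) ^ m) - 1) / \<beta> n) \<longlonglongrightarrow> - of_nat m"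
proof -
  define h where "h = (\<lambda>n. \<beta> n * \<epsilon>1 n)"
  have h0: "h \<longlonglongrightarrow> 0" using tendsto_mult[OF \<beta>_lim \<epsilon>1_lim] by (simp add: h_def)
  have nz: "\<forall>\<^sub>F n in sequentially. \<epsilon>1 n \<noteq> 0"
    using \<epsilon>1_lim by (rule tendsto_imp_eventually_ne) simp
  then have nzh: "\<forall>\<^sub>F n in sequentially. h n \<noteq> 0" by eventually_elim (simp add: h_def \<beta>_nz)
  have "((\<lambda>z. inverse (z ^ m)) has_field_derivative - of_nat m) (at (1::complex))"
    by (auto intro!: derivative_eq_intros)
  then have "((\<lambda>h. (inverse ((1 + h) ^ m) - 1) / h) \<longlongrightarrow> - of_nat m) (at (0::complex))"
    by (simp add: DERIV_def)
  then have "(\<lambda>n. (inverse ((1 + h n) ^ m) - 1) / h n) \<longlonglongrightarrow> - of_nat m"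
    by (rule filterlim_compose) (use h0 nzh in \<open>auto simp: filterlim_at\<close>)
  from tendsto_mult[OF this \<epsilon>1_lim]
  have "(\<lambda>n. (inverse ((1 + h n) ^ m) - 1) / h n * \<epsilon>1 n) \<longlonglongrightarrow> - of_nat m" by simp
  then show ?thesis
  proof (rule Lim_transform_eventually)
    show "\<forall>\<^sub>F n in sequentially. (inverse ((1 + h n) ^ m) - 1) / h n * \<epsilon>1 n = (inverse ((1 + \<beta> n * \<epsilon>1 n) ^ m) - 1) / \<beta> n"
      using nz by eventually_elim (simp add: h_def \<beta>_nz)
  qed
qed

text \<open>Up to a constant, \<open>1 / \<beta>\<close> is an approximate Fatou coordinate: each
  step translates it by nearly \<open>- p\<close>. Inversion carries the sector found for it back to
  \<open>\<beta>\<close>, because it preserves the sign of the real part and its ratio to the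
  modulus.\<close>

lemma sector: "\<forall>\<^sub>F n in sequentially. Re (\<beta> n) \<le> - (norm (\<beta> n) / 2)"
proof -
  define \<zeta> where "\<zeta> = (\<lambda>n. inverse (\<beta> n))"
  have "\<zeta> (Suc n) - \<zeta> n = (inverse ((1 + \<beta> n * \<epsilon>1 n) ^ p) - 1) / \<beta> n" for n
  proof -
    have "\<beta> (Suc n) = \<beta> n * (1 + \<beta> n * \<epsilon>1 n) ^ p"
      unfolding \<beta>_def[of "Suc n"] x_Suc power_mult_distrib by (simp add: \<beta>_def)
    then have "\<zeta> (Suc n) = \<zeta> n * inverse ((1 + \<beta> n * \<epsilon>1 n) ^ p)" by (simp add: \<zeta>_def)
    then show ?thesis by (simp add: \<zeta>_def divide_inverse algebra_simps)
  qed
  then have "(\<lambda>n. \<zeta> (Suc n) - \<zeta> n) \<longlonglongrightarrow> - of_real (real p)"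
    using ratio_power_lim[OF p] by simp
  then have "\<forall>\<^sub>F n in sequentially. Re (\<zeta> n) \<le> - (norm (\<zeta> n) / 2)"
    by (rule drift_imp_sector[rotated]) (use p in simp)
  then show ?thesis
  proof eventually_elim
    case (elim n)
    have nz: "norm (\<beta> n) > 0" using \<beta>_nz by simp
    have "Re (\<zeta> n) = Re (\<beta> n) / (norm (\<beta> n))\<^sup>2" by (simp add: \<zeta>_def cmod_power2)
    moreover have "norm (\<zeta> n) = norm (\<beta> n) / (norm (\<beta> n))\<^sup>2"
      using nz by (simp add: \<zeta>_def norm_inverse power2_eq_square divide_inverse)
    ultimately have "Re (\<beta> n) / (norm (\<beta> n))\<^sup>2 \<le> - (norm (\<beta> n) / 2) / (norm (\<beta> n))\<^sup>2" using elim by simp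
    from mult_right_mono[OF this, of "(norm (\<beta> n))\<^sup>2"] nz show ?case by simp
  qed
qed

lemma norm_ratio: "\<forall>\<^sub>F n in sequentially. norm (1 + \<beta> n * \<epsilon>1 n) \<le> 1 - norm (\<beta> n) / 4"
  using norm_one_plus_sector[OF \<beta>_lim sector, of 1 \<epsilon>1] \<epsilon>1_lim by simp

lemma norm_decrease: "\<forall>\<^sub>F n in sequentially. norm (\<beta> n) * norm (x n) / 4 \<le> norm (x n) - norm (x (Suc n))"
  using norm_ratio
proof eventually_elim
  case (elim n)
  have "norm (x (Suc n)) \<le> norm (x n) * (1 - norm (\<beta> n) / 4)"
    unfolding x_Suc norm_mult by (intro mult_left_mono elim) auto
  then show ?case by (simp add: algebra_simps)
qed

text \<open>A sequence whose increments are small compared with those of the orbit itself varies at most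
  as much as the modulus of the orbit, which decreases monotonically.\<close>

lemma increments_imp_lipschitz:
  fixes y :: "nat \<Rightarrow> complex"
  assumes "\<forall>\<^sub>F n in sequentially. norm (y (Suc n) - y n) \<le> C * (norm (\<beta> n) * norm (x n))"
  shows "\<forall>\<^sub>F n in sequentially. \<forall>k\<ge>n. norm (y k - y n) \<le> 4 * \<bar>C\<bar> * (norm (x n) - norm (x k))"
proof -
  have "\<forall>\<^sub>F n in sequentially. norm (y (Suc n) - y n) \<le> 4 * \<bar>C\<bar> * (norm (x n) - norm (x (Suc n)))"
    using assms norm_decrease
  proof eventually_elim
    case (elim n)
    have "C * (norm (\<beta> n) * norm (x n)) \<le> \<bar>C\<bar> * (norm (\<beta> n) * norm (x n))" by (intro mult_right_mono) auto
    also have "\<dots> = 4 * \<bar>C\<bar> * (norm (\<beta> n) * norm (x n) / 4)" by simp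
    also have "\<dots> \<le> 4 * \<bar>C\<bar> * (norm (x n) - norm (x (Suc n)))" by (intro mult_left_mono elim) auto
    finally show ?case using elim by linarith
  qed
  then obtain N where N: "\<And>n. n \<ge> N \<Longrightarrow> norm (y (Suc n) - y n) \<le> 4 * \<bar>C\<bar> * (norm (x n) - norm (x (Suc n)))"
    by (auto simp: eventually_sequentially)
  have "norm (y k - y n) \<le> 4 * \<bar>C\<bar> * (norm (x n) - norm (x k))" if "n \<ge> N" "k \<ge> n" for n k
    using that(2)
  proof (induction k rule: dec_induct)
    case (step k)
    have "norm (y (Suc k) - y n) \<le> norm (y (Suc k) - y k) + norm (y k - y n)"
      using norm_triangle_ineq[of "y (Suc k) - y k" "y k - y n"] by simp
    also have "\<dots> \<le> 4 * \<bar>C\<bar> * (norm (x k) - norm (x (Suc k))) + 4 * \<bar>C\<bar> * (norm (x n) - norm (x k))"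
      using step that by (intro add_mono N) auto
    finally show ?case by (simp add: algebra_simps)
  qed simp
  then show ?thesis by (auto simp: eventually_sequentially)
qed

text \<open>Excludes spiralling: the chord between two orbit points is controlled by the difference
  of their moduli. The separation of the branches depends on it.\<close>

lemma orbit_lipschitz: "\<exists>C. \<forall>\<^sub>F n in sequentially. \<forall>k\<ge>n. norm (x k - x n) \<le> C * (norm (x n) - norm (x k))"
proof -
  have "\<forall>\<^sub>F n in sequentially. norm (\<epsilon>1 n) < 2"
    using order_tendstoD(2)[OF tendsto_norm[OF \<epsilon>1_lim], of 2] by simp
  then have "\<forall>\<^sub>F n in sequentially. norm (x (Suc n) - x n) \<le> 2 * (norm (\<beta> n) * norm (x n))"
  proof eventually_elim
    case (elim n)
    have "x (Suc n) - x n = \<epsilon>1 n * (\<beta> n * x n)" by (simp add: x_Suc algebra_simps)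
    then show ?case using elim by (simp add: norm_mult mult_right_mono)
  qed
  from increments_imp_lipschitz[OF this] show ?thesis by blast
qed

text \<open>The orbit shrinks like \<open>1 + \<beta> n\<close>, the homogeneous solutions like
  \<open>1 + (p + 1) * \<beta> n\<close>. The ratio of \<open>y\<close> to the orbit is therefore
  contracted by about \<open>1 + p * \<beta> n\<close>, while the inhomogeneity adds only a multiple
  of \<open>norm (\<beta> n)\<close> to it. The second claim feeds the resulting size of the
  increments into \<open>increments_imp_lipschitz\<close>.\<close>

lemma linear_recursion_bound:
  fixes y :: "nat \<Rightarrow> complex"
  assumes "\<forall>\<^sub>F n in sequentially. norm (y (Suc n) - deriv f (x n) * y n) \<le> C * norm (x n) ^ (p + 1)"
  shows "\<exists>C'. \<forall>\<^sub>F n in sequentially. norm (y n) \<le> C' * norm (x n)"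
    and "\<exists>C'. \<forall>\<^sub>F n in sequentially. \<forall>k\<ge>n. norm (y k - y n) \<le> C' * (norm (x n) - norm (x k))"
proof -
  define t where "t = (\<lambda>n. norm (y n) / norm (x n))"
  define C1 where "C1 = 2 * \<bar>C\<bar> / norm b"
  have xp: "norm (x n) > 0" for n using x(2) by simp
  have bp: "norm b > 0" using b by simp
  have xpow: "\<bar>C\<bar> * norm (x n) ^ (p + 1) = \<bar>C\<bar> / norm b * (norm (\<beta> n) * norm (x n))" for n
    using bp by (simp add: \<beta>_def norm_mult norm_power)
  \<comment> \<open>Chosen so that \<open>deriv f (x n)\<close> divided by
    \<open>x (Suc n) / x n\<close> equals \<open>1 + \<beta> n * e n\<close>; the limits of
    \<open>\<epsilon>1\<close> and \<open>\<epsilon>2\<close> give the limit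
    \<open>p\<close>.\<close>
  define e where "e = (\<lambda>n. (\<epsilon>2 n - \<epsilon>1 n) / (1 + \<beta> n * \<epsilon>1 n))"
  have "e \<longlonglongrightarrow> (of_nat (p + 1) - 1) / (1 + 0 * 1)"
    unfolding e_def by (intro tendsto_intros \<epsilon>1_lim \<epsilon>2_lim \<beta>_lim) simp
  then have e: "e \<longlonglongrightarrow> of_real (real p)" by simp
  have contr: "\<forall>\<^sub>F n in sequentially. norm (1 + \<beta> n * e n) \<le> 1 - real p * norm (\<beta> n) / 4"
    by (rule norm_one_plus_sector[OF \<beta>_lim sector _ e]) (use p in simp)
  have "(\<lambda>n. norm (1 + \<beta> n * \<epsilon>1 n)) \<longlonglongrightarrow> norm (1 + 0 * 1 :: complex)"
    by (intro tendsto_intros \<beta>_lim \<epsilon>1_lim)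
  then have half: "\<forall>\<^sub>F n in sequentially. norm (1 + \<beta> n * \<epsilon>1 n) > 1 / 2"
    by (rule order_tendstoD) simp
  have small: "\<forall>\<^sub>F n in sequentially. real p / 4 * norm (\<beta> n) < 1"
  proof -
    have "(\<lambda>n. real p / 4 * norm (\<beta> n)) \<longlonglongrightarrow> real p / 4 * norm (0::complex)" by (intro tendsto_intros \<beta>_lim)
    then show ?thesis by (rule order_tendstoD) simp
  qed
  have "\<forall>\<^sub>F n in sequentially. t (Suc n) \<le> (1 - real p / 4 * norm (\<beta> n)) * t n + C1 * norm (\<beta> n) \<and> real p / 4 * norm (\<beta> n) \<le> 1"
    using assms contr half small
  proof eventually_elim
    case (elim n)
    have q0: "1 + \<beta> n * \<epsilon>1 n \<noteq> 0" using elim(3) by auto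
    have xS: "norm (x (Suc n)) \<ge> norm (x n) / 2"
    proof -
      have "norm (x n) * (1 / 2) \<le> norm (x n) * norm (1 + \<beta> n * \<epsilon>1 n)"
        using elim(3) by (intro mult_left_mono) auto
      then show ?thesis by (simp add: x_Suc norm_mult)
    qed
    have "deriv f (x n) / (1 + \<beta> n * \<epsilon>1 n) = 1 + \<beta> n * e n"
      using q0 by (simp add: deriv_f e_def field_simps)
    then have dq: "deriv f (x n) * y n / x (Suc n) = (1 + \<beta> n * e n) * (y n / x n)"
    proof -
      define q where "q = 1 + \<beta> n * \<epsilon>1 n"
      have "deriv f (x n) = q * (1 + \<beta> n * e n)" "q \<noteq> 0" "x (Suc n) = x n * q"
        using q0 \<open>deriv f (x n) / (1 + \<beta> n * \<epsilon>1 n) = 1 + \<beta> n * e n\<close> by (auto simp: q_def x_Suc nonzero_divide_eq_eq mult.commute)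
      then show ?thesis using x(2)[of n] by simp
    qed
    have "y (Suc n) / x (Suc n) = deriv f (x n) * y n / x (Suc n) + (y (Suc n) - deriv f (x n) * y n) / x (Suc n)"
      by (simp add: diff_divide_distrib)
    then have "t (Suc n) \<le> norm (deriv f (x n) * y n / x (Suc n)) + norm ((y (Suc n) - deriv f (x n) * y n) / x (Suc n))"
      unfolding t_def norm_divide[symmetric] by (metis norm_triangle_ineq)
    also have "norm (deriv f (x n) * y n / x (Suc n)) \<le> (1 - real p / 4 * norm (\<beta> n)) * t n"
      unfolding dq norm_mult using elim(2) by (auto simp: t_def norm_divide intro!: mult_right_mono divide_right_mono)
    also have "norm ((y (Suc n) - deriv f (x n) * y n) / x (Suc n)) \<le> (\<bar>C\<bar> * norm (x n) ^ (p + 1)) / (norm (x n) / 2)"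
      unfolding norm_divide
    proof (rule frac_le)
      have "C * norm (x n) ^ (p + 1) \<le> \<bar>C\<bar> * norm (x n) ^ (p + 1)" by (intro mult_right_mono) auto
      then show "norm (y (Suc n) - deriv f (x n) * y n) \<le> \<bar>C\<bar> * norm (x n) ^ (p + 1)" using elim(1) by linarith
    qed (use xS xp in auto)
    also have "\<dots> = C1 * norm (\<beta> n)" unfolding xpow C1_def using xp[of n] by (simp add: field_simps)
    finally show ?case using elim(4) by simp
  qed
  then obtain N where N: "\<And>n. n \<ge> N \<Longrightarrow> t (Suc n) \<le> (1 - real p / 4 * norm (\<beta> n)) * t n + C1 * norm (\<beta> n)"
    "\<And>n. n \<ge> N \<Longrightarrow> real p / 4 * norm (\<beta> n) \<le> 1" by (auto simp: eventually_sequentially)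
  have "t n \<le> max (t N) (C1 / (real p / 4))" if "n \<ge> N" for n
    by (rule contraction_sequence_bounded[where t=t and a="real p / 4" and \<theta>="\<lambda>n. norm (\<beta> n)", OF N(1)]) (use N(2) that p in auto)
  then obtain B where B: "\<And>n. n \<ge> N \<Longrightarrow> t n \<le> B" by blast
  have yB: "norm (y n) \<le> B * norm (x n)" if "n \<ge> N" for n
    using B[OF that] xp[of n] by (simp add: t_def field_simps)
  then have evB: "\<forall>\<^sub>F n in sequentially. norm (y n) \<le> B * norm (x n)" by (auto simp: eventually_sequentially)
  then show "\<exists>C'. \<forall>\<^sub>F n in sequentially. norm (y n) \<le> C' * norm (x n)" by blast
  have e2: "\<forall>\<^sub>F n in sequentially. norm (\<epsilon>2 n) < real (p + 2)"
  proof -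
    have "norm (of_nat (p + 1) :: complex) < real (p + 2)" unfolding norm_of_nat by simp
    then show ?thesis by (rule order_tendstoD(2)[OF tendsto_norm[OF \<epsilon>2_lim]])
  qed
  have "\<forall>\<^sub>F n in sequentially. norm (y (Suc n) - y n) \<le> (real (p + 2) * B + \<bar>C\<bar> / norm b) * (norm (\<beta> n) * norm (x n))"
    using assms evB e2
  proof eventually_elim
    case (elim n)
    have "y (Suc n) - y n = (y (Suc n) - deriv f (x n) * y n) + \<epsilon>2 n * (\<beta> n * y n)"
      by (simp add: deriv_f algebra_simps)
    then have "norm (y (Suc n) - y n) \<le> norm (y (Suc n) - deriv f (x n) * y n) + norm (\<epsilon>2 n) * (norm (\<beta> n) * norm (y n))"
      by (metis norm_triangle_ineq norm_mult)
    also have "\<dots> \<le> \<bar>C\<bar> * norm (x n) ^ (p + 1) + real (p + 2) * (norm (\<beta> n) * (B * norm (x n)))"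
    proof (intro add_mono mult_mono)
      have "C * norm (x n) ^ (p + 1) \<le> \<bar>C\<bar> * norm (x n) ^ (p + 1)" by (intro mult_right_mono) auto
      then show "norm (y (Suc n) - deriv f (x n) * y n) \<le> \<bar>C\<bar> * norm (x n) ^ (p + 1)" using elim(1) by linarith
    qed (use elim in auto)
    finally show ?case unfolding xpow by (simp add: algebra_simps)
  qed
  from increments_imp_lipschitz[OF this]
  show "\<exists>C'. \<forall>\<^sub>F n in sequentially. \<forall>k\<ge>n. norm (y k - y n) \<le> C' * (norm (x n) - norm (x k))" by blast
qed

text \<open>Increments comparable to \<open>x n ^ s\<close> sum up to a multiple of \<open>1 / x n ^ (p - s)\<close>.\<close>

lemma resonant_increments_unbounded:
  fixes y :: "nat \<Rightarrow> complex"
  assumes s: "s < p" and A: "A \<noteq> 0" and inc: "(\<lambda>n. (y (Suc n) - y n) / x n ^ s) \<longlonglongrightarrow> A"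
  shows "\<not> (\<exists>B. \<forall>n. norm (y n) \<le> B)"
proof
  assume "\<exists>B. \<forall>n. norm (y n) \<le> B"
  then obtain B where B: "\<And>n. norm (y n) \<le> B" by blast
  define m where "m = p - s"
  have m: "m \<ge> 1" "p = m + s" using s by (auto simp: m_def)
  have pw: "z ^ m * z ^ s = z ^ p" for z :: "'z::monoid_mult" using m by (simp add: power_add)
  \<comment> \<open>Since \<open>p = m + s\<close>, the increments of \<open>w\<close> are
    asymptotic to \<open>- m * b * x n ^ s\<close>; the constant \<open>c0\<close> matches them with
    the increments of \<open>y\<close>.\<close>
  define w where "w = (\<lambda>n. inverse (x n ^ m))"
  define c0 where "c0 = - A / (of_nat m * b)"
  have c0: "c0 \<noteq> 0" using A b m by (simp add: c0_def)
  have w_Suc: "w (Suc n) = w n * inverse ((1 + \<beta> n * \<epsilon>1 n) ^ m)" for n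
    unfolding w_def x_Suc power_mult_distrib inverse_mult_distrib ..
  have w_inc: "w (Suc n) - w n = b * x n ^ s * ((inverse ((1 + \<beta> n * \<epsilon>1 n) ^ m) - 1) / \<beta> n)" for n
  proof -
    have "w (Suc n) - w n = w n * (inverse ((1 + \<beta> n * \<epsilon>1 n) ^ m) - 1)"
      by (simp add: w_Suc algebra_simps)
    also have "w n * (inverse ((1 + \<beta> n * \<epsilon>1 n) ^ m) - 1) = b * x n ^ s / \<beta> n * (inverse ((1 + \<beta> n * \<epsilon>1 n) ^ m) - 1)"
      unfolding mult_cancel_right using b x(2)[of n] by (simp add: w_def \<beta>_def power_add field_simps flip: pw)
    finally show ?thesis by simp
  qed
  have "(\<lambda>n. (y (Suc n) - y n) / x n ^ s - c0 * (b * ((inverse ((1 + \<beta> n * \<epsilon>1 n) ^ m) - 1) / \<beta> n))) \<longlonglongrightarrow> A - c0 * (b * - of_nat m)"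
    by (intro tendsto_intros inc ratio_power_lim m)
  also have "A - c0 * (b * - of_nat m) = 0" using b m by (simp add: c0_def field_simps)
  also have "(\<lambda>n. (y (Suc n) - y n) / x n ^ s - c0 * (b * ((inverse ((1 + \<beta> n * \<epsilon>1 n) ^ m) - 1) / \<beta> n))) =
     (\<lambda>n. ((y (Suc n) - y n) - c0 * (w (Suc n) - w n)) / x n ^ s)"
    using x(2) by (auto simp: w_inc fun_eq_iff field_simps)
  finally have lim: "(\<lambda>n. ((y (Suc n) - y n) - c0 * (w (Suc n) - w n)) / x n ^ s) \<longlonglongrightarrow> 0" .
  \<comment> \<open>The modulus of \<open>w\<close> grows by at least
    \<open>norm b * norm (x n) ^ s / 4\<close> per step; half of this, multiplied by
    \<open>norm c0\<close>, is the tolerated error.\<close>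
  define \<eta> where "\<eta> = norm c0 * norm b / 8"
  have \<eta>: "\<eta> > 0" using c0 b by (simp add: \<eta>_def)
  from tendstoD[OF lim \<eta>]
  have ev1: "\<forall>\<^sub>F n in sequentially. norm ((y (Suc n) - y n) - c0 * (w (Suc n) - w n)) \<le> \<eta> * norm (x n) ^ s"
    by eventually_elim (use x(2) in \<open>auto simp: norm_divide norm_power field_simps\<close>)
  have half: "\<forall>\<^sub>F n in sequentially. norm (1 + \<beta> n * \<epsilon>1 n) > 1 / 2"
  proof -
    have "(\<lambda>n. norm (1 + \<beta> n * \<epsilon>1 n)) \<longlonglongrightarrow> norm (1 + 0 * 1 :: complex)"
      by (intro tendsto_intros \<beta>_lim \<epsilon>1_lim)
    then show ?thesis by (rule order_tendstoD) simp
  qed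
  have "\<forall>\<^sub>F n in sequentially. norm ((y (Suc n) - c0 * w (Suc n)) - (y n - c0 * w n)) \<le> norm c0 / 2 * (norm (w (Suc n)) - norm (w n))"
    using ev1 norm_ratio half
  proof eventually_elim
    case (elim n)
    define q where "q = norm (1 + \<beta> n * \<epsilon>1 n)"
    have q: "0 < q" "q \<le> 1" "q \<le> 1 - norm (\<beta> n) / 4" using elim by (auto simp: q_def intro: order_trans)
    have "q ^ m \<le> q ^ 1" using q m by (intro power_decreasing) auto
    then have "inverse q \<le> inverse (q ^ m)" using q by (intro le_imp_inverse_le) auto
    moreover have "1 + norm (\<beta> n) / 4 \<le> inverse q"
    proof -
      have "(1 + norm (\<beta> n) / 4) * q \<le> (1 + norm (\<beta> n) / 4) * (1 - norm (\<beta> n) / 4)" using q by (intro mult_left_mono) auto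
      also have "\<dots> \<le> 1" by (simp add: algebra_simps)
      finally show ?thesis using q by (simp add: field_simps)
    qed
    ultimately have "norm (w n) * (norm (\<beta> n) / 4) \<le> norm (w n) * (inverse (q ^ m) - 1)" by (intro mult_left_mono) auto
    also have "\<dots> = norm (w (Suc n)) - norm (w n)"
      by (simp add: w_Suc norm_mult norm_inverse norm_power q_def algebra_simps)
    also have "norm (w n) * (norm (\<beta> n) / 4) = norm b * norm (x n) ^ s / 4"
      using x(2)[of n] by (simp add: w_def \<beta>_def norm_mult norm_inverse norm_divide norm_power field_simps flip: pw)
    finally have "norm b * norm (x n) ^ s / 4 \<le> norm (w (Suc n)) - norm (w n)" .
    then have "norm c0 / 2 * (norm b * norm (x n) ^ s / 4) \<le> norm c0 / 2 * (norm (w (Suc n)) - norm (w n))"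
      by (intro mult_left_mono) auto
    then have "\<eta> * norm (x n) ^ s \<le> norm c0 / 2 * (norm (w (Suc n)) - norm (w n))" by (simp add: \<eta>_def)
    with elim(1) show ?case by (simp add: algebra_simps)
  qed
  then obtain N where N: "\<And>n. n \<ge> N \<Longrightarrow> norm ((y (Suc n) - c0 * w (Suc n)) - (y n - c0 * w n)) \<le> norm c0 / 2 * (norm (w (Suc n)) - norm (w n))"
    by (auto simp: eventually_sequentially)
  define T where "T = (\<lambda>n. y n - c0 * w n)"
  have dT: "norm (T n - T N) \<le> norm c0 / 2 * (norm (w n) - norm (w N))" if "n \<ge> N" for n
    using that
  proof (induction n rule: dec_induct)
    case (step n)
    have "norm (T (Suc n) - T N) \<le> norm (T (Suc n) - T n) + norm (T n - T N)"
      using norm_triangle_ineq[of "T (Suc n) - T n" "T n - T N"] by simp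
    also have "\<dots> \<le> norm c0 / 2 * (norm (w (Suc n)) - norm (w n)) + norm c0 / 2 * (norm (w n) - norm (w N))"
      using step N[of n] by (intro add_mono) (auto simp: T_def)
    finally show ?case by (simp add: algebra_simps)
  qed simp
  \<comment> \<open>\<open>c0 * w\<close> is \<open>y - T\<close>, and \<open>T\<close> varies by at
    most half as much as \<open>c0 * w\<close> grows. A bounded \<open>y\<close> would bound
    \<open>w\<close>, which tends to infinity.\<close>
  have bound: "norm (w n) \<le> 2 * (B + norm (T N)) / norm c0" if "n \<ge> N" for n
  proof -
    have "norm c0 * norm (w n) = norm (y n - T n)" by (simp add: T_def norm_mult)
    also have "\<dots> \<le> norm (y n) + norm (T N) + norm (T n - T N)" by norm
    also have "\<dots> \<le> B + norm (T N) + norm c0 / 2 * norm (w n)"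
    proof -
      have "norm c0 / 2 * (norm (w n) - norm (w N)) \<le> norm c0 / 2 * norm (w n)" by (intro mult_left_mono) auto
      then show ?thesis using dT[OF that] B[of n] by linarith
    qed
    finally show ?thesis using c0 by (simp add: field_simps)
  qed
  have "(\<lambda>n. x n ^ m) \<longlonglongrightarrow> 0 ^ m" by (intro tendsto_intros x)
  then have "filterlim (\<lambda>n. x n ^ m) (at 0) sequentially" using m x(2) by (auto simp: filterlim_at zero_power)
  then have "filterlim w at_infinity sequentially"
    unfolding w_def by (rule filterlim_compose[OF filterlim_inverse_at_infinity])
  then have "\<forall>\<^sub>F n in sequentially. norm (w n) \<ge> 2 * (B + norm (T N)) / norm c0 + 1"
    using filterlim_at_infinity_imp_norm_at_top unfolding filterlim_at_top by blast
  then obtain n where "n \<ge> N" "norm (w n) \<ge> 2 * (B + norm (T N)) / norm c0 + 1"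
    by (metis (no_types, lifting) eventually_sequentially le_cases nle_le)
  with bound[of n] show False by linarith
qed

end

section \<open>Taylor coefficients in the parameter along a parabolic orbit\<close>

text \<open>\<open>d\<close> carries the dependence on the parameter and may be nonzero at
  \<open>u = 0\<close>, which admits a displaced fixed point; \<open>r\<close> is flat at
  \<open>u = 0\<close> uniformly in the parameter. The first bound silences the parameter below
  order \<open>M\<close>, the second makes the nonlinear contributions comparable to the decrease of
  the modulus along the orbit.\<close>

locale parabolic_family = parabolic_germ "F 0" p b \<delta> "\<lambda>n. z n 0"
  for F :: "complex \<Rightarrow> complex \<Rightarrow> complex" and p b \<delta> and z :: "nat \<Rightarrow> complex \<Rightarrow> complex" +
  fixes d r :: "complex \<Rightarrow> complex \<Rightarrow> complex" and M :: nat and \<rho> C :: real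
  assumes \<rho>: "\<rho> > 0" and M: "M \<ge> 1"
    and F: "holomorphic2_on F (ball 0 \<rho> \<times> ball 0 \<delta>)" and r: "holomorphic2_on r (ball 0 \<rho> \<times> ball 0 \<delta>)"
    and split: "\<And>l u. l \<in> ball 0 \<rho> \<Longrightarrow> u \<in> ball 0 \<delta> \<Longrightarrow> F l u = u + d l u + r l u"
    and d_bound: "\<And>l u. l \<in> ball 0 \<rho> \<Longrightarrow> u \<in> ball 0 \<delta> \<Longrightarrow> norm (d l u) \<le> C * norm l ^ M"
    and r_bound: "\<And>l u. l \<in> ball 0 \<rho> \<Longrightarrow> u \<in> ball 0 \<delta> \<Longrightarrow> norm (r l u) \<le> C * norm u ^ (p + 1)"
    and z: "\<And>n. z n analytic_on {0}" "\<And>n. \<forall>\<^sub>F l in nhds 0. z (Suc n) l = F l (z n l)"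
begin

text \<open>The jet strictly below order \<open>j\<close>: it suffices for the nonlinear part of the
  coefficient of order \<open>j\<close> at the next step.\<close>

definition P where "P j n l = (\<Sum>i<j. taylor_coeff i (z n) * l ^ i)"

lemma dom_open: "open (ball (0::complex) \<rho> \<times> ball (0::complex) \<delta>)"
  by (simp add: open_Times)

lemma P_bound:
  assumes j: "1 \<le> j"
    and small: "\<And>i. 1 \<le> i \<Longrightarrow> i < j \<Longrightarrow> \<exists>C. \<forall>n. norm (taylor_coeff i (z n)) \<le> C * norm (z n 0)"
  shows "\<exists>C1>0. \<forall>n l. norm l \<le> 1 \<longrightarrow> norm (P j n l) \<le> C1 * norm (z n 0)"
proof -
  have "\<exists>C. \<forall>n. norm (taylor_coeff i (z n)) \<le> C * norm (z n 0)" if "i < j" for i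
  proof (cases "i = 0")
    case True
    then show ?thesis by (intro exI[of _ 1]) simp
  qed (use small that in auto)
  then obtain K where K: "\<And>i n. i < j \<Longrightarrow> norm (taylor_coeff i (z n)) \<le> K i * norm (z n 0)" by metis
  define C1 where "C1 = (\<Sum>i<j. \<bar>K i\<bar>) + 1"
  have "norm (P j n l) \<le> C1 * norm (z n 0)" if "norm l \<le> 1" for n l
  proof -
    have "norm (P j n l) \<le> (\<Sum>i<j. \<bar>K i\<bar> * norm (z n 0))"
      unfolding P_def
    proof (rule sum_norm_le)
      fix i assume i: "i \<in> {..<j}"
      have "norm (taylor_coeff i (z n)) \<le> \<bar>K i\<bar> * norm (z n 0)"
        using K[of i n] i by (smt (verit) abs_ge_self lessThan_iff mult_right_mono norm_ge_zero)
      moreover have "norm l ^ i \<le> 1" using that by (intro power_le_one) auto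
      ultimately have "norm (taylor_coeff i (z n)) * norm l ^ i \<le> \<bar>K i\<bar> * norm (z n 0) * 1" by (intro mult_mono) auto
      then show "norm (taylor_coeff i (z n) * l ^ i) \<le> \<bar>K i\<bar> * norm (z n 0)" by (simp add: norm_mult norm_power)
    qed
    also have "\<dots> \<le> C1 * norm (z n 0)" by (simp add: C1_def flip: sum_distrib_right) (simp add: algebra_simps)
    finally show ?thesis .
  qed
  moreover have "C1 > 0" unfolding C1_def by (intro add_nonneg_pos sum_nonneg) auto
  ultimately show ?thesis by blast
qed

text \<open>Replacing \<open>z n\<close> by its jet below \<open>j\<close> removes only the linear
  contribution of the coefficient of order \<open>j\<close>. On the jet, which is of the size of the
  orbit point, \<open>r\<close> is of order \<open>p + 1\<close>, and Cauchy's estimate transfers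
  this to its coefficients; what remains is the contribution of \<open>d\<close>.\<close>

lemma taylor_coeff_recursion:
  assumes j: "1 \<le> j"
    and small: "\<And>i. 1 \<le> i \<Longrightarrow> i < j \<Longrightarrow> \<exists>C. \<forall>n. norm (taylor_coeff i (z n)) \<le> C * norm (z n 0)"
  shows "\<exists>C'. \<forall>\<^sub>F n in sequentially. (\<lambda>l. d l (P j n l)) analytic_on {0} \<and>
     norm (taylor_coeff j (z (Suc n)) - deriv (F 0) (z n 0) * taylor_coeff j (z n) - taylor_coeff j (\<lambda>l. d l (P j n l)))
       \<le> C' * norm (z n 0) ^ (p + 1)"
proof -
  obtain C1 where C1: "C1 > 0" "\<And>n l. norm l \<le> 1 \<Longrightarrow> norm (P j n l) \<le> C1 * norm (z n 0)"
    using P_bound[OF j small] by blast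
  define R where "R = min \<rho> 1"
  have R: "R > 0" "R \<le> \<rho>" "R \<le> 1" using \<rho> by (auto simp: R_def)
  have C: "C \<ge> 0"
  proof -
    have "0 \<le> norm (d (of_real (\<rho> / 2)) 0)" by simp
    also have "\<dots> \<le> C * norm (complex_of_real (\<rho> / 2)) ^ M" using \<rho> \<delta> by (intro d_bound) auto
    finally have "0 \<le> C * (\<rho> / 2) ^ M" using \<rho> by simp
    moreover have "(\<rho> / 2) ^ M > 0" using \<rho> by simp
    ultimately show ?thesis by (auto simp: zero_le_mult_iff)
  qed
  \<comment> \<open>The bound \<open>C * (C1 * norm (z n 0)) ^ (p + 1)\<close> for \<open>r\<close>
    on the jet, divided by the power of the radius \<open>R / 2\<close> from Cauchy's
    estimate.\<close>
  define C' where "C' = C * C1 ^ (p + 1) / (R / 2) ^ j"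
  have "(\<lambda>n. C1 * norm (z n 0)) \<longlonglongrightarrow> C1 * norm (0::complex)" by (intro tendsto_intros x)
  then have "\<forall>\<^sub>F n in sequentially. C1 * norm (z n 0) < \<delta>" by (rule order_tendstoD) (use \<delta> in simp)
  then have "\<forall>\<^sub>F n in sequentially. (\<lambda>l. d l (P j n l)) analytic_on {0} \<and>
     norm (taylor_coeff j (z (Suc n)) - deriv (F 0) (z n 0) * taylor_coeff j (z n) - taylor_coeff j (\<lambda>l. d l (P j n l)))
       \<le> C' * norm (z n 0) ^ (p + 1)"
  proof eventually_elim
    case (elim n)
    define Pn where "Pn = P j n"
    have Pn_ball: "Pn l \<in> ball 0 \<delta>" and Pn_le: "norm (Pn l) \<le> C1 * norm (z n 0)" if "l \<in> ball 0 R" for l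
      using C1(2)[of l n] that R elim by (auto simp: Pn_def)
    have hP: "Pn holomorphic_on ball 0 R" unfolding Pn_def P_def[abs_def] by (intro holomorphic_intros)
    have an: "g analytic_on {0}" if "g holomorphic_on ball 0 R" for g :: "complex \<Rightarrow> complex"
      unfolding analytic_at using that R by (intro exI[of _ "ball 0 R"]) auto
    have hF: "(\<lambda>l. F l (Pn l)) holomorphic_on ball 0 R"
      by (rule holomorphic2_on_holomorphic_compose[OF F dom_open]) (use hP Pn_ball R in \<open>auto intro: holomorphic_intros\<close>)
    have hr: "(\<lambda>l. r l (Pn l)) holomorphic_on ball 0 R"
      by (rule holomorphic2_on_holomorphic_compose[OF r dom_open]) (use hP Pn_ball R in \<open>auto intro: holomorphic_intros\<close>)
    have deq: "d l (Pn l) = F l (Pn l) - Pn l - r l (Pn l)" if "l \<in> ball 0 R" for l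
      using split[of l "Pn l"] Pn_ball[OF that] that R by (simp add: algebra_simps)
    have hd: "(\<lambda>l. d l (Pn l)) holomorphic_on ball 0 R"
      by (rule holomorphic_transform[of "\<lambda>l. F l (Pn l) - Pn l - r l (Pn l)"])
         (use deq in \<open>auto intro!: holomorphic_intros hF hP hr\<close>)
    have P0: "Pn 0 = z n 0" using j by (simp add: Pn_def P_def)
    have tP: "taylor_coeff i Pn = (if i < j then taylor_coeff i (z n) else 0)" for i
      unfolding Pn_def P_def[abs_def] by (rule taylor_coeff_polynomial)
    have "((\<lambda>l. (F l (z n l) - F l (Pn l)) / l ^ j) \<longlongrightarrow>
       deriv (\<lambda>w. F w (z n 0)) 0 * 0 + deriv (F 0) (z n 0) * taylor_coeff j (z n)) (at 0)"
    proof (rule holomorphic2_on_strict_tendsto[OF F dom_open])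
      show "(0, z n 0) \<in> ball 0 \<rho> \<times> ball 0 \<delta>" using \<rho> x(3)[of n] by simp
      show "(z n \<longlongrightarrow> z n 0) (at 0)" using analytic_at_imp_isCont[OF z(1)[of n]] by (simp add: isCont_def)
      show "(Pn \<longlongrightarrow> z n 0) (at 0)" using analytic_at_imp_isCont[OF an[OF hP]] P0 by (simp add: isCont_def)
      show "((\<lambda>l. (z n l - Pn l) / l ^ j) \<longlongrightarrow> taylor_coeff j (z n)) (at 0)"
        by (subst taylor_coeff_diff_tendsto_iff[OF z(1) an[OF hP]]) (simp add: tP)
    qed auto
    moreover have "\<forall>\<^sub>F l in at 0. (F l (z n l) - F l (Pn l)) / l ^ j = (z (Suc n) l - F l (Pn l)) / l ^ j"
      using z(2)[of n] unfolding eventually_at_filter by eventually_elim simp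
    ultimately have "((\<lambda>l. (z (Suc n) l - F l (Pn l)) / l ^ j) \<longlongrightarrow> deriv (F 0) (z n 0) * taylor_coeff j (z n)) (at 0)"
      using Lim_transform_eventually by fastforce
    then have 1: "taylor_coeff j (z (Suc n)) = taylor_coeff j (\<lambda>l. F l (Pn l)) + deriv (F 0) (z n 0) * taylor_coeff j (z n)"
      by (subst (asm) taylor_coeff_diff_tendsto_iff[OF z(1) an[OF hF]]) simp
    have "taylor_coeff j (\<lambda>l. F l (Pn l)) = taylor_coeff j (\<lambda>l. Pn l + (d l (Pn l) + r l (Pn l)))"
      by (rule taylor_coeff_cong, rule eventually_mono[OF eventually_nhds_in_open[of "ball 0 R" 0]])
         (use R deq in auto)
    also have "\<dots> = taylor_coeff j Pn + (taylor_coeff j (\<lambda>l. d l (Pn l)) + taylor_coeff j (\<lambda>l. r l (Pn l)))"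
      by (subst taylor_coeff_add taylor_coeff_add[OF an[OF hd] an[OF hr]] | intro an holomorphic_intros hP hd hr refl)+
    finally have 2: "taylor_coeff j (\<lambda>l. F l (Pn l)) = taylor_coeff j (\<lambda>l. d l (Pn l)) + taylor_coeff j (\<lambda>l. r l (Pn l))"
      by (simp add: tP)
    have "norm (taylor_coeff j (\<lambda>l. r l (Pn l))) \<le> (C * (C1 * norm (z n 0)) ^ (p + 1)) / (R / 2) ^ j"
    proof (rule norm_taylor_coeff_le[OF hr])
      fix l :: complex assume "norm l \<le> R / 2"
      then have l: "l \<in> ball 0 R" using R by auto
      have "norm (r l (Pn l)) \<le> C * norm (Pn l) ^ (p + 1)" using r_bound[of l "Pn l"] Pn_ball[OF l] l R by auto
      also have "\<dots> \<le> C * (C1 * norm (z n 0)) ^ (p + 1)" using C Pn_le[OF l] by (intro mult_left_mono power_mono) auto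
      finally show "norm (r l (Pn l)) \<le> C * (C1 * norm (z n 0)) ^ (p + 1)" .
    qed (use R in auto)
    also have "\<dots> = C' * norm (z n 0) ^ (p + 1)" unfolding C'_def power_mult_distrib by simp
    finally show ?case using an[OF hd] unfolding 1 2 by (simp add: Pn_def)
  qed
  then show ?thesis by blast
qed

text \<open>Below order \<open>M\<close> the function \<open>d\<close> contributes nothing, so
  \<open>linear_recursion_bound\<close> applies; the induction on \<open>j\<close> supplies the size
  of the jet that the recursion presupposes.\<close>

lemma taylor_coeff_low:
  assumes "1 \<le> j" "j < M"
  shows "\<exists>C. \<forall>n. norm (taylor_coeff j (z n)) \<le> C * norm (z n 0)"
    and "\<exists>C. \<forall>\<^sub>F n in sequentially. \<forall>k\<ge>n. norm (taylor_coeff j (z k) - taylor_coeff j (z n)) \<le> C * (norm (z n 0) - norm (z k 0))"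
proof -
  have rec: "\<exists>C'. \<forall>\<^sub>F n in sequentially. norm (taylor_coeff j (z (Suc n)) - deriv (F 0) (z n 0) * taylor_coeff j (z n)) \<le> C' * norm (z n 0) ^ (p + 1)"
    if j: "1 \<le> j" "j < M" and small: "\<And>i. 1 \<le> i \<Longrightarrow> i < j \<Longrightarrow> \<exists>C. \<forall>n. norm (taylor_coeff i (z n)) \<le> C * norm (z n 0)" for j
  proof -
    obtain C1 where C1: "C1 > 0" "\<And>n l. norm l \<le> 1 \<Longrightarrow> norm (P j n l) \<le> C1 * norm (z n 0)"
      using P_bound[OF j(1) small] by blast
    have "(\<lambda>n. C1 * norm (z n 0)) \<longlonglongrightarrow> C1 * norm (0::complex)" by (intro tendsto_intros x)
    then have near: "\<forall>\<^sub>F n in sequentially. C1 * norm (z n 0) < \<delta>" by (rule order_tendstoD) (use \<delta> in simp)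
    obtain C' where "\<forall>\<^sub>F n in sequentially. (\<lambda>l. d l (P j n l)) analytic_on {0} \<and>
     norm (taylor_coeff j (z (Suc n)) - deriv (F 0) (z n 0) * taylor_coeff j (z n) - taylor_coeff j (\<lambda>l. d l (P j n l)))
       \<le> C' * norm (z n 0) ^ (p + 1)"
      using taylor_coeff_recursion[OF j(1) small] by blast
    from this near have "\<forall>\<^sub>F n in sequentially. norm (taylor_coeff j (z (Suc n)) - deriv (F 0) (z n 0) * taylor_coeff j (z n)) \<le> C' * norm (z n 0) ^ (p + 1)"
    proof eventually_elim
      case (elim n)
      have "\<forall>\<^sub>F l in at 0. l \<in> ball 0 (min \<rho> 1)"
        using \<rho> by (intro eventually_at_in_open') auto
      then have "\<forall>\<^sub>F l in at 0. norm (d l (P j n l)) \<le> C * norm l ^ M"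
      proof eventually_elim
        case (elim l)
        then show ?case using C1(2)[of l n] \<open>C1 * norm (z n 0) < \<delta>\<close> by (intro d_bound) auto
      qed
      then have "taylor_coeff j (\<lambda>l. d l (P j n l)) = 0"
        using elim j by (intro taylor_coeff_bigO_zero[of _ C M]) auto
      then show ?case using elim by simp
    qed
    then show ?thesis by blast
  qed
  have small: "\<exists>C. \<forall>n. norm (taylor_coeff j (z n)) \<le> C * norm (z n 0)" if "1 \<le> j" "j < M" for j
    using that
  proof (induction j rule: less_induct)
    case (less j)
    have "\<exists>C'. \<forall>\<^sub>F n in sequentially. norm (taylor_coeff j (z (Suc n)) - deriv (F 0) (z n 0) * taylor_coeff j (z n)) \<le> C' * norm (z n 0) ^ (p + 1)"
      by (rule rec) (use less in auto)
    then obtain C' where "\<forall>\<^sub>F n in sequentially. norm (taylor_coeff j (z n)) \<le> C' * norm (z n 0)"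
      using linear_recursion_bound(1)[of "\<lambda>n. taylor_coeff j (z n)"] by blast
    then obtain C'' where "\<And>n. norm (taylor_coeff j (z n)) \<le> C'' * norm (z n 0)"
      by (rule eventually_norm_le_imp_all) (use x(2) in auto)
    then show ?case by blast
  qed
  show "\<exists>C. \<forall>n. norm (taylor_coeff j (z n)) \<le> C * norm (z n 0)" by (rule small[OF assms])
  have "\<exists>C'. \<forall>\<^sub>F n in sequentially. norm (taylor_coeff j (z (Suc n)) - deriv (F 0) (z n 0) * taylor_coeff j (z n)) \<le> C' * norm (z n 0) ^ (p + 1)"
    by (rule rec[OF assms small]) (use assms in auto)
  then show "\<exists>C. \<forall>\<^sub>F n in sequentially. \<forall>k\<ge>n. norm (taylor_coeff j (z k) - taylor_coeff j (z n)) \<le> C * (norm (z n 0) - norm (z k 0))"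
    using linear_recursion_bound(2)[of "\<lambda>n. taylor_coeff j (z n)"] by blast
qed

text \<open>At order \<open>M\<close> the function \<open>d\<close> contributes
  \<open>A * z n 0 ^ s\<close> up to one more power of the orbit point. If the coefficients were
  bounded, the linear term would be of order \<open>p\<close>, hence also negligible because
  \<open>s < p\<close>, and the increments would be resonant.\<close>

lemma taylor_coeff_critical_unbounded:
  assumes s: "s < p" and A: "A \<noteq> 0"
    and dA: "\<And>l u. l \<in> ball 0 \<rho> \<Longrightarrow> u \<in> ball 0 \<delta> \<Longrightarrow>
       norm (d l u - A * l ^ M * u ^ s) \<le> C2 * norm l ^ M * (norm u ^ (s + 1) + norm l)"
  shows "\<not> (\<exists>B. \<forall>n. norm (taylor_coeff M (z n)) \<le> B)"
proof
  assume "\<exists>B. \<forall>n. norm (taylor_coeff M (z n)) \<le> B"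
  then obtain B where B: "\<And>n. norm (taylor_coeff M (z n)) \<le> B" by blast
  have small: "\<exists>C. \<forall>n. norm (taylor_coeff i (z n)) \<le> C * norm (z n 0)" if "1 \<le> i" "i < M" for i
    by (rule taylor_coeff_low(1)[OF that])
  obtain C1 where C1: "C1 > 0" "\<And>n l. norm l \<le> 1 \<Longrightarrow> norm (P M n l) \<le> C1 * norm (z n 0)"
    using P_bound[OF M small] by blast
  have "(\<lambda>n. C1 * norm (z n 0)) \<longlonglongrightarrow> C1 * norm (0::complex)" by (intro tendsto_intros x)
  then have near: "\<forall>\<^sub>F n in sequentially. C1 * norm (z n 0) < \<delta>" by (rule order_tendstoD) (use \<delta> in simp)
  have "(\<lambda>n. norm (z n 0)) \<longlonglongrightarrow> norm (0::complex)" by (intro tendsto_intros x)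
  then have near1: "\<forall>\<^sub>F n in sequentially. norm (z n 0) < 1" by (rule order_tendstoD) simp
  obtain C' where rec: "\<forall>\<^sub>F n in sequentially. (\<lambda>l. d l (P M n l)) analytic_on {0} \<and>
     norm (taylor_coeff M (z (Suc n)) - deriv (F 0) (z n 0) * taylor_coeff M (z n) - taylor_coeff M (\<lambda>l. d l (P M n l)))
       \<le> C' * norm (z n 0) ^ (p + 1)"
    using taylor_coeff_recursion[OF M small] by blast
  have e2: "\<forall>\<^sub>F n in sequentially. norm (\<epsilon>2 n) < real (p + 2)"
  proof -
    have "norm (of_nat (p + 1) :: complex) < real (p + 2)" unfolding norm_of_nat by simp
    then show ?thesis by (rule order_tendstoD(2)[OF tendsto_norm[OF \<epsilon>2_lim]])
  qed
  define K where "K = \<bar>C'\<bar> + C2 * C1 ^ (s + 1) + real (p + 2) * norm b * B"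
  define y where "y = (\<lambda>n. taylor_coeff M (z n))"
  have B0: "B \<ge> 0" using B[of 0] norm_ge_zero order_trans by blast
  have "\<forall>\<^sub>F n in sequentially. norm ((y (Suc n) - y n) / z n 0 ^ s - A) \<le> K * norm (z n 0)"
    using near near1 rec e2
  proof eventually_elim
    case (elim n)
    define x0 where "x0 = norm (z n 0)"
    have x0: "0 < x0" "x0 < 1" using elim x(2)[of n] by (auto simp: x0_def)
    define Pn where "Pn = P M n"
    have hP: "Pn holomorphic_on UNIV" unfolding Pn_def P_def[abs_def] by (intro holomorphic_intros)
    have P0: "Pn 0 = z n 0" using M by (simp add: Pn_def P_def)
    have contP: "(Pn \<longlongrightarrow> z n 0) (at 0)"
      using hP P0 by (metis holomorphic_on_imp_continuous_on continuous_on_eq_continuous_at isCont_def open_UNIV UNIV_I)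
    define D where "D = taylor_coeff M (\<lambda>l. d l (Pn l))"
    have near_l: "\<forall>\<^sub>F l in at 0. l \<in> ball 0 (min \<rho> 1)" using \<rho> by (intro eventually_at_in_open') auto
    have Pball: "Pn l \<in> ball 0 \<delta>" "norm (Pn l) \<le> C1 * x0" if "l \<in> ball 0 (min \<rho> 1)" for l
      using C1(2)[of l n] that elim by (auto simp: Pn_def x0_def)
    have D_lim: "((\<lambda>l. d l (Pn l) / l ^ M) \<longlongrightarrow> D) (at 0)"
      unfolding D_def
    proof (rule taylor_coeff_tendsto)
      show an: "(\<lambda>l. d l (Pn l)) analytic_on {0}" using elim by (simp add: Pn_def)
      fix i assume "i < M"
      moreover have "\<forall>\<^sub>F l in at 0. norm (d l (Pn l)) \<le> C * norm l ^ M"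
        using near_l by eventually_elim (use Pball in \<open>intro d_bound, auto\<close>)
      ultimately show "taylor_coeff i (\<lambda>l. d l (Pn l)) = 0" by (intro taylor_coeff_bigO_zero[OF an])
    qed
    \<comment> \<open>The coefficient of \<open>d\<close> is obtained as a limit in \<open>l\<close>
      at fixed \<open>n\<close>: the term \<open>norm l\<close> in \<open>dA\<close> disappears, and
      the jet tends to the orbit point.\<close>
    have D: "norm (D - A * z n 0 ^ s) \<le> C2 * (x0 ^ (s + 1) * C1 ^ (s + 1))"
    proof (rule tendsto_le)
      show "((\<lambda>l. norm (d l (Pn l) / l ^ M - A * Pn l ^ s)) \<longlongrightarrow> norm (D - A * z n 0 ^ s)) (at 0)"
        by (intro tendsto_intros D_lim contP)
      have "((\<lambda>l::complex. C2 * ((C1 * x0) ^ (s + 1) + norm l)) \<longlongrightarrow> C2 * ((C1 * x0) ^ (s + 1) + norm (0::complex))) (at 0)"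
        by (intro tendsto_intros)
      then show "((\<lambda>l::complex. C2 * ((C1 * x0) ^ (s + 1) + norm l)) \<longlongrightarrow> C2 * (x0 ^ (s + 1) * C1 ^ (s + 1))) (at 0)"
        by (simp add: power_mult_distrib mult_ac)
      have "\<forall>\<^sub>F l in at 0. l \<noteq> (0::complex)" by (simp add: eventually_at_filter)
      with near_l show "\<forall>\<^sub>F l in at 0. norm (d l (Pn l) / l ^ M - A * Pn l ^ s) \<le> C2 * ((C1 * x0) ^ (s + 1) + norm l)"
      proof eventually_elim
        case (elim l)
        have C2: "C2 \<ge> 0"
        proof -
          have "norm (d l 0 - A * l ^ M * 0 ^ s) \<le> C2 * norm l ^ M * (norm (0::complex) ^ (s + 1) + norm l)"
            by (rule dA) (use elim \<delta> in auto)
          from order_trans[OF norm_ge_zero this] have "0 \<le> C2 * (norm l ^ M * norm l)" by simp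
          moreover have "norm l ^ M * norm l > 0" using elim by simp
          ultimately show ?thesis by (auto simp: zero_le_mult_iff)
        qed
        have "norm (d l (Pn l) / l ^ M - A * Pn l ^ s) = norm (d l (Pn l) - A * l ^ M * Pn l ^ s) / norm l ^ M"
          using elim by (simp add: field_simps norm_divide flip: norm_power norm_divide)
        also have "\<dots> \<le> (C2 * norm l ^ M * (norm (Pn l) ^ (s + 1) + norm l)) / norm l ^ M"
          using elim Pball[of l] by (intro divide_right_mono dA) auto
        also have "\<dots> = C2 * (norm (Pn l) ^ (s + 1) + norm l)" using elim by simp
        also have "\<dots> \<le> C2 * ((C1 * x0) ^ (s + 1) + norm l)"
          using elim Pball[of l] C2 by (intro mult_left_mono add_right_mono power_mono) auto
        finally show ?case .
      qed
    qed auto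
    define E where "E = y (Suc n) - deriv (F 0) (z n 0) * y n - D"
    have E: "norm E \<le> C' * x0 ^ (p + 1)" using elim by (simp add: E_def y_def D_def Pn_def x0_def)
    have "y (Suc n) - y n - A * z n 0 ^ s = E + (D - A * z n 0 ^ s) + \<epsilon>2 n * (\<beta> n * y n)"
      by (simp add: E_def deriv_f algebra_simps)
    also have "norm \<dots> \<le> C' * x0 ^ (p + 1) + C2 * (x0 ^ (s + 1) * C1 ^ (s + 1)) + real (p + 2) * (norm b * x0 ^ p * B)"
    proof (intro norm_triangle_mono E D)
      have "norm (\<epsilon>2 n) * (norm (\<beta> n) * norm (y n)) \<le> real (p + 2) * (norm b * x0 ^ p * B)"
        using elim B[of n] by (intro mult_mono) (auto simp: \<beta>_def norm_mult norm_power x0_def y_def)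
      then show "norm (\<epsilon>2 n * (\<beta> n * y n)) \<le> real (p + 2) * (norm b * x0 ^ p * B)" by (simp add: norm_mult)
    qed
    also have "\<dots> \<le> \<bar>C'\<bar> * x0 ^ (s + 1) + C2 * (x0 ^ (s + 1) * C1 ^ (s + 1)) + real (p + 2) * (norm b * x0 ^ (s + 1) * B)"
    proof -
      \<comment> \<open>The place where \<open>s < p\<close> enters: both error terms are at least
        one power of the orbit point smaller than \<open>x0 ^ s\<close>.\<close>
      have le: "x0 ^ (p + 1) \<le> x0 ^ (s + 1)" "x0 ^ p \<le> x0 ^ (s + 1)"
        using x0 s by (simp_all only: power_decreasing less_imp_le Suc_leI Suc_eq_plus1[symmetric] Suc_le_mono)
      have "C' * x0 ^ (p + 1) \<le> \<bar>C'\<bar> * x0 ^ (p + 1)" using x0 by (intro mult_right_mono) auto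
      also have "\<dots> \<le> \<bar>C'\<bar> * x0 ^ (s + 1)" by (rule mult_left_mono[OF le(1)]) simp
      finally have "C' * x0 ^ (p + 1) \<le> \<bar>C'\<bar> * x0 ^ (s + 1)" .
      moreover have "norm b * x0 ^ p * B \<le> norm b * x0 ^ (s + 1) * B"
        by (rule mult_right_mono[OF mult_left_mono[OF le(2)]]) (use B0 in auto)
      ultimately have "C' * x0 ^ (p + 1) \<le> \<bar>C'\<bar> * x0 ^ (s + 1)" "norm b * x0 ^ p * B \<le> norm b * x0 ^ (s + 1) * B"
        by auto
      then show ?thesis by (intro add_mono mult_left_mono order_refl) auto
    qed
    also have "\<dots> = K * x0 * x0 ^ s" by (simp add: K_def algebra_simps)
    finally have *: "norm (y (Suc n) - y n - A * z n 0 ^ s) \<le> K * x0 * x0 ^ s" .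
    have "(y (Suc n) - y n) / z n 0 ^ s - A = (y (Suc n) - y n - A * z n 0 ^ s) / z n 0 ^ s"
      using x(2)[of n] by (simp add: field_simps)
    then have "norm ((y (Suc n) - y n) / z n 0 ^ s - A) = norm (y (Suc n) - y n - A * z n 0 ^ s) / x0 ^ s"
      by (simp add: norm_divide norm_power x0_def)
    also have "\<dots> \<le> K * x0 * x0 ^ s / x0 ^ s" using * x0 by (intro divide_right_mono) auto
    finally show ?case using x0 by (simp add: x0_def)
  qed
  moreover have "(\<lambda>n. K * norm (z n 0)) \<longlonglongrightarrow> K * norm (0::complex)" by (intro tendsto_intros x)
  then have "(\<lambda>n. K * norm (z n 0)) \<longlonglongrightarrow> 0" by simp
  ultimately have "(\<lambda>n. (y (Suc n) - y n) / z n 0 ^ s - A) \<longlonglongrightarrow> 0"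
    by (rule Lim_null_comparison)
  then have "(\<lambda>n. (y (Suc n) - y n) / z n 0 ^ s) \<longlonglongrightarrow> A" by (simp add: LIM_zero_iff)
  from resonant_increments_unbounded[OF s A this] B show False by (auto simp: y_def)
qed

end

section \<open>Perturbations of periodic points\<close>

lemma holomorphic2_on_iterates:
  assumes \<Phi>: "holomorphic2_on \<Phi> (ball 0 \<rho> \<times> ball 0 \<delta>)" and pos: "\<rho> > 0" "\<delta> > 0" and 0: "\<Phi> 0 0 = 0"
  shows "\<exists>\<rho>'>0. \<exists>\<delta>'>0. \<rho>' \<le> \<rho> \<and> \<delta>' \<le> \<delta> \<and>
    (\<forall>i\<le>k. holomorphic2_on (\<lambda>l u. (\<Phi> l ^^ i) u) (ball 0 \<rho>' \<times> ball 0 \<delta>') \<and>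
       (\<forall>l\<in>ball 0 \<rho>'. \<forall>u\<in>ball 0 \<delta>'. (\<Phi> l ^^ i) u \<in> ball 0 \<delta>))"
proof (induction k)
  case 0
  have "holomorphic2_on (\<lambda>l u. u) (ball (0::complex) \<rho> \<times> ball (0::complex) \<delta>)"
    by (rule holomorphic2_on_snd_only[of _ "\<lambda>u. u" UNIV]) (auto simp: open_Times)
  then show ?case using pos by (intro exI[of _ \<rho>] conjI exI[of _ \<delta>]) auto
next
  case (Suc k)
  then obtain \<rho>' \<delta>' where *: "\<rho>' > 0" "\<delta>' > 0" "\<rho>' \<le> \<rho>" "\<delta>' \<le> \<delta>"
    and hol: "\<And>i. i \<le> k \<Longrightarrow> holomorphic2_on (\<lambda>l u. (\<Phi> l ^^ i) u) (ball 0 \<rho>' \<times> ball 0 \<delta>')"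
    and ball: "\<And>i l u. i \<le> k \<Longrightarrow> l \<in> ball 0 \<rho>' \<Longrightarrow> u \<in> ball 0 \<delta>' \<Longrightarrow> (\<Phi> l ^^ i) u \<in> ball 0 \<delta>" by blast
  define S where "S = ball (0::complex) \<rho>' \<times> ball (0::complex) \<delta>'"
  have S: "open S" "(0, 0) \<in> S" using * by (auto simp: S_def open_Times)
  have fst: "holomorphic2_on (\<lambda>l u. l) S" using S(1) by (rule holomorphic2_on_fst_only[of _ "\<lambda>u. u" UNIV]) auto
  have hS: "holomorphic2_on (\<lambda>l u. (\<Phi> l ^^ Suc k) u) S"
    using holomorphic2_on_compose[OF \<Phi> _ S(1) fst hol[OF order_refl, folded S_def]] ball[OF order_refl] *
    by (auto simp: S_def open_Times)
  have fix0: "(\<Phi> 0 ^^ i) 0 = 0" for i by (induction i) (auto simp: 0)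
  have c: "continuous_on S (\<lambda>p. (\<Phi> (fst p) ^^ Suc k) (snd p))"
    using holomorphic2_on_imp_continuous_on[OF hS] by (simp add: case_prod_unfold)
  have "open (S \<inter> (\<lambda>p. (\<Phi> (fst p) ^^ Suc k) (snd p)) -` ball 0 \<delta>)"
    by (rule continuous_open_preimage[OF c S(1) open_ball])
  moreover have "(0, 0) \<in> S \<inter> (\<lambda>p. (\<Phi> (fst p) ^^ Suc k) (snd p)) -` ball 0 \<delta>"
    using S pos fix0[of "Suc k"] by (simp del: funpow.simps)
  ultimately obtain r where r: "r > 0" "cball 0 r \<times> cball 0 r \<subseteq> S \<inter> (\<lambda>p. (\<Phi> (fst p) ^^ Suc k) (snd p)) -` ball 0 \<delta>"
    by (rule open_Times_cball_subset)
  define r1 where "r1 = min r \<rho>'"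
  define r2 where "r2 = min r \<delta>'"
  have sub: "ball 0 r1 \<times> ball 0 r2 \<subseteq> S" by (auto simp: S_def r1_def r2_def)
  have in_ball: "(\<Phi> l ^^ Suc k) u \<in> ball 0 \<delta>" if "l \<in> ball 0 r1" "u \<in> ball 0 r2" for l u
  proof -
    have "(l, u) \<in> S \<inter> (\<lambda>p. (\<Phi> (fst p) ^^ Suc k) (snd p)) -` ball 0 \<delta>"
      by (rule subsetD[OF r(2)]) (use that in \<open>auto simp: r1_def r2_def\<close>)
    then show ?thesis by (simp del: funpow.simps)
  qed
  have "holomorphic2_on (\<lambda>l u. (\<Phi> l ^^ i) u) (ball 0 r1 \<times> ball 0 r2) \<and>
       (\<forall>l\<in>ball 0 r1. \<forall>u\<in>ball 0 r2. (\<Phi> l ^^ i) u \<in> ball 0 \<delta>)" if "i \<le> Suc k" for i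
  proof (cases "i = Suc k")
    case True
    then show ?thesis using holomorphic2_on_subset[OF hS sub] in_ball by blast
  next
    case False
    then have i: "i \<le> k" using that by simp
    have "holomorphic2_on (\<lambda>l u. (\<Phi> l ^^ i) u) (ball 0 r1 \<times> ball 0 r2)"
      using holomorphic2_on_subset[OF hol[OF i, folded S_def] sub] .
    moreover have "(\<Phi> l ^^ i) u \<in> ball 0 \<delta>" if "l \<in> ball 0 r1" "u \<in> ball 0 r2" for l u
      using that by (intro ball[OF i]) (auto simp: r1_def r2_def)
    ultimately show ?thesis by blast
  qed
  moreover have "r1 > 0" "r2 > 0" "r1 \<le> \<rho>" "r2 \<le> \<delta>" using r * by (auto simp: r1_def r2_def)
  ultimately show ?case by blast
qed

lemma deriv_funpow_fixpoint:
  fixes h :: "complex \<Rightarrow> complex"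
  assumes "(h has_field_derivative \<kappa>) (at 0)" "h 0 = 0"
  shows "((h ^^ k) has_field_derivative \<kappa> ^ k) (at 0)"
proof (induction k)
  case (Suc k)
  have fix0: "(h ^^ i) 0 = 0" for i by (induction i) (auto simp: assms)
  have "((h \<circ> (h ^^ k)) has_field_derivative \<kappa> * \<kappa> ^ k) (at 0)"
    by (rule DERIV_chain) (use Suc assms fix0 in auto)
  then show ?case by (simp add: o_def)
qed (auto simp: id_def)

text \<open>The first nonlinear term of \<open>h ^^ p\<close> has a degree \<open>k\<close> with \<open>\<kappa> ^ k = \<kappa>\<close>, because \<open>h ^^ p\<close>
  commutes with \<open>h\<close>.\<close>

lemma taylor_coeff_funpow_root_of_unity:
  fixes h :: "complex \<Rightarrow> complex"
  assumes h: "h analytic_on {0}" and h0: "h 0 = 0" and \<kappa>: "deriv h 0 = \<kappa>" "\<kappa> ^ p = 1" "p \<ge> 1"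
    and prim: "\<And>k. 2 \<le> k \<Longrightarrow> k \<le> p \<Longrightarrow> \<kappa> ^ k \<noteq> \<kappa>"
    and an: "(\<lambda>u. (h ^^ p) u - u) analytic_on {0}" and k: "k \<le> p"
  shows "taylor_coeff k (\<lambda>u. (h ^^ p) u - u) = 0"
proof (rule ccontr)
  assume nz: "taylor_coeff k (\<lambda>u. (h ^^ p) u - u) \<noteq> 0"
  define e where "e = (\<lambda>u. (h ^^ p) u - u)"
  define m where "m = (LEAST k. taylor_coeff k e \<noteq> 0)"
  have m: "taylor_coeff m e \<noteq> 0" "\<And>i. i < m \<Longrightarrow> taylor_coeff i e = 0"
    unfolding m_def using LeastI[of "\<lambda>k. taylor_coeff k e \<noteq> 0", OF nz[folded e_def]]
      not_less_Least[of _ "\<lambda>k. taylor_coeff k e \<noteq> 0"] by auto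
  have "m \<le> k" unfolding m_def by (rule Least_le[of "\<lambda>k. taylor_coeff k e \<noteq> 0", OF nz[folded e_def]])
  then have mp: "m \<le> p" using k by simp
  have \<kappa>0: "\<kappa> \<noteq> 0" using \<kappa> by (metis one_neq_zero power_0_left not_one_le_zero)
  have fix0: "(h ^^ i) 0 = 0" for i by (induction i) (auto simp: h0)
  obtain R where R: "R > 0" "h holomorphic_on ball 0 R" using h by (auto simp: analytic_on_def)
  have dh: "(h has_field_derivative \<kappa>) (at 0)"
    using holomorphic_derivI[OF R(2)] R \<kappa> by auto
  have "m \<noteq> 0"
  proof
    assume "m = 0"
    with m(1) show False by (simp add: e_def fix0)
  qed
  moreover have "m \<noteq> 1"
  proof
    assume "m = 1"
    have "(e has_field_derivative \<kappa> ^ p - 1) (at 0)" unfolding e_def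
      by (intro derivative_intros deriv_funpow_fixpoint dh h0)
    then have "deriv e 0 = 0" using \<kappa> by (simp add: DERIV_imp_deriv)
    then show False using m(1) \<open>m = 1\<close> by (simp add: taylor_coeff_1)
  qed
  ultimately have m2: "2 \<le> m" by simp
  define \<epsilon> where "\<epsilon> = taylor_coeff m e"
  have lim_e: "((\<lambda>u. e u / u ^ m) \<longlongrightarrow> \<epsilon>) (at 0)"
    unfolding \<epsilon>_def using taylor_coeff_tendsto[OF an[folded e_def] m(2)] .
  have lim_h: "((\<lambda>u. h u / u) \<longlongrightarrow> \<kappa>) (at 0)"
    using dh h0 by (simp add: has_field_derivative_iff)
  have h_lim0: "(h \<longlongrightarrow> 0) (at 0)" using analytic_at_imp_isCont[OF h] h0 by (simp add: isCont_def)
  have e_lim0: "(e \<longlongrightarrow> 0) (at 0)" using analytic_at_imp_isCont[OF an] fix0 by (simp add: isCont_def e_def)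
  have "\<forall>\<^sub>F u in at 0. h u / u \<noteq> 0" using lim_h \<kappa>0 by (rule tendsto_imp_eventually_ne)
  then have h_nz: "\<forall>\<^sub>F u in at 0. h u \<noteq> 0" by eventually_elim auto
  then have "filterlim h (at 0) (at 0)" using h_lim0 by (auto simp: filterlim_at)
  from filterlim_compose[OF lim_e this] have "((\<lambda>u. e (h u) / h u ^ m) \<longlongrightarrow> \<epsilon>) (at 0)" .
  from tendsto_mult[OF this tendsto_power[OF lim_h, of m]]
  have "((\<lambda>u. e (h u) / h u ^ m * (h u / u) ^ m) \<longlongrightarrow> \<epsilon> * \<kappa> ^ m) (at 0)" .
  then have 1: "((\<lambda>u. e (h u) / u ^ m) \<longlongrightarrow> \<epsilon> * \<kappa> ^ m) (at 0)"
    by (rule Lim_transform_eventually) (use h_nz in eventually_elim, simp add: power_divide)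
  have "holomorphic2_on (\<lambda>w. h) (UNIV \<times> ball 0 R)"
    by (rule holomorphic2_on_snd_only[OF _ R(2)]) (auto simp: open_Times)
  moreover have "open (UNIV \<times> ball (0::complex) R)" "(0::complex, 0) \<in> UNIV \<times> ball 0 R" using R by (auto simp: open_Times)
  ultimately have "((\<lambda>u. (h (u + e u) - h u) / u ^ m) \<longlongrightarrow> deriv (\<lambda>w. h 0) (0::complex) * 0 + deriv h 0 * \<epsilon>) (at 0)"
    by (rule holomorphic2_on_strict_tendsto[where \<alpha>="\<lambda>u. 0" and \<alpha>'="\<lambda>u. 0"])
       (use lim_e in \<open>auto intro!: tendsto_eq_intros e_lim0\<close>)
  \<comment> \<open>\<open>u + e u\<close> is \<open>(h ^^ p) u\<close>, and \<open>h\<close>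
    commutes with its iterate. Leading coefficients on the two sides are
    \<open>\<kappa> * \<epsilon>\<close> and \<open>\<kappa> ^ m * \<epsilon>\<close>.\<close>
  moreover have "h (u + e u) - h u = e (h u)" for u
    by (simp add: e_def funpow_swap1)
  ultimately have "((\<lambda>u. e (h u) / u ^ m) \<longlongrightarrow> \<kappa> * \<epsilon>) (at 0)" using \<kappa> by simp
  from LIM_unique[OF 1 this] m(1) have "\<kappa> ^ m = \<kappa>" by (simp add: \<epsilon>_def)
  with prim[OF m2 mp] show False by blast
qed

text \<open>The p-th iterate is compared with that of an auxiliary family whose multiplier is
  exactly \<open>\<kappa>\<close> for every parameter. By
  \<open>taylor_coeff_funpow_root_of_unity\<close> the latter differs from the identity to order
  \<open>p + 1\<close> only, which gives \<open>r\<close>; the difference of the two iterates is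
  \<open>d\<close>, led by the change of the p-th power of the multiplier.\<close>

lemma root_of_unity_family_split:
  fixes \<phi> :: "complex \<Rightarrow> complex \<Rightarrow> complex"
  assumes \<phi>: "holomorphic2_on \<phi> (ball 0 \<rho> \<times> ball 0 \<delta>)" and pos: "\<rho> > 0" "\<delta> > 0"
    and \<phi>0: "\<And>l. l \<in> ball 0 \<rho> \<Longrightarrow> \<phi> l 0 = 0"
    and \<kappa>: "deriv (\<phi> 0) 0 = \<kappa>" "\<kappa> ^ p = 1" and p: "p \<ge> 1" and prim: "\<And>k. 2 \<le> k \<Longrightarrow> k \<le> p \<Longrightarrow> \<kappa> ^ k \<noteq> \<kappa>"
    and A: "((\<lambda>l. (deriv (\<phi> l) 0 - \<kappa>) / l ^ M) \<longlongrightarrow> A) (at 0)" and M: "M \<ge> 1"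
  obtains \<rho>' \<delta>' d r C where "\<rho>' > 0" "\<delta>' > 0" "\<rho>' \<le> \<rho>" "\<delta>' \<le> \<delta>"
    "holomorphic2_on (\<lambda>l u. (\<phi> l ^^ p) u) (ball 0 \<rho>' \<times> ball 0 \<delta>')" "holomorphic2_on r (ball 0 \<rho>' \<times> ball 0 \<delta>')"
    "\<And>l u i. l \<in> ball 0 \<rho>' \<Longrightarrow> u \<in> ball 0 \<delta>' \<Longrightarrow> i \<le> p \<Longrightarrow> (\<phi> l ^^ i) u \<in> ball 0 \<delta>"
    "\<And>l u. l \<in> ball 0 \<rho>' \<Longrightarrow> u \<in> ball 0 \<delta>' \<Longrightarrow> (\<phi> l ^^ p) u = u + d l u + r l u"
    "\<And>l u. l \<in> ball 0 \<rho>' \<Longrightarrow> u \<in> ball 0 \<delta>' \<Longrightarrow> norm (d l u) \<le> C * norm l ^ M"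
    "\<And>l u. l \<in> ball 0 \<rho>' \<Longrightarrow> u \<in> ball 0 \<delta>' \<Longrightarrow> norm (r l u) \<le> C * norm u ^ (p + 1)"
    "\<And>l u. l \<in> ball 0 \<rho>' \<Longrightarrow> u \<in> ball 0 \<delta>' \<Longrightarrow>
        norm (d l u - of_nat p * \<kappa> ^ (p - 1) * A * l ^ M * u ^ 1) \<le> C * norm l ^ M * (norm u ^ (1 + 1) + norm l)"
proof -
  have dom: "open (ball (0::complex) \<rho> \<times> ball (0::complex) \<delta>)" by (simp add: open_Times)
  define K where "K = (\<lambda>l. deriv (\<phi> l) 0)"
  \<comment> \<open>Correcting the linear term restores the multiplier \<open>\<kappa>\<close>; the
    correction is of order \<open>M\<close> in the parameter.\<close>
  define \<psi> where "\<psi> = (\<lambda>l u. \<phi> l u - (K l - \<kappa>) * u)"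
  have Kh: "K holomorphic_on ball 0 \<rho>"
    unfolding K_def by (rule holomorphic2_on_holomorphic_compose[OF holomorphic2_on_deriv_snd[OF \<phi> dom] dom])
       (use pos in \<open>auto intro: holomorphic_intros\<close>)
  have K0: "K 0 = \<kappa>" using \<kappa> by (simp add: K_def)
  have \<psi>: "holomorphic2_on \<psi> (ball 0 \<rho> \<times> ball 0 \<delta>)"
    unfolding \<psi>_def
  proof (intro holomorphic2_on_diff holomorphic2_on_mult dom \<phi>)
    show "holomorphic2_on (\<lambda>l u. K l) (ball 0 \<rho> \<times> ball 0 \<delta>)"
      by (rule holomorphic2_on_fst_only[OF dom Kh]) auto
    show "holomorphic2_on (\<lambda>l u. \<kappa>) (ball 0 \<rho> \<times> ball 0 \<delta>)"
      by (rule holomorphic2_on_fst_only[OF dom, of _ UNIV]) auto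
    show "holomorphic2_on (\<lambda>l u. u) (ball 0 \<rho> \<times> ball 0 \<delta>)"
      by (rule holomorphic2_on_snd_only[OF dom, of _ UNIV]) auto
  qed
  have \<psi>_app: "\<psi> l u = \<phi> l u - (K l - \<kappa>) * u" for l u by (simp add: \<psi>_def)
  have \<psi>0: "\<psi> l 0 = 0" if "l \<in> ball 0 \<rho>" for l using \<phi>0[OF that] by (simp add: \<psi>_def)
  obtain \<rho>1 \<delta>1 where 1: "\<rho>1 > 0" "\<delta>1 > 0" "\<rho>1 \<le> \<rho>" "\<delta>1 \<le> \<delta>"
    "\<And>i. i \<le> p \<Longrightarrow> holomorphic2_on (\<lambda>l u. (\<phi> l ^^ i) u) (ball 0 \<rho>1 \<times> ball 0 \<delta>1)"
    "\<And>i l u. i \<le> p \<Longrightarrow> l \<in> ball 0 \<rho>1 \<Longrightarrow> u \<in> ball 0 \<delta>1 \<Longrightarrow> (\<phi> l ^^ i) u \<in> ball 0 \<delta>"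
    using holomorphic2_on_iterates[OF \<phi> pos \<phi>0, of p] pos by auto
  obtain \<rho>2 \<delta>2 where 2: "\<rho>2 > 0" "\<delta>2 > 0" "\<rho>2 \<le> \<rho>" "\<delta>2 \<le> \<delta>"
    "\<And>i. i \<le> p \<Longrightarrow> holomorphic2_on (\<lambda>l u. (\<psi> l ^^ i) u) (ball 0 \<rho>2 \<times> ball 0 \<delta>2)"
    "\<And>i l u. i \<le> p \<Longrightarrow> l \<in> ball 0 \<rho>2 \<Longrightarrow> u \<in> ball 0 \<delta>2 \<Longrightarrow> (\<psi> l ^^ i) u \<in> ball 0 \<delta>"
    using holomorphic2_on_iterates[OF \<psi> pos \<psi>0, of p] pos by auto
  \<comment> \<open>Halving keeps the closed disc inside the domain, where compactness bounds
    \<open>k2\<close>; the bound 1 makes powers of \<open>norm l\<close> decrease with the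
    exponent.\<close>
  define \<rho>' where "\<rho>' = min 1 (min \<rho>1 \<rho>2) / 2"
  define \<delta>' where "\<delta>' = min 1 (min \<delta>1 \<delta>2)"
  have pos': "\<rho>' > 0" "\<delta>' > 0" "\<rho>' < \<rho>1" "\<rho>' < \<rho>2" "\<delta>' \<le> \<delta>1" "\<delta>' \<le> \<delta>2" "\<rho>' < 1" "\<delta>' \<le> 1"
    using 1 2 by (auto simp: \<rho>'_def \<delta>'_def)
  define S where "S = ball (0::complex) \<rho>' \<times> ball (0::complex) \<delta>'"
  have oS: "open S" by (simp add: S_def open_Times)
  have sub: "S \<subseteq> ball 0 \<rho>1 \<times> ball 0 \<delta>1" "S \<subseteq> ball 0 \<rho>2 \<times> ball 0 \<delta>2" using pos' by (auto simp: S_def)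
  have hf: "holomorphic2_on (\<lambda>l u. (\<phi> l ^^ i) u) S" and hg: "holomorphic2_on (\<lambda>l u. (\<psi> l ^^ i) u) S" if "i \<le> p" for i
    using holomorphic2_on_subset[OF 1(5)[OF that] sub(1)] holomorphic2_on_subset[OF 2(5)[OF that] sub(2)] by auto
  have bf: "(\<phi> l ^^ i) u \<in> ball 0 \<delta>" and bg: "(\<psi> l ^^ i) u \<in> ball 0 \<delta>" if "i \<le> p" "l \<in> ball 0 \<rho>'" "u \<in> ball 0 \<delta>'" for i l u
    using 1(6)[OF that(1), of l u] 2(6)[OF that(1), of l u] that pos' by auto
  define r where "r = (\<lambda>l u. (\<psi> l ^^ p) u - u)"
  define d where "d = (\<lambda>l u. (\<phi> l ^^ p) u - (\<psi> l ^^ p) u)"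
  have snd: "holomorphic2_on (\<lambda>l u. u) S" by (rule holomorphic2_on_snd_only[OF oS, of _ UNIV]) auto
  have hr: "holomorphic2_on r S" unfolding r_def by (intro holomorphic2_on_diff oS hg snd) simp
  have hd: "holomorphic2_on d S" unfolding d_def by (intro holomorphic2_on_diff oS hg hf) simp_all
  have slice2: "(\<lambda>u. H l u) holomorphic_on ball 0 \<delta>'" if "holomorphic2_on H S" "l \<in> ball 0 \<rho>'" for H l
    by (rule holomorphic2_on_holomorphic_compose[OF that(1) oS]) (use that in \<open>auto simp: S_def intro: holomorphic_intros\<close>)
  have slice1: "(\<lambda>l. H l u) holomorphic_on ball 0 \<rho>'" if "holomorphic2_on H S" "u \<in> ball 0 \<delta>'" for H u
    by (rule holomorphic2_on_holomorphic_compose[OF that(1) oS]) (use that in \<open>auto simp: S_def intro: holomorphic_intros\<close>)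
  have an\<rho>: "f analytic_on {0}" if "f holomorphic_on ball 0 \<rho>'" for f :: "complex \<Rightarrow> complex"
    unfolding analytic_at using that pos' by (intro exI[of _ "ball 0 \<rho>'"]) auto
  have an\<delta>: "f analytic_on {0}" if "f holomorphic_on ball 0 \<delta>'" for f :: "complex \<Rightarrow> complex"
    unfolding analytic_at using that pos' by (intro exI[of _ "ball 0 \<delta>'"]) auto
  have dphi: "(\<phi> l has_field_derivative K l) (at 0)" if "l \<in> ball 0 \<rho>" for l
    using holomorphic2_on_snd[OF \<phi> dom, of l 0] that pos by (simp add: K_def DERIV_deriv_iff_field_differentiable)
  have dpsi: "(\<psi> l has_field_derivative \<kappa>) (at 0)" if "l \<in> ball 0 \<rho>" for l
    unfolding \<psi>_def by (rule derivative_eq_intros dphi that refl | simp)+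
  have \<rho>'\<rho>: "l \<in> ball 0 \<rho>" if "l \<in> ball 0 \<rho>'" for l using that pos' 1 by auto
  have fix\<phi>: "(\<phi> l ^^ i) 0 = 0" and fix\<psi>: "(\<psi> l ^^ i) 0 = 0" if "l \<in> ball 0 \<rho>'" for i l
    using \<phi>0[OF \<rho>'\<rho>[OF that]] \<psi>0[OF \<rho>'\<rho>[OF that]] by (induction i) auto
  define B where "B = 2 * (2 * \<delta> + 1)"
  have r_bd: "norm (r l u) \<le> \<delta> + 1" if "l \<in> ball 0 \<rho>'" "u \<in> ball 0 \<delta>'" for l u
    using bg[OF order_refl that] that pos' norm_triangle_ineq4[of "(\<psi> l ^^ p) u" u] by (auto simp: r_def)
  have r_le: "norm (r l u) \<le> 2 * (\<delta> + 1) * (4 * norm u / \<delta>') ^ (p + 1)" if l: "l \<in> ball 0 \<rho>'" and u: "u \<in> ball 0 \<delta>'" for l u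
  proof (rule zero_order_bound[OF slice2[OF hr l] pos'(2) r_bd[OF l] _ u])
    fix k assume "k < p + 1"
    then have kp: "k \<le> p" by simp
    have "\<psi> l holomorphic_on ball 0 \<delta>'"
      using slice2[OF hg[of 1] l] p by simp
    then have h\<psi>: "\<psi> l analytic_on {0}" by (rule an\<delta>)
    have an: "(\<lambda>u. (\<psi> l ^^ p) u - u) analytic_on {0}" using an\<delta>[OF slice2[OF hr l]] by (simp add: r_def)
    have "taylor_coeff k (\<lambda>u. (\<psi> l ^^ p) u - u) = 0"
      by (rule taylor_coeff_funpow_root_of_unity[OF h\<psi> \<psi>0[OF \<rho>'\<rho>[OF l]]
            DERIV_imp_deriv[OF dpsi[OF \<rho>'\<rho>[OF l]]] \<kappa>(2) p prim an kp])
    then show "taylor_coeff k (r l) = 0" by (simp add: r_def[abs_def])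
  qed auto
  have d_bd: "norm (d l u) \<le> 2 * \<delta>" if "l \<in> ball 0 \<rho>'" "u \<in> ball 0 \<delta>'" for l u
    using bf[OF order_refl that] bg[OF order_refl that] norm_triangle_ineq4[of "(\<phi> l ^^ p) u" "(\<psi> l ^^ p) u"] by (auto simp: d_def)
  \<comment> \<open>At a fixed point \<open>u\<close> the two families agree below order
    \<open>M\<close> in \<open>l\<close>. The induction on the number of iterations adds at each
    step the correction \<open>(K l - \<kappa>) * u\<close>, itself of order
    \<open>M\<close>.\<close>
  have lim_iter: "((\<lambda>l. ((\<phi> l ^^ i) u - (\<psi> l ^^ i) u) / l ^ j) \<longlongrightarrow> 0) (at 0)" if j: "j < M" and u: "u \<in> ball 0 \<delta>'" and "i \<le> p" for i j u
    using that(3)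
  proof (induction i)
    case (Suc i)
    then have i: "i \<le> p" by simp
    have l0: "0 \<in> ball 0 \<rho>'" using pos' by simp
    have \<phi>\<psi>0: "\<psi> 0 = \<phi> 0" using K0 by (auto simp: \<psi>_def)
    have c1: "((\<lambda>l. (\<phi> l ^^ i) u) \<longlongrightarrow> (\<phi> 0 ^^ i) u) (at 0)" and c2: "((\<lambda>l. (\<psi> l ^^ i) u) \<longlongrightarrow> (\<phi> 0 ^^ i) u) (at 0)"
      using analytic_at_imp_isCont[OF an\<rho>[OF slice1[OF hf[OF i] u]]] analytic_at_imp_isCont[OF an\<rho>[OF slice1[OF hg[OF i] u]]]
      by (auto simp: isCont_def \<phi>\<psi>0)
    have L1: "((\<lambda>l. (\<phi> l ((\<phi> l ^^ i) u) - \<phi> l ((\<psi> l ^^ i) u)) / l ^ j) \<longlongrightarrow>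
        deriv (\<lambda>w. \<phi> w ((\<phi> 0 ^^ i) u)) 0 * 0 + deriv (\<phi> 0) ((\<phi> 0 ^^ i) u) * 0) (at 0)"
      by (rule holomorphic2_on_strict_tendsto[OF \<phi> dom _ _ _ c2 c1]) (use Suc i bf[OF i l0 u] pos in auto)
    have L2: "((\<lambda>l. ((K l - \<kappa>) / l ^ M * l ^ (M - j)) * (\<psi> l ^^ i) u) \<longlongrightarrow> (A * 0 ^ (M - j)) * (\<phi> 0 ^^ i) u) (at 0)"
      unfolding K_def by (intro tendsto_intros A c2)
    have "((\<lambda>l. (\<phi> l ((\<phi> l ^^ i) u) - \<phi> l ((\<psi> l ^^ i) u)) / l ^ j + ((K l - \<kappa>) / l ^ M * l ^ (M - j)) * (\<psi> l ^^ i) u) \<longlongrightarrow> 0 + 0) (at 0)"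
      by (rule tendsto_eq_rhs[OF tendsto_add[OF L1 L2]]) (use j in simp)
    then show ?case
    proof (rule Lim_transform_eventually[OF tendsto_eq_rhs])
      have *: "w / l ^ M * l ^ (M - j) = w / l ^ j" if "l \<noteq> 0" for l w :: complex
        using that j by (simp add: divide_simps flip: power_add)
      show "\<forall>\<^sub>F l in at 0. (\<phi> l ((\<phi> l ^^ i) u) - \<phi> l ((\<psi> l ^^ i) u)) / l ^ j + ((K l - \<kappa>) / l ^ M * l ^ (M - j)) * (\<psi> l ^^ i) u =
          ((\<phi> l ^^ Suc i) u - (\<psi> l ^^ Suc i) u) / l ^ j"
        unfolding eventually_at_filter
      proof (intro always_eventually allI impI)
        fix l :: complex assume l: "l \<noteq> 0"
        show "(\<phi> l ((\<phi> l ^^ i) u) - \<phi> l ((\<psi> l ^^ i) u)) / l ^ j + ((K l - \<kappa>) / l ^ M * l ^ (M - j)) * (\<psi> l ^^ i) u =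
          ((\<phi> l ^^ Suc i) u - (\<psi> l ^^ Suc i) u) / l ^ j"
          unfolding *[OF l] funpow.simps o_apply \<psi>_app by (simp add: divide_inverse algebra_simps)
      qed
    qed simp
  qed simp
  have d_le: "norm (d l u) \<le> 2 * (2 * \<delta>) * (4 * norm l / \<rho>') ^ M" if l: "l \<in> ball 0 \<rho>'" and u: "u \<in> ball 0 \<delta>'" for l u
  proof (rule zero_order_bound[OF slice1[OF hd u] pos'(1) d_bd[OF _ u] _ l])
    fix k assume k: "k < M"
    show "taylor_coeff k (\<lambda>l. d l u) = 0"
      by (rule taylor_coeff_zeroI(2)[OF an\<rho>[OF slice1[OF hd u]]]) (use lim_iter[OF k u order_refl] in \<open>simp add: d_def\<close>)
  qed
  define D where "D = 4 * \<delta> * (4 / \<rho>') ^ M"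
  have D: "norm (d l u) \<le> D * norm l ^ M" if l: "l \<in> ball 0 \<rho>'" and u: "u \<in> ball 0 \<delta>'" for l u
    using d_le[OF that] by (simp add: D_def power_mult_distrib power_divide field_simps)
  have D0: "D \<ge> 0" using pos pos' by (simp add: D_def)
  define A' where "A' = of_nat p * \<kappa> ^ (p - 1) * A"
  \<comment> \<open>\<open>k1 l\<close> is the coefficient of \<open>u\<close> in
    \<open>d l u\<close>. Factoring a difference of p-th powers gives its leading coefficient
    \<open>A'\<close>, and \<open>k2\<close> is what then remains, of order
    \<open>M + 1\<close>.\<close>
  define k1 where "k1 = (\<lambda>l. K l ^ p - \<kappa> ^ p)"
  define k2 where "k2 = (\<lambda>l. k1 l - A' * l ^ M)"
  have K_sub: "cball 0 \<rho>' \<subseteq> ball (0::complex) \<rho>" using pos' 1 by auto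
  have k1h: "k1 holomorphic_on ball 0 \<rho>" unfolding k1_def by (intro holomorphic_intros Kh)
  have k2h: "k2 holomorphic_on ball 0 \<rho>" unfolding k2_def by (intro holomorphic_intros k1h)
  have "bounded (k2 ` cball 0 \<rho>')"
    by (intro compact_imp_bounded compact_continuous_image holomorphic_on_imp_continuous_on holomorphic_on_subset[OF k2h K_sub]) auto
  then obtain B2 where B2: "\<And>l. l \<in> cball 0 \<rho>' \<Longrightarrow> norm (k2 l) \<le> B2" unfolding bounded_iff by blast
  have K_lim: "(K \<longlongrightarrow> \<kappa>) (at 0)"
    using Kh K0 pos by (metis centre_in_ball continuous_on_eq_continuous_at holomorphic_on_imp_continuous_on isCont_def open_ball)
  have k1_lim: "((\<lambda>l. k1 l / l ^ M) \<longlongrightarrow> A') (at 0)"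
  proof -
    have "((\<lambda>l. (K l - \<kappa>) / l ^ M * (\<Sum>i<p. \<kappa> ^ (p - Suc i) * K l ^ i)) \<longlongrightarrow> A * (\<Sum>i<p. \<kappa> ^ (p - Suc i) * \<kappa> ^ i)) (at 0)"
      by (intro tendsto_mult tendsto_sum tendsto_power tendsto_const K_lim) (use A in \<open>simp add: K_def\<close>)
    also have "(\<Sum>i<p. \<kappa> ^ (p - Suc i) * \<kappa> ^ i) = (\<Sum>i<p. \<kappa> ^ (p - 1))"
      by (intro sum.cong) (auto simp flip: power_add)
    also have "A * (\<Sum>i<p. \<kappa> ^ (p - 1)) = A'" by (simp add: A'_def)
    finally show ?thesis by (simp add: k1_def power_diff_sumr2)
  qed
  have k2_lim: "((\<lambda>l. k2 l / l ^ M) \<longlongrightarrow> 0) (at 0)"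
  proof -
    have "((\<lambda>l. k1 l / l ^ M - A') \<longlongrightarrow> A' - A') (at 0)" by (intro tendsto_intros k1_lim)
    then show ?thesis
      by (rule Lim_transform_eventually[OF tendsto_eq_rhs]) (auto simp: eventually_at_filter k2_def diff_divide_distrib)
  qed
  have k2_an: "k2 analytic_on {0}" unfolding analytic_at using k2h pos by (intro exI[of _ "ball 0 \<rho>"]) auto
  have k2_le: "norm (k2 l) \<le> 2 * B2 * (4 * norm l / \<rho>') ^ (M + 1)" if "l \<in> ball 0 \<rho>'" for l
  proof (rule zero_order_bound[OF _ pos'(1) _ _ that])
    show "k2 holomorphic_on ball 0 \<rho>'" using k2h by (rule holomorphic_on_subset) (use pos' 1 in auto)
    show "taylor_coeff k k2 = 0" if "k < M + 1" for k
      using taylor_coeff_zeroI[OF k2_an k2_lim] that by (cases "k = M") auto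
  qed (use B2 in auto)
  define D2 where "D2 = 2 * B2 * (4 / \<rho>') ^ (M + 1)"
  have k2_le': "norm (k2 l) \<le> D2 * norm l ^ (M + 1)" if "l \<in> ball 0 \<rho>'" for l
    using k2_le[OF that] by (simp add: D2_def power_mult_distrib power_divide field_simps)
  have B2nn: "B2 \<ge> 0" using order_trans[OF norm_ge_zero B2[of 0]] pos' by simp
  have D2nn: "D2 \<ge> 0" using B2nn pos' by (simp add: D2_def)
  define E where "E = D + norm A' + D2"
  have k1_le: "norm (k1 l) \<le> (norm A' + D2) * norm l ^ M" if "l \<in> ball 0 \<rho>'" for l
  proof -
    have "k1 l = A' * l ^ M + k2 l" by (simp add: k2_def)
    then have "norm (k1 l) \<le> norm A' * norm l ^ M + D2 * norm l ^ (M + 1)"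
      using norm_triangle_ineq[of "A' * l ^ M" "k2 l"] k2_le'[OF that] by (simp add: norm_mult norm_power)
    also have "D2 * norm l ^ (M + 1) \<le> D2 * norm l ^ M"
      using D2nn that pos' by (intro mult_left_mono power_decreasing) auto
    finally show ?thesis by (simp add: algebra_simps)
  qed
  \<comment> \<open>The smallness in \<open>l\<close> is kept as the supremum bound while the double
    zero in \<open>u\<close> is exploited, so that the estimate carries both factors
    \<open>norm l ^ M\<close> and \<open>norm u ^ 2\<close>.\<close>
  have e_le: "norm (d l u - k1 l * u) \<le> 2 * (E * norm l ^ M) * (4 * norm u / \<delta>') ^ 2" if l: "l \<in> ball 0 \<rho>'" and u: "u \<in> ball 0 \<delta>'" for l u
  proof (rule zero_order_bound[OF _ pos'(2) _ _ u])
    show hol: "(\<lambda>u. d l u - k1 l * u) holomorphic_on ball 0 \<delta>'" by (intro holomorphic_intros slice2[OF hd l])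
    show "norm (d l u - k1 l * u) \<le> E * norm l ^ M" if "u \<in> ball 0 \<delta>'" for u
    proof -
      have "norm (k1 l * u) \<le> (norm A' + D2) * norm l ^ M * 1"
        unfolding norm_mult using k1_le[OF l] that pos' D2nn by (intro mult_mono) auto
      then show ?thesis using D[OF l that] norm_triangle_ineq4[of "d l u" "k1 l * u"] by (simp add: E_def algebra_simps)
    qed
    have "((\<lambda>u. d l u - k1 l * u) has_field_derivative (K l ^ p - \<kappa> ^ p) - k1 l) (at 0)"
      unfolding d_def by (rule derivative_eq_intros deriv_funpow_fixpoint dphi dpsi \<rho>'\<rho> l \<phi>0 \<psi>0 refl | simp)+
    then have "deriv (\<lambda>u. d l u - k1 l * u) 0 = 0" by (simp add: DERIV_imp_deriv k1_def)
    then show "taylor_coeff k (\<lambda>u. d l u - k1 l * u) = 0" if "k < 2" for k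
      using that by (auto simp: less_2_cases_iff taylor_coeff_1 d_def fix\<phi>[OF l] fix\<psi>[OF l])
  qed
  define C where "C = Max {D, 2 * (\<delta> + 1) * (4 / \<delta>') ^ (p + 1), 2 * E * (4 / \<delta>') ^ 2, D2}"
  have C: "D \<le> C" "2 * (\<delta> + 1) * (4 / \<delta>') ^ (p + 1) \<le> C" "2 * E * (4 / \<delta>') ^ 2 \<le> C" "D2 \<le> C" by (auto simp: C_def)
  show thesis
  proof (rule that[of \<rho>' \<delta>' r d C])
    show "\<rho>' > 0" "\<delta>' > 0" "\<rho>' \<le> \<rho>" "\<delta>' \<le> \<delta>" using pos' 1 by auto
    show "holomorphic2_on (\<lambda>l u. (\<phi> l ^^ p) u) (ball 0 \<rho>' \<times> ball 0 \<delta>')" "holomorphic2_on r (ball 0 \<rho>' \<times> ball 0 \<delta>')"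
      using hf[OF order_refl] hr by (auto simp: S_def)
    show "(\<phi> l ^^ i) u \<in> ball 0 \<delta>" if "l \<in> ball 0 \<rho>'" "u \<in> ball 0 \<delta>'" "i \<le> p" for l u i using bf that by blast
    fix l u assume lu: "l \<in> ball (0::complex) \<rho>'" "u \<in> ball (0::complex) \<delta>'"
    show "(\<phi> l ^^ p) u = u + d l u + r l u" by (simp add: d_def r_def)
    show "norm (d l u) \<le> C * norm l ^ M"
      using D[OF lu] mult_right_mono[OF C(1), of "norm l ^ M"] by simp
    have "norm (r l u) \<le> (2 * (\<delta> + 1) * (4 / \<delta>') ^ (p + 1)) * norm u ^ (p + 1)"
      using r_le[OF lu] by (simp add: power_mult_distrib power_divide field_simps)
    also have "\<dots> \<le> C * norm u ^ (p + 1)" by (intro mult_right_mono C) auto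
    finally show "norm (r l u) \<le> C * norm u ^ (p + 1)" .
    have "d l u - A' * l ^ M * u ^ 1 = (d l u - k1 l * u) + k2 l * u" by (simp add: k2_def algebra_simps)
    also have "norm \<dots> \<le> (2 * E * (4 / \<delta>') ^ 2) * (norm l ^ M * norm u ^ 2) + D2 * norm l ^ (M + 1)"
    proof (rule norm_triangle_mono)
      show "norm (d l u - k1 l * u) \<le> (2 * E * (4 / \<delta>') ^ 2) * (norm l ^ M * norm u ^ 2)"
        using e_le[OF lu] by (simp add: power_mult_distrib power_divide field_simps)
      have "norm (k2 l * u) \<le> D2 * norm l ^ (M + 1) * 1"
        unfolding norm_mult using k2_le'[OF lu(1)] lu pos' D2nn by (intro mult_mono) auto
      then show "norm (k2 l * u) \<le> D2 * norm l ^ (M + 1)" by simp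
    qed
    also have "\<dots> \<le> C * (norm l ^ M * norm u ^ 2) + C * norm l ^ (M + 1)"
      by (intro add_mono mult_right_mono C) auto
    also have "\<dots> = C * norm l ^ M * (norm u ^ (1 + 1) + norm l)" by (simp add: algebra_simps power2_eq_square)
    finally show "norm (d l u - of_nat p * \<kappa> ^ (p - 1) * A * l ^ M * u ^ 1) \<le> C * norm l ^ M * (norm u ^ (1 + 1) + norm l)"
      by (simp add: A'_def)
  qed
qed

section \<open>Transport of Lipschitz jets and separation of branches\<close>

text \<open>A quantitative form of local injectivity. It converts Lipschitz dependence on a source
  point into Lipschitz dependence on its image.\<close>

lemma holomorphic_locally_expanding:
  assumes h: "h holomorphic_on S" "open S" "a \<in> S" and nz: "deriv h a \<noteq> 0"
  obtains \<delta> where "\<delta> > 0" "ball a \<delta> \<subseteq> S"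
    "\<And>x y. x \<in> ball a \<delta> \<Longrightarrow> y \<in> ball a \<delta> \<Longrightarrow> norm (deriv h a) / 2 * norm (x - y) \<le> norm (h x - h y)"
proof -
  have oS: "open ((UNIV::complex set) \<times> S)" using h by (simp add: open_Times)
  have H: "holomorphic2_on (\<lambda>w::complex. h) (UNIV \<times> S)"
    by (rule holomorphic2_on_snd_only[OF oS h(1,2)]) auto
  have e: "norm (deriv h a) / 2 > 0" and mem: "(0::complex, a) \<in> UNIV \<times> S" using nz h by auto
  show thesis
  proof (rule holomorphic2_on_strict_derivative[OF H oS mem e], goal_cases)
    case d: (1 d)
    show ?case
  proof (rule that[OF d(1)])
    show "ball a d \<subseteq> S"
    proof
      fix x assume "x \<in> ball a d"
      then have "(0::complex, x) \<in> UNIV \<times> S" using d(1) by (intro subsetD[OF d(2)]) auto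
      then show "x \<in> S" by simp
    qed
    fix x y assume xy: "x \<in> ball a d" "y \<in> ball a d"
    have "norm (h x - h y - deriv h a * (x - y)) \<le> norm (deriv h a) / 2 * norm (x - y)"
      using d(3)[of 0 0 y x] xy d(1) by simp
    moreover have "norm (deriv h a) * norm (x - y) \<le> norm (h x - h y) + norm (h x - h y - deriv h a * (x - y))"
      using norm_triangle_ineq4[of "h x - h y" "h x - h y - deriv h a * (x - y)"] by (simp add: norm_mult)
    ultimately show "norm (deriv h a) / 2 * norm (x - y) \<le> norm (h x - h y)" by (simp add: algebra_simps)
  qed
  qed
qed

text \<open>The curves enter only through their jets below \<open>M\<close>, which depend on the
  point in a Lipschitz way uniformly for small \<open>l\<close>. So do their images under
  \<open>F\<close>, and Cauchy's estimate for the difference of two image curves yields the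
  coefficients.\<close>

lemma taylor_coeff_transport:
  assumes F: "holomorphic2_on F S" and S: "open S" and mem: "(c, a) \<in> S"
  obtains \<delta> where "\<delta> > 0"
    "\<And>T \<gamma> M j. T \<subseteq> ball a \<delta> \<Longrightarrow> (\<And>x. x \<in> T \<Longrightarrow> \<gamma> x analytic_on {0}) \<Longrightarrow> (\<And>x. x \<in> T \<Longrightarrow> \<gamma> x 0 = x) \<Longrightarrow>
       (\<And>j. 1 \<le> j \<Longrightarrow> j < M \<Longrightarrow> \<exists>L. L-lipschitz_on T (\<lambda>x. taylor_coeff j (\<gamma> x))) \<Longrightarrow> j < M \<Longrightarrow>
       \<exists>L. L-lipschitz_on T (\<lambda>x. taylor_coeff j (\<lambda>l. F (c + l) (\<gamma> x l)))"
proof -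
  obtain r where r: "r > 0" "cball c r \<times> cball a r \<subseteq> S" by (rule open_Times_cball_subset[OF S mem])
  have inS: "(w, z) \<in> S" if "w \<in> cball c r" "z \<in> cball a r" for w z
    by (rule subsetD[OF r(2)]) (use that in auto)
  have "bounded ((\<lambda>(w, z). deriv (F w) z) ` (cball c r \<times> cball a r))"
    by (intro compact_imp_bounded compact_continuous_image compact_Times compact_cball
        continuous_on_subset[OF holomorphic2_on_imp_continuous_on[OF holomorphic2_on_deriv_snd[OF F S]] r(2)])
  then obtain B where B: "\<And>w z. w \<in> cball c r \<Longrightarrow> z \<in> cball a r \<Longrightarrow> norm (deriv (F w) z) \<le> B"
    unfolding bounded_iff by fastforce
  have B0: "B \<ge> 0" using order_trans[OF norm_ge_zero B[of c a]] r by simp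
  have Flip: "norm (F w u - F w v) \<le> B * norm (u - v)" if w: "w \<in> cball c r" and uv: "u \<in> ball a r" "v \<in> ball a r" for w u v
  proof (rule field_differentiable_bound[of "ball a r" "F w" "deriv (F w)"])
    fix z assume z: "z \<in> ball a r"
    have "(F w has_field_derivative deriv (F w) z) (at z)"
      using holomorphic2_on_snd[OF F S inS[OF w]] z by (simp add: DERIV_deriv_iff_field_differentiable)
    then show "(F w has_field_derivative deriv (F w) z) (at z within ball a r)" by (rule has_field_derivative_at_within)
    show "norm (deriv (F w) z) \<le> B" using B[OF w] z by simp
  qed (use uv in auto)
  show thesis
  proof (rule that[of "r / 2"])
    show "r / 2 > 0" using r by simp
    fix T \<gamma> and M j :: nat
    assume T: "T \<subseteq> ball a (r / 2)" and an: "\<And>x. x \<in> T \<Longrightarrow> \<gamma> x analytic_on {0}" and \<gamma>0: "\<And>x. x \<in> T \<Longrightarrow> \<gamma> x 0 = x"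
      and lip: "\<And>j. 1 \<le> j \<Longrightarrow> j < M \<Longrightarrow> \<exists>L. L-lipschitz_on T (\<lambda>x. taylor_coeff j (\<gamma> x))" and j: "j < M"
    have "\<exists>L. L-lipschitz_on T (\<lambda>x. taylor_coeff j (\<gamma> x))" if "j < M" for j
    proof (cases "j = 0")
      case True
      have "1-lipschitz_on T (\<lambda>x. x)" by (rule lipschitz_on_id)
      then have "1-lipschitz_on T (\<lambda>x. taylor_coeff j (\<gamma> x))"
        by (rule lipschitz_on_transform) (use True \<gamma>0 in auto)
      then show ?thesis by blast
    qed (use lip that in auto)
    then obtain L where L: "\<And>j. j < M \<Longrightarrow> (L j)-lipschitz_on T (\<lambda>x. taylor_coeff j (\<gamma> x))" by metis
    have "\<exists>k. k > 0 \<and> (\<forall>x\<in>T. norm (taylor_coeff j (\<gamma> x)) \<le> k)" if "j < M" for j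
    proof -
      obtain B where "B > 0" "\<And>x. x \<in> T \<Longrightarrow> norm (taylor_coeff j (\<gamma> x)) \<le> B"
        using lipschitz_on_bounded[OF L[OF \<open>j < M\<close>] bounded_subset[OF bounded_ball T]] by blast
      then show ?thesis by blast
    qed
    then obtain k where k: "\<And>j. j < M \<Longrightarrow> k j > 0" "\<And>j x. j < M \<Longrightarrow> x \<in> T \<Longrightarrow> norm (taylor_coeff j (\<gamma> x)) \<le> k j" by metis
    define LL where "LL = (\<Sum>j<M. L j)"
    define KK where "KK = (\<Sum>j<M. k j) + 1"
    have Lj: "L j \<ge> 0" if "j < M" for j using lipschitz_on_nonneg[OF L[OF that]] .
    have KK: "KK > 0" unfolding KK_def by (intro add_nonneg_pos sum_nonneg) (use k(1) in \<open>auto intro: less_imp_le\<close>)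
    define \<pi> where "\<pi> = (\<lambda>x l. \<Sum>j<M. taylor_coeff j (\<gamma> x) * l ^ j)"
    \<comment> \<open>Keeps the polynomial curves within \<open>KK * R\<close>, hence within
      \<open>r / 2\<close>, of their starting points, on top of the \<open>r / 2\<close> by which
      those may differ from \<open>a\<close>.\<close>
    define R where "R = min (min 1 r) (r / (2 * KK))"
    have R: "R > 0" "R \<le> 1" "R \<le> r" "R * KK \<le> r / 2" using r KK by (auto simp: R_def min_def field_simps)
    have \<pi>0: "\<pi> x 0 = x" if "x \<in> T" for x
    proof -
      have "\<pi> x 0 = taylor_coeff 0 (\<gamma> x)" using j by (simp add: \<pi>_def)
      then show ?thesis using \<gamma>0[OF that] by simp
    qed
    have \<pi>_ball: "\<pi> x l \<in> ball a r" if x: "x \<in> T" and l: "l \<in> ball 0 R" for x l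
    proof -
      have "{..<M} = insert 0 {1..<M}" using j by auto
      then have "\<pi> x l = x + (\<Sum>j=1..<M. taylor_coeff j (\<gamma> x) * l ^ j)" using \<gamma>0[OF x] by (simp add: \<pi>_def)
      then have "norm (\<pi> x l - x) \<le> (\<Sum>j=1..<M. k j * norm l)"
      proof (simp, intro sum_norm_le)
        fix j assume j: "j \<in> {Suc 0..<M}"
        have "norm l ^ j \<le> norm l ^ 1" using l R j by (intro power_decreasing) auto
        then show "norm (taylor_coeff j (\<gamma> x) * l ^ j) \<le> k j * norm l"
          unfolding norm_mult norm_power using k[of j] x j by (intro mult_mono) (auto intro: less_imp_le)
      qed
      also have "\<dots> = (\<Sum>j=1..<M. k j) * norm l" by (simp add: sum_distrib_right)
      also have "\<dots> \<le> KK * R"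
      proof (intro mult_mono)
        have "(\<Sum>j=1..<M. k j) \<le> (\<Sum>j<M. k j)" by (intro sum_mono2) (use k(1) in \<open>auto intro: less_imp_le\<close>)
        then show "(\<Sum>j=1..<M. k j) \<le> KK" by (simp add: KK_def)
      qed (use l KK in auto)
      also have "\<dots> \<le> r / 2" using R by (simp add: mult.commute)
      finally have "norm (\<pi> x l - x) \<le> r / 2" .
      moreover have "dist a x < r / 2" using T x by auto
      ultimately show ?thesis using dist_triangle[of a "\<pi> x l" x] by (simp add: dist_norm norm_minus_commute)
    qed
    have \<pi>_lip: "norm (\<pi> x l - \<pi> y l) \<le> LL * norm (x - y)" if xy: "x \<in> T" "y \<in> T" and l: "l \<in> ball 0 R" for x y l
    proof -
      have "\<pi> x l - \<pi> y l = (\<Sum>j<M. (taylor_coeff j (\<gamma> x) - taylor_coeff j (\<gamma> y)) * l ^ j)"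
        by (simp add: \<pi>_def left_diff_distrib sum_subtractf)
      also have "norm \<dots> \<le> (\<Sum>j<M. L j * norm (x - y))"
      proof (intro sum_norm_le)
        fix j assume "j \<in> {..<M}"
        then have j: "j < M" by simp
        have "norm l ^ j \<le> 1" using l R by (intro power_le_one) auto
        moreover have "norm (taylor_coeff j (\<gamma> x) - taylor_coeff j (\<gamma> y)) \<le> L j * norm (x - y)"
          using lipschitz_onD[OF L[OF j] xy] by (simp add: dist_norm)
        ultimately have "norm (taylor_coeff j (\<gamma> x) - taylor_coeff j (\<gamma> y)) * norm l ^ j \<le> L j * norm (x - y) * 1"
          using Lj[OF j] by (intro mult_mono) auto
        then show "norm ((taylor_coeff j (\<gamma> x) - taylor_coeff j (\<gamma> y)) * l ^ j) \<le> L j * norm (x - y)"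
          by (simp add: norm_mult norm_power)
      qed
      also have "\<dots> = LL * norm (x - y)" by (simp add: LL_def sum_distrib_right)
      finally show ?thesis .
    qed
    have hF: "(\<lambda>l. F (c + l) (\<pi> x l)) holomorphic_on ball 0 R" if "x \<in> T" for x
    proof (rule holomorphic2_on_holomorphic_compose[OF F S])
      show "(c + l, \<pi> x l) \<in> S" if "l \<in> ball 0 R" for l
        using \<pi>_ball[OF \<open>x \<in> T\<close> that] that R by (intro inS) (auto simp: dist_norm)
    qed (auto simp: \<pi>_def intro!: holomorphic_intros)
    have anR: "f analytic_on {0}" if "f holomorphic_on ball 0 R" for f :: "complex \<Rightarrow> complex"
      unfolding analytic_at using that R by (intro exI[of _ "ball 0 R"]) auto
    have eq: "taylor_coeff j (\<lambda>l. F (c + l) (\<gamma> x l)) = taylor_coeff j (\<lambda>l. F (c + l) (\<pi> x l))" if x: "x \<in> T" for x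
    proof -
      have axS: "(c, x) \<in> S" using T x r by (intro inS) auto
      have an\<pi>: "\<pi> x analytic_on {0}" unfolding \<pi>_def by (intro analytic_intros)
      have anF\<gamma>: "(\<lambda>l. F (c + l) (\<gamma> x l)) analytic_on {0}"
      proof -
        obtain e where e: "e > 0" "\<gamma> x holomorphic_on ball 0 e" using an[OF x] by (auto simp: analytic_on_def)
        have "continuous_on (ball 0 e) (\<lambda>l. (c + l, \<gamma> x l))"
          by (intro continuous_intros holomorphic_on_imp_continuous_on e)
        then have "open (ball 0 e \<inter> (\<lambda>l. (c + l, \<gamma> x l)) -` S)" using S by (intro continuous_open_preimage) auto
        moreover have "0 \<in> ball 0 e \<inter> (\<lambda>l. (c + l, \<gamma> x l)) -` S" using e axS \<gamma>0[OF x] by simp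
        ultimately show ?thesis unfolding analytic_at
          by (intro exI[of _ "ball 0 e \<inter> (\<lambda>l. (c + l, \<gamma> x l)) -` S"] conjI holomorphic2_on_holomorphic_compose[OF F S])
             (auto intro!: holomorphic_intros holomorphic_on_subset[OF e(2)])
      qed
      have "((\<lambda>l. (F (c + l) (\<gamma> x l) - F (c + l) (\<pi> x l)) / l ^ j) \<longlongrightarrow> deriv (\<lambda>w. F w x) c * 0 + deriv (F c) x * 0) (at 0)"
      proof (rule holomorphic2_on_strict_tendsto[OF F S axS])
        show "((\<lambda>l. c + l) \<longlongrightarrow> c) (at 0)" "((\<lambda>l. c + l) \<longlongrightarrow> c) (at 0)" by (auto intro!: tendsto_eq_intros)
        show "(\<pi> x \<longlongrightarrow> x) (at 0)" using analytic_at_imp_isCont[OF an\<pi>] \<pi>0[OF x] by (simp add: isCont_def)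
        show "(\<gamma> x \<longlongrightarrow> x) (at 0)" using analytic_at_imp_isCont[OF an[OF x]] \<gamma>0[OF x] by (simp add: isCont_def)
        show "((\<lambda>l. (\<gamma> x l - \<pi> x l) / l ^ j) \<longlongrightarrow> 0) (at 0)"
          using j by (subst taylor_coeff_diff_tendsto_iff[OF an[OF x] an\<pi>]) (auto simp: \<pi>_def taylor_coeff_polynomial)
      qed auto
      then show ?thesis
        by (subst (asm) taylor_coeff_diff_tendsto_iff[OF anF\<gamma> anR[OF hF[OF x]]]) simp
    qed
    have LL: "LL \<ge> 0" unfolding LL_def by (intro sum_nonneg) (use Lj in auto)
    have "(B * LL / (R / 2) ^ j)-lipschitz_on T (\<lambda>x. taylor_coeff j (\<lambda>l. F (c + l) (\<gamma> x l)))"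
    proof (rule lipschitz_onI)
      fix x y assume xy: "x \<in> T" "y \<in> T"
      have "norm (taylor_coeff j (\<lambda>l. F (c + l) (\<pi> x l) - F (c + l) (\<pi> y l))) \<le> (B * (LL * norm (x - y))) / (R / 2) ^ j"
      proof (rule norm_taylor_coeff_le)
        show "(\<lambda>l. F (c + l) (\<pi> x l) - F (c + l) (\<pi> y l)) holomorphic_on ball 0 R"
          by (intro holomorphic_intros hF xy)
        fix l :: complex assume "norm l \<le> R / 2"
        then have l: "l \<in> ball 0 R" using R by simp
        have "norm (F (c + l) (\<pi> x l) - F (c + l) (\<pi> y l)) \<le> B * norm (\<pi> x l - \<pi> y l)"
          using \<pi>_ball xy l R by (intro Flip) (auto simp: dist_norm)
        also have "\<dots> \<le> B * (LL * norm (x - y))" using \<pi>_lip[OF xy l] B0 by (intro mult_left_mono)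
        finally show "norm (F (c + l) (\<pi> x l) - F (c + l) (\<pi> y l)) \<le> B * (LL * norm (x - y))" .
      qed (use R in auto)
      then show "dist (taylor_coeff j (\<lambda>l. F (c + l) (\<gamma> x l))) (taylor_coeff j (\<lambda>l. F (c + l) (\<gamma> y l))) \<le> B * LL / (R / 2) ^ j * dist x y"
        unfolding eq[OF xy(1)] eq[OF xy(2)] dist_norm
        by (subst (asm) taylor_coeff_diff[OF anR[OF hF[OF xy(1)]] anR[OF hF[OF xy(2)]]]) (simp add: mult_ac)
    qed (use B0 LL R in simp)
    then show "\<exists>L. L-lipschitz_on T (\<lambda>x. taylor_coeff j (\<lambda>l. F (c + l) (\<gamma> x l)))" by blast
  qed
qed

text \<open>Two points on different branches of the orbit, seen from the fixed point under angles that
  differ by an argument of \<open>\<kappa> ^ i / \<kappa> ^ i'\<close>, are as far apart as they are from the fixed point.\<close>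

lemma branches_separated:
  fixes x :: "nat \<Rightarrow> complex" and y :: "nat \<Rightarrow> nat \<Rightarrow> complex" and p :: nat
  assumes nz: "\<And>n. x n \<noteq> 0" and mono: "\<And>n k. n \<le> k \<Longrightarrow> norm (x k) \<le> norm (x n)" and orb: "\<exists>C. \<forall>\<^sub>F n in sequentially. \<forall>k\<ge>n. norm (x k - x n) \<le> C * (norm (x n) - norm (x k))"
    and y: "\<And>i. i < p \<Longrightarrow> (\<lambda>n. y i n / x n) \<longlonglongrightarrow> \<kappa> ^ i" and \<kappa>: "norm \<kappa> = 1"
    and ne: "\<And>i j. i < p \<Longrightarrow> j < p \<Longrightarrow> i \<noteq> j \<Longrightarrow> \<kappa> ^ i \<noteq> \<kappa> ^ j"
  shows "\<exists>c>0. \<exists>N. \<forall>n\<ge>N. \<forall>k\<ge>N. \<forall>i<p. \<forall>j<p. i \<noteq> j \<longrightarrow> c * (norm (x n) + norm (x k)) \<le> norm (y i n - y j k)"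
proof -
  obtain C0 where C0: "\<forall>\<^sub>F n in sequentially. \<forall>k\<ge>n. norm (x k - x n) \<le> C0 * (norm (x n) - norm (x k))"
    using orb by blast
  \<comment> \<open>The inserted 1 keeps the minimum meaningful for \<open>p = 1\<close>, when there
    are no pairs of distinct branches.\<close>
  define \<sigma> where "\<sigma> = Min (insert 1 ((\<lambda>(i, j). norm (\<kappa> ^ i - \<kappa> ^ j)) ` {(i, j). i < p \<and> j < p \<and> i \<noteq> j}))"
  have fin: "finite {(i, j). i < p \<and> j < p \<and> i \<noteq> j}" by (rule finite_subset[of _ "{..<p} \<times> {..<p}"]) auto
  have \<sigma>: "\<sigma> > 0" unfolding \<sigma>_def using fin ne by (subst Min_gr_iff) auto
  have \<sigma>_le: "\<sigma> \<le> norm (\<kappa> ^ i - \<kappa> ^ j)" if "i < p" "j < p" "i \<noteq> j" for i j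
    unfolding \<sigma>_def using fin that by (intro Min_le) auto
  define C where "C = \<bar>C0\<bar>"
  have C: "C \<ge> 0" by (simp add: C_def)
  \<comment> \<open>Chosen so that \<open>Z\<close> below is at least
    \<open>4 * \<epsilon> * norm (x n)\<close>: up to two parts are lost by replacing the branches
    by rotated copies of the main one, and two remain.\<close>
  define \<epsilon> where "\<epsilon> = \<sigma> / (4 * (C + 1))"
  have \<epsilon>: "\<epsilon> > 0" using \<sigma> C by (simp add: \<epsilon>_def)
  have "\<forall>\<^sub>F n in sequentially. \<forall>i\<in>{..<p}. dist (y i n / x n) (\<kappa> ^ i) < \<epsilon>"
    by (intro eventually_ball_finite ballI) (use tendstoD[OF y \<epsilon>] in auto)
  with C0 have "\<forall>\<^sub>F n in sequentially. (\<forall>i\<in>{..<p}. dist (y i n / x n) (\<kappa> ^ i) < \<epsilon>) \<and>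
     (\<forall>k\<ge>n. norm (x k - x n) \<le> C0 * (norm (x n) - norm (x k)))" by eventually_elim simp
  then obtain N where N: "\<And>n i. n \<ge> N \<Longrightarrow> i < p \<Longrightarrow> dist (y i n / x n) (\<kappa> ^ i) < \<epsilon>"
     "\<And>n k. n \<ge> N \<Longrightarrow> k \<ge> n \<Longrightarrow> norm (x k - x n) \<le> C0 * (norm (x n) - norm (x k))"
    unfolding eventually_sequentially by (metis lessThan_iff)
  have near: "norm (y i n - \<kappa> ^ i * x n) \<le> \<epsilon> * norm (x n)" if "n \<ge> N" "i < p" for i n
  proof -
    have "y i n - \<kappa> ^ i * x n = (y i n / x n - \<kappa> ^ i) * x n" using nz by (simp add: field_simps)
    then have "norm (y i n - \<kappa> ^ i * x n) = dist (y i n / x n) (\<kappa> ^ i) * norm (x n)" by (simp add: norm_mult dist_norm)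
    also have "\<dots> \<le> \<epsilon> * norm (x n)" using N(1)[OF that] by (intro mult_right_mono) auto
    finally show ?thesis .
  qed
  have main: "\<epsilon> * (norm (x n) + norm (x k)) \<le> norm (y i n - y j k)"
    if n: "n \<ge> N" and k: "k \<ge> n" and ij: "i < p" "j < p" "i \<noteq> j" for n k i j
  proof -
    define D where "D = norm (x n) - norm (x k)"
    have xkn: "norm (x k - x n) \<le> C0 * D" using N(2)[OF n k] by (simp add: D_def)
    have D: "D \<ge> 0" using mono[OF k] by (simp add: D_def)
    have xkn': "norm (x k - x n) \<le> C * D"
      using xkn mult_right_mono[OF abs_ge_self[of C0] D] by (simp add: C_def)
    define Z where "Z = norm (\<kappa> ^ i * x n - \<kappa> ^ j * x k)"
    have nk: "norm (\<kappa> ^ i) = 1" for i using \<kappa> by (simp add: norm_power)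
    have Z1: "D \<le> Z" using norm_triangle_ineq2[of "\<kappa> ^ i * x n" "\<kappa> ^ j * x k"] by (simp add: Z_def D_def norm_mult nk)
    have Z2: "\<sigma> * norm (x n) - C * D \<le> Z"
    proof -
      have "\<sigma> * norm (x n) \<le> norm ((\<kappa> ^ i - \<kappa> ^ j) * x n)"
        unfolding norm_mult using \<sigma>_le[OF ij] by (intro mult_right_mono) auto
      also have "(\<kappa> ^ i - \<kappa> ^ j) * x n = (\<kappa> ^ i * x n - \<kappa> ^ j * x k) + \<kappa> ^ j * (x k - x n)" by (simp add: algebra_simps)
      also have "norm \<dots> \<le> Z + norm (x k - x n)"
        unfolding Z_def by (rule norm_triangle_mono) (auto simp: norm_mult nk)
      finally show ?thesis using xkn' by linarith
    qed
    \<comment> \<open>If the moduli differ much, \<open>Z\<close> is large by \<open>Z1\<close>; if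
      they differ little, the two points of the main branch are close by \<open>orb\<close>, and the
      angle keeps the rotated copies apart by \<open>Z2\<close>. The factor \<open>C + 1\<close>
      combines the two cases.\<close>
    have "C * D \<le> C * Z" using Z1 C by (intro mult_left_mono)
    with Z2 have "\<sigma> * norm (x n) \<le> (C + 1) * Z" by (simp add: algebra_simps)
    then have Z: "4 * \<epsilon> * norm (x n) \<le> Z" using C by (simp add: \<epsilon>_def field_simps)
    have xk: "norm (x k) \<le> norm (x n)" using D by (simp add: D_def)
    have "Z \<le> norm (y i n - y j k) + norm (y i n - \<kappa> ^ i * x n) + norm (y j k - \<kappa> ^ j * x k)"
      unfolding Z_def by norm
    also have "\<dots> \<le> norm (y i n - y j k) + \<epsilon> * norm (x n) + \<epsilon> * norm (x k)"
      using near[OF n ij(1)] near[of k j] n k ij by auto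
    finally have "4 * \<epsilon> * norm (x n) \<le> norm (y i n - y j k) + \<epsilon> * norm (x n) + \<epsilon> * norm (x k)" using Z by linarith
    moreover have "\<epsilon> * norm (x k) \<le> \<epsilon> * norm (x n)" using xk \<epsilon> by (intro mult_left_mono) auto
    moreover have "\<epsilon> * norm (x n) \<ge> 0" using \<epsilon> by simp
    ultimately have "2 * (\<epsilon> * norm (x n)) \<le> norm (y i n - y j k)" by (simp add: mult.assoc)
    with \<open>\<epsilon> * norm (x k) \<le> \<epsilon> * norm (x n)\<close> show ?thesis by (simp add: distrib_left)
  qed
  have "\<epsilon> * (norm (x n) + norm (x k)) \<le> norm (y i n - y j k)"
    if "n \<ge> N" "k \<ge> N" "i < p" "j < p" "i \<noteq> j" for n k i j
    using main[of n k i j] main[of k n j i] that by (cases "n \<le> k") (auto simp: norm_minus_commute add.commute)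
  then show ?thesis using \<epsilon> by blast
qed

section \<open>Koenigs linearisation depending on a parameter\<close>

text \<open>Since the multiplier is the same for all parameters, the classical limit of rescaled
  iterates converges uniformly in the parameter too. The inverse \<open>\<Psi>\<close> is the more
  useful map afterwards, as it parametrises the dynamics by multiplication with
  \<open>\<kappa>\<close>.\<close>

lemma koenigs_family:
  fixes \<Phi> :: "complex \<Rightarrow> complex \<Rightarrow> complex"
  assumes \<Phi>: "holomorphic2_on \<Phi> (ball 0 \<rho> \<times> ball 0 \<delta>)" and pos: "\<rho> > 0" "\<delta> > 0"
    and \<Phi>0: "\<And>l. l \<in> ball 0 \<rho> \<Longrightarrow> \<Phi> l 0 = 0" and d\<Phi>: "\<And>l. l \<in> ball 0 \<rho> \<Longrightarrow> deriv (\<Phi> l) 0 = \<kappa>"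
    and \<kappa>: "0 < norm \<kappa>" "norm \<kappa> < 1"
  obtains r d \<Psi> \<eta> where "r > 0" "d > 0" "r \<le> \<rho>" "holomorphic2_on \<Psi> (ball 0 r \<times> ball 0 r)" "holomorphic2_on \<eta> (ball 0 d \<times> ball 0 d)"
    "\<And>l t. l \<in> ball 0 r \<Longrightarrow> t \<in> ball 0 r \<Longrightarrow> \<Psi> l t \<in> ball 0 \<delta> \<and> \<Phi> l (\<Psi> l t) = \<Psi> l (\<kappa> * t)"
    "\<And>l. l \<in> ball 0 r \<Longrightarrow> \<Psi> l 0 = 0" "deriv (\<Psi> 0) 0 \<noteq> 0"
    "\<And>l z. l \<in> ball 0 d \<Longrightarrow> z \<in> ball 0 d \<Longrightarrow> l \<in> ball 0 r \<and> \<eta> l z \<in> ball 0 r \<and> \<Psi> l (\<eta> l z) = z"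
proof -
  obtain \<rho>1 \<delta>1 where 1: "\<rho>1 > 0" "\<delta>1 > 0" "\<rho>1 \<le> \<rho>" "\<delta>1 \<le> \<delta>"
    "\<And>l u. l \<in> ball 0 \<rho>1 \<Longrightarrow> u \<in> ball 0 \<delta>1 \<Longrightarrow> \<Phi> l u \<in> ball 0 \<delta>"
  proof -
    have "\<Phi> 0 0 = 0" using \<Phi>0[of 0] pos by simp
    from holomorphic2_on_iterates[OF \<Phi> pos this, of 1] obtain \<rho>1 \<delta>1 where ab: "\<rho>1 > 0" "\<delta>1 > 0" "\<rho>1 \<le> \<rho>" "\<delta>1 \<le> \<delta>"
      and *: "\<forall>i\<le>1. holomorphic2_on (\<lambda>l u. (\<Phi> l ^^ i) u) (ball 0 \<rho>1 \<times> ball 0 \<delta>1) \<and>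
       (\<forall>l\<in>ball 0 \<rho>1. \<forall>u\<in>ball 0 \<delta>1. (\<Phi> l ^^ i) u \<in> ball 0 \<delta>)" by (elim exE conjE) (rule that; assumption)
    have step: "\<Phi> l u \<in> ball 0 \<delta>" if "l \<in> ball 0 \<rho>1" "u \<in> ball 0 \<delta>1" for l u
      using *[rule_format, of 1] that by auto
    show thesis by (rule that[OF ab step])
  qed
  have dom: "open (ball (0::complex) \<rho> \<times> ball (0::complex) \<delta>)" by (simp add: open_Times)
  define C where "C = 2 * (\<delta> + norm \<kappa> * \<delta>1) * (4 / \<delta>1) ^ 2"
  have C0: "C \<ge> 0" using pos 1 by (simp add: C_def)
  have quad: "norm (\<Phi> l u - \<kappa> * u) \<le> C * norm u ^ 2" if l: "l \<in> ball 0 \<rho>1" and u: "u \<in> ball 0 \<delta>1" for l u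
  proof -
    have l\<rho>: "l \<in> ball 0 \<rho>" using l 1 by auto
    have hol: "\<Phi> l holomorphic_on ball 0 \<delta>1"
      by (rule holomorphic2_on_holomorphic_compose[OF \<Phi> dom, of _ "\<lambda>_. l" "\<lambda>u. u"]) (use l\<rho> 1 in \<open>auto intro: holomorphic_intros\<close>)
    have "norm (\<Phi> l u - \<kappa> * u) \<le> 2 * (\<delta> + norm \<kappa> * \<delta>1) * (4 * norm u / \<delta>1) ^ 2"
    proof (rule zero_order_bound[OF _ 1(2) _ _ u])
      show "(\<lambda>u. \<Phi> l u - \<kappa> * u) holomorphic_on ball 0 \<delta>1" by (intro holomorphic_intros hol)
      show "norm (\<Phi> l u - \<kappa> * u) \<le> \<delta> + norm \<kappa> * \<delta>1" if "u \<in> ball 0 \<delta>1" for u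
      proof -
        have "norm (\<kappa> * u) \<le> norm \<kappa> * \<delta>1" unfolding norm_mult using that by (intro mult_left_mono) auto
        then show ?thesis using 1(5)[OF l that] norm_triangle_ineq4[of "\<Phi> l u" "\<kappa> * u"] by auto
      qed
      have "(\<Phi> l has_field_derivative \<kappa>) (at 0)"
        using holomorphic_derivI[OF hol, of 0] 1 d\<Phi>[OF l\<rho>] by auto
      then have "((\<lambda>u. \<Phi> l u - \<kappa> * u) has_field_derivative 0) (at 0)"
        by (auto intro!: derivative_eq_intros)
      then have "deriv (\<lambda>u. \<Phi> l u - \<kappa> * u) 0 = 0" by (rule DERIV_imp_deriv)
      then show "taylor_coeff k (\<lambda>u. \<Phi> l u - \<kappa> * u) = 0" if "k < 2" for k
        using that \<Phi>0[OF l\<rho>] by (auto simp: less_2_cases_iff taylor_coeff_1)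
    qed
    also have "\<dots> = C * norm u ^ 2" by (simp add: C_def power_mult_distrib power_divide)
    finally show ?thesis .
  qed
  \<comment> \<open>The iterates contract by \<open>\<theta>\<close> and the nonlinear error is
    quadratic, so the telescoping series has ratio \<open>q\<close>, which is
    \<open>\<theta> ^ 2 / norm \<kappa>\<close>; a \<open>\<theta>\<close> between
    \<open>norm \<kappa>\<close> and its square root makes this less than 1.\<close>
  have "norm \<kappa> < sqrt (norm \<kappa>)"
    using \<kappa> by (simp add: real_less_rsqrt power2_eq_square)
  then obtain \<theta> where \<theta>: "norm \<kappa> < \<theta>" "\<theta> < sqrt (norm \<kappa>)" using dense by blast
  have "norm \<kappa> \<ge> 0" by simp
  then have "0 \<le> \<theta>" using \<theta>(1) by linarith
  then have "\<theta> ^ 2 < sqrt (norm \<kappa>) ^ 2" using \<theta>(2) by (intro power_strict_mono) auto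
  then have \<theta>2: "\<theta> ^ 2 < norm \<kappa>" by simp
  have "sqrt (norm \<kappa>) < 1" using \<kappa>(2) by simp
  then have \<theta>1: "\<theta> < 1" using \<theta>(2) by linarith
  define \<delta>2 where "\<delta>2 = min \<delta>1 ((\<theta> - norm \<kappa>) / (C + 1))"
  have \<delta>2: "\<delta>2 > 0" "\<delta>2 \<le> \<delta>1" "C * \<delta>2 \<le> \<theta> - norm \<kappa>"
  proof -
    show "\<delta>2 > 0" "\<delta>2 \<le> \<delta>1" using 1 \<theta> C0 by (auto simp: \<delta>2_def)
    have "C * \<delta>2 \<le> (C + 1) * \<delta>2" using \<open>\<delta>2 > 0\<close> by simp
    also have "\<dots> \<le> (C + 1) * ((\<theta> - norm \<kappa>) / (C + 1))" using C0 by (intro mult_left_mono) (auto simp: \<delta>2_def)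
    also have "\<dots> = \<theta> - norm \<kappa>" using C0 by simp
    finally show "C * \<delta>2 \<le> \<theta> - norm \<kappa>" .
  qed
  have contr: "norm (\<Phi> l u) \<le> \<theta> * norm u" if l: "l \<in> ball 0 \<rho>1" and u: "u \<in> ball 0 \<delta>2" for l u
  proof -
    have "norm (\<Phi> l u) \<le> norm (\<kappa> * u) + norm (\<Phi> l u - \<kappa> * u)" by norm
    also have "\<dots> \<le> norm \<kappa> * norm u + C * norm u ^ 2" using quad[OF l, of u] u \<delta>2 by (auto simp: norm_mult)
    also have "C * norm u ^ 2 \<le> (\<theta> - norm \<kappa>) * norm u"
    proof -
      have "C * norm u \<le> C * \<delta>2" using u C0 by (intro mult_left_mono) auto
      then have "C * norm u \<le> \<theta> - norm \<kappa>" using \<delta>2 by linarith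
      then have "C * norm u * norm u \<le> (\<theta> - norm \<kappa>) * norm u" by (intro mult_right_mono) auto
      then show ?thesis by (simp add: power2_eq_square mult.assoc)
    qed
    finally show ?thesis by (simp add: algebra_simps)
  qed
  have \<theta>0: "\<theta> > 0" using \<theta> \<kappa> by linarith
  have iter: "norm ((\<Phi> l ^^ n) u) \<le> \<theta> ^ n * norm u" "(\<Phi> l ^^ n) u \<in> ball 0 \<delta>2" if l: "l \<in> ball 0 \<rho>1" and u: "u \<in> ball 0 \<delta>2" for l u n
  proof (induction n)
    case (Suc n)
    { case 1
      have "norm ((\<Phi> l ^^ Suc n) u) \<le> \<theta> * norm ((\<Phi> l ^^ n) u)" using contr[OF l Suc(2)] by simp
      also have "\<dots> \<le> \<theta> * (\<theta> ^ n * norm u)" using Suc(1) \<theta>0 by (intro mult_left_mono) auto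
      finally show ?case by simp }
    note * = this
    { case 2
      have "\<theta> ^ Suc n * norm u \<le> 1 * norm u" using \<theta>0 \<theta>1 by (intro mult_right_mono power_le_one) auto
      then show ?case using * u by auto }
  qed (use u in auto)
  define S where "S = ball (0::complex) \<rho>1 \<times> ball (0::complex) \<delta>2"
  have oS: "open S" by (simp add: S_def open_Times)
  have sub: "S \<subseteq> ball 0 \<rho> \<times> ball 0 \<delta>" using 1 \<delta>2 by (auto simp: S_def)
  have fst: "holomorphic2_on (\<lambda>l u. l) S" by (rule holomorphic2_on_fst_only[OF oS, of "\<lambda>u. u" UNIV]) auto
  have hit: "holomorphic2_on (\<lambda>l u. (\<Phi> l ^^ n) u) S" for n
  proof (induction n)
    case 0
    show ?case using holomorphic2_on_snd_only[OF oS, of "\<lambda>u. u" UNIV] by auto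
  next
    case (Suc n)
    have "holomorphic2_on (\<lambda>l u. \<Phi> l ((\<Phi> l ^^ n) u)) S"
      by (rule holomorphic2_on_compose[OF holomorphic2_on_subset[OF \<Phi> sub] oS oS fst Suc])
         (use iter(2) in \<open>auto simp: S_def\<close>)
    then show ?case by simp
  qed
  define \<eta>n where "\<eta>n = (\<lambda>n l u. (\<Phi> l ^^ n) u / \<kappa> ^ n)"
  have h\<eta>n: "holomorphic2_on (\<eta>n n) S" for n
  proof -
    have "holomorphic2_on (\<lambda>l u. (\<Phi> l ^^ n) u * inverse (\<kappa> ^ n)) S"
      by (intro holomorphic2_on_mult oS hit holomorphic2_on_fst_only[OF oS, of "\<lambda>_. inverse (\<kappa> ^ n)" UNIV]) auto
    then show ?thesis by (simp add: \<eta>n_def divide_inverse)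
  qed
  have \<kappa>0: "\<kappa> \<noteq> 0" using \<kappa> by auto
  define q where "q = \<theta> ^ 2 / norm \<kappa>"
  have q: "0 \<le> q" "q < 1" using \<theta>2 \<kappa> by (auto simp: q_def)
  have inc: "norm (\<eta>n (Suc n) l u - \<eta>n n l u) \<le> C / norm \<kappa> * norm u ^ 2 * q ^ n" if "(l, u) \<in> S" for n l u
  proof -
    have l: "l \<in> ball 0 \<rho>1" and u: "u \<in> ball 0 \<delta>2" using that by (auto simp: S_def)
    define v where "v = (\<Phi> l ^^ n) u"
    have "\<eta>n (Suc n) l u - \<eta>n n l u = (\<Phi> l v - \<kappa> * v) / \<kappa> ^ Suc n"
      using \<kappa>0 by (simp add: \<eta>n_def v_def field_simps)
    then have "norm (\<eta>n (Suc n) l u - \<eta>n n l u) = norm (\<Phi> l v - \<kappa> * v) / norm \<kappa> ^ Suc n" by (simp add: norm_divide norm_mult norm_power)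
    also have "\<dots> \<le> (C * norm v ^ 2) / norm \<kappa> ^ Suc n"
      using iter(2)[OF l u, of n] \<delta>2 by (intro divide_right_mono quad[OF l]) (auto simp: v_def)
    also have "\<dots> \<le> (C * (\<theta> ^ n * norm u) ^ 2) / norm \<kappa> ^ Suc n"
      using iter(1)[OF l u, of n] C0 by (intro divide_right_mono mult_left_mono power_mono) (auto simp: v_def)
    also have "\<dots> = C / norm \<kappa> * norm u ^ 2 * q ^ n"
      by (simp add: q_def power_divide power_mult_distrib power2_eq_square)
    finally show ?thesis .
  qed
  define \<Sigma> where "\<Sigma> = (\<lambda>l u. \<Sum>n. \<eta>n (Suc n) l u - \<eta>n n l u)"
  define \<eta> where "\<eta> = (\<lambda>l u. u + \<Sigma> l u)"
  have sums: "(\<Sum>i<n. \<eta>n (Suc i) l u - \<eta>n i l u) = \<eta>n n l u - u" for n l u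
    by (subst sum_lessThan_telescope) (simp add: \<eta>n_def)
  have summ: "summable (\<lambda>n. C / norm \<kappa> * K * q ^ n)" for K using q by (intro summable_mult summable_geometric) auto
  have "uniform_limit S (\<lambda>n p. \<Sum>i<n. \<eta>n (Suc i) (fst p) (snd p) - \<eta>n i (fst p) (snd p)) (\<lambda>p. \<Sum>i. \<eta>n (Suc i) (fst p) (snd p) - \<eta>n i (fst p) (snd p)) sequentially"
  proof (rule Weierstrass_m_test[OF _ summ[of "\<delta>2 ^ 2"]])
    fix n p assume p: "p \<in> S"
    have "norm (\<eta>n (Suc n) (fst p) (snd p) - \<eta>n n (fst p) (snd p)) \<le> C / norm \<kappa> * norm (snd p) ^ 2 * q ^ n"
      using inc[of "fst p" "snd p"] p by simp
    also have "\<dots> \<le> C / norm \<kappa> * \<delta>2 ^ 2 * q ^ n"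
      using p q C0 \<kappa> by (intro mult_right_mono mult_left_mono power_mono) (auto simp: S_def)
    finally show "norm (\<eta>n (Suc n) (fst p) (snd p) - \<eta>n n (fst p) (snd p)) \<le> C / norm \<kappa> * \<delta>2 ^ 2 * q ^ n" .
  qed
  then have "uniform_limit S (\<lambda>n p. \<eta>n n (fst p) (snd p) - snd p) (\<lambda>p. \<Sigma> (fst p) (snd p)) sequentially"
    by (simp only: sums \<Sigma>_def)
  from uniform_limit_add[OF uniform_limit_const[where S=S and c=snd and f=sequentially] this]
  have ul: "uniform_limit S (\<lambda>n (l, u). \<eta>n n l u) (\<lambda>(l, u). \<eta> l u) sequentially"
    by (simp add: \<eta>_def case_prod_unfold)
  have h\<eta>: "holomorphic2_on \<eta> S" by (rule holomorphic2_on_uniform_limit[OF oS h\<eta>n ul])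
  have lim: "(\<lambda>n. \<eta>n n l u) \<longlonglongrightarrow> \<eta> l u" if "(l, u) \<in> S" for l u
    using tendsto_uniform_limitI[OF ul that] by simp
  have fix0: "(\<Phi> l ^^ n) 0 = 0" if "l \<in> ball 0 \<rho>1" for l n using \<Phi>0[of l] that 1 by (induction n) auto
  have \<eta>0: "\<eta> l 0 = 0" if "l \<in> ball 0 \<rho>1" for l using fix0[OF that] by (simp add: \<eta>_def \<Sigma>_def \<eta>n_def del: funpow.simps)
  have conj: "\<eta> l (\<Phi> l u) = \<kappa> * \<eta> l u" if "(l, u) \<in> S" for l u
  proof -
    have l: "l \<in> ball 0 \<rho>1" and u: "u \<in> ball 0 \<delta>2" using that by (auto simp: S_def)
    have "(l, \<Phi> l u) \<in> S" using iter(2)[OF l u, of 1] l by (simp add: S_def)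
    from lim[OF this] have "(\<lambda>n. \<eta>n n l (\<Phi> l u)) \<longlonglongrightarrow> \<eta> l (\<Phi> l u)" .
    moreover have "\<eta>n n l (\<Phi> l u) = \<kappa> * \<eta>n (Suc n) l u" for n using \<kappa>0 by (simp add: \<eta>n_def funpow_swap1)
    moreover have "(\<lambda>n. \<kappa> * \<eta>n (Suc n) l u) \<longlonglongrightarrow> \<kappa> * \<eta> l u"
      by (intro tendsto_intros LIMSEQ_Suc lim that)
    ultimately show ?thesis using LIMSEQ_unique by simp
  qed
  have \<eta>_quad: "norm (\<eta> l u - u) \<le> C / norm \<kappa> / (1 - q) * norm u ^ 2" if "(l, u) \<in> S" for l u
  proof -
    have "norm (\<Sigma> l u) \<le> (\<Sum>n. C / norm \<kappa> * norm u ^ 2 * q ^ n)"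
      unfolding \<Sigma>_def by (rule norm_suminf_le[OF inc[OF that] summ])
    also have "\<dots> = C / norm \<kappa> * norm u ^ 2 * (1 / (1 - q))"
      by (subst suminf_mult) (use q in \<open>auto simp: suminf_geometric intro: summable_geometric\<close>)
    finally show ?thesis by (simp add: \<eta>_def mult_ac)
  qed
  have d\<eta>: "(\<eta> 0 has_field_derivative 1) (at 0)"
  proof -
    have "((\<lambda>u. (\<eta> 0 u - u) / u) \<longlongrightarrow> 0) (at 0)"
    proof (rule Lim_null_comparison)
      have "\<forall>\<^sub>F u in at 0. u \<in> ball 0 \<delta>2" "\<forall>\<^sub>F u in at 0. u \<noteq> (0::complex)"
        using \<delta>2 by (intro eventually_at_in_open') (auto simp: eventually_at_filter)
      then show "\<forall>\<^sub>F u in at 0. norm ((\<eta> 0 u - u) / u) \<le> C / norm \<kappa> / (1 - q) * norm u"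
      proof eventually_elim
        case (elim u)
        then show ?case using \<eta>_quad[of 0 u] 1 by (simp add: S_def norm_divide power2_eq_square divide_le_eq mult.assoc)
      qed
      have "((\<lambda>u::complex. C / norm \<kappa> / (1 - q) * norm u) \<longlongrightarrow> C / norm \<kappa> / (1 - q) * norm (0::complex)) (at 0)" by (intro tendsto_intros)
      then show "((\<lambda>u::complex. C / norm \<kappa> / (1 - q) * norm u) \<longlongrightarrow> 0) (at 0)" by simp
    qed
    then have "((\<lambda>u. (\<eta> 0 u - u) / u + 1) \<longlongrightarrow> 0 + 1) (at 0)" by (intro tendsto_intros)
    then have "((\<lambda>u. \<eta> 0 u / u) \<longlongrightarrow> 1) (at 0)"
      by (rule Lim_transform_eventually[OF tendsto_eq_rhs]) (auto simp: eventually_at_filter field_simps)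
    then show ?thesis using \<eta>0[of 0] 1 by (simp add: has_field_derivative_iff)
  qed
  have mem0: "(0, 0) \<in> S" using 1 \<delta>2 by (simp add: S_def)
  have \<eta>00: "\<eta> 0 0 = 0" using \<eta>0[of 0] 1 by simp
  have nz\<eta>: "deriv (\<eta> 0) 0 \<noteq> 0" using DERIV_imp_deriv[OF d\<eta>] by simp
  obtain \<Psi> r1 d1 where \<Psi>: "r1 > 0" "d1 > 0" "holomorphic2_on \<Psi> (ball 0 r1 \<times> ball 0 r1)"
    "\<And>w t. w \<in> ball 0 r1 \<Longrightarrow> t \<in> ball 0 r1 \<Longrightarrow> (w, \<Psi> w t) \<in> S \<and> \<eta> w (\<Psi> w t) = t"
    "\<And>w z. w \<in> ball 0 d1 \<Longrightarrow> z \<in> ball 0 d1 \<Longrightarrow> w \<in> ball 0 r1 \<and> \<eta> w z \<in> ball 0 r1 \<and> \<Psi> w (\<eta> w z) = z"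
  proof (rule holomorphic2_on_local_inverse[OF h\<eta> oS mem0 nz\<eta>, unfolded \<eta>00], goal_cases)
    case (1 \<Psi> r d)
    show ?case by (rule 1(1)[OF 1(2-6)])
  qed
  define S1 where "S1 = ball (0::complex) r1 \<times> ball (0::complex) r1"
  have oS1: "open S1" by (simp add: S1_def open_Times)
  have c\<Psi>: "continuous_on S1 (\<lambda>p. \<Psi> (fst p) (snd p))"
    using holomorphic2_on_imp_continuous_on[OF \<Psi>(3)] by (simp add: S1_def case_prod_unfold)
  have "continuous_on S (\<lambda>p. \<Phi> (fst p) (snd p))"
    using holomorphic2_on_imp_continuous_on[OF holomorphic2_on_subset[OF \<Phi> sub]] by (simp add: case_prod_unfold)
  moreover have "continuous_on S1 (\<lambda>p. (fst p, \<Psi> (fst p) (snd p)))" by (intro continuous_intros c\<Psi>)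
  moreover have "(\<lambda>p. (fst p, \<Psi> (fst p) (snd p))) ` S1 \<subseteq> S" using \<Psi>(4) by (auto simp: S1_def)
  ultimately have c2: "continuous_on S1 (\<lambda>p. \<Phi> (fst p) (\<Psi> (fst p) (snd p)))"
    using continuous_on_compose2[of S "\<lambda>p. \<Phi> (fst p) (snd p)" S1 "\<lambda>p. (fst p, \<Psi> (fst p) (snd p))"] by simp
  have \<Psi>0: "\<Psi> l 0 = 0" if "l \<in> ball 0 (min r1 (min d1 \<rho>1))" for l
    using \<Psi>(5)[of l 0] \<eta>0[of l] that \<Psi>(2) by auto
  \<comment> \<open>To pass from \<open>conj\<close> to the equation for \<open>\<Psi>\<close>, the
    point \<open>\<Phi> l (\<Psi> l t)\<close> must lie where \<open>\<Psi> l\<close> inverts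
    \<open>\<eta> l\<close>. The radius \<open>r2\<close> ensures this.\<close>
  have oT: "open (S1 \<inter> (\<lambda>p. \<Phi> (fst p) (\<Psi> (fst p) (snd p))) -` ball 0 d1)"
    by (rule continuous_open_preimage[OF c2 oS1 open_ball])
  have mT: "(0, 0) \<in> S1 \<inter> (\<lambda>p. \<Phi> (fst p) (\<Psi> (fst p) (snd p))) -` ball 0 d1"
    using \<Psi>(1,2) \<Psi>0[of 0] \<Phi>0[of 0] pos 1 by (simp add: S1_def)
  obtain r2 where r2: "r2 > 0" "cball 0 r2 \<times> cball 0 r2 \<subseteq> S1 \<inter> (\<lambda>p. \<Phi> (fst p) (\<Psi> (fst p) (snd p))) -` ball 0 d1"
    by (rule open_Times_cball_subset[OF oT mT])
  define r where "r = Min {r1, r2, d1, \<rho>1}"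
  have r: "r > 0" "r \<le> r1" "r \<le> r2" "r \<le> d1" "r \<le> \<rho>1" using \<Psi> r2 1 by (auto simp: r_def)
  have c\<eta>: "continuous_on S (\<lambda>p. \<eta> (fst p) (snd p))"
    using holomorphic2_on_imp_continuous_on[OF h\<eta>] by (simp add: case_prod_unfold)
  have oV: "open (S \<inter> (\<lambda>p. \<eta> (fst p) (snd p)) -` ball 0 r)"
    by (rule continuous_open_preimage[OF c\<eta> oS open_ball])
  have mV: "(0, 0) \<in> S \<inter> (\<lambda>p. \<eta> (fst p) (snd p)) -` ball 0 r" using mem0 \<eta>00 r by simp
  obtain d2 where d2: "d2 > 0" "cball 0 d2 \<times> cball 0 d2 \<subseteq> S \<inter> (\<lambda>p. \<eta> (fst p) (snd p)) -` ball 0 r"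
    by (rule open_Times_cball_subset[OF oV mV])
  define d where "d = Min {d1, d2, r}"
  have d: "d > 0" "d \<le> d1" "d \<le> d2" "d \<le> r" using \<Psi> d2 r by (auto simp: d_def)
  show thesis
  proof (rule that[of r d \<Psi> \<eta>])
    show "r > 0" "d > 0" "r \<le> \<rho>" using r d 1 by auto
    show "holomorphic2_on \<Psi> (ball 0 r \<times> ball 0 r)" by (rule holomorphic2_on_subset[OF \<Psi>(3)]) (use r in auto)
    have "ball 0 d \<times> ball 0 d \<subseteq> cball 0 d2 \<times> cball (0::complex) d2" using d by auto
    then have "ball 0 d \<times> ball 0 d \<subseteq> S" using d2(2) by blast
    then show "holomorphic2_on \<eta> (ball 0 d \<times> ball 0 d)" by (rule holomorphic2_on_subset[OF h\<eta>])
    show "\<Psi> l 0 = 0" if "l \<in> ball 0 r" for l using that r by (intro \<Psi>0) auto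
    show "\<Psi> l t \<in> ball 0 \<delta> \<and> \<Phi> l (\<Psi> l t) = \<Psi> l (\<kappa> * t)" if lt: "l \<in> ball 0 r" "t \<in> ball 0 r" for l t
    proof
      have S: "(l, \<Psi> l t) \<in> S" "\<eta> l (\<Psi> l t) = t" using \<Psi>(4)[of l t] lt r by auto
      then show "\<Psi> l t \<in> ball 0 \<delta>" using sub by auto
      have "(l, t) \<in> S1 \<inter> (\<lambda>p. \<Phi> (fst p) (\<Psi> (fst p) (snd p))) -` ball 0 d1"
        by (rule subsetD[OF r2(2)]) (use lt r in auto)
      then have "\<Phi> l (\<Psi> l t) \<in> ball 0 d1" by simp
      moreover have "l \<in> ball 0 d1" using lt r by auto
      ultimately have "\<Psi> l (\<eta> l (\<Phi> l (\<Psi> l t))) = \<Phi> l (\<Psi> l t)" using \<Psi>(5) by blast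
      then show "\<Phi> l (\<Psi> l t) = \<Psi> l (\<kappa> * t)" using conj[OF S(1)] S(2) by simp
    qed
    show "l \<in> ball 0 r \<and> \<eta> l z \<in> ball 0 r \<and> \<Psi> l (\<eta> l z) = z" if lz: "l \<in> ball 0 d" "z \<in> ball 0 d" for l z
    proof -
      have "(l, z) \<in> S \<inter> (\<lambda>p. \<eta> (fst p) (snd p)) -` ball 0 r"
        by (rule subsetD[OF d2(2)]) (use lz d in auto)
      moreover have "\<Psi> l (\<eta> l z) = z" using \<Psi>(5)[of l z] lz d by auto
      ultimately show ?thesis using lz d by auto
    qed
    have "(0::complex, 0::complex) \<in> S1" using \<Psi> by (simp add: S1_def)
    then have "\<Psi> 0 field_differentiable at 0"
      using holomorphic2_on_snd[OF \<Psi>(3)] by (auto simp: S1_def open_Times)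
    then have D: "(\<Psi> 0 has_field_derivative deriv (\<Psi> 0) 0) (at 0)" by (simp add: DERIV_deriv_iff_field_differentiable)
    have "\<Psi> 0 0 = 0" using \<Psi>0[of 0] \<Psi> 1 by simp
    then have "((\<eta> 0 \<circ> \<Psi> 0) has_field_derivative 1 * deriv (\<Psi> 0) 0) (at 0)"
      using d\<eta> by (intro DERIV_chain D) simp
    moreover have "((\<lambda>t. t) has_field_derivative 1) (at (0::complex))" by simp
    then have "((\<eta> 0 \<circ> \<Psi> 0) has_field_derivative 1) (at 0)"
      by (rule has_field_derivative_transform_within_open[of _ _ _ "ball 0 r1"]) (use \<Psi>(1,4) in auto)
    ultimately have "1 * deriv (\<Psi> 0) 0 = 1" by (rule DERIV_unique)
    then show "deriv (\<Psi> 0) 0 \<noteq> 0" by auto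
  qed
qed

section \<open>The marked orbit and its limit cycle\<close>

lemma analytic_compose2:
  assumes F: "holomorphic2_on F S" and S: "open S" and \<alpha>: "\<alpha> analytic_on {x}" and \<beta>: "\<beta> analytic_on {x}" and mem: "(\<alpha> x, \<beta> x) \<in> S"
  shows "(\<lambda>l. F (\<alpha> l) (\<beta> l)) analytic_on {x}"
proof -
  obtain A where A: "open A" "x \<in> A" "\<alpha> holomorphic_on A" using \<alpha> by (auto simp: analytic_at)
  obtain B where B: "open B" "x \<in> B" "\<beta> holomorphic_on B" using \<beta> by (auto simp: analytic_at)
  have h: "\<alpha> holomorphic_on A \<inter> B" "\<beta> holomorphic_on A \<inter> B"
    using A B by (auto elim: holomorphic_on_subset)
  have o: "open ((A \<inter> B) \<inter> (\<lambda>l. (\<alpha> l, \<beta> l)) -` S)"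
    by (rule continuous_open_preimage) (use A B S h in \<open>auto intro!: continuous_on_Pair holomorphic_on_imp_continuous_on\<close>)
  have "(\<lambda>l. F (\<alpha> l) (\<beta> l)) holomorphic_on ((A \<inter> B) \<inter> (\<lambda>l. (\<alpha> l, \<beta> l)) -` S)"
    by (rule holomorphic2_on_holomorphic_compose[OF F S o]) (use h in \<open>auto elim: holomorphic_on_subset\<close>)
  then show ?thesis unfolding analytic_at using o A B mem by blast
qed

lemma analytic_zero_or_order:
  assumes f: "f analytic_on {0}"
  shows "(\<forall>\<^sub>F l in nhds 0. f l = 0) \<or> (\<exists>M A. A \<noteq> 0 \<and> (\<forall>j<M. taylor_coeff j f = 0) \<and> taylor_coeff M f = A)"
proof (cases "\<forall>j. taylor_coeff j f = 0")
  case True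
  then have "f has_fps_expansion 0" using has_fps_expansion_taylor[OF f] by (simp add: fps_zero_def)
  then show ?thesis by (simp add: has_fps_expansion_0_iff)
next
  case False
  define M where "M = (LEAST k. taylor_coeff k f \<noteq> 0)"
  have "taylor_coeff M f \<noteq> 0" using LeastI_ex[of "\<lambda>k. taylor_coeff k f \<noteq> 0"] False by (simp add: M_def)
  moreover have "\<forall>j<M. taylor_coeff j f = 0" using not_less_Least by (auto simp: M_def)
  ultimately show ?thesis by blast
qed

locale transversality_setting =
  fixes U W :: "complex set" and g :: "complex \<Rightarrow> complex" and G :: "complex \<Rightarrow> complex \<Rightarrow> complex"
    and c1 \<kappa> :: complex and a :: "nat \<Rightarrow> complex" and q :: nat and r0 :: real
  assumes mm: "marked_map U g c1"
    and infinite_orbit: "infinite (marked_orbit g c1)"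
    and per: "periodic_orbit U g q a"
    and conv: "(\<lambda>n. infdist ((g ^^ n) c1) (a ` {..<q})) \<longlonglongrightarrow> 0"
    and \<kappa>_def: "\<kappa> = deriv (g ^^ q) (a 0)"
    and ld: "local_holomorphic_deformation U g c1 W G"
    and r0: "r0 > 0"
    and lp: "lifting_property U g c1 W G (marked_orbit g c1 \<union> Omega U g (a ` {..<q}) r0)"
begin

lemma basic: "open U" "g holomorphic_on U" "c1 \<in> U" "open W" "connected W" "c1 \<in> W" "holomorphic2_on G (W \<times> U)"
  "\<And>z. z \<in> U \<Longrightarrow> G c1 z = g z" "\<And>w z. w \<in> W \<Longrightarrow> z \<in> U \<Longrightarrow> deriv (G w) z \<noteq> 0"
  using mm ld unfolding marked_map_def local_holomorphic_deformation_def by auto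

lemma q1: "q \<ge> 1" and aU: "j < q \<Longrightarrow> a j \<in> U" and a_inj: "inj_on a {..<q}" and ga: "j < q \<Longrightarrow> g (a j) = a (Suc j mod q)"
  using per unfolding periodic_orbit_def by auto

definition c where "c n = (g ^^ n) c1"

lemma c_0 [simp]: "c 0 = c1" and c_Suc: "c (Suc n) = g (c n)" and c_add: "c (m + n) = (g ^^ m) (c n)"
  by (simp_all add: c_def funpow_add)

lemma marked_orbit_c: "marked_orbit g c1 = range c"
  by (simp add: marked_orbit_def c_def)

lemma cU: "c n \<in> U"
  using mm unfolding marked_map_def iterate_defined_def c_def by blast

lemma a_iter: "j < q \<Longrightarrow> (g ^^ n) (a j) = a ((j + n) mod q)"
proof (induction n)
  case (Suc n)
  then show ?case using ga[of "(j + n) mod q"] q1 by (simp add: mod_Suc_eq)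
qed simp

lemma a_iterU: "j < q \<Longrightarrow> (g ^^ n) (a j) \<in> U"
  using a_iter[of j n] aU[of "(j + n) mod q"] q1 by simp

lemma inj_c: "inj c"
proof (rule ccontr)
  assume "\<not> inj c"
  then obtain m n where mn: "m < n" "c m = c n" unfolding inj_def by (metis linorder_neqE_nat)
  have "c k \<in> c ` {..<n}" for k
  proof (induction k rule: less_induct)
    case (less k)
    show ?case
    proof (cases "k < n")
      case False
      have "c k = c ((k - n) + n)" using False by simp
      also have "\<dots> = c ((k - n) + m)" unfolding c_add by (simp add: mn)
      finally show ?thesis using less[of "(k - n) + m"] False mn by simp
    qed simp
  qed
  then have "range c \<subseteq> c ` {..<n}" by blast
  then show False using infinite_orbit finite_subset unfolding marked_orbit_c by blast
qed

lemma c_ne_a: "j < q \<Longrightarrow> c n \<noteq> a j"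
proof
  assume j: "j < q" and eq: "c n = a j"
  have "c k \<in> c ` {..<n} \<union> a ` {..<q}" for k
  proof (cases "k < n")
    case False
    have "c k = c ((k - n) + n)" using False by simp
    also have "\<dots> = a ((j + (k - n)) mod q)" unfolding c_add eq by (rule a_iter[OF j])
    finally show ?thesis using q1 by auto
  qed simp
  then have "range c \<subseteq> c ` {..<n} \<union> a ` {..<q}" by blast
  then show False using infinite_orbit finite_subset[of "range c" "c ` {..<n} \<union> a ` {..<q}"] unfolding marked_orbit_c by auto
qed

text \<open>The joint domain of the n-th iterate: the points at which the map is evaluated lie in
  \<open>U\<close>, the last image need not.\<close>

definition Dom where "Dom n = {p. fst p \<in> W \<and> (\<forall>k<n. (G (fst p) ^^ k) (snd p) \<in> U)}"

lemma WU: "open (W \<times> U)" using basic by (simp add: open_Times)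

lemma open_Dom: "open (Dom n)" and hol_Dom: "holomorphic2_on (\<lambda>w z. (G w ^^ n) z) (Dom n)"
proof (induction n)
  case 0
  have "Dom 0 = W \<times> UNIV" by (auto simp: Dom_def)
  moreover have o: "open (W \<times> (UNIV :: complex set))" using basic by (simp add: open_Times)
  ultimately show "open (Dom 0)" "holomorphic2_on (\<lambda>w z. (G w ^^ 0) z) (Dom 0)"
    using holomorphic2_on_snd_only[OF o, of "\<lambda>z. z" UNIV] by auto
next
  case (Suc n)
  have eq: "Dom (Suc n) = Dom n \<inter> (\<lambda>p. (G (fst p) ^^ n) (snd p)) -` U"
    by (auto simp: Dom_def less_Suc_eq)
  have cont: "continuous_on (Dom n) (\<lambda>p. (G (fst p) ^^ n) (snd p))"
    using holomorphic2_on_imp_continuous_on[OF Suc(2)] by (simp add: case_prod_unfold)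
  show o: "open (Dom (Suc n))" unfolding eq by (rule continuous_open_preimage[OF cont Suc(1) basic(1)])
  have fst: "holomorphic2_on (\<lambda>w z. w) (Dom (Suc n))" by (rule holomorphic2_on_fst_only[OF o, of "\<lambda>w. w" UNIV]) auto
  have "holomorphic2_on (\<lambda>w z. (G w ^^ n) z) (Dom (Suc n))" by (rule holomorphic2_on_subset[OF Suc(2)]) (auto simp: eq)
  from holomorphic2_on_compose[OF basic(7) WU o fst this]
  have "holomorphic2_on (\<lambda>w z. G w ((G w ^^ n) z)) (Dom (Suc n))" by (auto simp: Dom_def)
  then show "holomorphic2_on (\<lambda>w z. (G w ^^ Suc n) z) (Dom (Suc n))" by simp
qed

lemma G_iter_eq: "(\<And>k. k < n \<Longrightarrow> (g ^^ k) z \<in> U) \<Longrightarrow> (G c1 ^^ n) z = (g ^^ n) z"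
  by (induction n) (auto simp: basic(8))

lemma Dom_c1: "(\<And>k. k < n \<Longrightarrow> (g ^^ k) z \<in> U) \<Longrightarrow> (c1, z) \<in> Dom n"
proof -
  assume *: "\<And>k. k < n \<Longrightarrow> (g ^^ k) z \<in> U"
  have "(G c1 ^^ k) z \<in> U" if "k < n" for k
    using G_iter_eq[of k z] * that by auto
  then show ?thesis using basic by (simp add: Dom_def)
qed

lemma Dom_c: "(c1, c m) \<in> Dom n" and G_iter_c: "(G c1 ^^ n) (c m) = c (n + m)"
proof -
  have "(g ^^ k) (c m) \<in> U" for k using cU[of "k + m"] by (simp add: c_add)
  then show "(c1, c m) \<in> Dom n" "(G c1 ^^ n) (c m) = c (n + m)"
    using Dom_c1[of n "c m"] G_iter_eq[of n "c m"] by (auto simp: c_add)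
qed

lemma Dom_a: "j < q \<Longrightarrow> (c1, a j) \<in> Dom n" and G_iter_a: "j < q \<Longrightarrow> (G c1 ^^ n) (a j) = a ((j + n) mod q)"
proof -
  assume j: "j < q"
  then show "(c1, a j) \<in> Dom n" using Dom_c1[of n "a j"] a_iterU by blast
  show "(G c1 ^^ n) (a j) = a ((j + n) mod q)" using G_iter_eq[of n "a j"] a_iterU[OF j] a_iter[OF j] by simp
qed

text \<open>Outside \<open>U\<close> the total functions \<open>g\<close> and \<open>G c1\<close>
  may differ, so their iterates are compared only where the orbit stays in \<open>U\<close>. A
  neighbourhood of the cycle is enough for all derivatives at \<open>a 0\<close>.\<close>

lemma G_iter_ev_eq: "\<forall>\<^sub>F z in nhds (a 0). (G c1 ^^ n) z = (g ^^ n) z"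
proof -
  have 0: "0 < q" using q1 by simp
  have "open {z. (c1, z) \<in> Dom n}"
    using continuous_open_vimage[OF open_Dom[of n], of "\<lambda>z. (c1, z)"] by (auto simp: vimage_def intro: continuous_intros)
  then have "\<forall>\<^sub>F z in nhds (a 0). z \<in> {z. (c1, z) \<in> Dom n}" by (rule eventually_nhds_in_open) (simp add: Dom_a[OF 0])
  then show ?thesis
  proof eventually_elim
    case (elim z)
    have "(G c1 ^^ k) z = (g ^^ k) z" if "k \<le> n" for k
      using that elim
    proof (induction k)
      case (Suc k)
      have "\<forall>k<n. (G c1 ^^ k) z \<in> U" using elim by (simp add: Dom_def)
      then have "(G c1 ^^ k) z \<in> U" using Suc.prems(1) by simp
      then have "G c1 ((G c1 ^^ k) z) = g ((G c1 ^^ k) z)" by (rule basic(8))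
      then show ?case using Suc by simp
    qed simp
    then show ?case by simp
  qed
qed

lemma deriv_g_iter: "(deriv ^^ k) (g ^^ n) (a 0) = (deriv ^^ k) (G c1 ^^ n) (a 0)"
  by (rule higher_deriv_cong_ev) (use G_iter_ev_eq[of n] in \<open>auto elim: eventually_mono\<close>)

text \<open>The displacement \<open>l\<close> moves the parameter and the starting point together,
  in accordance with the double role of \<open>c1\<close>.\<close>

definition orbit_germ where "orbit_germ n l = (G (c1 + l) ^^ n) (c1 + l)"

lemma orbit_germ_analytic: "orbit_germ n analytic_on {0}"
  unfolding orbit_germ_def by (rule analytic_compose2[OF hol_Dom open_Dom]) (use Dom_c[of 0 n] in \<open>auto intro: analytic_intros\<close>)

lemma orbit_germ_0: "orbit_germ n 0 = c n"
  using G_iter_c[of n 0] by (simp add: orbit_germ_def)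

lemma orbit_germ_add: "orbit_germ (m + n) l = (G (c1 + l) ^^ m) (orbit_germ n l)"
  by (simp add: orbit_germ_def funpow_add)

text \<open>The assumption controls only the distance to the cycle as a set. Eventually the nearest
  point of the cycle is unique and advances by one at every step, so the orbit acquires a phase
  modulo \<open>q\<close>.\<close>

lemma orbit_converges: "\<exists>n0. (\<lambda>n. c (n0 + q * n)) \<longlonglongrightarrow> a 0"
proof -
  have 0: "0 < q" using q1 by simp
  have fin: "finite (a ` {..<q})" "a ` {..<q} \<noteq> {}" using 0 by auto
  obtain \<epsilon> where \<epsilon>: "\<epsilon> > 0" "\<And>i j. i < q \<Longrightarrow> j < q \<Longrightarrow> i \<noteq> j \<Longrightarrow> \<epsilon> \<le> dist (a i) (a j)"
  proof -
    define D where "D = insert 1 ((\<lambda>(i, j). dist (a i) (a j)) ` {(i, j). i < q \<and> j < q \<and> i \<noteq> j})"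
    have fD: "finite D" unfolding D_def
      by (intro finite.insertI finite_imageI finite_subset[of "{(i, j). i < q \<and> j < q \<and> i \<noteq> j}" "{..<q} \<times> {..<q}"]) auto
    have "Min D > 0" using fD a_inj by (subst Min_gr_iff) (auto simp: D_def inj_on_def)
    moreover have "Min D \<le> dist (a i) (a j)" if "i < q" "j < q" "i \<noteq> j" for i j
      using fD that by (intro Min_le) (auto simp: D_def)
    ultimately show thesis using that by blast
  qed
  have "\<exists>d>0. \<forall>x. dist x (a j) < d \<longrightarrow> dist (g x) (a (Suc j mod q)) < \<epsilon> / 2" if "j < q" for j
  proof -
    have "isCont g (a j)" using basic(1,2) aU[OF that] by (metis continuous_on_eq_continuous_at holomorphic_on_imp_continuous_on)
    then show ?thesis unfolding continuous_at_eps_delta using \<epsilon>(1) ga[OF that] by (metis half_gt_zero)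
  qed
  then obtain d where d: "\<And>j. j < q \<Longrightarrow> d j > 0" "\<And>j x. j < q \<Longrightarrow> dist x (a j) < d j \<Longrightarrow> dist (g x) (a (Suc j mod q)) < \<epsilon> / 2" by metis
  define \<delta> where "\<delta> = Min (insert (\<epsilon> / 2) (d ` {..<q}))"
  have \<delta>: "\<delta> > 0" "\<delta> \<le> \<epsilon> / 2" "\<And>j. j < q \<Longrightarrow> \<delta> \<le> d j"
  proof -
    show "\<delta> > 0" unfolding \<delta>_def using \<epsilon>(1) d(1) by (subst Min_gr_iff) auto
    show "\<delta> \<le> \<epsilon> / 2" unfolding \<delta>_def by (rule Min_le) auto
    show "\<delta> \<le> d j" if "j < q" for j unfolding \<delta>_def by (rule Min_le) (use that in auto)
  qed
  have attain: "\<exists>j<q. infdist (c n) (a ` {..<q}) = dist (c n) (a j)" for n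
    using infdist_attains_inf[OF finite_imp_closed[OF fin(1)] fin(2), of "c n"] by auto
  then obtain i where i: "\<And>n. i n < q" "\<And>n. infdist (c n) (a ` {..<q}) = dist (c n) (a (i n))" by metis
  have lim: "(\<lambda>n. dist (c n) (a (i n))) \<longlonglongrightarrow> 0" using conv[folded c_def] by (simp only: i(2))
  from order_tendstoD(2)[OF lim \<delta>(1)] obtain N where N: "\<And>n. n \<ge> N \<Longrightarrow> dist (c n) (a (i n)) < \<delta>"
    by (auto simp: eventually_sequentially)
  \<comment> \<open>The next orbit point is within \<open>\<epsilon> / 2\<close> of the image of its
    predecessor's nearest cycle point and of its own nearest one, while distinct points of the cycle
    are at least \<open>\<epsilon>\<close> apart.\<close>
  have step: "i (Suc n) = Suc (i n) mod q" if n: "n \<ge> N" for n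
  proof (rule ccontr)
    assume ne: "i (Suc n) \<noteq> Suc (i n) mod q"
    have "dist (c (Suc n)) (a (Suc (i n) mod q)) < \<epsilon> / 2"
      unfolding c_Suc using N[OF n] \<delta>(3)[OF i(1)] by (intro d i) (auto intro: less_le_trans)
    moreover have "dist (c (Suc n)) (a (i (Suc n))) < \<epsilon> / 2" using N[of "Suc n"] n \<delta>(2) by auto
    moreover have "\<epsilon> \<le> dist (a (i (Suc n))) (a (Suc (i n) mod q))" using ne i 0 by (intro \<epsilon>) auto
    ultimately show False using dist_triangle2[of "a (i (Suc n))" "a (Suc (i n) mod q)" "c (Suc n)"] by (simp add: dist_commute)
  qed
  have i_add: "i (N + k) = (i N + k) mod q" for k
  proof (induction k)
    case 0
    then show ?case using i(1)[of N] by simp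
  next
    case (Suc k)
    then show ?case using step[of "N + k"] by (simp add: mod_Suc_eq)
  qed
  \<comment> \<open>Waits after time \<open>N\<close> until the phase has returned to 0.\<close>
  define n0 where "n0 = N + (q - i N)"
  have "i (n0 + q * n) = 0" for n
  proof -
    have "n0 + q * n = N + ((q - i N) + q * n)" by (simp add: n0_def)
    then have "i (n0 + q * n) = (i N + ((q - i N) + q * n)) mod q" using i_add by metis
    also have "i N + ((q - i N) + q * n) = q + q * n" using i(1)[of N] by simp
    finally show ?thesis by simp
  qed
  moreover have "filterlim (\<lambda>n. n0 + q * n) at_top sequentially"
    by (rule filterlim_subseq) (use 0 in \<open>auto simp: strict_mono_def\<close>)
  from filterlim_compose[OF lim this] have "(\<lambda>n. dist (c (n0 + q * n)) (a (i (n0 + q * n)))) \<longlonglongrightarrow> 0" .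
  ultimately have "(\<lambda>n. dist (c (n0 + q * n)) (a 0)) \<longlonglongrightarrow> 0" by simp
  then have "(\<lambda>n. c (n0 + q * n)) \<longlonglongrightarrow> a 0" by (rule iffD2[OF tendsto_dist_iff])
  then show ?thesis by blast
qed

text \<open>The points of the moving cycle are the images of the moving point \<open>\<alpha> w\<close>.\<close>

lemma persistent_cycle:
  assumes \<alpha>: "\<alpha> analytic_on {c1}" "\<alpha> c1 = a 0"
    and fixd: "\<forall>\<^sub>F w in nhds c1. (G w ^^ q) (\<alpha> w) = \<alpha> w" and mult: "\<forall>\<^sub>F w in nhds c1. deriv (G w ^^ q) (\<alpha> w) = \<kappa>"
  shows "\<exists>W1 A. open W1 \<and> c1 \<in> W1 \<and> W1 \<subseteq> W \<and>
       (\<forall>j<q. A j holomorphic_on W1 \<and> A j c1 = a j) \<and>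
       (\<forall>w\<in>W1. (\<forall>j<q. iterate_defined U (G w) q (A j w) \<and> (G w ^^ q) (A j w) = A j w) \<and>
                deriv (G w ^^ q) (A 0 w) = \<kappa>)"
proof -
  have 0: "0 < q" using q1 by simp
  obtain B where B: "open B" "c1 \<in> B" "\<alpha> holomorphic_on B" using \<alpha> by (auto simp: analytic_at)
  have "\<forall>\<^sub>F w in nhds c1. (G w ^^ q) (\<alpha> w) = \<alpha> w \<and> deriv (G w ^^ q) (\<alpha> w) = \<kappa>" using fixd mult by eventually_elim simp
  then obtain E where E: "open E" "c1 \<in> E" "\<And>w. w \<in> E \<Longrightarrow> (G w ^^ q) (\<alpha> w) = \<alpha> w \<and> deriv (G w ^^ q) (\<alpha> w) = \<kappa>"
    unfolding eventually_nhds by blast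
  define W1 where "W1 = (B \<inter> (\<lambda>w. (w, \<alpha> w)) -` Dom q) \<inter> E"
  have "open (B \<inter> (\<lambda>w. (w, \<alpha> w)) -` Dom q)"
    by (rule continuous_open_preimage[OF _ B(1) open_Dom]) (intro continuous_intros holomorphic_on_imp_continuous_on B)
  then have o: "open W1" using E by (simp add: W1_def open_Int)
  have c1: "c1 \<in> W1" using B E Dom_a[OF 0] \<alpha> by (simp add: W1_def)
  have inDom: "(w, \<alpha> w) \<in> Dom j" if "w \<in> W1" "j \<le> q" for w j using that by (auto simp: W1_def Dom_def)
  have inW: "W1 \<subseteq> W" by (auto simp: W1_def Dom_def)
  define A where "A = (\<lambda>j w. (G w ^^ j) (\<alpha> w))"
  have h\<alpha>: "\<alpha> holomorphic_on W1" using B(3) by (rule holomorphic_on_subset) (auto simp: W1_def)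
  have 1: "A j holomorphic_on W1" "A j c1 = a j" if j: "j < q" for j
  proof -
    show "A j holomorphic_on W1"
      unfolding A_def by (rule holomorphic2_on_holomorphic_compose[OF hol_Dom open_Dom o])
        (use inDom j h\<alpha> in \<open>auto intro: holomorphic_intros\<close>)
    show "A j c1 = a j" using G_iter_a[OF 0, of j] \<alpha> j by (simp add: A_def)
  qed
  have 2: "deriv (G w ^^ q) (A 0 w) = \<kappa>" "j < q \<Longrightarrow> (G w ^^ q) (A j w) = A j w"
    "j < q \<Longrightarrow> iterate_defined U (G w) q (A j w)" if w: "w \<in> W1" for w j
  proof -
    have per: "(G w ^^ q) (\<alpha> w) = \<alpha> w" using E(3) w by (simp add: W1_def)
    show "deriv (G w ^^ q) (A 0 w) = \<kappa>" using E(3) w by (simp add: W1_def A_def)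
    have "(G w ^^ q) ((G w ^^ j) (\<alpha> w)) = (G w ^^ j) ((G w ^^ q) (\<alpha> w))"
      by (metis add.commute comp_apply funpow_add)
    then show "(G w ^^ q) (A j w) = A j w" by (simp add: A_def per)
    have U: "(G w ^^ k) (\<alpha> w) \<in> U" if "k < q" for k using inDom[OF w, of q] that by (auto simp: Dom_def)
    show "iterate_defined U (G w) q (A j w)" if j: "j < q"
      unfolding iterate_defined_def
    proof (intro allI impI)
      fix k assume k: "k < q"
      have eq: "(G w ^^ k) (A j w) = (G w ^^ (k + j)) (\<alpha> w)" by (simp add: A_def funpow_add)
      show "(G w ^^ k) (A j w) \<in> U"
      proof (cases "k + j < q")
        case True
        then show ?thesis using U eq by simp
      next
        case False
        then have "(G w ^^ (k + j)) (\<alpha> w) = (G w ^^ (k + j - q + q)) (\<alpha> w)" by simp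
        also have "\<dots> = (G w ^^ (k + j - q)) (\<alpha> w)" unfolding funpow_add o_apply per ..
        finally show ?thesis using U[of "k + j - q"] eq k j by simp
      qed
    qed
  qed
  show ?thesis by (rule exI[of _ W1], rule exI[of _ A], intro conjI o c1 inW allI impI ballI 1 2)
qed

end

lemma finite_lipschitz_on:
  fixes f :: "'a::heine_borel \<Rightarrow> 'b::real_normed_vector"
  assumes "finite R"
  shows "\<exists>L. L-lipschitz_on R f"
proof -
  have "\<exists>L. L-lipschitz_on (\<Union>i\<in>R. {i}) f"
  proof (rule lipschitz_on_UN_separated[OF assms, where C="\<lambda>i. {i}"])
    show "\<exists>L. L-lipschitz_on {i} f" for i by (rule exI[of _ 0], rule lipschitz_on_singleton) simp
  qed auto
  then show ?thesis by simp
qed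

section \<open>Germs along the marked orbit\<close>

context transversality_setting
begin

text \<open>Orbit points are pairwise distinct, so the index, and with it the germ, is a function of
  the point; this is the form in which motions and Lipschitz conditions are stated.\<close>

definition germ_at where "germ_at x = orbit_germ (inv c x)"

lemma germ_at_c [simp]: "germ_at (c n) = orbit_germ n"
  by (simp add: germ_at_def inv_f_f[OF inj_c])

text \<open>The germs of the orbit satisfy the functional equation exactly, so
  \<open>\<Delta>\<close> is 0. Since \<open>Y N\<close> vanishes at \<open>c1\<close> and the
  equation holds up to \<open>C / N\<close>, it tends to 0 at each orbit point in turn; the uniform
  bound on the sum of \<open>Y N\<close> and the coefficient then passes to the coefficient.\<close>

lemma orbit_coeff_bounded:
  assumes M: "M \<ge> 2" and lip: "\<And>j. 1 \<le> j \<Longrightarrow> j < M \<Longrightarrow> \<exists>L. L-lipschitz_on (range c) (\<lambda>x. taylor_coeff j (germ_at x))"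
  shows "\<exists>B. \<forall>n. norm (taylor_coeff M (orbit_germ n)) \<le> B"
proof -
  have X1: "range c \<subseteq> marked_orbit g c1 \<union> Omega U g (a ` {..<q}) r0" by (simp add: marked_orbit_c)
  have X2: "c1 \<in> range c" using c_0 by (metis rangeI)
  have X3: "g ` range c \<subseteq> range c" by (auto simp flip: c_Suc)
  have \<gamma>1: "germ_at x analytic_on {0}" and \<gamma>2: "germ_at x 0 = x" if "x \<in> range c" for x
    using that by (auto simp: orbit_germ_analytic orbit_germ_0)
  have \<gamma>3: "germ_at c1 l = c1 + l" for l using germ_at_c[of 0] by (simp add: orbit_germ_def)
  have \<Delta>: "((\<lambda>l. (G (c1 + l) (germ_at x l) - germ_at (g x) l) / l ^ M) \<longlongrightarrow> 0) (at 0)" if "x \<in> range c" for x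
  proof -
    obtain n where n: "x = c n" using \<open>x \<in> range c\<close> by blast
    have "germ_at (g x) l = G (c1 + l) (germ_at x l)" for l
      using orbit_germ_add[of 1 n l] by (simp add: n flip: c_Suc)
    then show ?thesis by simp
  qed
  show ?thesis
  proof (rule lifting_average[OF mm ld lp X1 X2 X3 M \<gamma>1 \<gamma>2 \<gamma>3 lip \<Delta>], goal_cases)
    case Y: (6 C Y)
    \<comment> \<open>\<open>Suc N\<close> keeps the number of averaged lifts positive. Pointwise
      convergence is enough, because the uniformity in \<open>k\<close> is already in the bound
      \<open>C\<close>.\<close>
    have lim0: "(\<lambda>N. Y (Suc N) (c k)) \<longlonglongrightarrow> 0" for k
    proof (induction k)
      case 0
      then show ?case using Y(4) by simp
    next
      case (Suc k)
      have "(\<lambda>N. Y (Suc N) (g (c k)) - deriv g (c k) * Y (Suc N) (c k)) \<longlonglongrightarrow> 0"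
      proof (rule Lim_null_comparison)
        show "\<forall>\<^sub>F N in sequentially. norm (Y (Suc N) (g (c k)) - deriv g (c k) * Y (Suc N) (c k)) \<le> C * inverse (real (Suc N))"
          using Y(3)[of "Suc _" "c k"] by (simp add: divide_inverse)
        have "(\<lambda>N. C * inverse (real (Suc N))) \<longlonglongrightarrow> C * 0" by (intro tendsto_intros LIMSEQ_inverse_real_of_nat)
        then show "(\<lambda>N. C * inverse (real (Suc N))) \<longlonglongrightarrow> 0" by simp
      qed
      from tendsto_add[OF this tendsto_mult[OF tendsto_const[of "deriv g (c k)"] Suc]]
      show ?case by (simp add: c_Suc)
    qed
    have "norm (taylor_coeff M (orbit_germ k)) \<le> C" for k
    proof (rule tendsto_upperbound)
      have "(\<lambda>N. norm (Y (Suc N) (c k) + taylor_coeff M (germ_at (c k)))) \<longlonglongrightarrow> norm (0 + taylor_coeff M (germ_at (c k)))"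
        by (intro tendsto_intros lim0)
      then show "(\<lambda>N. norm (Y (Suc N) (c k) + taylor_coeff M (germ_at (c k)))) \<longlonglongrightarrow> norm (taylor_coeff M (orbit_germ k))" by simp
      show "\<forall>\<^sub>F N in sequentially. norm (Y (Suc N) (c k) + taylor_coeff M (germ_at (c k))) \<le> C"
        using Y(2)[of "Suc _" "c k"] by simp
    qed simp
    then show ?case by blast
  qed
qed

lemma iterate_derivative_nonzero: "\<exists>D. D \<noteq> 0 \<and> ((G c1 ^^ m) has_field_derivative D) (at (a 0))"
proof (induction m)
  case 0
  show ?case by (intro exI[of _ 1]) (simp add: id_def)
next
  case (Suc m)
  then obtain D where D: "D \<noteq> 0" "((G c1 ^^ m) has_field_derivative D) (at (a 0))" by blast
  have q0: "0 < q" using q1 by simp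
  have am: "(G c1 ^^ m) (a 0) = a (m mod q)" using G_iter_a[OF q0, of m] by simp
  have U: "a (m mod q) \<in> U" by (rule aU) (use q0 in simp)
  have "(G c1 has_field_derivative deriv (G c1) (a (m mod q))) (at (a (m mod q)))"
    using holomorphic2_on_snd[OF basic(7) WU, of c1 "a (m mod q)"] U basic(6) by (simp add: DERIV_deriv_iff_field_differentiable)
  then have "((G c1 \<circ> (G c1 ^^ m)) has_field_derivative deriv (G c1) (a (m mod q)) * D) (at (a 0))"
    by (intro DERIV_chain D) (simp add: am)
  then show ?case using D(1) basic(9)[OF basic(6) U] by (intro exI[of _ "deriv (G c1) (a (m mod q)) * D"]) (simp add: o_def)
qed

text \<open>\<open>taylor_coeff_transport\<close> handles the dependence on the source point, and
  local expansion of the iterate near \<open>a 0\<close> turns it into dependence on the image.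
  \<open>V\<close> is constrained on the image only, so that different assignments of germs can be
  plugged in.\<close>

lemma push_forward_lipschitz:
  "\<exists>\<delta>>0. \<forall>S \<gamma> V j M. S \<subseteq> ball (a 0) \<delta> \<longrightarrow> (\<forall>x\<in>S. \<gamma> x analytic_on {0} \<and> \<gamma> x 0 = x) \<longrightarrow>
     (\<forall>j. 1 \<le> j \<and> j < M \<longrightarrow> (\<exists>L. L-lipschitz_on S (\<lambda>x. taylor_coeff j (\<gamma> x)))) \<longrightarrow> j < M \<longrightarrow>
     (\<forall>x\<in>S. V ((G c1 ^^ m) x) = taylor_coeff j (\<lambda>l. (G (c1 + l) ^^ m) (\<gamma> x l))) \<longrightarrow>
     (\<exists>L. L-lipschitz_on ((G c1 ^^ m) ` S) V)"
proof -
  have q0: "0 < q" using q1 by simp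
  obtain D where D: "D \<noteq> 0" "((G c1 ^^ m) has_field_derivative D) (at (a 0))" using iterate_derivative_nonzero by blast
  have dD: "deriv (G c1 ^^ m) (a 0) = D" using D(2) by (rule DERIV_imp_deriv)
  define S0 where "S0 = {z. (c1, z) \<in> Dom m}"
  have oS0: "open S0"
    unfolding S0_def using continuous_open_vimage[OF open_Dom[of m], of "\<lambda>z. (c1, z)"] by (auto simp: vimage_def intro: continuous_intros)
  have hG: "(G c1 ^^ m) holomorphic_on S0"
    by (rule holomorphic2_on_holomorphic_compose[OF hol_Dom open_Dom oS0]) (auto simp: S0_def intro: holomorphic_intros)
  have aS0: "a 0 \<in> S0" using Dom_a[OF q0] by (simp add: S0_def)
  have nzD: "deriv (G c1 ^^ m) (a 0) \<noteq> 0" using D dD by simp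
  obtain \<delta>1 where \<delta>1: "\<delta>1 > 0"
    "\<And>x y. x \<in> ball (a 0) \<delta>1 \<Longrightarrow> y \<in> ball (a 0) \<delta>1 \<Longrightarrow> norm D / 2 * norm (x - y) \<le> norm ((G c1 ^^ m) x - (G c1 ^^ m) y)"
  proof (rule holomorphic_locally_expanding[OF hG oS0 aS0 nzD, unfolded dD], goal_cases)
    case (1 \<delta>)
    show ?case by (rule 1(1)[OF 1(2) 1(4)])
  qed
  show ?thesis
  proof (rule taylor_coeff_transport[OF hol_Dom open_Dom Dom_a[OF q0, of m]], goal_cases)
    case (1 \<delta>2)
    show ?case
    proof (rule exI[of _ "min \<delta>1 \<delta>2"], intro conjI allI impI)
      show "min \<delta>1 \<delta>2 > 0" using \<delta>1 1 by simp
      fix S \<gamma> V and j M :: nat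
      assume S: "S \<subseteq> ball (a 0) (min \<delta>1 \<delta>2)" and \<gamma>: "\<forall>x\<in>S. \<gamma> x analytic_on {0} \<and> \<gamma> x 0 = x"
        and lip: "\<forall>j. 1 \<le> j \<and> j < M \<longrightarrow> (\<exists>L. L-lipschitz_on S (\<lambda>x. taylor_coeff j (\<gamma> x)))" and j: "j < M"
        and V: "\<forall>x\<in>S. V ((G c1 ^^ m) x) = taylor_coeff j (\<lambda>l. (G (c1 + l) ^^ m) (\<gamma> x l))"
      have S2: "S \<subseteq> ball (a 0) \<delta>2" using S by auto
      obtain L where L: "L-lipschitz_on S (\<lambda>x. taylor_coeff j (\<lambda>l. (G (c1 + l) ^^ m) (\<gamma> x l)))"
        using 1(2)[OF S2, of \<gamma> M j] \<gamma> lip j by auto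
      have "(2 * L / norm D)-lipschitz_on ((G c1 ^^ m) ` S) V"
      proof (rule lipschitz_onI)
        show "0 \<le> 2 * L / norm D" using lipschitz_on_nonneg[OF L] by simp
        fix u v assume "u \<in> (G c1 ^^ m) ` S" "v \<in> (G c1 ^^ m) ` S"
        then obtain x y where xy: "x \<in> S" "y \<in> S" "u = (G c1 ^^ m) x" "v = (G c1 ^^ m) y" by blast
        have "dist (V u) (V v) \<le> L * dist x y" using lipschitz_onD[OF L xy(1,2)] V xy by simp
        also have "dist x y \<le> 2 / norm D * dist u v"
        proof -
          have "norm D / 2 * norm (x - y) \<le> norm (u - v)" unfolding xy(3,4) using S xy by (intro \<delta>1(2)) auto
          then show ?thesis using D(1) by (simp add: dist_norm field_simps)
        qed
        then have "L * dist x y \<le> L * (2 / norm D * dist u v)" using lipschitz_on_nonneg[OF L] by (intro mult_left_mono)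
        finally show "dist (V u) (V v) \<le> 2 * L / norm D * dist u v" by (simp add: mult_ac)
      qed
      then show "\<exists>L. L-lipschitz_on ((G c1 ^^ m) ` S) V" by blast
    qed
  qed
qed

lemma push_forward_lipschitz_uniform:
  assumes "finite I"
  obtains \<delta> where "\<delta> > 0" "\<And>m S \<gamma> V j M. m \<in> I \<Longrightarrow> S \<subseteq> ball (a 0) \<delta> \<Longrightarrow> (\<And>x. x \<in> S \<Longrightarrow> \<gamma> x analytic_on {0}) \<Longrightarrow>
     (\<And>x. x \<in> S \<Longrightarrow> \<gamma> x 0 = x) \<Longrightarrow>
     (\<And>j. 1 \<le> j \<Longrightarrow> j < M \<Longrightarrow> \<exists>L. L-lipschitz_on S (\<lambda>x. taylor_coeff j (\<gamma> x))) \<Longrightarrow> j < M \<Longrightarrow>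
     (\<And>x. x \<in> S \<Longrightarrow> V ((G c1 ^^ m) x) = taylor_coeff j (\<lambda>l. (G (c1 + l) ^^ m) (\<gamma> x l))) \<Longrightarrow>
     \<exists>L. L-lipschitz_on ((G c1 ^^ m) ` S) V"
proof -
  define good where "good = (\<lambda>m \<delta>. \<forall>S \<gamma> V j M. S \<subseteq> ball (a 0) \<delta> \<longrightarrow> (\<forall>x\<in>S. \<gamma> x analytic_on {0} \<and> \<gamma> x 0 = x) \<longrightarrow>
     (\<forall>j. 1 \<le> j \<and> j < M \<longrightarrow> (\<exists>L. L-lipschitz_on S (\<lambda>x. taylor_coeff j (\<gamma> x)))) \<longrightarrow> j < M \<longrightarrow>
     (\<forall>x\<in>S. V ((G c1 ^^ m) x) = taylor_coeff j (\<lambda>l. (G (c1 + l) ^^ m) (\<gamma> x l))) \<longrightarrow>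
     (\<exists>L. L-lipschitz_on ((G c1 ^^ m) ` S) V))"
  have "\<exists>\<delta>>0. good m \<delta>" for m using push_forward_lipschitz[of m] unfolding good_def .
  then obtain \<Delta> where \<Delta>: "\<And>m. \<Delta> m > 0" "\<And>m. good m (\<Delta> m)" by metis
  define \<delta> where "\<delta> = Min (insert 1 (\<Delta> ` I))"
  have \<delta>: "\<delta> > 0" unfolding \<delta>_def using assms \<Delta> by (subst Min_gr_iff) auto
  have \<delta>_le: "\<delta> \<le> \<Delta> m" if "m \<in> I" for m unfolding \<delta>_def by (rule Min_le) (use assms that in auto)
  show thesis
  proof (rule that[OF \<delta>])
    fix m S \<gamma> V and j M :: nat
    assume m: "m \<in> I" and S: "S \<subseteq> ball (a 0) \<delta>" and *: "\<And>x. x \<in> S \<Longrightarrow> \<gamma> x analytic_on {0}" "\<And>x. x \<in> S \<Longrightarrow> \<gamma> x 0 = x"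
     "\<And>j. 1 \<le> j \<Longrightarrow> j < M \<Longrightarrow> \<exists>L. L-lipschitz_on S (\<lambda>x. taylor_coeff j (\<gamma> x))" "j < M"
     "\<And>x. x \<in> S \<Longrightarrow> V ((G c1 ^^ m) x) = taylor_coeff j (\<lambda>l. (G (c1 + l) ^^ m) (\<gamma> x l))"
    have "S \<subseteq> ball (a 0) (\<Delta> m)" using S \<delta>_le[OF m] by auto
    with * show "\<exists>L. L-lipschitz_on ((G c1 ^^ m) ` S) V"
      using \<Delta>(2)[of m, unfolded good_def, rule_format, of S \<gamma> M j V] by auto
  qed
qed

end

section \<open>The parabolic case\<close>

context transversality_setting
begin

lemma fixed_iterate_germ:
  assumes "\<forall>\<^sub>F w in nhds c1. (G w ^^ q) (\<alpha> w) = \<alpha> w"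
  shows "taylor_coeff j (\<lambda>l. (G (c1 + l) ^^ (q * i)) (\<alpha> (c1 + l))) = taylor_coeff j (\<lambda>l. \<alpha> (c1 + l))"
proof (rule taylor_coeff_cong)
  have "((\<lambda>l. c1 + l) \<longlongrightarrow> c1 + 0) (nhds 0)"
    by (rule tendsto_add[OF tendsto_const filterlim_ident])
  then have "filterlim (\<lambda>l. c1 + l) (nhds c1) (nhds 0)" by simp
  from eventually_compose_filterlim[OF assms this]
  show "\<forall>\<^sub>F l in nhds 0. (G (c1 + l) ^^ (q * i)) (\<alpha> (c1 + l)) = \<alpha> (c1 + l)"
  proof eventually_elim
    case (elim l)
    show ?case by (induction i) (simp_all add: funpow_add elim)
  qed
qed

text \<open>Covers both kinds of continuation: it is applied with \<open>s = 1\<close> and a moving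
  periodic point when \<open>p \<ge> 2\<close>, and with \<open>s = 0\<close> and a point
  \<open>\<alpha>\<close> not assumed periodic when \<open>p = 1\<close>. Most of the proof
  establishes the Lipschitz property on the whole orbit that \<open>orbit_coeff_bounded\<close> asks
  for.\<close>

lemma parabolic_contradiction:
  fixes f d r :: "complex \<Rightarrow> complex \<Rightarrow> complex" and A b :: complex and p s M :: nat
  assumes \<alpha>: "\<alpha> analytic_on {c1}" "\<alpha> c1 = a 0" and M: "M \<ge> 2" and p: "p \<ge> 1"
    and f: "\<And>l u. f l u = (G (c1 + l) ^^ (p * q)) (\<alpha> (c1 + l) + u) - \<alpha> (c1 + l)"
    and pos: "\<rho> > 0" "\<delta> > 0"
    and hf: "holomorphic2_on f (ball 0 \<rho> \<times> ball 0 \<delta>)" and hr: "holomorphic2_on r (ball 0 \<rho> \<times> ball 0 \<delta>)"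
    and split: "\<And>l u. l \<in> ball 0 \<rho> \<Longrightarrow> u \<in> ball 0 \<delta> \<Longrightarrow> f l u = u + d l u + r l u"
    and d_bound: "\<And>l u. l \<in> ball 0 \<rho> \<Longrightarrow> u \<in> ball 0 \<delta> \<Longrightarrow> norm (d l u) \<le> C * norm l ^ M"
    and r_bound: "\<And>l u. l \<in> ball 0 \<rho> \<Longrightarrow> u \<in> ball 0 \<delta> \<Longrightarrow> norm (r l u) \<le> C * norm u ^ (p + 1)"
    and dA: "\<And>l u. l \<in> ball 0 \<rho> \<Longrightarrow> u \<in> ball 0 \<delta> \<Longrightarrow>
       norm (d l u - A * l ^ M * u ^ s) \<le> C2 * norm l ^ M * (norm u ^ (s + 1) + norm l)"
    and A: "A \<noteq> 0" and s: "s < p" and b: "b \<noteq> 0" and f_lim: "((\<lambda>x. (f 0 x - x) / x ^ (p + 1)) \<longlongrightarrow> b) (at 0)"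
    and \<kappa>1: "norm \<kappa> = 1" and \<kappa>_ne: "\<And>i j. i < p \<Longrightarrow> j < p \<Longrightarrow> i \<noteq> j \<Longrightarrow> \<kappa> ^ i \<noteq> \<kappa> ^ j"
    and fixd: "p \<ge> 2 \<Longrightarrow> \<forall>\<^sub>F w in nhds c1. (G w ^^ q) (\<alpha> w) = \<alpha> w"
  shows False
proof -
  have q0: "0 < q" using q1 by simp
  obtain n0 where n0: "(\<lambda>n. c (n0 + q * n)) \<longlonglongrightarrow> a 0" using orbit_converges by blast
  have "filterlim (\<lambda>n. p * n) at_top sequentially"
    by (rule filterlim_subseq) (use p in \<open>auto simp: strict_mono_def\<close>)
  from filterlim_compose[OF n0 this] have e_lim: "(\<lambda>n. c (n0 + q * (p * n))) \<longlonglongrightarrow> a 0" .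
  from tendstoD[OF e_lim pos(2)] obtain N1 where N1: "\<And>n. n \<ge> N1 \<Longrightarrow> dist (c (n0 + q * (p * n))) (a 0) < \<delta>"
    by (auto simp: eventually_sequentially)
  \<comment> \<open>One branch of the orbit at \<open>a 0\<close>: indices advance by
    \<open>p * q\<close>, the number of steps in \<open>f\<close>, and \<open>N1\<close> places the
    branch inside the disc of radius \<open>\<delta>\<close>.\<close>
  define idx where "idx = (\<lambda>n. n0 + q * (p * (n + N1)))"
  define E where "E = (\<lambda>n. c (idx n))"
  define z where "z = (\<lambda>n l. orbit_germ (idx n) l - \<alpha> (c1 + l))"
  have "\<alpha> \<circ> (\<lambda>l. c1 + l) analytic_on {0}"
    by (rule analytic_on_compose) (use \<alpha> in \<open>auto intro: analytic_intros\<close>)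
  then have h\<alpha>: "(\<lambda>l. \<alpha> (c1 + l)) analytic_on {0}" by (simp add: o_def)
  have E_ne: "E n \<noteq> a 0" for n using c_ne_a[OF q0] by (simp add: E_def)
  have z0: "z n 0 = E n - a 0" for n by (simp add: z_def orbit_germ_0 E_def \<alpha>)
  have E_lim: "E \<longlonglongrightarrow> a 0" unfolding E_def idx_def using LIMSEQ_ignore_initial_segment[OF e_lim, of N1] by simp
  have idx_Suc: "idx (Suc n) = p * q + idx n" for n by (simp add: idx_def algebra_simps)
  have z_Suc: "z (Suc n) l = f l (z n l)" for n l
    by (simp add: z_def f idx_Suc orbit_germ_add)
  have f0_hol: "f 0 holomorphic_on ball 0 \<delta>"
    by (rule holomorphic2_on_holomorphic_compose[OF hf, of _ "\<lambda>_. 0" "\<lambda>u. u"]) (use pos in \<open>auto intro: holomorphic_intros simp: open_Times\<close>)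
  interpret P: parabolic_family f p b \<delta> z d r M \<rho> C
  proof unfold_locales
    have "(\<lambda>n. E n - a 0) \<longlonglongrightarrow> a 0 - a 0" by (intro tendsto_intros E_lim)
    then show "(\<lambda>n. z n 0) \<longlonglongrightarrow> 0" by (simp add: z0)
    show "z n 0 \<noteq> 0" for n using E_ne[of n] by (simp add: z0)
    show "z n 0 \<in> ball 0 \<delta>" for n using N1[of "n + N1"] by (simp add: z0 E_def idx_def dist_norm norm_minus_commute)
    show "z (Suc n) 0 = f 0 (z n 0)" for n by (rule z_Suc)
    show "z n analytic_on {0}" for n unfolding z_def by (intro analytic_intros orbit_germ_analytic h\<alpha>)
    show "\<forall>\<^sub>F l in nhds 0. z (Suc n) l = f l (z n l)" for n by (simp add: z_Suc)
  qed (use p b pos f0_hol f_lim M hf hr split d_bound r_bound in auto)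
  have tc_z: "taylor_coeff j (z n) = taylor_coeff j (orbit_germ (idx n)) - taylor_coeff j (\<lambda>l. \<alpha> (c1 + l))" for j n
    unfolding z_def by (rule taylor_coeff_diff[OF orbit_germ_analytic h\<alpha>])
  obtain N2 where N2: "\<And>n. n \<ge> N2 \<Longrightarrow> norm (z (Suc n) 0) \<le> norm (z n 0)"
  proof -
    have "\<forall>\<^sub>F n in sequentially. norm (z (Suc n) 0) \<le> norm (z n 0)"
      using P.norm_decrease
    proof eventually_elim
      case (elim n)
      have "0 \<le> norm (P.\<beta> n) * norm (z n 0) / 4" by simp
      with elim show ?case by linarith
    qed
    then show thesis using that by (auto simp: eventually_sequentially)
  qed
  have Gi_fix: "(G c1 ^^ (q * i)) (a 0) = a 0" for i using G_iter_a[OF q0, of "q * i"] by simp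
  \<comment> \<open>The i-th branch relative to \<open>a 0\<close>. To first order it is the main
    branch multiplied by \<open>\<kappa> ^ i\<close>.\<close>
  define y where "y = (\<lambda>i n. (G c1 ^^ (q * i)) (E (n + N2)) - a 0)"
  have der_i: "((G c1 ^^ (q * i)) has_field_derivative \<kappa> ^ i) (at (a 0))" for i
  proof (induction i)
    case (Suc i)
    obtain D where "((G c1 ^^ q) has_field_derivative D) (at (a 0))" using iterate_derivative_nonzero by blast
    moreover have "deriv (G c1 ^^ q) (a 0) = \<kappa>" using deriv_g_iter[of 1 q] by (simp add: \<kappa>_def)
    ultimately have "((G c1 ^^ q) has_field_derivative \<kappa>) (at (a 0))" by (metis DERIV_imp_deriv)
    then have "((G c1 ^^ q) \<circ> (G c1 ^^ (q * i)) has_field_derivative \<kappa> * \<kappa> ^ i) (at (a 0))"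
      by (intro DERIV_chain Suc) (simp add: Gi_fix)
    then show ?case by (simp add: funpow_add o_def)
  qed (simp add: id_def)
  have Em_at: "filterlim (\<lambda>n. E (n + N2)) (at (a 0)) sequentially"
    using LIMSEQ_ignore_initial_segment[OF E_lim, of N2] E_ne by (auto simp: filterlim_at)
  have y_lim: "(\<lambda>n. y i n / z (n + N2) 0) \<longlonglongrightarrow> \<kappa> ^ i" for i
  proof -
    have "((\<lambda>u. ((G c1 ^^ (q * i)) u - (G c1 ^^ (q * i)) (a 0)) / (u - a 0)) \<longlongrightarrow> \<kappa> ^ i) (at (a 0))"
      using der_i[of i] by (simp add: has_field_derivative_iff)
    from filterlim_compose[OF this Em_at] show ?thesis by (simp add: y_def z0 Gi_fix)
  qed
  have mono: "norm (z (k + N2) 0) \<le> norm (z (n + N2) 0)" if "n \<le> k" for n k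
    using that by (induction k rule: dec_induct) (auto intro: order_trans[OF N2])
  have "\<exists>c>0. \<exists>N. \<forall>n\<ge>N. \<forall>k\<ge>N. \<forall>i<p. \<forall>j<p. i \<noteq> j \<longrightarrow> c * (norm (z (n + N2) 0) + norm (z (k + N2) 0)) \<le> norm (y i n - y j k)"
  proof (rule branches_separated[OF _ mono _ y_lim \<kappa>1 \<kappa>_ne])
    show "z (n + N2) 0 \<noteq> 0" for n using P.x(2) .
    obtain K where "\<forall>\<^sub>F n in sequentially. \<forall>k\<ge>n. norm (z k 0 - z n 0) \<le> K * (norm (z n 0) - norm (z k 0))"
      using P.orbit_lipschitz by blast
    from eventually_compose_filterlim[OF this filterlim_add_const_nat_at_top[of N2]]
    have "\<forall>\<^sub>F n in sequentially. \<forall>k\<ge>n. norm (z (k + N2) 0 - z (n + N2) 0) \<le> K * (norm (z (n + N2) 0) - norm (z (k + N2) 0))"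
      by eventually_elim simp
    then show "\<exists>C. \<forall>\<^sub>F n in sequentially. \<forall>k\<ge>n. norm (z (k + N2) 0 - z (n + N2) 0) \<le> C * (norm (z (n + N2) 0) - norm (z (k + N2) 0))" by blast
  qed
  then obtain cc N3 where cc: "cc > 0" "\<And>n k i j. n \<ge> N3 \<Longrightarrow> k \<ge> N3 \<Longrightarrow> i < p \<Longrightarrow> j < p \<Longrightarrow> i \<noteq> j \<Longrightarrow>
     cc * (norm (z (n + N2) 0) + norm (z (k + N2) 0)) \<le> norm (y i n - y j k)" by blast
  have finI: "finite ({..<q} \<union> (\<lambda>i. q * i) ` {..<p})" by simp
  obtain \<delta>' where \<delta>': "\<delta>' > 0" "\<And>m S \<gamma> V j M. m \<in> {..<q} \<union> (\<lambda>i. q * i) ` {..<p} \<Longrightarrow> S \<subseteq> ball (a 0) \<delta>' \<Longrightarrow> (\<And>x. x \<in> S \<Longrightarrow> \<gamma> x analytic_on {0}) \<Longrightarrow>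
     (\<And>x. x \<in> S \<Longrightarrow> \<gamma> x 0 = x) \<Longrightarrow>
     (\<And>j. 1 \<le> j \<Longrightarrow> j < M \<Longrightarrow> \<exists>L. L-lipschitz_on S (\<lambda>x. taylor_coeff j (\<gamma> x))) \<Longrightarrow> j < M \<Longrightarrow>
     (\<And>x. x \<in> S \<Longrightarrow> V ((G c1 ^^ m) x) = taylor_coeff j (\<lambda>l. (G (c1 + l) ^^ m) (\<gamma> x l))) \<Longrightarrow>
     \<exists>L. L-lipschitz_on ((G c1 ^^ m) ` S) V"
  proof (rule push_forward_lipschitz_uniform[OF finI], goal_cases)
    case (1 \<delta>)
    show ?case by (rule 1(1)[OF 1(2) 1(3)])
  qed
  have GE: "(G c1 ^^ m) (E n) = c (m + idx n)" for m n by (simp add: E_def G_iter_c)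
  have Ei_lim: "(\<lambda>n. (G c1 ^^ (q * i)) (E n)) \<longlonglongrightarrow> a 0" for i
    using isCont_tendsto_compose[OF DERIV_isCont[OF der_i[of i]] E_lim] by (simp add: Gi_fix)
  have ev1: "\<forall>\<^sub>F n in sequentially. \<forall>i\<in>{..<p}. (G c1 ^^ (q * i)) (E n) \<in> ball (a 0) \<delta>'"
    by (intro eventually_ball_finite ballI finite_lessThan topological_tendstoD[OF Ei_lim open_ball]) (use \<delta>' in simp)
  have ev2: "\<forall>\<^sub>F n in sequentially. \<forall>i\<in>{..<p}. norm (y i n) \<le> 2 * norm (z (n + N2) 0)"
  proof (intro eventually_ball_finite ballI finite_lessThan)
    fix i
    have "\<forall>\<^sub>F n in sequentially. norm (y i n / z (n + N2) 0) < 2"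
      by (rule order_tendstoD(2)[OF tendsto_norm[OF y_lim]]) (simp add: norm_power \<kappa>1)
    then show "\<forall>\<^sub>F n in sequentially. norm (y i n) \<le> 2 * norm (z (n + N2) 0)"
    proof eventually_elim
      case (elim n)
      then show ?case using P.x(2)[of "n + N2"] by (simp add: norm_divide field_simps)
    qed
  qed
  have "\<forall>j\<in>{1..<M}. \<exists>K. \<forall>\<^sub>F n in sequentially. \<forall>k\<ge>n. norm (taylor_coeff j (z k) - taylor_coeff j (z n)) \<le> K * (norm (z n 0) - norm (z k 0))"
    by (rule ballI, rule P.taylor_coeff_low(2)) auto
  from bchoice[OF this] obtain K where "\<forall>j\<in>{1..<M}. \<forall>\<^sub>F n in sequentially. \<forall>k\<ge>n. norm (taylor_coeff j (z k) - taylor_coeff j (z n)) \<le> K j * (norm (z n 0) - norm (z k 0))"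
    by (elim exE)
  note K = bspec[OF this]
  have "\<forall>j\<in>{1..<M}. \<exists>K'. \<forall>n. norm (taylor_coeff j (z n)) \<le> K' * norm (z n 0)"
    by (rule ballI, rule P.taylor_coeff_low(1)) auto
  from bchoice[OF this] obtain K' where "\<forall>j\<in>{1..<M}. \<forall>n. norm (taylor_coeff j (z n)) \<le> K' j * norm (z n 0)"
    by (elim exE)
  then have K': "norm (taylor_coeff j (z n)) \<le> K' j * norm (z n 0)" if "j \<in> {1..<M}" for j n using that by simp
  have ev3: "\<forall>\<^sub>F n in sequentially. \<forall>j\<in>{1..<M}. \<forall>k\<ge>n. norm (taylor_coeff j (z k) - taylor_coeff j (z n)) \<le> K j * (norm (z n 0) - norm (z k 0))"
    by (intro eventually_ball_finite ballI K) auto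
  obtain N4 where N4: "\<And>n i. n \<ge> N4 \<Longrightarrow> i < p \<Longrightarrow> (G c1 ^^ (q * i)) (E n) \<in> ball (a 0) \<delta>'"
    "\<And>n i. n \<ge> N4 \<Longrightarrow> i < p \<Longrightarrow> norm (y i n) \<le> 2 * norm (z (n + N2) 0)"
    "\<And>n j k. n \<ge> N4 \<Longrightarrow> j \<in> {1..<M} \<Longrightarrow> k \<ge> n \<Longrightarrow> norm (taylor_coeff j (z k) - taylor_coeff j (z n)) \<le> K j * (norm (z n 0) - norm (z k 0))"
  proof -
    obtain n1 where n1: "\<forall>n\<ge>n1. \<forall>i\<in>{..<p}. (G c1 ^^ (q * i)) (E n) \<in> ball (a 0) \<delta>'" using ev1 unfolding eventually_sequentially by blast
    obtain n2 where n2: "\<forall>n\<ge>n2. \<forall>i\<in>{..<p}. norm (y i n) \<le> 2 * norm (z (n + N2) 0)" using ev2 unfolding eventually_sequentially by blast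
    obtain n3 where n3: "\<forall>n\<ge>n3. \<forall>j\<in>{1..<M}. \<forall>k\<ge>n. norm (taylor_coeff j (z k) - taylor_coeff j (z n)) \<le> K j * (norm (z n 0) - norm (z k 0))"
      using ev3 unfolding eventually_sequentially by blast
    show thesis by (rule that[of "max n1 (max n2 n3)"]) (use n1 n2 n3 in auto)
  qed
  define N5 where "N5 = N2 + (N3 + N4)"
  define T where "T = insert (a 0) (range (\<lambda>n. E (n + N5)))"
  \<comment> \<open>The limit point receives the moving point as its germ. All branches contain it,
    so a Lipschitz estimate between branches can be routed through it.\<close>
  define germ' where "germ' = (\<lambda>x. if x = a 0 then (\<lambda>l. \<alpha> (c1 + l)) else germ_at x)"
  have germ'_a: "germ' (a 0) = (\<lambda>l. \<alpha> (c1 + l))" by (simp add: germ'_def)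
  have germ'_c: "germ' (c n) = orbit_germ n" for n using c_ne_a[OF q0, of n] by (simp add: germ'_def)
  have germ'_E: "germ' (E n) = orbit_germ (idx n)" for n by (simp add: E_def germ'_c)
  have germ'_an: "germ' x analytic_on {0}" "germ' x 0 = x" if "x = a 0 \<or> x \<in> range c" for x
    using that by (auto simp: germ'_a germ'_c h\<alpha> \<alpha> orbit_germ_analytic orbit_germ_0)
  have T_c: "x = a 0 \<or> x \<in> range c" if "x \<in> T" for x using that by (auto simp: T_def E_def)
  have T_ball: "T \<subseteq> ball (a 0) \<delta>'" using N4(1)[of _ 0] p \<delta>' by (auto simp: T_def N5_def)
  have lip_T: "\<exists>L. L-lipschitz_on T (\<lambda>x. taylor_coeff j (germ' x))" if j: "1 \<le> j" "j < M" for j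
  proof -
    have jM: "j \<in> {1..<M}" using j by simp
    define L where "L = \<bar>K j\<bar> + \<bar>K' j\<bar>"
    define w where "w = (\<lambda>x. taylor_coeff j (germ' x))"
    have wa: "dist (w (E n)) (w (a 0)) \<le> L * dist (E n) (a 0)" for n
    proof -
      have "dist (w (E n)) (w (a 0)) = norm (taylor_coeff j (z n))" by (simp add: w_def germ'_E germ'_a tc_z dist_norm)
      also have "\<dots> \<le> K' j * norm (z n 0)" by (rule K'[OF jM])
      also have "\<dots> \<le> L * norm (z n 0)" by (intro mult_right_mono) (auto simp: L_def)
      finally show ?thesis by (simp add: z0 dist_norm)
    qed
    have wE: "dist (w (E k)) (w (E n)) \<le> L * dist (E k) (E n)" if "n \<ge> N4" "k \<ge> n" for n k
    proof -
      have "dist (w (E k)) (w (E n)) = norm (taylor_coeff j (z k) - taylor_coeff j (z n))" by (simp add: w_def germ'_E tc_z dist_norm)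
      also have "\<dots> \<le> K j * (norm (z n 0) - norm (z k 0))" by (rule N4(3)[OF that(1) jM that(2)])
      also have "\<dots> \<le> \<bar>K j\<bar> * \<bar>norm (z n 0) - norm (z k 0)\<bar>" by (metis abs_ge_self abs_mult)
      also have "\<dots> \<le> L * norm (z k 0 - z n 0)"
        using norm_triangle_ineq3[of "z n 0" "z k 0"] by (intro mult_mono) (auto simp: L_def norm_minus_commute)
      finally show ?thesis by (simp add: z0 dist_norm)
    qed
    have "L-lipschitz_on T w"
    proof (rule lipschitz_onI)
      fix x y assume xy: "x \<in> T" "y \<in> T"
      consider "x = y" | n where "x = a 0" "y = E n" | n where "y = a 0" "x = E n" | n k where "n \<ge> N4" "k \<ge> N4" "x = E n" "y = E k"
    proof -
      have *: "u = a 0 \<or> (\<exists>n\<ge>N4. u = E n)" if u: "u \<in> T" for u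
        using u unfolding T_def N5_def by (elim insertE rangeE) (auto intro!: exI[of _ "_ + (N2 + (N3 + N4))"])
      from *[OF xy(1)] *[OF xy(2)] show thesis by (elim disjE exE conjE) (use that in auto)
    qed
      then show "dist (w x) (w y) \<le> L * dist x y"
      proof cases
        case 2
        then show ?thesis using wa[of n] by (simp add: dist_commute)
      next
        case 3
        then show ?thesis using wa[of n] by simp
      next
        case 4
        then show ?thesis using wE[of n k] wE[of k n] by (cases "n \<le> k") (auto simp: dist_commute)
      qed simp
    qed (simp add: L_def)
    then show ?thesis unfolding w_def by blast
  qed
  define B where "B = (\<lambda>i. (G c1 ^^ (q * i)) ` T)"
  have B_form: "x = a 0 \<or> (\<exists>n. x = c (q * i + idx (n + N5)))" if "x \<in> B i" for x i
    using that by (auto simp: B_def T_def Gi_fix GE)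
  have lip_B: "\<exists>L. L-lipschitz_on (B i) (\<lambda>x. taylor_coeff j (germ' x))" if i: "i < p" and j: "j < M" for i j
    unfolding B_def
  proof (rule \<delta>'(2)[of "q * i" T germ' M j])
    fix x assume "x \<in> T"
    then consider "x = a 0" | n where "x = E n" by (auto simp: T_def)
    then show "taylor_coeff j (germ' ((G c1 ^^ (q * i)) x)) = taylor_coeff j (\<lambda>l. (G (c1 + l) ^^ (q * i)) (germ' x l))"
    proof cases
      case 1
      show ?thesis
      proof (cases "i = 0")
        case False
        \<comment> \<open>Pushing the germ of \<open>a 0\<close> forward reproduces it only if
          \<open>\<alpha>\<close> is periodic; for \<open>p = 1\<close> the only branch is
          \<open>i = 0\<close> and nothing is pushed.\<close>
        then have "p \<ge> 2" using i by simp
        then show ?thesis using fixed_iterate_germ[OF fixd] 1 by (simp add: germ'_a Gi_fix)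
      qed simp
    next
      case 2
      have "germ' ((G c1 ^^ (q * i)) x) = (\<lambda>l. (G (c1 + l) ^^ (q * i)) (germ' x l))"
        unfolding 2 GE germ'_c germ'_E by (rule ext) (rule orbit_germ_add)
      then show ?thesis by simp
    qed
  qed (use i j T_ball lip_T germ'_an[OF T_c] in auto)
  define S where "S = (\<Union>i<p. B i)"
  have S_form: "x = a 0 \<or> (\<exists>k. x = c (n0 + q * k))" if "x \<in> S" for x
  proof -
    have *: "q * i + idx m = n0 + q * (i + p * (m + N1))" for i m by (simp add: idx_def algebra_simps)
    obtain i where "x \<in> B i" using \<open>x \<in> S\<close> by (auto simp: S_def)
    from B_form[OF this] show ?thesis unfolding * by blast
  qed
  have S_c: "x = a 0 \<or> x \<in> range c" if "x \<in> S" for x using S_form[OF that] by auto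
  have a_B: "a 0 \<in> B i" for i unfolding B_def by (rule image_eqI[of _ _ "a 0"]) (simp_all add: Gi_fix T_def)
  have S_ball: "S \<subseteq> ball (a 0) \<delta>'"
  proof
    fix x assume "x \<in> S"
    then obtain i where i: "i < p" "x \<in> B i" by (auto simp: S_def)
    then consider "x = a 0" | n where "x = (G c1 ^^ (q * i)) (E (n + N5))" by (auto simp: B_def T_def Gi_fix)
    then show "x \<in> ball (a 0) \<delta>'" using \<delta>' N4(1)[of "_ + N5" i] i by cases (auto simp: N5_def)
  qed
  have lip_S: "\<exists>L. L-lipschitz_on S (\<lambda>x. taylor_coeff j (germ' x))" if j: "j < M" for j
  proof -
    define w where "w = (\<lambda>x. taylor_coeff j (germ' x))"
    have "\<exists>L. L-lipschitz_on (B i) w" if "i < p" for i unfolding w_def by (rule lip_B[OF that j])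
    then have "\<forall>i\<in>{..<p}. \<exists>L. L-lipschitz_on (B i) w" by simp
    from bchoice[OF this] obtain L where "\<forall>i\<in>{..<p}. (L i)-lipschitz_on (B i) w" by (elim exE)
    then have L: "(L i)-lipschitz_on (B i) w" if "i < p" for i using that by simp
    define LL where "LL = (\<Sum>i<p. L i)"
    have L0: "L i \<ge> 0" if "i < p" for i using lipschitz_on_nonneg[OF L[OF that]] .
    have L_le: "L i \<le> LL" if "i < p" for i unfolding LL_def by (rule member_le_sum) (use that L0 in auto)
    have LL0: "LL \<ge> 0" unfolding LL_def by (rule sum_nonneg) (use L0 in auto)
    have same: "dist (w x) (w y) \<le> LL * dist x y" if "i < p" "x \<in> B i" "y \<in> B i" for i x y
      using lipschitz_onD[OF L[OF that(1)] that(2,3)] mult_right_mono[OF L_le[OF that(1)], of "dist x y"] by simp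
    define LM where "LM = LL + LL * 2 / cc"
    have LM: "LM \<ge> LL" "LM \<ge> 0" using LL0 cc(1) by (auto simp: LM_def)
    have "LM-lipschitz_on S w"
    proof (rule lipschitz_onI)
      fix x x' assume "x \<in> S" "x' \<in> S"
      then obtain i i' where i: "i < p" "x \<in> B i" "i' < p" "x' \<in> B i'" by (auto simp: S_def)
      have easy: "dist (w x) (w x') \<le> LM * dist x x'" if "k < p" "x \<in> B k" "x' \<in> B k" for k
        using same[OF that] mult_right_mono[OF LM(1), of "dist x x'"] by simp
      show "dist (w x) (w x') \<le> LM * dist x x'"
      proof (cases "i = i' \<or> x = a 0 \<or> x' = a 0")
        case True
        then show ?thesis using easy i a_B by metis
      next
        case False
        obtain n n' where n: "x = (G c1 ^^ (q * i)) (E (n + N5))" "x' = (G c1 ^^ (q * i')) (E (n' + N5))"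
          proof -
          have *: "\<exists>n. u = (G c1 ^^ (q * k)) (E (n + N5))" if "u \<in> B k" "u \<noteq> a 0" for u k
            using that unfolding B_def T_def by (elim imageE insertE rangeE) (use Gi_fix in simp, blast)
          have "x \<noteq> a 0" "x' \<noteq> a 0" using False by auto
          from *[OF i(2) this(1)] *[OF i(4) this(2)] show thesis by (elim exE) (rule that)
        qed
        define m where "m = n + (N3 + N4)"
        define m' where "m' = n' + (N3 + N4)"
        have m: "n + N5 = m + N2" "n' + N5 = m' + N2" "m \<ge> N3" "m \<ge> N4" "m' \<ge> N3" "m' \<ge> N4"
          by (auto simp: m_def m'_def N5_def)
        have xy: "x - a 0 = y i m" "x' - a 0 = y i' m'" unfolding n m y_def by simp_all
        \<comment> \<open>Points on different branches are compared via \<open>a 0\<close>: their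
          distances from it are bounded by the moduli on the main branch, and by \<open>cc\<close>
          the sum of these moduli is bounded by the mutual distance.\<close>
        have "dist (w x) (w x') \<le> dist (w x) (w (a 0)) + dist (w x') (w (a 0))" by (rule dist_triangle2)
        also have "\<dots> \<le> LL * norm (y i m) + LL * norm (y i' m')"
          using same[OF i(1,2) a_B] same[OF i(3,4) a_B] by (simp add: dist_norm xy flip: xy)
        also have "\<dots> \<le> LL * (2 * norm (z (m + N2) 0)) + LL * (2 * norm (z (m' + N2) 0))"
          using N4(2) m i LL0 by (intro add_mono mult_left_mono) auto
        also have "\<dots> = LL * 2 / cc * (cc * (norm (z (m + N2) 0) + norm (z (m' + N2) 0)))" using cc(1) by (simp add: field_simps)
        also have "\<dots> \<le> LL * 2 / cc * norm (y i m - y i' m')"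
          using cc m i False LL0 by (intro mult_left_mono cc(2)) auto
        also have "norm (y i m - y i' m') = dist x x'" by (simp add: dist_norm flip: xy)
        also have "LL * 2 / cc * dist x x' \<le> LM * dist x x'" using LL0 by (intro mult_right_mono) (auto simp: LM_def)
        finally show ?thesis .
      qed
    qed (rule LM(2))
    then show ?thesis unfolding w_def by blast
  qed
  have contG: "continuous_on {x. x = a 0 \<or> x \<in> range c} (G c1 ^^ m)" for m
  proof (rule continuous_at_imp_continuous_on, rule ballI)
    fix x assume "x \<in> {x. x = a 0 \<or> x \<in> range c}"
    then have "(c1, x) \<in> Dom m" using Dom_a[OF q0] Dom_c by auto
    from holomorphic2_on_snd[OF hol_Dom open_Dom this] show "isCont (G c1 ^^ m) x"
      by (rule field_differentiable_imp_continuous_at)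
  qed
  have compT: "compact T" unfolding T_def
    by (rule compact_sequence_with_limit, rule LIMSEQ_ignore_initial_segment[OF E_lim])
  have compS: "compact S" unfolding S_def B_def
    by (intro compact_UN compact_continuous_image continuous_on_subset[OF contG] compT) (use T_c in auto)
  define Cm where "Cm = (\<lambda>m. (G c1 ^^ m) ` S)"
  \<comment> \<open>The part of the orbit near \<open>a m\<close>, inside the compact set
    \<open>Cm m\<close>. The limit point is left out because only orbit points must carry the germs
    of the motion, and \<open>germ_at\<close> is meaningful there alone.\<close>
  define Sm where "Sm = (\<lambda>m. (G c1 ^^ m) ` (S - {a 0}))"
  have compC: "compact (Cm m)" for m unfolding Cm_def
    by (intro compact_continuous_image continuous_on_subset[OF contG] compS) (use S_c in auto)
  have C_form: "x = a m \<or> (\<exists>k. x = c (m + (n0 + q * k)))" if "x \<in> Cm m" "m < q" for x m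
  proof -
    obtain u where u: "u \<in> S" "x = (G c1 ^^ m) u" using \<open>x \<in> Cm m\<close> by (auto simp: Cm_def)
    show ?thesis using S_form[OF u(1)] G_iter_a[OF q0, of m] that by (auto simp: u(2) G_iter_c)
  qed
  \<comment> \<open>Orbit points in \<open>Cm m\<close> have indices congruent to
    \<open>m + n0\<close> modulo \<open>q\<close>, and indices are determined by points.\<close>
  have C_disj: "Cm m \<inter> Cm m' = {}" if "m < q" "m' < q" "m \<noteq> m'" for m m'
  proof (rule ccontr)
    assume "Cm m \<inter> Cm m' \<noteq> {}"
    then obtain x where "x \<in> Cm m" "x \<in> Cm m'" by blast
    from C_form[OF this(1) that(1)] C_form[OF this(2) that(2)]
    show False
    proof (elim disjE exE)
      fix k k' assume "x = c (m + (n0 + q * k))" "x = c (m' + (n0 + q * k'))"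
      then have "m + (n0 + q * k) = m' + (n0 + q * k')" by (intro injD[OF inj_c]) simp
      then have "m + q * k = m' + q * k'" by simp
      then have "(m + q * k) mod q = (m' + q * k') mod q" by simp
      then show False using that by simp
    qed (use that a_inj c_ne_a in \<open>auto simp: inj_on_def\<close>)
  qed
  have lip_Sm: "\<exists>L. L-lipschitz_on (Sm m) (\<lambda>x. taylor_coeff j (germ_at x))" if m: "m < q" and j: "j < M" for m j
    unfolding Sm_def
  proof (rule \<delta>'(2)[of m "S - {a 0}" germ' M j])
    fix x assume x: "x \<in> S - {a 0}"
    then obtain k where k: "x = c k" using S_c by blast
    have "germ_at ((G c1 ^^ m) x) = (\<lambda>l. (G (c1 + l) ^^ m) (germ' x l))"
      unfolding k G_iter_c germ'_c germ_at_c by (rule ext) (rule orbit_germ_add)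
    then show "taylor_coeff j (germ_at ((G c1 ^^ m) x)) = taylor_coeff j (\<lambda>l. (G (c1 + l) ^^ m) (germ' x l))" by simp
  next
    fix j assume "1 \<le> j" "j < M"
    then obtain L where "L-lipschitz_on S (\<lambda>x. taylor_coeff j (germ' x))" using lip_S by blast
    then have "L-lipschitz_on (S - {a 0}) (\<lambda>x. taylor_coeff j (germ' x))" by (rule lipschitz_on_subset) auto
    then show "\<exists>L. L-lipschitz_on (S - {a 0}) (\<lambda>x. taylor_coeff j (germ' x))" by blast
  qed (use m j S_ball germ'_an[OF S_c] in auto)
  have Sm_Cm: "Sm m \<subseteq> Cm m" for m by (auto simp: Sm_def Cm_def)
  define R where "R = range c - (\<Union>m<q. Cm m)"
  \<comment> \<open>An index beyond the threshold is decomposed in mixed radix: \<open>m\<close>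
    within the cycle, \<open>i\<close> for the branch, \<open>t1\<close> for the position on the
    branch.\<close>
  have tail: "c n \<in> (\<Union>m<q. Sm m)" if "n \<ge> n0 + q * (p * (N5 + N1))" for n
  proof -
    define t where "t = n - (n0 + q * (p * (N5 + N1)))"
    define t1 where "t1 = (t div q) div p"
    define i where "i = (t div q) mod p"
    define m where "m = t mod q"
    have i: "i < p" "m < q" using p q0 by (auto simp: i_def m_def)
    have "t div q = p * t1 + i" by (simp add: t1_def i_def)
    moreover have "t = q * (t div q) + m" by (simp add: m_def)
    ultimately have "n = m + (q * i + idx (t1 + N5))" using that by (simp add: t_def idx_def algebra_simps)
    then have "c n = (G c1 ^^ m) ((G c1 ^^ (q * i)) (E (t1 + N5)))" by (simp add: GE G_iter_c)
    moreover have "(G c1 ^^ (q * i)) (E (t1 + N5)) \<in> S - {a 0}"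
    proof
      show "(G c1 ^^ (q * i)) (E (t1 + N5)) \<in> S" unfolding S_def B_def T_def using i by blast
      show "(G c1 ^^ (q * i)) (E (t1 + N5)) \<notin> {a 0}" using c_ne_a[OF q0] by (simp add: GE)
    qed
    ultimately show ?thesis using i by (auto simp: Sm_def)
  qed
  have "R \<subseteq> c ` {..<n0 + q * (p * (N5 + N1))}"
  proof
    fix x assume x: "x \<in> R"
    then obtain n where n: "x = c n" by (auto simp: R_def)
    have "\<not> n \<ge> n0 + q * (p * (N5 + N1))"
      using tail[of n] x Sm_Cm n by (auto simp: R_def)
    then show "x \<in> c ` {..<n0 + q * (p * (N5 + N1))}" using n by auto
  qed
  then have finR: "finite R" by (rule finite_subset) simp
  have cover: "range c \<subseteq> (\<Union>m<q. Sm m) \<union> R"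
  proof
    fix x assume x: "x \<in> range c"
    show "x \<in> (\<Union>m<q. Sm m) \<union> R"
    proof (cases "x \<in> R")
      case False
      then obtain m where m: "m < q" "x \<in> Cm m" using x by (auto simp: R_def)
      then obtain u where u: "u \<in> S" "x = (G c1 ^^ m) u" by (auto simp: Cm_def)
      have "u \<noteq> a 0" using u G_iter_a[OF q0, of m] m c_ne_a[OF m(1)] x by auto
      then show ?thesis using u m by (auto simp: Sm_def)
    qed simp
  qed
  have "\<exists>L. L-lipschitz_on (range c) (\<lambda>x. taylor_coeff j (germ_at x))" if j: "1 \<le> j" "j < M" for j
  proof -
    define w where "w = (\<lambda>x. taylor_coeff j (germ_at x))"
    have "\<exists>L. L-lipschitz_on (\<Union>m\<in>{..<q}. Sm m) w"
      by (rule lipschitz_on_UN_separated[where C=Cm]) (use lip_Sm j Sm_Cm compC C_disj in \<open>auto simp: w_def\<close>)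
    then obtain L1 where L1: "L1-lipschitz_on (\<Union>m\<in>{..<q}. Sm m) w" by blast
    obtain L2 where L2: "L2-lipschitz_on R w" using finite_lipschitz_on[OF finR] by blast
    have "\<exists>L. L-lipschitz_on ((\<Union>m\<in>{..<q}. Sm m) \<union> R) w"
      by (rule lipschitz_on_Un_separated[OF L1 _ _ L2, where C="\<Union>m\<in>{..<q}. Cm m" and D=R])
         (use Sm_Cm compC finR finite_imp_compact in \<open>auto simp: R_def intro!: compact_UN\<close>)
    then show ?thesis unfolding w_def using lipschitz_on_subset[OF _ cover] by blast
  qed
  \<comment> \<open>The coefficients of \<open>z n\<close> differ from those of the orbit by a
    coefficient of \<open>\<alpha>\<close> that is independent of \<open>n\<close>, so they would be
    bounded too.\<close>
  from orbit_coeff_bounded[OF M this] obtain Bd where Bd: "\<And>n. norm (taylor_coeff M (orbit_germ n)) \<le> Bd" by blast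
  have "norm (taylor_coeff M (z n)) \<le> Bd + norm (taylor_coeff M (\<lambda>l. \<alpha> (c1 + l)))" for n
    unfolding tc_z using Bd[of "idx n"] norm_triangle_ineq4 order_trans add_right_mono by meson
  with P.taylor_coeff_critical_unbounded[OF s A dA] show False by blast
qed

end

section \<open>Continuation of the periodic point and the two parabolic cases\<close>

text \<open>The last conclusion is the differentiated equation; it determines
  \<open>\<alpha>'\<close> and is what lets failure of transversality be read as the vanishing of a
  first-order term.\<close>

lemma implicit_function:
  assumes H: "holomorphic2_on H S" and S: "open S" and mem: "(w0, z0) \<in> S" and nz: "deriv (H w0) z0 \<noteq> 0"
  obtains \<alpha> \<alpha>' where "\<alpha> analytic_on {w0}" "\<alpha> w0 = z0" "\<forall>\<^sub>F w in nhds w0. H w (\<alpha> w) = H w0 z0"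
    "(\<alpha> has_field_derivative \<alpha>') (at w0)" "deriv (\<lambda>w. H w z0) w0 + deriv (H w0) z0 * \<alpha>' = 0"
proof (rule holomorphic2_on_local_inverse[OF H S mem nz], goal_cases)
  case \<Psi>: (1 \<Psi> r d)
  define \<alpha> where "\<alpha> = (\<lambda>w. \<Psi> w (H w0 z0))"
  have "\<alpha> holomorphic_on ball w0 r" unfolding \<alpha>_def
    by (rule holomorphic2_on_holomorphic_compose[OF \<Psi>(4)]) (use \<Psi>(2) in \<open>auto simp: open_Times intro: holomorphic_intros\<close>)
  then have an: "\<alpha> analytic_on {w0}" using \<Psi>(2) unfolding analytic_at by (intro exI[of _ "ball w0 r"]) auto
  have \<alpha>0: "\<alpha> w0 = z0" using \<Psi>(6)[of w0 z0] \<Psi>(3) by (simp add: \<alpha>_def)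
  have ev: "\<forall>\<^sub>F w in nhds w0. H w (\<alpha> w) = H w0 z0"
    by (rule eventually_mono[OF eventually_nhds_in_open[OF open_ball, of w0 w0 r]]) (use \<Psi>(2,5) in \<open>auto simp: \<alpha>_def\<close>)
  obtain \<alpha>' where \<alpha>': "(\<alpha> has_field_derivative \<alpha>') (at w0)"
    using analytic_on_imp_differentiable_at[OF an] by (auto simp: field_differentiable_def)
  have "((\<lambda>w. H w (\<alpha> w)) has_field_derivative deriv (\<lambda>w. H w z0) w0 * 1 + deriv (H w0) z0 * \<alpha>') (at w0)"
    using holomorphic2_on_chain[OF H S DERIV_ident \<alpha>', unfolded \<alpha>0] mem by simp
  moreover have "((\<lambda>w. H w (\<alpha> w)) has_field_derivative 0) (at w0)"
    using ev by (subst DERIV_cong_ev[OF refl _ refl]) auto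
  ultimately have "deriv (\<lambda>w. H w z0) w0 + deriv (H w0) z0 * \<alpha>' = 0" using DERIV_unique by fastforce
  then show ?case by (rule \<Psi>(1)[OF an \<alpha>0 ev \<alpha>'])
qed

lemma eventually_shift: "(\<forall>\<^sub>F l in nhds 0. P (c + l)) \<longleftrightarrow> (\<forall>\<^sub>F w in nhds (c::complex). P w)"
proof
  assume *: "\<forall>\<^sub>F l in nhds 0. P (c + l)"
  have "((\<lambda>w. w - c) \<longlongrightarrow> c - c) (nhds c)" by (rule tendsto_diff[OF filterlim_ident tendsto_const])
  then have "filterlim (\<lambda>w. w - c) (nhds 0) (nhds c)" by simp
  from eventually_compose_filterlim[OF * this] show "\<forall>\<^sub>F w in nhds c. P w" by simp
next
  assume *: "\<forall>\<^sub>F w in nhds c. P w"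
  have "((\<lambda>l. c + l) \<longlongrightarrow> c + 0) (nhds 0)" by (rule tendsto_add[OF tendsto_const filterlim_ident])
  then have "filterlim (\<lambda>l. c + l) (nhds c) (nhds 0)" by simp
  from eventually_compose_filterlim[OF * this] show "\<forall>\<^sub>F l in nhds 0. P (c + l)" .
qed

lemma analytic_zero_or_order_ge_2:
  assumes e: "e analytic_on {0}" "e 0 = 0" "(e has_field_derivative 0) (at 0)"
  shows "(\<forall>\<^sub>F l in nhds 0. e l = 0) \<or>
    (\<exists>M A. M \<ge> 2 \<and> A \<noteq> 0 \<and> (\<forall>j<M. taylor_coeff j e = 0) \<and> taylor_coeff M e = A \<and> ((\<lambda>l. e l / l ^ M) \<longlongrightarrow> A) (at 0))"
  using analytic_zero_or_order[OF e(1)]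
proof (elim disjE exE conjE)
  fix M A assume A: "A \<noteq> 0" "\<forall>j<M. taylor_coeff j e = 0" "taylor_coeff M e = A"
  have "taylor_coeff (Suc 0) e = 0" using e(3) by (simp add: taylor_coeff_1 DERIV_imp_deriv)
  with A e(2) have "M \<noteq> 0" "M \<noteq> Suc 0" by (metis taylor_coeff_0, metis)
  then have "M \<ge> 2" by linarith
  then show ?thesis using A taylor_coeff_tendsto[OF e(1), of M] by blast
qed blast

lemma root_of_unity_power_eq_1_iff:
  assumes p: "p \<ge> 1" "coprime l (int p)" and \<kappa>: "\<kappa> = exp (2 * of_real pi * \<i> * of_int l / of_nat p)"
  shows "\<kappa> ^ n = 1 \<longleftrightarrow> p dvd n"
proof -
  have "\<kappa> ^ n = exp (of_nat n * (2 * of_real pi * \<i> * of_int l / of_nat p))" by (simp only: \<kappa> exp_of_nat_mult)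
  also have "of_nat n * (2 * of_real pi * \<i> * of_int l / of_nat p) = of_real (2 * pi * (real_of_int (l * int n) / real p)) * \<i>"
    by (simp add: field_simps)
  finally have "\<kappa> ^ n = 1 \<longleftrightarrow> (\<exists>m::int. 2 * pi * (real_of_int (l * int n) / real p) = of_int (2 * m) * pi)"
    by (simp add: exp_eq_1)
  also have "\<dots> \<longleftrightarrow> (\<exists>m::int. real_of_int (l * int n) = real_of_int (int p * m))" using p by (simp add: field_simps)
  also have "\<dots> \<longleftrightarrow> (\<exists>m::int. l * int n = int p * m)" by (simp only: of_int_eq_iff)
  also have "\<dots> \<longleftrightarrow> int p dvd l * int n" by (simp add: dvd_def)
  also have "\<dots> \<longleftrightarrow> p dvd n" using p(2) by (simp add: coprime_commute coprime_dvd_mult_right_iff)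
  finally show ?thesis .
qed

context transversality_setting
begin

lemma q0: "0 < q" using q1 by simp

lemma deriv_return: "deriv (G c1 ^^ q) (a 0) = \<kappa>" "deriv (deriv (G c1 ^^ q)) (a 0) = (deriv ^^ 2) (g ^^ q) (a 0)"
  using deriv_g_iter[of 1 q] deriv_g_iter[of 2 q] by (simp_all add: \<kappa>_def numeral_2_eq_2)

lemma Dom_mono: "m \<le> n \<Longrightarrow> Dom n \<subseteq> Dom m"
  by (auto simp: Dom_def)

text \<open>By \<open>deriv_deriv_commute\<close> the mixed derivative can be written as the
  derivative of \<open>Q\<close> at \<open>a 0\<close>, so the right-hand side is the linear term
  that failure of transversality cancels.\<close>

lemma deriv_multiplier:
  assumes \<alpha>: "(\<alpha> has_field_derivative \<alpha>') (at c1)" "\<alpha> c1 = a 0"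
  shows "((\<lambda>l. deriv (G (c1 + l) ^^ q) (\<alpha> (c1 + l)) - \<kappa>) has_field_derivative
            deriv (\<lambda>z. deriv (\<lambda>w. (G w ^^ q) z) c1) (a 0) + (deriv ^^ 2) (g ^^ q) (a 0) * \<alpha>') (at 0)"
proof -
  have h: "holomorphic2_on (\<lambda>w. deriv (G w ^^ q)) (Dom q)" using holomorphic2_on_deriv_snd[OF hol_Dom open_Dom] by simp
  have "((\<lambda>w. deriv (G w ^^ q) (\<alpha> w)) has_field_derivative
       deriv (\<lambda>w. deriv (G w ^^ q) (\<alpha> c1)) c1 * 1 + deriv (deriv (G c1 ^^ q)) (\<alpha> c1) * \<alpha>') (at c1)"
    by (rule holomorphic2_on_chain[OF h open_Dom DERIV_ident \<alpha>(1)]) (simp add: \<alpha> Dom_a q0)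
  also have "deriv (\<lambda>w. deriv (G w ^^ q) (\<alpha> c1)) c1 = deriv (\<lambda>z. deriv (\<lambda>w. (G w ^^ q) z) c1) (a 0)"
    unfolding \<alpha>(2) using deriv_deriv_commute[OF hol_Dom open_Dom Dom_a[OF q0]] by simp
  finally have "((\<lambda>w. deriv (G w ^^ q) (\<alpha> w)) has_field_derivative
      deriv (\<lambda>z. deriv (\<lambda>w. (G w ^^ q) z) c1) (a 0) + (deriv ^^ 2) (g ^^ q) (a 0) * \<alpha>') (at (c1 + 0))"
    by (simp add: \<alpha>(2) deriv_return)
  then have "((\<lambda>w. deriv (G w ^^ q) (\<alpha> w) - \<kappa>) has_field_derivative
      deriv (\<lambda>z. deriv (\<lambda>w. (G w ^^ q) z) c1) (a 0) + (deriv ^^ 2) (g ^^ q) (a 0) * \<alpha>' - 0) (at (c1 + 0))"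
    by (intro DERIV_diff DERIV_const)
  from DERIV_shift[THEN iffD1, of _ _ 0 c1] this show ?thesis
    by (simp add: DERIV_shift add.commute)
qed

text \<open>A single radius serves the domain of the iterates, the holomorphy of
  \<open>\<alpha>\<close> and a property \<open>P\<close> valid near \<open>c1\<close>.\<close>

lemma local_coordinates:
  assumes \<alpha>: "\<alpha> analytic_on {c1}" "\<alpha> c1 = a 0" and P: "\<forall>\<^sub>F w in nhds c1. P w"
  obtains \<rho> where "\<rho> > 0" "(\<lambda>l. \<alpha> (c1 + l)) holomorphic_on ball 0 \<rho>" "\<And>l. l \<in> ball 0 \<rho> \<Longrightarrow> P (c1 + l)"
    "\<And>l u. l \<in> ball 0 \<rho> \<Longrightarrow> u \<in> ball 0 \<rho> \<Longrightarrow> (c1 + l, \<alpha> (c1 + l) + u) \<in> Dom n"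
    "\<And>m. m \<le> n \<Longrightarrow> holomorphic2_on (\<lambda>l u. (G (c1 + l) ^^ m) (\<alpha> (c1 + l) + u)) (ball 0 \<rho> \<times> ball 0 \<rho>)"
    "\<And>m. m \<le> n \<Longrightarrow> holomorphic2_on (\<lambda>l u. (G (c1 + l) ^^ m) (\<alpha> (c1 + l) + u) - \<alpha> (c1 + l)) (ball 0 \<rho> \<times> ball 0 \<rho>)"
proof -
  have "\<forall>\<^sub>F l in nhds 0. P (c1 + l)" using P by (simp add: eventually_shift[of P])
  then obtain E where E: "open E" "0 \<in> E" "\<And>l. l \<in> E \<Longrightarrow> P (c1 + l)" unfolding eventually_nhds by blast
  obtain B where B: "open B" "c1 \<in> B" "\<alpha> holomorphic_on B" using \<alpha>(1) by (auto simp: analytic_at)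
  define B' where "B' = (\<lambda>l. c1 + l) -` B"
  have B': "open B'" "0 \<in> B'" using B by (auto simp: B'_def intro!: open_vimage continuous_intros)
  have h\<alpha>: "(\<lambda>l. \<alpha> (c1 + l)) holomorphic_on B'"
    using holomorphic_on_compose_gen[OF _ B(3), of "\<lambda>l. c1 + l" B'] by (force simp: B'_def o_def intro: holomorphic_intros)
  have c: "continuous_on (B' \<times> UNIV) (\<lambda>p. \<alpha> (c1 + fst p))"
    by (rule continuous_on_compose2[OF holomorphic_on_imp_continuous_on[OF h\<alpha>]]) (auto intro: continuous_intros)
  define S where "S = (B' \<times> UNIV) \<inter> (\<lambda>p. (c1 + fst p, \<alpha> (c1 + fst p) + snd p)) -` Dom n"
  have "open S" unfolding S_def
    by (rule continuous_open_preimage[OF _ _ open_Dom]) (use B' c in \<open>auto intro!: continuous_intros simp: open_Times\<close>)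
  moreover have "(0, 0) \<in> S" using B' by (simp add: S_def \<alpha> Dom_a q0)
  ultimately obtain r where r: "r > 0" "cball 0 r \<times> cball 0 r \<subseteq> S" by (rule open_Times_cball_subset)
  obtain e where e: "e > 0" "ball 0 e \<subseteq> E" using E open_contains_ball by blast
  define \<rho> where "\<rho> = min r e"
  have \<rho>: "\<rho> > 0" using r e by (simp add: \<rho>_def)
  have inS: "(l, u) \<in> S" if "l \<in> ball 0 \<rho>" "u \<in> ball 0 \<rho>" for l u
    by (rule subsetD[OF r(2)]) (use that in \<open>auto simp: \<rho>_def\<close>)
  have mem: "(c1 + l, \<alpha> (c1 + l) + u) \<in> Dom n" "l \<in> B'" if "l \<in> ball 0 \<rho>" "u \<in> ball 0 \<rho>" for l u
    using inS[OF that] by (auto simp: S_def)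
  have o: "open (ball (0::complex) \<rho> \<times> ball (0::complex) \<rho>)" by (simp add: open_Times)
  have sub: "ball 0 \<rho> \<subseteq> B'" using mem(2)[of _ 0] \<rho> by auto
  have h\<alpha>': "(\<lambda>l. \<alpha> (c1 + l)) holomorphic_on ball 0 \<rho>" using h\<alpha> sub by (rule holomorphic_on_subset)
  have f1: "holomorphic2_on (\<lambda>l u. c1 + l) (ball 0 \<rho> \<times> ball 0 \<rho>)"
    by (rule holomorphic2_on_fst_only[OF o, of _ UNIV]) (auto intro: holomorphic_intros)
  have f2: "holomorphic2_on (\<lambda>l u. \<alpha> (c1 + l)) (ball 0 \<rho> \<times> ball 0 \<rho>)"
    by (rule holomorphic2_on_fst_only[OF o h\<alpha>']) auto
  have f3: "holomorphic2_on (\<lambda>l u. u) (ball 0 \<rho> \<times> ball 0 \<rho>)"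
    by (rule holomorphic2_on_snd_only[OF o, of "\<lambda>u. u" UNIV]) auto
  have h: "holomorphic2_on (\<lambda>l u. (G (c1 + l) ^^ m) (\<alpha> (c1 + l) + u)) (ball 0 \<rho> \<times> ball 0 \<rho>)" if "m \<le> n" for m
    by (rule holomorphic2_on_compose[OF hol_Dom[of m] open_Dom o f1 holomorphic2_on_add[OF o f2 f3]])
       (use mem(1) Dom_mono[OF that] in auto)
  show thesis
    by (rule that[OF \<rho> h\<alpha>' _ mem(1) h holomorphic2_on_diff[OF o h f2]]) (use E(3) e in \<open>auto simp: \<rho>_def\<close>)
qed

lemma coordinate_iterate:
  "((\<lambda>u. (G w ^^ q) (z + u) - z) ^^ i) u = (G w ^^ (i * q)) (z + u) - z"
  by (induction i) (simp_all add: funpow_add)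

lemma return_expansion: "(\<lambda>u. (G c1 ^^ n) (a 0 + u)) has_fps_expansion fps_expansion (G c1 ^^ n) (a 0)"
proof (rule analytic_at_imp_has_fps_expansion)
  have "(\<lambda>z. (G c1 ^^ n) z) analytic_on {a 0}"
    by (rule analytic_compose2[OF hol_Dom open_Dom]) (use Dom_a[OF q0] in \<open>auto intro: analytic_intros\<close>)
  then show "(G c1 ^^ n) analytic_on {a 0}" by simp
qed

text \<open>As 0 is fixed for all parameters in the moving coordinate, the perturbation begins with
  the change of the multiplier times \<open>u\<close>, so \<open>s = 1\<close>. That
  \<open>\<kappa>\<close> is a primitive root is used twice: to annihilate the low coefficients of
  the p-th iterate and to give the branches distinct directions.\<close>

lemma parabolic_dichotomy_primitive:
  assumes p: "p \<ge> 2" "coprime l (int p)" and \<kappa>: "\<kappa> = exp (2 * of_real pi * \<i> * of_int l / of_nat p)"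
    and nondeg: "(deriv ^^ (p + 1)) (g ^^ (p * q)) (a 0) \<noteq> 0"
    and \<alpha>: "\<alpha> analytic_on {c1}" "\<alpha> c1 = a 0" "\<forall>\<^sub>F w in nhds c1. (G w ^^ q) (\<alpha> w) = \<alpha> w"
    and M: "M \<ge> 2" and A: "A \<noteq> 0" "((\<lambda>l. (deriv (G (c1 + l) ^^ q) (\<alpha> (c1 + l)) - \<kappa>) / l ^ M) \<longlongrightarrow> A) (at 0)"
  shows False
proof -
  have p1: "p \<ge> 1" using p by simp
  note root = root_of_unity_power_eq_1_iff[OF p1 p(2) \<kappa>]
  have \<kappa>p: "\<kappa> ^ p = 1" by (simp add: root)
  have \<kappa>n: "norm \<kappa> = 1" by (rule power_eq_1_iff[THEN disjE, of "norm \<kappa>" p]) (use \<kappa>p p in \<open>auto simp flip: norm_power\<close>)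
  have \<kappa>0: "\<kappa> \<noteq> 0" using \<kappa>n by auto
  have distinct: "\<kappa> ^ i \<noteq> \<kappa> ^ j" if "i < p" "j < p" "i \<noteq> j" for i j
    using that
  proof (induction i j rule: linorder_wlog)
    case (le i j)
    show ?case
    proof
      assume "\<kappa> ^ i = \<kappa> ^ j"
      moreover have "\<kappa> ^ j = \<kappa> ^ i * \<kappa> ^ (j - i)" using le by (simp flip: power_add)
      ultimately have "\<kappa> ^ (j - i) = 1" using \<kappa>0 by simp
      then have "p dvd j - i" by (simp add: root)
      then show False using le by (auto dest: dvd_imp_le)
    qed
  qed (metis)
  have prim: "\<kappa> ^ k \<noteq> \<kappa>" if "2 \<le> k" "k \<le> p" for k
  proof
    assume "\<kappa> ^ k = \<kappa>"
    moreover have "\<kappa> ^ k = \<kappa> * \<kappa> ^ (k - 1)" using that by (cases k) auto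
    ultimately have "\<kappa> ^ (k - 1) = 1" using \<kappa>0 by simp
    then have "p dvd k - 1" by (simp add: root)
    then show False using that by (auto dest: dvd_imp_le)
  qed
  define \<phi> where "\<phi> = (\<lambda>l u. (G (c1 + l) ^^ q) (\<alpha> (c1 + l) + u) - \<alpha> (c1 + l))"
  have \<phi>i: "(\<phi> l ^^ i) u = (G (c1 + l) ^^ (i * q)) (\<alpha> (c1 + l) + u) - \<alpha> (c1 + l)" for l u i
    unfolding \<phi>_def by (rule coordinate_iterate)
  obtain \<rho> where \<rho>: "\<rho> > 0" "\<And>l. l \<in> ball 0 \<rho> \<Longrightarrow> (G (c1 + l) ^^ q) (\<alpha> (c1 + l)) = \<alpha> (c1 + l)"
    "\<And>l u. l \<in> ball 0 \<rho> \<Longrightarrow> u \<in> ball 0 \<rho> \<Longrightarrow> (c1 + l, \<alpha> (c1 + l) + u) \<in> Dom q"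
    "\<And>m. m \<le> q \<Longrightarrow> holomorphic2_on (\<lambda>l u. (G (c1 + l) ^^ m) (\<alpha> (c1 + l) + u) - \<alpha> (c1 + l)) (ball 0 \<rho> \<times> ball 0 \<rho>)"
  proof (rule local_coordinates[OF \<alpha>, of q], goal_cases)
    case (1 \<rho>)
    show ?case by (rule 1(1)[OF 1(2,4,5,7)])
  qed
  have \<phi>h: "holomorphic2_on \<phi> (ball 0 \<rho> \<times> ball 0 \<rho>)" unfolding \<phi>_def by (rule \<rho>(4)) simp
  have \<phi>0: "\<phi> l 0 = 0" if "l \<in> ball 0 \<rho>" for l using \<rho>(2)[OF that] by (simp add: \<phi>_def)
  have d\<phi>: "deriv (\<phi> l) 0 = deriv (G (c1 + l) ^^ q) (\<alpha> (c1 + l))" if "l \<in> ball 0 \<rho>" for l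
  proof -
    have "(c1 + l, \<alpha> (c1 + l)) \<in> Dom q" using \<rho>(3)[OF that, of 0] \<rho>(1) by simp
    from holomorphic2_on_snd[OF hol_Dom open_Dom this]
    have "((G (c1 + l) ^^ q) has_field_derivative deriv (G (c1 + l) ^^ q) (\<alpha> (c1 + l))) (at (0 + \<alpha> (c1 + l)))"
      by (simp add: field_differentiable_derivI)
    then have "((\<lambda>u. (G (c1 + l) ^^ q) (u + \<alpha> (c1 + l)) - \<alpha> (c1 + l)) has_field_derivative deriv (G (c1 + l) ^^ q) (\<alpha> (c1 + l)) - 0) (at 0)"
      by (intro DERIV_diff DERIV_const) (simp only: DERIV_shift)
    then show ?thesis unfolding \<phi>_def by (intro DERIV_imp_deriv) (simp add: add.commute)
  qed
  have d\<phi>0: "deriv (\<phi> 0) 0 = \<kappa>" using d\<phi>[of 0] \<rho>(1) by (simp add: \<alpha> deriv_return)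
  have A': "((\<lambda>l. (deriv (\<phi> l) 0 - \<kappa>) / l ^ M) \<longlongrightarrow> A) (at 0)"
  proof (rule Lim_transform_eventually[OF A(2)])
    have "\<forall>\<^sub>F l in nhds 0. l \<in> ball (0::complex) \<rho>" by (rule eventually_nhds_in_open) (use \<rho> in auto)
    then have "\<forall>\<^sub>F l in at 0. l \<in> ball (0::complex) \<rho>" by (simp add: eventually_at_filter eventually_mono)
    then show "\<forall>\<^sub>F l in at 0. (deriv (G (c1 + l) ^^ q) (\<alpha> (c1 + l)) - \<kappa>) / l ^ M = (deriv (\<phi> l) 0 - \<kappa>) / l ^ M"
      by eventually_elim (simp add: d\<phi>)
  qed
  have M1: "M \<ge> 1" using M by simp
  have \<phi>an: "\<phi> 0 analytic_on {0}"
  proof -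
    have "\<phi> 0 holomorphic_on ball 0 \<rho>"
      by (rule holomorphic2_on_holomorphic_compose[OF \<phi>h, of _ "\<lambda>_. 0" "\<lambda>u. u"]) (use \<rho> in \<open>auto intro: holomorphic_intros simp: open_Times\<close>)
    then show ?thesis using \<rho>(1) unfolding analytic_at by (intro exI[of _ "ball 0 \<rho>"]) auto
  qed
  define F where "F = (\<lambda>u. (\<phi> 0 ^^ p) u - u)"
  \<comment> \<open>Subtracting a constant and \<open>fps_X\<close> does not touch the coefficient
    of order \<open>p + 1\<close>; hence \<open>b\<close> is, up to a factorial, the derivative in
    the nondegeneracy assumption.\<close>
  define FE where "FE = fps_expansion (G c1 ^^ (p * q)) (a 0) - fps_const (a 0) - fps_X"
  have FE: "F has_fps_expansion FE" unfolding F_def \<phi>i FE_def using \<alpha>(2)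
    by (auto intro!: fps_expansion_intros return_expansion)
  have Fan: "F analytic_on {0}" using has_fps_expansion_imp_analytic_0[OF FE] .
  have F_low: "taylor_coeff k F = 0" if "k \<le> p" for k
    unfolding F_def
    by (rule taylor_coeff_funpow_root_of_unity[OF \<phi>an \<phi>0 d\<phi>0 \<kappa>p p1 prim]) (use that \<rho>(1) Fan F_def in auto)
  define b where "b = taylor_coeff (p + 1) F"
  have "b = (deriv ^^ (p + 1)) (g ^^ (p * q)) (a 0) / fact (p + 1)"
    unfolding b_def taylor_coeff_eqI[OF FE] deriv_g_iter using p by (simp add: FE_def fps_expansion_def)
  then have b: "b \<noteq> 0" using nondeg fact_nonzero by (metis divide_eq_0_iff)
  have blim: "((\<lambda>x. ((\<phi> 0 ^^ p) x - x) / x ^ (p + 1)) \<longlongrightarrow> b) (at 0)"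
    unfolding b_def F_def[symmetric] using taylor_coeff_tendsto[OF Fan, of "p + 1"] F_low by (simp add: F_def)
  show False
  proof (rule root_of_unity_family_split[OF \<phi>h \<rho>(1) \<rho>(1) \<phi>0 d\<phi>0 \<kappa>p p1 prim A' M1], goal_cases)
    case sp: (4 \<rho>' \<delta>' d r C)
    have nz: "of_nat p * \<kappa> ^ (p - 1) * A \<noteq> 0" using p \<kappa>0 A(1) by simp
    show False
      by (rule parabolic_contradiction[OF \<alpha>(1,2) M p1 \<phi>i sp(1,2,5,6,8,9,10,11) nz _ b blim \<kappa>n distinct \<alpha>(3)]) (use p in auto)
  qed auto
qed

text \<open>Centred at the point of derivative 1, the return map has the exact linear term
  \<open>u\<close> for every parameter. The displacement \<open>e\<close> of that point, constant in
  \<open>u\<close>, is the whole perturbation, so \<open>s = 0\<close>.\<close>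

lemma parabolic_dichotomy_one:
  assumes \<kappa>1: "\<kappa> = 1" and nondeg: "(deriv ^^ 2) (g ^^ q) (a 0) \<noteq> 0"
    and \<alpha>: "\<alpha> analytic_on {c1}" "\<alpha> c1 = a 0" "\<forall>\<^sub>F w in nhds c1. deriv (G w ^^ q) (\<alpha> w) = 1"
    and M: "M \<ge> 2" and A: "A \<noteq> 0" and e: "e = (\<lambda>l. (G (c1 + l) ^^ q) (\<alpha> (c1 + l)) - \<alpha> (c1 + l))"
    and tc: "\<forall>j<M. taylor_coeff j e = 0" "taylor_coeff M e = A"
  shows False
proof -
  define f where "f = (\<lambda>l u. (G (c1 + l) ^^ (1 * q)) (\<alpha> (c1 + l) + u) - \<alpha> (c1 + l))"
  obtain \<rho> where \<rho>: "\<rho> > 0" "(\<lambda>l. \<alpha> (c1 + l)) holomorphic_on ball 0 \<rho>" "\<And>l. l \<in> ball 0 \<rho> \<Longrightarrow> deriv (G (c1 + l) ^^ q) (\<alpha> (c1 + l)) = 1"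
    "\<And>l u. l \<in> ball 0 \<rho> \<Longrightarrow> u \<in> ball 0 \<rho> \<Longrightarrow> (c1 + l, \<alpha> (c1 + l) + u) \<in> Dom q"
    "\<And>m. m \<le> q \<Longrightarrow> holomorphic2_on (\<lambda>l u. (G (c1 + l) ^^ m) (\<alpha> (c1 + l) + u) - \<alpha> (c1 + l)) (ball 0 \<rho> \<times> ball 0 \<rho>)"
  proof (rule local_coordinates[OF \<alpha>, of q], goal_cases)
    case (1 \<rho>)
    show ?case by (rule 1(1)[OF 1(2,3,4,5,7)])
  qed
  have o: "open (ball (0::complex) \<rho> \<times> ball (0::complex) \<rho>)" by (simp add: open_Times)
  have hf: "holomorphic2_on f (ball 0 \<rho> \<times> ball 0 \<rho>)" unfolding f_def using \<rho>(5)[of q] by simp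
  have slice: "f l holomorphic_on ball 0 \<rho>" if "l \<in> ball 0 \<rho>" for l
    by (rule holomorphic2_on_holomorphic_compose[OF hf o, of _ "\<lambda>_. l" "\<lambda>u. u"]) (use \<rho> that in \<open>auto intro: holomorphic_intros\<close>)
  have e0: "e l = f l 0" for l by (simp add: e f_def)
  have he: "e holomorphic_on ball 0 \<rho>" unfolding e0[abs_def]
    by (rule holomorphic2_on_holomorphic_compose[OF hf o, of _ "\<lambda>l. l" "\<lambda>u. 0"]) (use \<rho> in \<open>auto intro: holomorphic_intros\<close>)
  \<comment> \<open>Both the value and the derivative of \<open>r l\<close> at 0 vanish for every
    \<open>l\<close>, so a double zero is available without passing to an auxiliary family.\<close>
  define r where "r = (\<lambda>l u. f l u - u - e l)"
  have hr: "holomorphic2_on r (ball 0 \<rho> \<times> ball 0 \<rho>)" unfolding r_def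
    by (intro holomorphic2_on_diff[OF o] hf holomorphic2_on_fst_only[OF o he] holomorphic2_on_snd_only[OF o, of "\<lambda>u. u" UNIV]) auto
  have df: "(f l has_field_derivative 1) (at 0)" if "l \<in> ball 0 \<rho>" for l
  proof -
    have "(c1 + l, \<alpha> (c1 + l)) \<in> Dom q" using \<rho>(4)[OF that, of 0] \<rho>(1) by simp
    from holomorphic2_on_snd[OF hol_Dom open_Dom this]
    have "((G (c1 + l) ^^ q) has_field_derivative deriv (G (c1 + l) ^^ q) (\<alpha> (c1 + l))) (at (0 + \<alpha> (c1 + l)))"
      by (simp add: field_differentiable_derivI)
    then have "((\<lambda>u. (G (c1 + l) ^^ q) (u + \<alpha> (c1 + l)) - \<alpha> (c1 + l)) has_field_derivative deriv (G (c1 + l) ^^ q) (\<alpha> (c1 + l)) - 0) (at 0)"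
      by (intro DERIV_diff DERIV_const) (simp only: DERIV_shift)
    then show ?thesis using \<rho>(3)[OF that] by (simp add: f_def add.commute)
  qed
  define \<sigma> where "\<sigma> = \<rho> / 2"
  have \<sigma>: "\<sigma> > 0" "\<sigma> < \<rho>" using \<rho>(1) by (auto simp: \<sigma>_def)
  have sub: "ball (0::complex) \<sigma> \<subseteq> ball 0 \<rho>" "cball (0::complex) \<sigma> \<subseteq> ball 0 \<rho>" using \<sigma> by auto
  obtain B1 where B1: "\<And>l u. l \<in> cball 0 \<sigma> \<Longrightarrow> u \<in> cball 0 \<sigma> \<Longrightarrow> norm (r l u) \<le> B1"
  proof -
    have "bounded ((\<lambda>(l, u). r l u) ` (cball 0 \<sigma> \<times> cball 0 \<sigma>))"
      by (intro compact_imp_bounded compact_continuous_image compact_Times compact_cball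
          continuous_on_subset[OF holomorphic2_on_imp_continuous_on[OF hr]] Sigma_mono sub)
    then show thesis using that unfolding bounded_iff by fastforce
  qed
  define eA where "eA = (\<lambda>l. e l - A * l ^ M)"
  have heA: "eA holomorphic_on ball 0 \<rho>" unfolding eA_def by (intro holomorphic_intros he)
  obtain B2 where B2: "\<And>l. l \<in> cball 0 \<sigma> \<Longrightarrow> norm (e l) \<le> B2"
    using compact_imp_bounded[OF compact_continuous_image[OF continuous_on_subset[OF holomorphic_on_imp_continuous_on[OF he] sub(2)] compact_cball]]
    unfolding bounded_iff by fastforce
  obtain B3 where B3: "\<And>l. l \<in> cball 0 \<sigma> \<Longrightarrow> norm (eA l) \<le> B3"
    using compact_imp_bounded[OF compact_continuous_image[OF continuous_on_subset[OF holomorphic_on_imp_continuous_on[OF heA] sub(2)] compact_cball]]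
    unfolding bounded_iff by fastforce
  have ean: "e analytic_on {0}" using he \<rho>(1) unfolding analytic_at by (intro exI[of _ "ball 0 \<rho>"]) auto
  have tA: "taylor_coeff k eA = 0" if "k < M + 1" for k
  proof -
    have "taylor_coeff k (\<lambda>l. A * l ^ M) = (if k = M then A else 0)"
      using taylor_coeff_polynomial[of k "\<lambda>i. if i = M then A else 0" "M + 1"] that by simp
    moreover have "taylor_coeff k e = (if k = M then A else 0)" using tc that by auto
    moreover have "(\<lambda>l. A * l ^ M) analytic_on {0}" by (intro analytic_intros)
    ultimately show ?thesis unfolding eA_def by (subst taylor_coeff_diff[OF ean]) auto
  qed
  define K where "K = (4 / \<sigma>) ^ (M + 1)"
  define C where "C = 2 * B2 * (4 / \<sigma>) ^ M + 2 * B1 * (4 / \<sigma>) ^ 2"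
  have B0: "B1 \<ge> 0" "B2 \<ge> 0" "B3 \<ge> 0" using order_trans[OF norm_ge_zero B1[of 0 0]] order_trans[OF norm_ge_zero B2[of 0]]
      order_trans[OF norm_ge_zero B3[of 0]] \<sigma> by auto
  have e_bd: "norm (e l) \<le> C * norm l ^ M" if "l \<in> ball 0 \<sigma>" for l
  proof -
    have "norm (e l) \<le> 2 * B2 * (4 * norm l / \<sigma>) ^ M"
      by (rule zero_order_bound[OF holomorphic_on_subset[OF he sub(1)] \<sigma>(1) B2]) (use tc that in auto)
    also have "\<dots> = 2 * B2 * (4 / \<sigma>) ^ M * norm l ^ M" by (simp add: power_mult_distrib power_divide)
    also have "\<dots> \<le> C * norm l ^ M" using B0 \<sigma> by (intro mult_right_mono) (auto simp: C_def)
    finally show ?thesis .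
  qed
  have r_bd: "norm (r l u) \<le> C * norm u ^ (1 + 1)" if "l \<in> ball 0 \<sigma>" "u \<in> ball 0 \<sigma>" for l u
  proof -
    have l: "l \<in> ball 0 \<rho>" using that sub by auto
    have "(r l has_field_derivative 1 - 1 - 0) (at 0)" unfolding r_def by (intro DERIV_diff df[OF l] DERIV_ident DERIV_const)
    then have tr: "taylor_coeff k (r l) = 0" if "k < 2" for k
      using that by (cases k) (auto simp: taylor_coeff_1 DERIV_imp_deriv r_def e0)
    have "norm (r l u) \<le> 2 * B1 * (4 * norm u / \<sigma>) ^ 2"
      by (rule zero_order_bound[OF _ \<sigma>(1) _ tr]) (use that B1 l sub slice[OF l] in \<open>auto simp: r_def intro!: holomorphic_intros elim: holomorphic_on_subset\<close>)
    also have "\<dots> = 2 * B1 * (4 / \<sigma>) ^ 2 * norm u ^ 2" by (simp add: power_mult_distrib power_divide)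
    also have "\<dots> \<le> C * norm u ^ 2" using B0 \<sigma> by (intro mult_right_mono) (auto simp: C_def)
    finally show ?thesis by (simp add: numeral_2_eq_2)
  qed
  have A_bd: "norm (e l - A * l ^ M * u ^ 0) \<le> (2 * B3 * K) * norm l ^ M * (norm u ^ (0 + 1) + norm l)" if "l \<in> ball 0 \<sigma>" for l u
  proof -
    have "norm (eA l) \<le> 2 * B3 * (4 * norm l / \<sigma>) ^ (M + 1)"
      by (rule zero_order_bound[OF holomorphic_on_subset[OF heA sub(1)] \<sigma>(1) B3 tA]) (use that in auto)
    also have "\<dots> = (2 * B3 * K) * norm l ^ M * norm l" by (simp add: K_def power_mult_distrib power_divide)
    also have "\<dots> \<le> (2 * B3 * K) * norm l ^ M * (norm u ^ (0 + 1) + norm l)"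
      using B0 \<sigma> by (intro mult_left_mono) (auto simp: K_def)
    finally show ?thesis by (simp add: eA_def)
  qed
  define F where "F = (\<lambda>u. f 0 u - u)"
  define FE where "FE = fps_expansion (G c1 ^^ q) (a 0) - fps_const (a 0) - fps_X"
  have FE: "F has_fps_expansion FE" unfolding F_def f_def FE_def using \<alpha>(2)
    by (auto intro!: fps_expansion_intros return_expansion)
  have Fan: "F analytic_on {0}" using has_fps_expansion_imp_analytic_0[OF FE] .
  have F_low: "taylor_coeff k F = 0" if "k < 2" for k
  proof -
    have f00: "f 0 0 = 0" using tc(1) M e0[of 0] by (metis taylor_coeff_0 zero_less_numeral order_less_le_trans)
    have "(F has_field_derivative 1 - 1) (at 0)" unfolding F_def by (intro DERIV_diff df DERIV_ident) (use \<rho> in simp)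
    then show ?thesis using that f00 by (cases k) (auto simp: taylor_coeff_1 DERIV_imp_deriv F_def)
  qed
  define b where "b = taylor_coeff 2 F"
  have "b = (deriv ^^ 2) (g ^^ q) (a 0) / fact 2"
    unfolding b_def taylor_coeff_eqI[OF FE] deriv_g_iter by (simp add: FE_def fps_expansion_def)
  then have b: "b \<noteq> 0" using nondeg fact_nonzero by (metis divide_eq_0_iff)
  have blim: "((\<lambda>x. (f 0 x - x) / x ^ (1 + 1)) \<longlongrightarrow> b) (at 0)"
    using taylor_coeff_tendsto[OF Fan F_low, of 2] by (simp add: b_def F_def numeral_2_eq_2)
  have sub2: "ball (0::complex) \<sigma> \<times> ball (0::complex) \<sigma> \<subseteq> ball 0 \<rho> \<times> ball 0 \<rho>" using sub by auto
  have split: "f l u = u + e l + r l u" for l u by (simp add: r_def)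
  have f_eq: "f l u = (G (c1 + l) ^^ (1 * q)) (\<alpha> (c1 + l) + u) - \<alpha> (c1 + l)" for l u by (simp add: f_def)
  show False
    by (rule parabolic_contradiction[OF \<alpha>(1,2) M order_refl f_eq \<sigma>(1) \<sigma>(1) holomorphic2_on_subset[OF hf sub2]
        holomorphic2_on_subset[OF hr sub2] split e_bd r_bd A_bd A _ b blim _ _]) (use \<kappa>1 in auto)
qed

end

section \<open>The attracting case\<close>

lemma holomorphic_lipschitz_on_cball:
  fixes f :: "complex \<Rightarrow> complex"
  assumes f: "f holomorphic_on ball 0 s" and d: "d < s"
  shows "\<exists>L. L-lipschitz_on (cball 0 d) f"
proof -
  have sub: "cball (0::complex) d \<subseteq> ball 0 s" using d by auto
  have "deriv f holomorphic_on ball 0 s" by (rule holomorphic_deriv[OF f open_ball])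
  then have "continuous_on (cball 0 d) (deriv f)" using sub holomorphic_on_imp_continuous_on holomorphic_on_subset by blast
  from compact_imp_bounded[OF compact_continuous_image[OF this compact_cball]]
  obtain B where B: "\<And>z. z \<in> cball 0 d \<Longrightarrow> norm (deriv f z) \<le> B" unfolding bounded_iff by blast
  have "(max B 0)-lipschitz_on (cball 0 d) f"
  proof (rule lipschitz_onI)
    fix x y :: complex assume xy: "x \<in> cball 0 d" "y \<in> cball 0 d"
    have "norm (f x - f y) \<le> max B 0 * norm (x - y)"
    proof (rule field_differentiable_bound[OF convex_cball _ _ xy])
      fix z assume z: "z \<in> cball (0::complex) d"
      show "(f has_field_derivative deriv f z) (at z within cball 0 d)"
        by (rule has_field_derivative_at_within, rule holomorphic_derivI[OF f open_ball]) (use z sub in auto)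
      show "norm (deriv f z) \<le> max B 0" using B[OF z] by simp
    qed
    then show "dist (f x) (f y) \<le> max B 0 * dist x y" by (simp add: dist_norm)
  qed simp
  then show ?thesis by blast
qed

lemma lipschitz_on_image_of_expanding:
  fixes P :: "complex \<Rightarrow> complex" and v w :: "complex \<Rightarrow> complex"
  assumes v: "L-lipschitz_on T v" and P: "m > 0" "\<And>t t'. t \<in> T \<Longrightarrow> t' \<in> T \<Longrightarrow> m * norm (t - t') \<le> norm (P t - P t')"
    and w: "\<And>t. t \<in> T \<Longrightarrow> w (P t) = v t"
  shows "(L / m)-lipschitz_on (P ` T) w"
proof (rule lipschitz_onI)
  have L: "L \<ge> 0" using lipschitz_on_nonneg[OF v] .
  then show "0 \<le> L / m" using P by simp
  fix x y assume "x \<in> P ` T" "y \<in> P ` T"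
  then obtain t t' where t: "t \<in> T" "t' \<in> T" "x = P t" "y = P t'" by blast
  have "dist (w x) (w y) \<le> L * dist t t'" unfolding t using lipschitz_onD[OF v t(1,2)] t w by simp
  also have "\<dots> = L / m * (m * norm (t - t'))" using P by (simp add: dist_norm)
  also have "\<dots> \<le> L / m * dist x y" using P(2)[OF t(1,2)] P(1) L by (intro mult_left_mono) (auto simp: dist_norm t)
  finally show "dist (w x) (w y) \<le> L / m * dist x y" .
qed

context transversality_setting
begin

text \<open>\<open>t0\<close> and \<open>n1\<close> are the Koenigs coordinate and the time of entry
  of the orbit into small discs around the cycle. The set \<open>X\<close> consists of the orbit and
  these discs; Koenigs curves rescaled to match the orbit at entry make its germs one compatible
  family, with an error \<open>\<Delta>\<close> only where a turn around the cycle is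
  completed.\<close>

lemma hyperbolic_contradiction:
  fixes \<Psi> :: "complex \<Rightarrow> complex \<Rightarrow> complex"
  defines "P \<equiv> \<lambda>i t. (G c1 ^^ i) (a 0 + \<Psi> 0 t)"
  assumes \<alpha>: "\<alpha> analytic_on {c1}" "\<alpha> c1 = a 0" and \<rho>: "\<rho> > 0" "(\<lambda>l. \<alpha> (c1 + l)) holomorphic_on ball 0 \<rho>"
    and dom: "\<And>l u. l \<in> ball 0 \<rho> \<Longrightarrow> u \<in> ball 0 \<rho> \<Longrightarrow> (c1 + l, \<alpha> (c1 + l) + u) \<in> Dom q"
    and r: "r > 0" "r \<le> \<rho>" and \<Psi>h: "holomorphic2_on \<Psi> (ball 0 r \<times> ball 0 r)"
    and \<Psi>m: "\<And>l t. l \<in> ball 0 r \<Longrightarrow> t \<in> ball 0 r \<Longrightarrow> \<Psi> l t \<in> ball 0 \<rho>" and \<Psi>0: "\<Psi> 0 0 = 0" and d\<Psi>: "deriv (\<Psi> 0) 0 \<noteq> 0"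
    and conj: "\<And>l t. l \<in> ball 0 r \<Longrightarrow> t \<in> ball 0 r \<Longrightarrow>
        (G (c1 + l) ^^ q) (\<alpha> (c1 + l) + \<Psi> l t) = \<alpha> (c1 + l) + (\<Psi> l (\<kappa> * t) + K l * \<Psi> l t)"
    and K: "K 0 = 0" "((\<lambda>l. K l / l ^ M) \<longlongrightarrow> A) (at 0)" and A: "A \<noteq> 0" and M: "M \<ge> 2"
    and \<kappa>: "0 < norm \<kappa>" "norm \<kappa> < 1"
    and s: "s > 0" "2 * s \<le> r" and near: "\<And>i t. i < q \<Longrightarrow> t \<in> ball 0 s \<Longrightarrow> P i t \<in> ball (a i) \<epsilon>"
    and disj: "\<And>i j. i < q \<Longrightarrow> j < q \<Longrightarrow> i \<noteq> j \<Longrightarrow> ball (a i) \<epsilon> \<inter> ball (a j) \<epsilon> = {}" and \<epsilon>: "\<epsilon> \<le> r0"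
    and expand: "\<And>i. i < q \<Longrightarrow> \<exists>m>0. \<forall>t\<in>ball 0 s. \<forall>t'\<in>ball 0 s. m * norm (t - t') \<le> norm (P i t - P i t')"
    and t0: "norm t0 < \<delta>" "\<delta> < s" "norm \<kappa> * \<delta> < norm t0"
    and \<tau>: "\<tau> analytic_on {0}" "\<tau> 0 = 1" and entry: "\<forall>\<^sub>F l in nhds 0. \<alpha> (c1 + l) + \<Psi> l (\<tau> l * t0) = orbit_germ n1 l" and n1: "n1 \<ge> 1"
  shows False
proof -
  have \<delta>0: "\<delta> > 0" using t0(1) norm_ge_zero[of t0] by linarith
  have sr: "ball (0::complex) s \<subseteq> ball 0 r" using s by auto
  have \<delta>s: "cball (0::complex) \<delta> \<subseteq> ball 0 s" "ball (0::complex) \<delta> \<subseteq> ball 0 s" "ball (0::complex) \<delta> \<subseteq> cball 0 \<delta>" using t0 by auto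
  have r\<rho>: "ball (0::complex) r \<subseteq> ball 0 \<rho>" using r by auto
  have z_r: "(0::complex) \<in> ball 0 r" "(0::complex) \<in> ball 0 s" "(0::complex) \<in> ball 0 \<delta>" using r s \<delta>0 by auto
  have \<kappa>s: "\<kappa> ^ k * t \<in> ball 0 e" if "t \<in> ball 0 e" for k t e
  proof -
    have "norm (\<kappa> ^ k * t) \<le> 1 * norm t" unfolding norm_mult norm_power
      by (rule mult_right_mono) (use \<kappa> in \<open>auto intro: power_le_one\<close>)
    then show ?thesis using that by simp
  qed
  have Pdom: "(c1, a 0 + \<Psi> 0 t) \<in> Dom q" if "t \<in> ball 0 s" for t
    using dom[of 0 "\<Psi> 0 t"] \<Psi>m[of 0 t] that sr z_r \<rho> \<alpha>(2) by auto
  have PU: "P i t \<in> U" if "i < q" "t \<in> ball 0 s" for i t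
    using Pdom[OF that(2)] that(1) by (simp add: Dom_def P_def)
  have gP: "g (P i t) = P (Suc i) t" if "i < q" "t \<in> ball 0 s" for i t
    using basic(8)[OF PU[OF that]] by (simp add: P_def)
  have Pq: "P q t = P 0 (\<kappa> * t)" if "t \<in> ball 0 s" for t
    using conj[of 0 t] that sr z_r by (auto simp: P_def \<alpha> K)
  have orb: "(g ^^ n) (P 0 t) = P (n mod q) (\<kappa> ^ (n div q) * t)" if t: "t \<in> ball 0 s" for n t
  proof (induction n)
    case (Suc n)
    have "g (P (n mod q) (\<kappa> ^ (n div q) * t)) = P (Suc (n mod q)) (\<kappa> ^ (n div q) * t)"
      by (rule gP) (use q0 \<kappa>s[OF t] in auto)
    moreover have "P q (\<kappa> ^ (n div q) * t) = P 0 (\<kappa> * (\<kappa> ^ (n div q) * t))" by (rule Pq[OF \<kappa>s[OF t]])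
    ultimately show ?case using Suc by (auto simp: mod_Suc div_Suc mult.assoc)
  qed simp
  have P_g: "P i t = (g ^^ i) (P 0 t)" if "i < q" "t \<in> ball 0 s" for i t
    using orb[OF that(2), of i] that(1) by simp
  have P0: "P i 0 = a i" if "i < q" for i using G_iter_a[OF q0, of i] that by (simp add: P_def \<Psi>0)
  have inj_i: "i = j" if "P i t = P j t'" "i < q" "j < q" "t \<in> ball 0 s" "t' \<in> ball 0 s" for i j t t'
    using near[of i t] near[of j t'] disj[of i j] that by (metis disjoint_iff)
  have inj_t: "t = t'" if "P i t = P i t'" "i < q" "t \<in> ball 0 s" "t' \<in> ball 0 s" for i t t'
  proof -
    obtain m where m: "m > 0" "\<forall>t\<in>ball 0 s. \<forall>t'\<in>ball 0 s. m * norm (t - t') \<le> norm (P i t - P i t')" using expand[OF \<open>i < q\<close>] by blast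
    have "m * norm (t - t') \<le> 0" using m(2) that by force
    then show ?thesis using m(1) by (simp add: mult_le_0_iff)
  qed
  have hP: "P i holomorphic_on ball 0 s" if "i \<le> q" for i
  proof -
    have h: "(\<lambda>t. \<Psi> 0 t) holomorphic_on ball 0 s"
      by (rule holomorphic2_on_holomorphic_compose[OF \<Psi>h, of _ "\<lambda>_. 0" "\<lambda>t. t"]) (use sr z_r in \<open>auto intro: holomorphic_intros simp: open_Times\<close>)
    show ?thesis unfolding P_def
      by (rule holomorphic2_on_holomorphic_compose[OF hol_Dom open_Dom]) (use h Pdom Dom_mono[OF that] in \<open>auto intro!: holomorphic_intros\<close>)
  qed
  have h\<Psi>: "(\<lambda>t. \<Psi> 0 t) holomorphic_on ball 0 s" using hP[of 0] holomorphic_on_diff[OF hP[of 0] holomorphic_on_const[of "a 0"]]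
    by (simp add: P_def)
  define N where "N = (\<Union>i<q. P i ` ball 0 \<delta>)"
  have c_n1: "c n1 = P 0 t0" using eventually_nhds_x_imp_x[OF entry] by (simp add: \<alpha> \<tau> orbit_germ_0 P_def)
  have t0s: "t0 \<in> ball 0 s" "t0 \<in> ball 0 \<delta>" using t0 by auto
  \<comment> \<open>An earlier visit would be followed by at least one complete turn before time
    \<open>n1\<close>, leaving a coordinate of modulus at most
    \<open>norm \<kappa> * \<delta>\<close>, less than \<open>norm t0\<close>. The closed disc is
    excluded because separation by compact sets is used later.\<close>
  have before: "c n \<notin> P i ` cball 0 \<delta>" if "n < n1" "i < q" for n i
  proof
    assume "c n \<in> P i ` cball 0 \<delta>"
    then obtain t where t: "c n = P i t" "norm t \<le> \<delta>" by auto
    have ts: "t \<in> ball 0 s" using t \<delta>s by auto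
    have "c n1 = (g ^^ (n1 - n)) (c n)" using c_add[of "n1 - n" n] that by simp
    also have "\<dots> = (g ^^ (n1 - n + i)) (P 0 t)" unfolding t(1) P_g[OF that(2) ts] by (simp add: funpow_add)
    finally have eq: "P 0 t0 = P ((n1 - n + i) mod q) (\<kappa> ^ ((n1 - n + i) div q) * t)" unfolding orb[OF ts] c_n1 .
    then have m0: "(n1 - n + i) mod q = 0" using inj_i[OF eq q0 _ t0s(1) \<kappa>s[OF ts]] q0 by simp
    then have "t0 = \<kappa> ^ ((n1 - n + i) div q) * t" using inj_t[OF _ q0 t0s(1) \<kappa>s[OF ts]] eq by simp
    moreover have "(n1 - n + i) div q \<noteq> 0" using m0 that q0 by (auto simp: div_eq_0_iff)
    then obtain k where "(n1 - n + i) div q = Suc k" using not0_implies_Suc by blast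
    ultimately have "norm t0 = norm \<kappa> * norm (\<kappa> ^ k * t)" by (simp add: norm_mult)
    also have "\<dots> \<le> norm \<kappa> * \<delta>"
    proof (rule mult_left_mono)
      have "norm (\<kappa> ^ k * t) \<le> 1 * norm t" unfolding norm_mult norm_power
        by (rule mult_right_mono) (use \<kappa> in \<open>auto intro: power_le_one\<close>)
      then show "norm (\<kappa> ^ k * t) \<le> \<delta>" using t by simp
    qed simp
    finally show False using t0 by simp
  qed
  have after: "c (n1 + n) = P (n mod q) (\<kappa> ^ (n div q) * t0)" for n
    using orb[OF t0s(1), of n] c_add[of n n1] by (simp add: c_n1 add.commute)
  have N_I: "P i t \<in> N" if "i < q" "t \<in> ball 0 \<delta>" for i t unfolding N_def using that by blast
  have gN: "g (P i t) = (if Suc i < q then P (Suc i) t else P 0 (\<kappa> * t))" if "i < q" "t \<in> ball 0 \<delta>" for i t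
    using gP[of i t] Pq[of t] that \<delta>s by (cases "Suc i = q") auto
  have N_Omega: "N \<subseteq> Omega U g (a ` {..<q}) r0"
  proof
    fix x assume "x \<in> N"
    then obtain i t where x: "x = P i t" "i < q" "t \<in> ball 0 \<delta>" by (auto simp: N_def)
    have ts: "t \<in> ball 0 s" using x \<delta>s by auto
    have x_orb: "(g ^^ n) x = P ((n + i) mod q) (\<kappa> ^ ((n + i) div q) * t)" for n
      unfolding x(1) P_g[OF x(2) ts] orb[OF ts, symmetric] by (simp add: funpow_add)
    have xU: "(g ^^ n) x \<in> U" for n unfolding x_orb by (rule PU) (use q0 \<kappa>s[OF ts] in auto)
    have inf: "infdist ((g ^^ n) x) (a ` {..<q}) \<le> dist ((g ^^ n) x) (a ((n + i) mod q))" for n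
      by (rule infdist_le) (use q0 in auto)
    have "dist ((g ^^ n) x) (a ((n + i) mod q)) < \<epsilon>" for n
      using near[of "(n + i) mod q" "\<kappa> ^ ((n + i) div q) * t"] q0 \<kappa>s[OF ts] unfolding x_orb by (simp add: dist_commute)
    then have inf_r0: "infdist ((g ^^ n) x) (a ` {..<q}) \<le> r0" for n using inf[of n] \<epsilon> by (meson less_imp_le order_trans)
    have "\<forall>j\<in>{..<q}. \<exists>L. L-lipschitz_on (cball 0 \<delta>) (P j)"
      using holomorphic_lipschitz_on_cball[OF hP t0(2)] by auto
    from bchoice[OF this] obtain L where L: "\<forall>j\<in>{..<q}. (L j)-lipschitz_on (cball 0 \<delta>) (P j)" by (elim exE)
    define LL where "LL = (\<Sum>j<q. L j)"
    have bd: "infdist ((g ^^ n) x) (a ` {..<q}) \<le> LL * \<delta> * norm \<kappa> ^ ((n + i) div q)" for n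
    proof -
      define j where "j = (n + i) mod q"
      have j: "j < q" using q0 by (simp add: j_def)
      have m: "\<kappa> ^ ((n + i) div q) * t \<in> cball 0 \<delta>" "0 \<in> cball (0::complex) \<delta>" using \<kappa>s[OF x(3), of "(n + i) div q"] \<delta>0 by auto
      have "infdist ((g ^^ n) x) (a ` {..<q}) \<le> dist (P j (\<kappa> ^ ((n + i) div q) * t)) (P j 0)"
        using inf[of n] unfolding x_orb using P0[OF j] by (simp add: j_def)
      also have "\<dots> \<le> L j * dist (\<kappa> ^ ((n + i) div q) * t) 0" by (rule lipschitz_onD[OF _ m]) (use L j in simp)
      also have "\<dots> \<le> LL * (norm \<kappa> ^ ((n + i) div q) * \<delta>)"
      proof (rule mult_mono)
        show "L j \<le> LL" unfolding LL_def by (rule member_le_sum) (use j L lipschitz_on_nonneg in auto)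
        then show "0 \<le> LL" using L j lipschitz_on_nonneg by force
        show "dist (\<kappa> ^ ((n + i) div q) * t) 0 \<le> norm \<kappa> ^ ((n + i) div q) * \<delta>"
          using x(3) by (auto simp: dist_norm norm_mult norm_power intro: mult_left_mono)
      qed simp
      finally show ?thesis by (simp add: mult_ac)
    qed
    have "filterlim (\<lambda>n. (n + i) div q) at_top sequentially"
      unfolding filterlim_at_top
    proof
      fix Z
      show "\<forall>\<^sub>F n in sequentially. Z \<le> (n + i) div q"
        using eventually_ge_at_top[of "Z * q"]
      proof eventually_elim
        case (elim n)
        then have "Z * q div q \<le> (n + i) div q" by (intro div_le_mono) simp
        then show ?case using q0 by simp
      qed
    qed
    from filterlim_compose[OF LIMSEQ_power_zero[of "norm \<kappa>"] this] have "(\<lambda>n. norm \<kappa> ^ ((n + i) div q)) \<longlonglongrightarrow> 0" using \<kappa> by simp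
    then have lim0: "(\<lambda>n. LL * \<delta> * norm \<kappa> ^ ((n + i) div q)) \<longlonglongrightarrow> 0" by (rule tendsto_mult_right_zero)
    have "(\<lambda>n. infdist ((g ^^ n) x) (a ` {..<q})) \<longlonglongrightarrow> 0"
      by (rule tendsto_sandwich[OF _ _ tendsto_const lim0]) (intro always_eventually allI bd infdist_nonneg)+
    then show "x \<in> Omega U g (a ` {..<q}) r0" using xU[of 0] xU inf_r0 by (simp add: Omega_def iterate_defined_def)
  qed
  define X where "X = range c \<union> N"
  have X_cases: "(\<exists>n<n1. x = c n \<and> x \<notin> N) \<or> (\<exists>i<q. \<exists>t\<in>ball 0 \<delta>. x = P i t)" if "x \<in> X" for x
  proof (cases "x \<in> N")
    case True
    then show ?thesis by (auto simp: N_def)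
  next
    case False
    then obtain n where n: "x = c n" using \<open>x \<in> X\<close> by (auto simp: X_def)
    have "n < n1"
    proof (rule ccontr)
      assume "\<not> n < n1"
      then have "c n = P ((n - n1) mod q) (\<kappa> ^ ((n - n1) div q) * t0)" using after[of "n - n1"] by simp
      then show False using False N_I[of "(n - n1) mod q" "\<kappa> ^ ((n - n1) div q) * t0"] \<kappa>s[OF t0s(2)] q0 n by simp
    qed
    then show ?thesis using n False by blast
  qed
  have c_notN: "c n \<notin> N" if "n < n1" for n using before[OF that] \<delta>s by (fastforce simp: N_def)
  \<comment> \<open>Multiplication by \<open>\<tau> l\<close> commutes with multiplication by
    \<open>\<kappa>\<close>, so the rescaled curves still follow one another under the dynamics up
    to the term \<open>K l\<close>, while at \<open>t0\<close> they coincide with the germ of the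
    orbit.\<close>
  define \<Gamma> where "\<Gamma> = (\<lambda>i t l. (G (c1 + l) ^^ i) (\<alpha> (c1 + l) + \<Psi> l (\<tau> l * t)))"
  \<comment> \<open>Germs must be attached to points; on \<open>N\<close> the position in the cycle
    and the coordinate can be recovered from the point because the discs are disjoint and
    injectively parametrised.\<close>
  define co where "co = inv_into ({..<q} \<times> ball 0 \<delta>) (\<lambda>(i, t). P i t)"
  have inj: "inj_on (\<lambda>(i, t). P i t) ({..<q} \<times> ball 0 \<delta>)"
  proof (rule inj_onI, clarify)
    fix i t j t' assume *: "i < q" "t \<in> ball (0::complex) \<delta>" "j < q" "t' \<in> ball (0::complex) \<delta>" "P i t = P j t'"
    have tt: "t \<in> ball 0 s" "t' \<in> ball 0 s" using * \<delta>s by auto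
    have "i = j" using inj_i[OF *(5,1,3) tt] .
    then show "i = j \<and> t = t'" using inj_t[OF _ _ tt] * by auto
  qed
  have co: "co (P i t) = (i, t)" if "i < q" "t \<in> ball 0 \<delta>" for i t
    using inv_into_f_f[OF inj, of "(i, t)"] that by (simp add: co_def)
  define \<gamma> where "\<gamma> = (\<lambda>x. if x \<in> N then \<Gamma> (fst (co x)) (snd (co x)) else germ_at x)"
  have \<gamma>P: "\<gamma> (P i t) = \<Gamma> i t" if "i < q" "t \<in> ball 0 \<delta>" for i t using co[OF that] N_I[OF that] by (simp add: \<gamma>_def)
  have \<gamma>c: "\<gamma> (c n) = orbit_germ n" if "n < n1" for n using c_notN[OF that] by (simp add: \<gamma>_def)
  \<comment> \<open>Only the completion of a turn multiplies the coordinate by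
    \<open>\<kappa>\<close>; there the return map differs from the linearised one by
    \<open>K l\<close> times the displacement, and \<open>K l\<close> is \<open>A * l ^ M\<close> to
    leading order.\<close>
  define \<Delta> where "\<Delta> = (\<lambda>x. if x \<in> N \<and> Suc (fst (co x)) = q then A * \<Psi> 0 (snd (co x)) else 0)"
  have \<Delta>P: "\<Delta> (P i t) = (if Suc i = q then A * \<Psi> 0 t else 0)" if "i < q" "t \<in> ball 0 \<delta>" for i t
    using co[OF that] N_I[OF that] by (simp add: \<Delta>_def)
  have \<Delta>c: "\<Delta> (c n) = 0" if "n < n1" for n using c_notN[OF that] by (simp add: \<Delta>_def)
  obtain T where T: "open T" "0 \<in> T" "\<tau> holomorphic_on T" using \<tau>(1) by (auto simp: analytic_at)
  have "isCont \<tau> 0" using T holomorphic_on_imp_continuous_on continuous_on_eq_continuous_at by blast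
  then have "\<forall>\<^sub>F l in nhds 0. dist (\<tau> l) 1 < 1"
    using \<tau>(2) unfolding isCont_def tendsto_at_iff_tendsto_nhds by (intro tendstoD) auto
  then have "\<forall>\<^sub>F l in nhds 0. dist (\<tau> l) 1 < 1 \<and> l \<in> T \<and> l \<in> ball 0 r"
    using eventually_nhds_in_open[OF T(1,2)] eventually_nhds_in_open[OF open_ball z_r(1)] by eventually_elim simp
  then obtain \<sigma> where \<sigma>: "\<sigma> > 0" "\<And>l. l \<in> ball 0 \<sigma> \<Longrightarrow> dist (\<tau> l) 1 < 1 \<and> l \<in> T \<and> l \<in> ball 0 r"
    unfolding eventually_nhds_metric by (auto simp: dist_commute)
  \<comment> \<open>\<open>\<tau>\<close> stays within distance 1 of its value 1, so rescaling at
    most doubles the coordinate; hence the assumption \<open>2 * s \<le> r\<close>.\<close>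
  have \<tau>t: "\<tau> l * t \<in> ball 0 r" if "l \<in> ball 0 \<sigma>" "t \<in> ball 0 s" for l t
  proof -
    have "norm (\<tau> l) \<le> 2" using \<sigma>(2)[OF that(1)] norm_triangle_ineq2[of "\<tau> l" 1] by (simp add: dist_norm)
    then have "norm (\<tau> l * t) \<le> 2 * norm t" by (simp add: norm_mult mult_right_mono)
    then show ?thesis using that s by auto
  qed
  have so: "open (ball (0::complex) \<sigma> \<times> ball (0::complex) s)" by (simp add: open_Times)
  have h1: "holomorphic2_on (\<lambda>l t. l) (ball 0 \<sigma> \<times> ball 0 s)" by (rule holomorphic2_on_fst_only[OF so, of "\<lambda>l. l" UNIV]) auto
  have h1': "holomorphic2_on (\<lambda>l t. c1 + l) (ball 0 \<sigma> \<times> ball 0 s)"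
    by (rule holomorphic2_on_fst_only[OF so, of "\<lambda>l. c1 + l" UNIV]) (auto intro: holomorphic_intros)
  have h2: "holomorphic2_on (\<lambda>l t. \<tau> l * t) (ball 0 \<sigma> \<times> ball 0 s)"
    by (intro holomorphic2_on_mult[OF so] holomorphic2_on_fst_only[OF so T(3,1)] holomorphic2_on_snd_only[OF so, of "\<lambda>u. u" UNIV]) (use \<sigma>(2) in auto)
  have h3: "holomorphic2_on (\<lambda>l t. \<Psi> l (\<tau> l * t)) (ball 0 \<sigma> \<times> ball 0 s)"
    by (rule holomorphic2_on_compose[OF \<Psi>h _ so h1 h2]) (use \<sigma>(2) \<tau>t in \<open>auto simp: open_Times\<close>)
  have h4: "holomorphic2_on (\<lambda>l t. \<alpha> (c1 + l)) (ball 0 \<sigma> \<times> ball 0 s)"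
    by (rule holomorphic2_on_fst_only[OF so \<rho>(2)]) (use \<sigma>(2) r\<rho> in auto)
  have h5: "holomorphic2_on (\<lambda>l t. \<Gamma> i t l) (ball 0 \<sigma> \<times> ball 0 s)" if "i \<le> q" for i unfolding \<Gamma>_def
  proof (rule holomorphic2_on_compose[OF hol_Dom[of i] open_Dom so h1' holomorphic2_on_add[OF so h4 h3]])
    fix l t assume "(l, t) \<in> ball (0::complex) \<sigma> \<times> ball (0::complex) s"
    then have "l \<in> ball 0 r" "\<tau> l * t \<in> ball 0 r" using \<sigma>(2) \<tau>t by auto
    then have "(c1 + l, \<alpha> (c1 + l) + \<Psi> l (\<tau> l * t)) \<in> Dom q" using dom \<Psi>m r\<rho> by blast
    then show "(c1 + l, \<alpha> (c1 + l) + \<Psi> l (\<tau> l * t)) \<in> Dom i" using Dom_mono[OF that] by blast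
  qed
  have tc_hol: "(\<lambda>t. taylor_coeff j (\<Gamma> i t)) holomorphic_on ball 0 s" if "i \<le> q" for i j
    using holomorphic2_on_taylor_coeff[OF h5[OF that] \<sigma>(1) open_ball, of j] by simp
  have \<Gamma>_an: "\<Gamma> i t analytic_on {0}" if "i \<le> q" "t \<in> ball 0 s" for i t
  proof -
    have "(\<lambda>l. \<Gamma> i t l) holomorphic_on ball 0 \<sigma>"
      by (rule holomorphic2_on_holomorphic_compose[OF h5[OF that(1)] so]) (use that in \<open>auto intro: holomorphic_intros\<close>)
    then show ?thesis using \<sigma>(1) unfolding analytic_at by (intro exI[of _ "ball 0 \<sigma>"]) auto
  qed
  have \<Gamma>0: "\<Gamma> i t 0 = P i t" for i t by (simp add: \<Gamma>_def P_def \<alpha> \<tau>)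
  have XK: "X \<subseteq> marked_orbit g c1 \<union> Omega U g (a ` {..<q}) r0" using N_Omega by (auto simp: X_def marked_orbit_c)
  have c1X: "c1 \<in> X" using rangeI[of c 0] by (simp add: X_def)
  have \<kappa>\<delta>: "\<kappa> * t \<in> ball 0 \<delta>" if "t \<in> ball 0 \<delta>" for t using \<kappa>s[OF that, of 1] by simp
  have gX: "g ` X \<subseteq> X"
  proof
    fix y assume "y \<in> g ` X"
    then obtain x where x: "x \<in> X" "y = g x" by blast
    from X_cases[OF x(1)] show "y \<in> X"
    proof (elim disjE exE bexE conjE)
      fix n assume "x = c n"
      then show ?thesis by (auto simp: x X_def simp flip: c_Suc)
    next
      fix i t assume "i < q" "t \<in> ball 0 \<delta>" "x = P i t"
      then show ?thesis using N_I[of "Suc i" t] N_I[OF q0 \<kappa>\<delta>, of t] by (auto simp: x gN X_def)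
    qed
  qed
  have \<gamma>1: "\<gamma> x analytic_on {0}" and \<gamma>2: "\<gamma> x 0 = x" if "x \<in> X" for x
    using X_cases[OF that] \<delta>s by (auto simp: \<gamma>c \<gamma>P \<Gamma>_an orbit_germ_analytic \<Gamma>0 orbit_germ_0)
  have lip: "\<exists>L. L-lipschitz_on X (\<lambda>x. taylor_coeff j (\<gamma> x))" for j
  proof -
    define w where "w = (\<lambda>x. taylor_coeff j (\<gamma> x))"
    have li: "\<exists>L. L-lipschitz_on (P i ` ball 0 \<delta>) w" if i: "i < q" for i
    proof -
      obtain L where "L-lipschitz_on (cball 0 \<delta>) (\<lambda>t. taylor_coeff j (\<Gamma> i t))"
        using holomorphic_lipschitz_on_cball[OF tc_hol t0(2)] i by (meson less_imp_le)
      then have L: "L-lipschitz_on (ball 0 \<delta>) (\<lambda>t. taylor_coeff j (\<Gamma> i t))" by (rule lipschitz_on_subset) auto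
      obtain m where m: "m > 0" "\<forall>t\<in>ball 0 s. \<forall>t'\<in>ball 0 s. m * norm (t - t') \<le> norm (P i t - P i t')" using expand[OF i] by blast
      have "(L / m)-lipschitz_on (P i ` ball 0 \<delta>) w"
      proof (rule lipschitz_on_image_of_expanding[OF L m(1)])
        show "m * norm (t - t') \<le> norm (P i t - P i t')" if "t \<in> ball 0 \<delta>" "t' \<in> ball 0 \<delta>" for t t'
          using m(2) subsetD[OF \<delta>s(2)] that by blast
        show "w (P i t) = taylor_coeff j (\<Gamma> i t)" if "t \<in> ball 0 \<delta>" for t
          by (simp add: w_def \<gamma>P[OF i that])
      qed
      then show ?thesis by blast
    qed
    have comp: "compact (P i ` cball 0 \<delta>)" if "i < q" for i
      by (intro compact_continuous_image compact_cball continuous_on_subset[OF holomorphic_on_imp_continuous_on[OF hP] \<delta>s(1)]) (use that in simp)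
    have "\<exists>L. L-lipschitz_on (\<Union>i\<in>{..<q}. P i ` ball 0 \<delta>) w"
    proof (rule lipschitz_on_UN_separated[where C="\<lambda>i. P i ` cball 0 \<delta>"])
      fix i j assume ij: "i \<in> {..<q}" "j \<in> {..<q}" "i \<noteq> j"
      show "P i ` cball 0 \<delta> \<inter> P j ` cball 0 \<delta> = {}"
      proof (rule ccontr)
        assume "P i ` cball 0 \<delta> \<inter> P j ` cball 0 \<delta> \<noteq> {}"
        then obtain t t' where *: "t \<in> cball 0 \<delta>" "t' \<in> cball 0 \<delta>" "P i t = P j t'" by blast
        then have "i = j" using inj_i[OF *(3)] ij \<delta>s(1) by blast
        then show False using ij by simp
      qed
    qed (use li comp in auto)
    then obtain L1 where L1: "L1-lipschitz_on N w" unfolding N_def by blast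
    obtain L2 where L2: "L2-lipschitz_on (c ` {..<n1}) w" using finite_lipschitz_on[of "c ` {..<n1}" w] by auto
    have "\<exists>L. L-lipschitz_on (N \<union> c ` {..<n1}) w"
    proof (rule lipschitz_on_Un_separated[OF L1 _ _ L2])
      show "N \<subseteq> (\<Union>i<q. P i ` cball 0 \<delta>)" unfolding N_def by (intro UN_mono image_mono) auto
      show "compact (\<Union>i<q. P i ` cball 0 \<delta>)" by (intro compact_UN) (use comp in auto)
      show "(\<Union>i<q. P i ` cball 0 \<delta>) \<inter> c ` {..<n1} = {}"
      proof (rule equals0I)
        fix x assume x: "x \<in> (\<Union>i<q. P i ` cball 0 \<delta>) \<inter> c ` {..<n1}"
        from IntD1[OF x] obtain i where i: "i < q" "x \<in> P i ` cball 0 \<delta>" by (metis UN_iff lessThan_iff)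
        from IntD2[OF x] obtain n where n: "n < n1" "x = c n" by (metis imageE lessThan_iff)
        show False using before[OF n(1) i(1)] i(2) n(2) by metis
      qed
    qed (auto intro: finite_imp_compact)
    moreover have "X \<subseteq> N \<union> c ` {..<n1}" using X_cases N_I by blast
    ultimately show ?thesis unfolding w_def using lipschitz_on_subset by blast
  qed
  have \<gamma>_c1: "\<gamma> c1 l = c1 + l" for l using \<gamma>c[of 0] n1 by (simp add: orbit_germ_def)
  have dlim: "((\<lambda>l. (G (c1 + l) (\<gamma> x l) - \<gamma> (g x) l) / l ^ M) \<longlongrightarrow> \<Delta> x) (at 0)" if x: "x \<in> X" for x
    using X_cases[OF x]
  proof (elim disjE exE bexE conjE)
    fix n assume n: "n < n1" "x = c n"
    have "\<forall>\<^sub>F l in nhds 0. \<gamma> (g x) l = orbit_germ (Suc n) l"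
    proof (cases "Suc n = n1")
      case True
      \<comment> \<open>At entry the assignment changes from germs of the orbit to Koenigs curves;
        \<open>entry\<close> says that the two coincide for small \<open>l\<close>.\<close>
      have "\<gamma> (g x) = \<Gamma> 0 t0" unfolding n c_Suc[symmetric] True c_n1 by (rule \<gamma>P[OF q0 t0s(2)])
      then show ?thesis using entry by (simp add: \<Gamma>_def True)
    next
      case False
      then show ?thesis using n \<gamma>c[of "Suc n"] by (simp flip: c_Suc)
    qed
    then have "\<forall>\<^sub>F l in at 0. \<gamma> (g x) l = orbit_germ (Suc n) l" by (simp add: eventually_at_filter eventually_mono)
    then have "\<forall>\<^sub>F l in at 0. 0 = (G (c1 + l) (\<gamma> x l) - \<gamma> (g x) l) / l ^ M"
      by eventually_elim (use n \<gamma>c[of n] orbit_germ_add[of 1 n] in simp)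
    from Lim_transform_eventually[OF tendsto_const this] show ?thesis using n \<Delta>c by simp
  next
    fix i t assume it: "i < q" "t \<in> ball 0 \<delta>" "x = P i t"
    have ts: "t \<in> ball 0 s" using it \<delta>s by auto
    show ?thesis
    proof (cases "Suc i = q")
      case False
      then have "G (c1 + l) (\<gamma> x l) - \<gamma> (g x) l = 0" for l using it \<gamma>P[of i t] \<gamma>P[of "Suc i" t] by (simp add: gN \<Gamma>_def)
      then show ?thesis using False it by (simp add: \<Delta>P)
    next
      case True
      have "(\<lambda>l. \<Psi> l (\<tau> l * t)) holomorphic_on ball 0 \<sigma>"
        by (rule holomorphic2_on_holomorphic_compose[OF h3 so, of _ "\<lambda>l. l" "\<lambda>_. t"]) (use ts in \<open>auto intro: holomorphic_intros\<close>)
      then have "isCont (\<lambda>l. \<Psi> l (\<tau> l * t)) 0"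
        using \<sigma>(1) holomorphic_on_imp_continuous_on continuous_on_eq_continuous_at[OF open_ball] by (metis centre_in_ball)
      then have "((\<lambda>l. \<Psi> l (\<tau> l * t)) \<longlongrightarrow> \<Psi> 0 t) (at 0)" by (simp add: isCont_def \<tau>)
      from tendsto_mult[OF K(2) this] have lim: "((\<lambda>l. K l / l ^ M * \<Psi> l (\<tau> l * t)) \<longlongrightarrow> \<Delta> x) (at 0)" using it True by (simp add: \<Delta>P)
      have "\<forall>\<^sub>F l in nhds 0. l \<in> ball (0::complex) \<sigma>" by (rule eventually_nhds_in_open) (use \<sigma> in auto)
      then have "\<forall>\<^sub>F l in at 0. l \<in> ball (0::complex) \<sigma>" by (simp add: eventually_at_filter eventually_mono)
      then have "\<forall>\<^sub>F l in at 0. K l / l ^ M * \<Psi> l (\<tau> l * t) = (G (c1 + l) (\<gamma> x l) - \<gamma> (g x) l) / l ^ M"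
      proof eventually_elim
        case (elim l)
        have "G (c1 + l) (\<gamma> x l) = (G (c1 + l) ^^ Suc i) (\<alpha> (c1 + l) + \<Psi> l (\<tau> l * t))"
          using it by (simp add: \<gamma>P \<Gamma>_def)
        also have "\<dots> = \<alpha> (c1 + l) + (\<Psi> l (\<kappa> * (\<tau> l * t)) + K l * \<Psi> l (\<tau> l * t))"
          unfolding True by (rule conj) (use elim \<sigma>(2) \<tau>t[OF _ ts] in auto)
        finally have "G (c1 + l) (\<gamma> x l) - \<gamma> (g x) l = K l * \<Psi> l (\<tau> l * t)"
          using it True \<gamma>P[OF q0 \<kappa>\<delta>[OF it(2)]] by (simp add: gN \<Gamma>_def mult.left_commute)
        then show ?case by simp
      qed
      from Lim_transform_eventually[OF lim this] show ?thesis .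
    qed
  qed
  have h_dg: "(\<lambda>t. deriv g (P i t)) holomorphic_on ball 0 s" if "i < q" for i
  proof -
    have "P i ` ball 0 s \<subseteq> U" using PU[OF that] by (rule image_subsetI)
    from holomorphic_on_compose_gen[OF hP[OF less_imp_le[OF that]] holomorphic_deriv[OF basic(2,1)] this]
    show ?thesis by (simp add: o_def)
  qed
  \<comment> \<open>The product of the derivatives of \<open>g\<close> along the first
    \<open>i\<close> steps; composing the one-step equations over a turn produces the factor
    \<open>Dn q\<close>, whose value at the fixed point is \<open>\<kappa>\<close>.\<close>
  define Dn where "Dn = (\<lambda>i t. deriv (G c1 ^^ i) (a 0 + \<Psi> 0 t))"
  have Dn_Suc: "Dn (Suc i) t = deriv g (P i t) * Dn i t" if it: "i < q" "t \<in> ball 0 s" for i t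
  proof -
    have "(c1, a 0 + \<Psi> 0 t) \<in> Dom i" using Pdom[OF it(2)] Dom_mono[of i q] it by auto
    then have "((G c1 ^^ i) has_field_derivative Dn i t) (at (a 0 + \<Psi> 0 t))"
      unfolding Dn_def by (intro field_differentiable_derivI holomorphic2_on_snd[OF hol_Dom open_Dom])
    moreover have "(G c1 has_field_derivative deriv g (P i t)) (at ((G c1 ^^ i) (a 0 + \<Psi> 0 t)))"
      by (rule has_field_derivative_transform_within_open[OF _ basic(1)])
         (use holomorphic_derivI[OF basic(2,1) PU[OF it]] PU[OF it] basic(8) in \<open>auto simp: P_def\<close>)
    ultimately have "(G c1 \<circ> (G c1 ^^ i) has_field_derivative deriv g (P i t) * Dn i t) (at (a 0 + \<Psi> 0 t))"
      by (rule DERIV_chain[rotated])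
    then show ?thesis unfolding Dn_def by (intro DERIV_imp_deriv) simp
  qed
  have Dn_hol: "Dn q holomorphic_on ball 0 s" unfolding Dn_def
    by (rule holomorphic2_on_holomorphic_compose[OF holomorphic2_on_deriv_snd[OF hol_Dom open_Dom] open_Dom open_ball])
       (use Pdom h\<Psi> in \<open>auto intro!: holomorphic_intros\<close>)
  have Dn_q0: "Dn q 0 = \<kappa>" by (simp add: Dn_def \<Psi>0 deriv_return)
  show False
  proof (rule lifting_average[OF mm ld lp XK c1X gX M \<gamma>1 \<gamma>2 \<gamma>_c1 lip dlim], goal_cases)
    case Y: (4 C Y)
    define y where "y = (\<lambda>N t. Y (Suc N) (P 0 t))"
    have step: "norm (Y (Suc N) (g (P i t)) - deriv g (P i t) * Y (Suc N) (P i t) - \<Delta> (P i t)) \<le> C / real (Suc N)"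
      if "i < q" "t \<in> ball 0 \<delta>" for i t N by (rule Y(3)) (use N_I[OF that] in \<open>auto simp: X_def\<close>)
    have bound_dg: "\<exists>B>0. \<forall>t\<in>ball 0 \<delta>. norm (deriv g (P i t)) \<le> B" if i: "i < q" for i
    proof -
      obtain L where "L-lipschitz_on (cball 0 \<delta>) (\<lambda>t. deriv g (P i t))" using holomorphic_lipschitz_on_cball[OF h_dg[OF i] t0(2)] by blast
      from lipschitz_on_bounded[OF this bounded_cball] obtain B where "B > 0" "\<And>t. t \<in> cball 0 \<delta> \<Longrightarrow> norm (deriv g (P i t)) \<le> B" by blast
      then show ?thesis by (intro exI[of _ B]) auto
    qed
    have next_est: "norm (Y (Suc N) (g (P i t)) - \<Delta> (P i t) - Dn (Suc i) t * y N t) \<le> (C + B * C1) / real (Suc N)"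
      if i: "i < q" and t: "t \<in> ball 0 \<delta>" and B: "B > 0" "norm (deriv g (P i t)) \<le> B"
        and IH: "norm (Y (Suc N) (P i t) - Dn i t * y N t) \<le> C1 / real (Suc N)" for i t N B C1
    proof -
      have second: "norm (deriv g (P i t) * (Y (Suc N) (P i t) - Dn i t * y N t)) \<le> B * (C1 / real (Suc N))"
        unfolding norm_mult by (rule mult_mono[OF B(2) IH]) (use B in auto)
      have "Y (Suc N) (g (P i t)) - \<Delta> (P i t) - Dn (Suc i) t * y N t =
        (Y (Suc N) (g (P i t)) - deriv g (P i t) * Y (Suc N) (P i t) - \<Delta> (P i t)) + deriv g (P i t) * (Y (Suc N) (P i t) - Dn i t * y N t)"
        using Dn_Suc[OF i, of t] t \<delta>s by (auto simp: algebra_simps)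
      also have "norm \<dots> \<le> C / real (Suc N) + B * (C1 / real (Suc N))"
        by (rule order_trans[OF norm_triangle_ineq add_mono[OF step[OF i t] second]])
      also have "\<dots> = (C + B * C1) / real (Suc N)" by (simp add: add_divide_distrib)
      finally show ?thesis .
    qed
    \<comment> \<open>Before the last step of a turn there is no \<open>\<Delta>\<close>, so the
      values at the i-th disc are those at the first one multiplied by \<open>Dn i\<close>, up to an
      error that remains of order \<open>1 / N\<close>.\<close>
    have est: "\<exists>C1. \<forall>N. \<forall>t\<in>ball 0 \<delta>. norm (Y (Suc N) (P i t) - Dn i t * y N t) \<le> C1 / real (Suc N)" if "i < q" for i
      using that
    proof (induction i)
      case 0
      have "Dn 0 t = 1" for t by (simp add: Dn_def id_def)
      then show ?case by (intro exI[of _ 0]) (simp add: y_def)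
    next
      case (Suc i)
      obtain C1 where C1: "\<And>N t. t \<in> ball 0 \<delta> \<Longrightarrow> norm (Y (Suc N) (P i t) - Dn i t * y N t) \<le> C1 / real (Suc N)"
        using Suc.IH[OF Suc_lessD[OF Suc.prems]] by blast
      obtain B where B: "B > 0" "\<forall>t\<in>ball 0 \<delta>. norm (deriv g (P i t)) \<le> B" using bound_dg[of i] Suc.prems by auto
      have "norm (Y (Suc N) (P (Suc i) t) - Dn (Suc i) t * y N t) \<le> (C + B * C1) / real (Suc N)" if t: "t \<in> ball 0 \<delta>" for N t
        using next_est[OF _ t B(1) _ C1[OF t], of N] B(2) t Suc.prems by (simp add: gN \<Delta>P)
      then show ?case by blast
    qed
    \<comment> \<open>The defect of the cohomological equation for the return map in the Koenigs
      coordinate. It is holomorphic and uniformly of order \<open>1 / N\<close>, so its derivative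
      at 0 tends to 0 as well.\<close>
    define err where "err = (\<lambda>N t. y N (\<kappa> * t) - A * \<Psi> 0 t - Dn q t * y N t)"
    obtain C2 where C2: "\<And>N t. t \<in> ball 0 \<delta> \<Longrightarrow> norm (err N t) \<le> C2 / real (Suc N)"
    proof -
      have q': "q - 1 < q" "Suc (q - 1) = q" using q0 by auto
      obtain C1 where C1: "\<And>N t. t \<in> ball 0 \<delta> \<Longrightarrow> norm (Y (Suc N) (P (q - 1) t) - Dn (q - 1) t * y N t) \<le> C1 / real (Suc N)"
        using est[OF q'(1)] by blast
      obtain B where B: "B > 0" "\<forall>t\<in>ball 0 \<delta>. norm (deriv g (P (q - 1) t)) \<le> B" using bound_dg[OF q'(1)] by auto
      have "norm (err N t) \<le> (C + B * C1) / real (Suc N)" if t: "t \<in> ball 0 \<delta>" for N t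
        using next_est[OF q'(1) t B(1) _ C1[OF t], of N] B(2) t q' by (simp add: gN \<Delta>P err_def y_def)
      then show thesis by (rule that)
    qed
    have y_hol: "y N holomorphic_on ball 0 \<delta>" for N unfolding y_def
    proof (rule Y(5)[OF open_ball])
      show "P 0 ` ball 0 \<delta> \<subseteq> X" using N_I[OF q0] by (auto simp: X_def)
      show "P 0 holomorphic_on ball 0 \<delta>" by (rule holomorphic_on_subset[OF hP \<delta>s(2)]) simp
      fix i
      have lin: "(\<lambda>t. \<kappa> ^ (i div q) * t) holomorphic_on ball 0 \<delta>" "(\<lambda>t. \<kappa> ^ (i div q) * t) ` ball 0 \<delta> \<subseteq> ball 0 s"
        using \<kappa>s \<delta>s(2) by (auto intro!: holomorphic_intros)
      have im: "i mod q < q" using q0 by simp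
      have o: "(g ^^ i) (P 0 t) = P (i mod q) (\<kappa> ^ (i div q) * t)" if "t \<in> ball 0 \<delta>" for t by (rule orb) (use that \<delta>s in auto)
      show "(\<lambda>t. taylor_coeff j (\<gamma> ((g ^^ i) (P 0 t)))) holomorphic_on ball 0 \<delta>" for j
      proof (rule holomorphic_transform)
        show "(\<lambda>t. taylor_coeff j (\<Gamma> (i mod q) (\<kappa> ^ (i div q) * t))) holomorphic_on ball 0 \<delta>"
          using holomorphic_on_compose_gen[OF lin(1) tc_hol[OF less_imp_le[OF im]] lin(2)] by (simp add: o_def)
      qed (simp add: o \<gamma>P[OF im \<kappa>s])
      show "(\<lambda>t. \<Delta> ((g ^^ i) (P 0 t))) holomorphic_on ball 0 \<delta>"
      proof (rule holomorphic_transform)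
        have "(\<lambda>t. \<Psi> 0 (\<kappa> ^ (i div q) * t)) holomorphic_on ball 0 \<delta>"
          using holomorphic_on_compose_gen[OF lin(1) h\<Psi> lin(2)] by (simp add: o_def)
        then show "(\<lambda>t. if Suc (i mod q) = q then A * \<Psi> 0 (\<kappa> ^ (i div q) * t) else 0) holomorphic_on ball 0 \<delta>"
          by (cases "Suc (i mod q) = q") (auto intro: holomorphic_intros)
      qed (simp add: o \<Delta>P[OF im \<kappa>s])
    qed
    define \<Psi>' where "\<Psi>' = deriv (\<Psi> 0) 0"
    define D' where "D' = deriv (Dn q) 0"
    have z\<delta>: "(0::complex) \<in> ball 0 \<delta>" using \<delta>0 by simp
    have dy: "(y N has_field_derivative deriv (y N) 0) (at 0)" for N by (rule holomorphic_derivI[OF y_hol open_ball z\<delta>])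
    have dy': "((\<lambda>t. y N (\<kappa> * t)) has_field_derivative deriv (y N) 0 * (\<kappa> * 1)) (at 0)" for N
      by (rule DERIV_chain2[of "y N"]) (use dy[of N] in \<open>auto intro!: derivative_eq_intros\<close>)
    have d\<Psi>': "((\<lambda>t. \<Psi> 0 t) has_field_derivative \<Psi>') (at 0)" unfolding \<Psi>'_def by (rule holomorphic_derivI[OF h\<Psi> open_ball z_r(2)])
    have dD: "(Dn q has_field_derivative D') (at 0)" unfolding D'_def by (rule holomorphic_derivI[OF Dn_hol open_ball z_r(2)])
    \<comment> \<open>The unknown derivative of \<open>y N\<close> at 0 appears with factor
      \<open>\<kappa>\<close> from the inner scaling and with factor \<open>Dn q 0\<close>, which is
      also \<open>\<kappa>\<close>, with opposite sign; it cancels and need not be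
      controlled.\<close>
    have derr: "deriv (err N) 0 = - (A * \<Psi>') - D' * y N 0" for N
    proof (rule DERIV_imp_deriv)
      have "(err N has_field_derivative deriv (y N) 0 * (\<kappa> * 1) - A * \<Psi>' - (D' * y N 0 + deriv (y N) 0 * Dn q 0)) (at 0)"
        unfolding err_def by (intro DERIV_diff dy' DERIV_cmult d\<Psi>' DERIV_mult dD dy)
      then show "(err N has_field_derivative - (A * \<Psi>') - D' * y N 0) (at 0)" by (simp add: Dn_q0 algebra_simps)
    qed
    have err_hol: "err N holomorphic_on ball 0 \<delta>" for N
    proof -
      have "(\<lambda>t. y N (\<kappa> * t)) holomorphic_on ball 0 \<delta>"
        using holomorphic_on_compose_gen[OF _ y_hol, of "\<lambda>t. \<kappa> * t" "ball 0 \<delta>" N] \<kappa>\<delta> by (force simp: o_def intro: holomorphic_intros)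
      then show ?thesis unfolding err_def
        by (intro holomorphic_intros y_hol holomorphic_on_subset[OF h\<Psi> \<delta>s(2)] holomorphic_on_subset[OF Dn_hol \<delta>s(2)])
    qed
    have "norm (deriv (err N) 0) \<le> C2 / (\<delta> / 2) * inverse (real (Suc N))" for N
      using norm_taylor_coeff_le[OF err_hol, of "\<delta> / 2" N "C2 / real (Suc N)" 1] C2 \<delta>0 by (simp add: taylor_coeff_1 field_simps)
    then have lim1: "(\<lambda>N. deriv (err N) 0) \<longlonglongrightarrow> 0"
      by (intro Lim_null_comparison[OF _ tendsto_mult_right_zero[OF LIMSEQ_inverse_real_of_nat]] always_eventually allI)
    have \<kappa>1: "1 - \<kappa> \<noteq> 0" using \<kappa> by auto
    \<comment> \<open>Evaluating \<open>err\<close> at 0, where \<open>\<Psi> 0\<close> vanishes,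
      controls the remaining unknown \<open>y N 0\<close>, since \<open>\<kappa>\<close> is not
      1.\<close>
    have "norm (y N 0 * (1 - \<kappa>)) \<le> C2 * inverse (real (Suc N))" for N
      using C2[OF z\<delta>, of N] by (simp add: err_def \<Psi>0 Dn_q0 algebra_simps divide_inverse)
    then have "(\<lambda>N. y N 0 * (1 - \<kappa>)) \<longlonglongrightarrow> 0"
      by (intro Lim_null_comparison[OF _ tendsto_mult_right_zero[OF LIMSEQ_inverse_real_of_nat]] always_eventually allI)
    from tendsto_mult[OF this tendsto_const[of "inverse (1 - \<kappa>)"]] have "(\<lambda>N. y N 0) \<longlonglongrightarrow> 0" using \<kappa>1 by (simp add: mult.assoc)
    from tendsto_add[OF lim1 tendsto_mult[OF tendsto_const[of D'] this]]
    have "(\<lambda>N. - (A * \<Psi>')) \<longlonglongrightarrow> 0" by (simp add: derr)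
    then have "A * \<Psi>' = 0" by (simp add: LIMSEQ_const_iff)
    then show False using A d\<Psi> by (simp add: \<Psi>'_def)
  qed
qed

lemma coordinate_derivative:
  assumes "(w, z) \<in> Dom q"
  shows "((\<lambda>u. (G w ^^ q) (z + u) - z) has_field_derivative deriv (G w ^^ q) z) (at 0)"
proof -
  have "((G w ^^ q) has_field_derivative deriv (G w ^^ q) z) (at (0 + z))"
    using holomorphic2_on_snd[OF hol_Dom open_Dom assms] by (simp add: field_differentiable_derivI)
  then have "((\<lambda>u. (G w ^^ q) (u + z) - z) has_field_derivative deriv (G w ^^ q) z - 0) (at 0)"
    by (intro DERIV_diff DERIV_const) (simp only: DERIV_shift)
  then show ?thesis by (simp add: add.commute)
qed

lemma separating_radius:
  obtains \<epsilon> where "\<epsilon> > 0" "\<epsilon> \<le> r0" "\<And>i j. i < q \<Longrightarrow> j < q \<Longrightarrow> i \<noteq> j \<Longrightarrow> ball (a i) \<epsilon> \<inter> ball (a j) \<epsilon> = {}"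
proof -
  have small: "\<forall>\<^sub>F e in at_right (0::real). e < x" if "x > 0" for x using order_tendstoD(2)[OF tendsto_ident_at that] .
  have "\<forall>\<^sub>F e in at_right (0::real). \<forall>i\<in>{..<q}. \<forall>j\<in>{..<q}. i \<noteq> j \<longrightarrow> e < dist (a i) (a j) / 2"
  proof (intro eventually_ball_finite ballI finite_lessThan)
    fix i j assume ij: "i \<in> {..<q}" "j \<in> {..<q}"
    show "\<forall>\<^sub>F e in at_right (0::real). i \<noteq> j \<longrightarrow> e < dist (a i) (a j) / 2"
    proof (cases "i = j")
      case False
      then have "dist (a i) (a j) / 2 > 0" using a_inj ij by (auto simp: inj_on_def)
      from small[OF this] show ?thesis by eventually_elim simp
    qed simp
  qed
  then have "\<forall>\<^sub>F e in at_right (0::real). e > 0 \<and> e < r0 \<and> (\<forall>i\<in>{..<q}. \<forall>j\<in>{..<q}. i \<noteq> j \<longrightarrow> e < dist (a i) (a j) / 2)"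
    using small[OF r0] eventually_at_right_less[of "0::real"] by eventually_elim auto
  from eventually_happens'[OF trivial_limit_at_right_real this]
  obtain e where e: "e > 0" "e < r0" "\<And>i j. i < q \<Longrightarrow> j < q \<Longrightarrow> i \<noteq> j \<Longrightarrow> e < dist (a i) (a j) / 2" by auto
  have "ball (a i) e \<inter> ball (a j) e = {}" if "i < q" "j < q" "i \<noteq> j" for i j
    by (rule disjoint_ballI) (use e(3)[OF that] in simp)
  then show thesis using that e(1,2) by (meson less_imp_le)
qed

text \<open>Supplies the data of \<open>hyperbolic_contradiction\<close>: a linearised family, a
  radius that works at all points of the cycle, and an entry point of the orbit with its Koenigs
  coordinate as a function of the parameter.\<close>

lemma hyperbolic_dichotomy:
  assumes \<kappa>: "0 < norm \<kappa>" "norm \<kappa> < 1"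
    and \<alpha>: "\<alpha> analytic_on {c1}" "\<alpha> c1 = a 0" "\<forall>\<^sub>F w in nhds c1. (G w ^^ q) (\<alpha> w) = \<alpha> w"
    and M: "M \<ge> 2" and A: "A \<noteq> 0" "((\<lambda>l. (deriv (G (c1 + l) ^^ q) (\<alpha> (c1 + l)) - \<kappa>) / l ^ M) \<longlongrightarrow> A) (at 0)"
  shows False
proof -
  obtain \<rho> where \<rho>: "\<rho> > 0" "(\<lambda>l. \<alpha> (c1 + l)) holomorphic_on ball 0 \<rho>" "\<And>l. l \<in> ball 0 \<rho> \<Longrightarrow> (G (c1 + l) ^^ q) (\<alpha> (c1 + l)) = \<alpha> (c1 + l)"
    "\<And>l u. l \<in> ball 0 \<rho> \<Longrightarrow> u \<in> ball 0 \<rho> \<Longrightarrow> (c1 + l, \<alpha> (c1 + l) + u) \<in> Dom q"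
    "\<And>m. m \<le> q \<Longrightarrow> holomorphic2_on (\<lambda>l u. (G (c1 + l) ^^ m) (\<alpha> (c1 + l) + u) - \<alpha> (c1 + l)) (ball 0 \<rho> \<times> ball 0 \<rho>)"
  proof (rule local_coordinates[OF \<alpha>, of q], goal_cases)
    case (1 \<rho>)
    show ?case by (rule 1(1)[OF 1(2,3,4,5,7)])
  qed
  have z\<rho>: "(0::complex) \<in> ball 0 \<rho>" using \<rho> by simp
  have o: "open (ball (0::complex) \<rho> \<times> ball (0::complex) \<rho>)" by (simp add: open_Times)
  define \<phi> where "\<phi> = (\<lambda>l u. (G (c1 + l) ^^ q) (\<alpha> (c1 + l) + u) - \<alpha> (c1 + l))"
  define K where "K = (\<lambda>l. deriv (G (c1 + l) ^^ q) (\<alpha> (c1 + l)) - \<kappa>)"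
  \<comment> \<open>Removing \<open>K l * u\<close> freezes the multiplier at
    \<open>\<kappa>\<close>, as \<open>koenigs_family\<close> requires; the removed term reappears
    in \<open>conj\<close>.\<close>
  define \<Phi> where "\<Phi> = (\<lambda>l u. \<phi> l u - K l * u)"
  have mem: "(c1 + l, \<alpha> (c1 + l)) \<in> Dom q" if "l \<in> ball 0 \<rho>" for l using \<rho>(4)[OF that z\<rho>] by simp
  have K_hol: "K holomorphic_on ball 0 \<rho>" unfolding K_def
    by (intro holomorphic_on_diff holomorphic_on_const
        holomorphic2_on_holomorphic_compose[OF holomorphic2_on_deriv_snd[OF hol_Dom open_Dom] open_Dom open_ball])
       (use mem \<rho>(2) in \<open>auto intro!: holomorphic_intros\<close>)
  have K0: "K 0 = 0" by (simp add: K_def \<alpha> deriv_return)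
  have \<Phi>h: "holomorphic2_on \<Phi> (ball 0 \<rho> \<times> ball 0 \<rho>)" unfolding \<Phi>_def \<phi>_def
    by (intro holomorphic2_on_diff[OF o] holomorphic2_on_mult[OF o] \<rho>(5)[of q]
        holomorphic2_on_fst_only[OF o K_hol] holomorphic2_on_snd_only[OF o, of "\<lambda>u. u" UNIV]) auto
  have \<Phi>0: "\<Phi> l 0 = 0" if "l \<in> ball 0 \<rho>" for l using \<rho>(3)[OF that] by (simp add: \<Phi>_def \<phi>_def)
  have d\<Phi>: "deriv (\<Phi> l) 0 = \<kappa>" if "l \<in> ball 0 \<rho>" for l
  proof (rule DERIV_imp_deriv)
    have "(\<Phi> l has_field_derivative deriv (G (c1 + l) ^^ q) (\<alpha> (c1 + l)) - K l * 1) (at 0)" unfolding \<Phi>_def \<phi>_def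
      by (intro DERIV_diff DERIV_cmult DERIV_ident coordinate_derivative[OF mem[OF that]])
    then show "(\<Phi> l has_field_derivative \<kappa>) (at 0)" by (simp add: K_def)
  qed
  show False
  proof (rule koenigs_family[OF \<Phi>h \<rho>(1) \<rho>(1) \<Phi>0 d\<Phi> \<kappa>], goal_cases)
    case k: (3 r d \<Psi> \<eta>)
    have zr: "(0::complex) \<in> ball 0 r" "(0::complex) \<in> ball 0 d" using k(1,2) by auto
    define P where "P = (\<lambda>i t. (G c1 ^^ i) (a 0 + \<Psi> 0 t))"
    have \<Psi>00: "\<Psi> 0 0 = 0" by (rule k(7)[OF zr(1)])
    have h\<Psi>: "(\<lambda>t. \<Psi> 0 t) holomorphic_on ball 0 r"
      by (rule holomorphic2_on_holomorphic_compose[OF k(4), of _ "\<lambda>_. 0" "\<lambda>t. t"]) (use zr in \<open>auto intro: holomorphic_intros simp: open_Times\<close>)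
    have hP: "P i holomorphic_on ball 0 r" if "i < q" for i unfolding P_def
    proof (rule holomorphic2_on_holomorphic_compose[OF hol_Dom open_Dom open_ball])
      show "(\<lambda>t. a 0 + \<Psi> 0 t) holomorphic_on ball 0 r" by (intro holomorphic_intros h\<Psi>)
      fix t assume "t \<in> ball (0::complex) r"
      then have "(c1, a 0 + \<Psi> 0 t) \<in> Dom q" using \<rho>(4)[OF z\<rho>, of "\<Psi> 0 t"] k(6)[OF zr(1)] \<alpha>(2) by auto
      then show "(c1, a 0 + \<Psi> 0 t) \<in> Dom i" using Dom_mono[of i q] that by auto
    qed auto
    have P0: "P i 0 = a i" if "i < q" for i using G_iter_a[OF q0, of i] that by (simp add: P_def \<Psi>00)
    have dP: "deriv (P i) 0 \<noteq> 0" for i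
    proof -
      obtain D where D: "D \<noteq> 0" "((G c1 ^^ i) has_field_derivative D) (at (a 0))" using iterate_derivative_nonzero by blast
      have "((\<lambda>t. a 0 + \<Psi> 0 t) has_field_derivative 0 + deriv (\<Psi> 0) 0) (at 0)"
        by (intro DERIV_add DERIV_const) (rule holomorphic_derivI[OF h\<Psi> open_ball zr(1)])
      then have "(P i has_field_derivative D * (0 + deriv (\<Psi> 0) 0)) (at 0)" unfolding P_def
        by (rule DERIV_chain2[rotated]) (use D(2) in \<open>simp add: \<Psi>00\<close>)
      then show ?thesis using D(1) k(8) DERIV_imp_deriv by force
    qed
    obtain \<epsilon> where \<epsilon>: "\<epsilon> > 0" "\<epsilon> \<le> r0" "\<And>i j. i < q \<Longrightarrow> j < q \<Longrightarrow> i \<noteq> j \<Longrightarrow> ball (a i) \<epsilon> \<inter> ball (a j) \<epsilon> = {}"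
    proof (rule separating_radius, goal_cases)
      case (1 \<epsilon>)
      show ?case by (rule 1(1)[OF 1(2,3,4)])
    qed
    have small: "\<forall>\<^sub>F e in at_right (0::real). e < x" if "x > 0" for x using order_tendstoD(2)[OF tendsto_ident_at that] .
    define good where "good = (\<lambda>e i. (\<forall>t\<in>ball 0 e. P i t \<in> ball (a i) \<epsilon>) \<and>
       (\<exists>m>0. \<forall>t\<in>ball 0 e. \<forall>t'\<in>ball 0 e. m * norm (t - t') \<le> norm (P i t - P i t')))"
    have "\<forall>\<^sub>F e in at_right 0. \<forall>i\<in>{..<q}. good e i"
    proof (intro eventually_ball_finite ballI finite_lessThan)
      fix i assume "i \<in> {..<q}"
      then have i: "i < q" by simp
      have "isCont (P i) 0" using holomorphic_on_imp_continuous_on[OF hP[OF i]] zr(1) by (simp add: continuous_on_eq_continuous_at)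
      then obtain e1 where e1: "e1 > 0" "\<And>t. dist t 0 < e1 \<Longrightarrow> dist (P i t) (P i 0) < \<epsilon>"
        using \<epsilon>(1) unfolding continuous_at_eps_delta by blast
      obtain e2 where e2: "e2 > 0" "\<And>x y. x \<in> ball 0 e2 \<Longrightarrow> y \<in> ball 0 e2 \<Longrightarrow> norm (deriv (P i) 0) / 2 * norm (x - y) \<le> norm (P i x - P i y)"
        using holomorphic_locally_expanding[OF hP[OF i] open_ball zr(1) dP] by metis
      show "\<forall>\<^sub>F e in at_right 0. good e i" using small[OF e1(1)] small[OF e2(1)]
      proof eventually_elim
        case (elim e)
        have "norm (deriv (P i) 0) / 2 > 0" using dP[of i] by simp
        moreover have "\<forall>t\<in>ball 0 e. P i t \<in> ball (a i) \<epsilon>" using e1(2) elim P0[OF i] by (auto simp: dist_commute)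
        moreover have "norm (deriv (P i) 0) / 2 * norm (t - t') \<le> norm (P i t - P i t')" if "t \<in> ball 0 e" "t' \<in> ball 0 e" for t t'
          by (rule e2(2)) (use that elim in auto)
        ultimately show ?case unfolding good_def by (intro conjI exI[of _ "norm (deriv (P i) 0) / 2"]) auto
      qed
    qed
    then have "\<forall>\<^sub>F e in at_right 0. (\<forall>i\<in>{..<q}. good e i) \<and> e > 0 \<and> e < r / 2"
      using small[of "r / 2"] k(1) eventually_at_right_less[of "0::real"] by (simp add: eventually_conj_iff)
    from eventually_happens'[OF trivial_limit_at_right_real this]
    obtain s where s': "\<forall>i\<in>{..<q}. good s i" "s > 0" "s < r / 2" by blast
    have s: "\<And>i. i < q \<Longrightarrow> good s i" "s > 0" "2 * s \<le> r" using s' by simp_all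
    have inj0: "t = 0" if t: "t \<in> ball 0 s" "\<Psi> 0 t = 0" for t
    proof -
      obtain m where m: "m > 0" "\<forall>t\<in>ball 0 s. \<forall>t'\<in>ball 0 s. m * norm (t - t') \<le> norm (P 0 t - P 0 t')" using s(1)[OF q0] by (auto simp: good_def)
      then have "m * norm (t - 0) \<le> norm (P 0 t - P 0 0)" using s(2) t(1) by (meson centre_in_ball)
      then show ?thesis using m(1) t(2) by (simp add: P_def \<Psi>00 mult_le_0_iff)
    qed
    have hz: "0 \<in> ball (0::complex) d" "\<eta> 0 0 \<in> ball 0 r" "\<Psi> 0 (\<eta> 0 0) = 0" using k(9)[OF zr(2) zr(2)] zr by auto
    \<comment> \<open>So far only \<open>\<Psi> 0 (\<eta> 0 0) = 0\<close> is known. By the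
      conjugacy all products of \<open>\<eta> 0 0\<close> with powers of \<open>\<kappa>\<close> are
      zeros of \<open>\<Psi> 0\<close>; they tend to 0, near which \<open>\<Psi> 0\<close> is
      injective.\<close>
    have \<eta>00: "\<eta> 0 0 = 0"
    proof -
      have pw: "\<Psi> 0 (\<kappa> ^ n * \<eta> 0 0) = 0 \<and> \<kappa> ^ n * \<eta> 0 0 \<in> ball 0 r" for n
      proof (induction n)
        case (Suc n)
        have "norm (\<kappa> * (\<kappa> ^ n * \<eta> 0 0)) \<le> 1 * norm (\<kappa> ^ n * \<eta> 0 0)"
          unfolding norm_mult[of \<kappa>] by (rule mult_right_mono) (use \<kappa> in auto)
        moreover have "\<Psi> 0 (\<kappa> * (\<kappa> ^ n * \<eta> 0 0)) = 0" using k(6)[OF zr(1), of "\<kappa> ^ n * \<eta> 0 0"] Suc \<Phi>0[OF z\<rho>] by simp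
        ultimately show ?case using Suc by (simp add: mult.assoc)
      qed (use hz in simp)
      have "(\<lambda>n. \<kappa> ^ n * \<eta> 0 0) \<longlonglongrightarrow> 0" by (rule tendsto_mult_left_zero[OF LIMSEQ_power_zero[OF \<kappa>(2)]])
      from topological_tendstoD[OF this open_ball[of 0 s]] s(2) obtain n where "\<kappa> ^ n * \<eta> 0 0 \<in> ball 0 s"
        using eventually_happens'[OF sequentially_bot] by auto
      then have "\<kappa> ^ n * \<eta> 0 0 = 0" using inj0 pw by blast
      then show ?thesis using \<kappa>(1) by auto
    qed
    obtain n0 where n0: "(\<lambda>n. c (n0 + q * n)) \<longlonglongrightarrow> a 0" using orbit_converges by blast
    have h\<eta>: "(\<lambda>z. \<eta> 0 z) holomorphic_on ball 0 d"
      by (rule holomorphic2_on_holomorphic_compose[OF k(5), of _ "\<lambda>_. 0" "\<lambda>t. t"]) (use zr in \<open>auto intro: holomorphic_intros simp: open_Times\<close>)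
    have "isCont (\<lambda>z. \<eta> 0 z) 0" using holomorphic_on_imp_continuous_on[OF h\<eta>] zr(2) by (simp add: continuous_on_eq_continuous_at)
    moreover have cl: "(\<lambda>n. c (n0 + q * n) - a 0) \<longlonglongrightarrow> 0" using tendsto_diff[OF n0 tendsto_const[of "a 0"]] by simp
    ultimately have tl: "(\<lambda>n. \<eta> 0 (c (n0 + q * n) - a 0)) \<longlonglongrightarrow> 0" using isCont_tendsto_compose[of 0 "\<lambda>z. \<eta> 0 z"] \<eta>00 by fastforce
    \<comment> \<open>Aiming at the radius \<open>norm \<kappa> * s\<close> instead of
      \<open>s\<close> leaves room for a \<open>\<delta>\<close> below \<open>s\<close> and between
      \<open>norm t0\<close> and \<open>norm t0 / norm \<kappa>\<close>.\<close>
    have ks: "norm \<kappa> * s > 0" using \<kappa> s(2) by simp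
    have "\<forall>\<^sub>F n in sequentially. c (n0 + q * n) - a 0 \<in> ball 0 d \<and> \<eta> 0 (c (n0 + q * n) - a 0) \<in> ball 0 (norm \<kappa> * s) \<and> n \<ge> 1"
      using topological_tendstoD[OF cl open_ball zr(2)] topological_tendstoD[OF tl open_ball, of 0 "norm \<kappa> * s"] ks eventually_ge_at_top[of "1::nat"]
      by (simp add: eventually_conj_iff)
    from eventually_happens'[OF sequentially_bot this] obtain n where n: "c (n0 + q * n) - a 0 \<in> ball 0 d"
      "\<eta> 0 (c (n0 + q * n) - a 0) \<in> ball 0 (norm \<kappa> * s)" "n \<ge> 1" by blast
    define n1 where "n1 = n0 + q * n"
    have "0 < q * n" using n(3) q0 by simp
    then have n1: "n1 \<ge> 1" unfolding n1_def by linarith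
    define t0 where "t0 = \<eta> 0 (c n1 - a 0)"
    have \<Psi>t0: "\<Psi> 0 t0 = c n1 - a 0" using k(9)[OF zr(2) n(1)] by (simp add: t0_def n1_def)
    have t0nz: "t0 \<noteq> 0" using \<Psi>t0 \<Psi>00 c_ne_a[OF q0, of n1] by auto
    have t0s: "norm t0 < norm \<kappa> * s" using n(2) by (simp add: t0_def n1_def)
    have "norm \<kappa> * norm t0 < 1 * norm t0" by (rule mult_strict_right_mono) (use \<kappa> t0nz in auto)
    then have "norm t0 < norm t0 / norm \<kappa>" using \<kappa>(1) by (simp add: pos_less_divide_eq mult.commute)
    from dense[OF this] obtain \<delta> where \<delta>: "norm t0 < \<delta>" "\<delta> < norm t0 / norm \<kappa>" by blast
    have "norm t0 / norm \<kappa> < s" using t0s \<kappa>(1) by (simp add: pos_divide_less_eq mult.commute)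
    then have \<delta>s: "\<delta> < s" using \<delta>(2) by linarith
    have \<kappa>\<delta>: "norm \<kappa> * \<delta> < norm t0" using \<delta>(2) \<kappa>(1) by (simp add: pos_less_divide_eq mult.commute)
    define e where "e = (\<lambda>l. orbit_germ n1 l - \<alpha> (c1 + l))"
    \<comment> \<open>The Koenigs coordinate of the moving orbit point at time \<open>n1\<close>,
      relative to its value \<open>t0\<close> at the base parameter.\<close>
    define \<tau> where "\<tau> = (\<lambda>l. \<eta> l (e l) / t0)"
    have "\<alpha> \<circ> (\<lambda>l. c1 + l) analytic_on {0}"
      by (rule analytic_on_compose) (use \<alpha> in \<open>auto intro: analytic_intros\<close>)
    then have e_an: "e analytic_on {0}" unfolding e_def by (intro analytic_intros orbit_germ_analytic) (simp add: o_def)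
    have e0: "e 0 = c n1 - a 0" by (simp add: e_def orbit_germ_0 \<alpha>)
    have od: "open (ball (0::complex) d \<times> ball (0::complex) d)" by (simp add: open_Times)
    have "(\<lambda>l. \<eta> l (e l)) analytic_on {0}"
      by (rule analytic_compose2[OF k(5) od _ e_an]) (use n(1) zr in \<open>auto simp: e0 n1_def intro: analytic_intros\<close>)
    then have \<tau>_an: "\<tau> analytic_on {0}" unfolding \<tau>_def by (intro analytic_on_divide analytic_on_const) (use t0nz in auto)
    have \<tau>0: "\<tau> 0 = 1" using t0nz by (simp add: \<tau>_def e0 t0_def)
    have "isCont e 0" using analytic_at_imp_isCont[OF e_an] .
    then have "(e \<longlongrightarrow> e 0) (nhds 0)" unfolding isCont_def tendsto_at_iff_tendsto_nhds .
    then have "(e \<longlongrightarrow> c n1 - a 0) (nhds 0)" by (simp only: e0)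
    from topological_tendstoD[OF this open_ball, of 0 d] n(1) have ev: "\<forall>\<^sub>F l in nhds 0. e l \<in> ball 0 d" by (simp add: n1_def)
    have entry: "\<forall>\<^sub>F l in nhds 0. \<alpha> (c1 + l) + \<Psi> l (\<tau> l * t0) = orbit_germ n1 l"
      using ev eventually_nhds_in_open[OF open_ball zr(2)]
    proof eventually_elim
      case (elim l)
      then have "\<Psi> l (\<eta> l (e l)) = e l" using k(9) by blast
      then show ?case using t0nz by (simp add: \<tau>_def e_def)
    qed
    have conj: "(G (c1 + l) ^^ q) (\<alpha> (c1 + l) + \<Psi> l t) = \<alpha> (c1 + l) + (\<Psi> l (\<kappa> * t) + K l * \<Psi> l t)"
      if "l \<in> ball 0 r" "t \<in> ball 0 r" for l t
      using k(6)[OF that] by (simp add: \<Phi>_def \<phi>_def algebra_simps)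
    have Klim: "((\<lambda>l. K l / l ^ M) \<longlongrightarrow> A) (at 0)" using A(2) by (simp add: K_def)
    have k6: "\<Psi> l t \<in> ball 0 \<rho>" if "l \<in> ball 0 r" "t \<in> ball 0 r" for l t using k(6)[OF that] by blast
    have near: "(G c1 ^^ i) (a 0 + \<Psi> 0 t) \<in> ball (a i) \<epsilon>" if "i < q" "t \<in> ball 0 s" for i t
      using s(1)[OF that(1)] that(2) by (auto simp: good_def P_def)
    have expand: "\<exists>m>0. \<forall>t\<in>ball 0 s. \<forall>t'\<in>ball 0 s. m * norm (t - t') \<le> norm ((G c1 ^^ i) (a 0 + \<Psi> 0 t) - (G c1 ^^ i) (a 0 + \<Psi> 0 t'))" if "i < q" for i
      using s(1)[OF that] by (simp add: good_def P_def)
    show False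
      by (rule hyperbolic_contradiction[OF \<alpha>(1,2) \<rho>(1,2,4) k(1,3,4) k6 \<Psi>00 k(8) conj K0 Klim A(1) M \<kappa> s(2,3) near \<epsilon>(3,2) expand \<delta>(1) \<delta>s \<kappa>\<delta> \<tau>_an \<tau>0 entry n1])
  qed auto
qed

section \<open>From failure of transversality to persistence\<close>

text \<open>For multiplier 1 the fixed point equation has vanishing derivative in \<open>z\<close>,
  but nondegeneracy makes the second derivative of the return map nonzero; this dictates which
  equation is solved implicitly in each case.\<close>

lemma persistence_of_not_transversal:
  assumes hyp: "hyperbolic_attracting \<kappa> \<or> nondegenerate_parabolic g q (a 0) \<kappa>"
    and Q: "Q = (\<lambda>z. deriv (\<lambda>w. (G w ^^ q) z) c1)"
    and eq: "(deriv ^^ 2) (g ^^ q) (a 0) * Q (a 0) = deriv Q (a 0) * (\<kappa> - 1)"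
  shows "\<exists>W1 A. open W1 \<and> c1 \<in> W1 \<and> W1 \<subseteq> W \<and>
       (\<forall>j<q. A j holomorphic_on W1 \<and> A j c1 = a j) \<and>
       (\<forall>w\<in>W1. (\<forall>j<q. iterate_defined U (G w) q (A j w) \<and> (G w ^^ q) (A j w) = A j w) \<and>
                deriv (G w ^^ q) (A 0 w) = \<kappa>)"
proof -
  define D2 where "D2 = (deriv ^^ 2) (g ^^ q) (a 0)"
  note hF = hol_Dom[of q] and o = open_Dom[of q] and mem = Dom_a[OF q0, of q]
  have hD: "holomorphic2_on (\<lambda>w. deriv (G w ^^ q)) (Dom q)" using holomorphic2_on_deriv_snd[OF hF o] by simp
  have Fd: "((G c1 ^^ q) has_field_derivative \<kappa>) (at (a 0))"
    using field_differentiable_derivI[OF holomorphic2_on_snd[OF hF o mem]] by (simp add: deriv_return)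
  have Fw: "((\<lambda>w. (G w ^^ q) (a 0)) has_field_derivative Q (a 0)) (at c1)"
    unfolding Q by (rule field_differentiable_derivI[OF holomorphic2_on_fst[OF hF o mem]])
  have fix0: "(G c1 ^^ q) (a 0) = a 0" using G_iter_a[OF q0, of q] by simp
  have shift_an: "(\<lambda>l. \<alpha> (c1 + l)) analytic_on {0}" if "\<alpha> analytic_on {c1}" for \<alpha> :: "complex \<Rightarrow> complex"
  proof -
    have "\<alpha> \<circ> (\<lambda>l. c1 + l) analytic_on {0}"
      by (rule analytic_on_compose) (use that in \<open>auto intro: analytic_intros\<close>)
    then show ?thesis by (simp add: o_def)
  qed
  have c_an: "(\<lambda>l. c1 + l) analytic_on {0}" by (intro analytic_intros)
  show ?thesis
  proof (cases "\<kappa> = 1")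
    case False
    define H where "H = (\<lambda>w z. (G w ^^ q) z - z)"
    have hH: "holomorphic2_on H (Dom q)" unfolding H_def
      by (rule holomorphic2_on_diff[OF o hF]) (rule holomorphic2_on_snd_only[OF o, of "\<lambda>u. u" UNIV], auto)
    have dH: "deriv (H c1) (a 0) = \<kappa> - 1" unfolding H_def by (rule DERIV_imp_deriv[OF DERIV_diff[OF Fd DERIV_ident]])
    have Hw: "deriv (\<lambda>w. H w (a 0)) c1 = Q (a 0)"
      using DERIV_imp_deriv[OF DERIV_diff[OF Fw DERIV_const[of "a 0"]]] by (simp add: H_def)
    have nz: "deriv (H c1) (a 0) \<noteq> 0" using False dH by simp
    show ?thesis
    proof (rule implicit_function[OF hH o mem nz], goal_cases)
      case I: (1 \<alpha> \<alpha>')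
      have fixd: "\<forall>\<^sub>F w in nhds c1. (G w ^^ q) (\<alpha> w) = \<alpha> w" using I(3) by eventually_elim (simp add: H_def fix0)
      define e where "e = (\<lambda>l. deriv (G (c1 + l) ^^ q) (\<alpha> (c1 + l)) - \<kappa>)"
      have \<alpha>': "(\<kappa> - 1) * \<alpha>' = - Q (a 0)" using I(5) unfolding dH Hw by (simp add: eq_neg_iff_add_eq_0 add.commute)
      \<comment> \<open>Multiplied by \<open>\<kappa> - 1\<close>, the derivative of the multiplier
        along \<open>\<alpha>\<close> is the difference of the two sides of the transversality
        condition, up to sign.\<close>
      have "(\<kappa> - 1) * (deriv Q (a 0) + D2 * \<alpha>') = deriv Q (a 0) * (\<kappa> - 1) + D2 * ((\<kappa> - 1) * \<alpha>')" by (simp add: algebra_simps)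
      also have "\<dots> = 0" unfolding \<alpha>' eq[symmetric] D2_def by simp
      finally have "deriv Q (a 0) + D2 * \<alpha>' = 0" using False by simp
      then have e': "(e has_field_derivative 0) (at 0)"
        using deriv_multiplier[OF I(4,2)] unfolding e_def D2_def Q by simp
      have "(\<lambda>l. deriv (G (c1 + l) ^^ q) (\<alpha> (c1 + l))) analytic_on {0}"
        by (rule analytic_compose2[OF hD o c_an shift_an[OF I(1)]]) (simp add: I(2) mem)
      then have e_an: "e analytic_on {0}" unfolding e_def by (intro analytic_intros)
      have e0: "e 0 = 0" by (simp add: e_def I(2) deriv_return)
      from analytic_zero_or_order_ge_2[OF e_an e0 e'] show ?case
      proof (elim disjE exE conjE)
        assume "\<forall>\<^sub>F l in nhds 0. e l = 0"
        then have "\<forall>\<^sub>F w in nhds c1. deriv (G w ^^ q) (\<alpha> w) - \<kappa> = 0"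
          unfolding e_def by (rule eventually_shift[THEN iffD1])
        then have "\<forall>\<^sub>F w in nhds c1. deriv (G w ^^ q) (\<alpha> w) = \<kappa>" by eventually_elim simp
        then show ?thesis by (rule persistent_cycle[OF I(1,2) fixd])
      next
        fix M A assume M: "M \<ge> 2" "A \<noteq> 0" and lim: "((\<lambda>l. e l / l ^ M) \<longlongrightarrow> A) (at 0)"
        note lim' = lim[unfolded e_def]
        have False using hyp
        proof
          assume "hyperbolic_attracting \<kappa>"
          then have "0 < norm \<kappa>" "norm \<kappa> < 1" by (auto simp: hyperbolic_attracting_def)
          then show False by (rule hyperbolic_dichotomy[OF _ _ I(1,2) fixd M lim'])
        next
          assume "nondegenerate_parabolic g q (a 0) \<kappa>"
          then obtain l p where p: "p \<ge> 1" "coprime l (int p)" "\<kappa> = exp (2 * of_real pi * \<i> * of_int l / of_nat p)"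
            "(deriv ^^ (p + 1)) (g ^^ (p * q)) (a 0) \<noteq> 0" unfolding nondegenerate_parabolic_def by blast
          \<comment> \<open>Since \<open>\<kappa>\<close> is not 1, the order \<open>p\<close> is at
            least 2, which is the range in which \<open>s = 1\<close> is admissible.\<close>
          have "\<not> p dvd 1" using root_of_unity_power_eq_1_iff[OF p(1,2,3), of 1] False by simp
          then have "p \<ge> 2" using p(1) by (cases "p = 1") auto
          then show False by (rule parabolic_dichotomy_primitive[OF _ p(2,3,4) I(1,2) fixd M lim'])
        qed
        then show ?thesis ..
      qed
    qed
  next
    case True
    have "\<not> hyperbolic_attracting \<kappa>" using True by (simp add: hyperbolic_attracting_def)
    then have "nondegenerate_parabolic g q (a 0) \<kappa>" using hyp by blast
    then obtain l p where p: "p \<ge> 1" "coprime l (int p)" "\<kappa> = exp (2 * of_real pi * \<i> * of_int l / of_nat p)"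
      "(deriv ^^ (p + 1)) (g ^^ (p * q)) (a 0) \<noteq> 0" unfolding nondegenerate_parabolic_def by blast
    have "p dvd 1" using root_of_unity_power_eq_1_iff[OF p(1,2,3), of 1] True by simp
    then have "p = 1" by simp
    then have nd: "(deriv ^^ 2) (g ^^ q) (a 0) \<noteq> 0" using p(4) by (simp add: numeral_2_eq_2)
    \<comment> \<open>With \<open>\<kappa> = 1\<close> the condition reduces to the vanishing of
      \<open>Q\<close> at \<open>a 0\<close>. The first-order displacement along
      \<open>\<alpha>\<close> is \<open>Q (a 0)\<close>, as the contributions of
      \<open>\<alpha>'\<close> cancel.\<close>
    have Q0: "Q (a 0) = 0" using eq nd True by simp
    have nz: "deriv (deriv (G c1 ^^ q)) (a 0) \<noteq> 0" using nd by (simp add: deriv_return)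
    show ?thesis
    proof (rule implicit_function[OF hD o mem nz], goal_cases)
      case I: (1 \<alpha> \<alpha>')
      have mult: "\<forall>\<^sub>F w in nhds c1. deriv (G w ^^ q) (\<alpha> w) = 1" using I(3) by eventually_elim (simp add: deriv_return True)
      define e where "e = (\<lambda>l. (G (c1 + l) ^^ q) (\<alpha> (c1 + l)) - \<alpha> (c1 + l))"
      have "((\<lambda>w. (G w ^^ q) (\<alpha> w)) has_field_derivative
          deriv (\<lambda>w. (G w ^^ q) (\<alpha> c1)) c1 * 1 + deriv (G c1 ^^ q) (\<alpha> c1) * \<alpha>') (at c1)"
        by (rule holomorphic2_on_chain[OF hF o DERIV_ident I(4)]) (simp add: I(2) mem)
      then have "((\<lambda>w. (G w ^^ q) (\<alpha> w)) has_field_derivative \<alpha>') (at c1)"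
        using Q0 DERIV_imp_deriv[OF Fw] by (simp add: I(2) deriv_return True)
      from DERIV_diff[OF this I(4)] have "((\<lambda>w. (G w ^^ q) (\<alpha> w) - \<alpha> w) has_field_derivative 0) (at (0 + c1))" by simp
      then have "((\<lambda>l. (G (l + c1) ^^ q) (\<alpha> (l + c1)) - \<alpha> (l + c1)) has_field_derivative 0) (at 0)" by (simp only: DERIV_shift)
      then have e': "(e has_field_derivative 0) (at 0)" unfolding e_def by (simp add: add.commute)
      have "(\<lambda>l. (G (c1 + l) ^^ q) (\<alpha> (c1 + l))) analytic_on {0}"
        by (rule analytic_compose2[OF hF o c_an shift_an[OF I(1)]]) (simp add: I(2) mem)
      then have e_an: "e analytic_on {0}" unfolding e_def by (rule analytic_on_diff[OF _ shift_an[OF I(1)]])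
      have e0: "e 0 = 0" by (simp add: e_def I(2) fix0)
      from analytic_zero_or_order_ge_2[OF e_an e0 e'] show ?case
      proof (elim disjE exE conjE)
        assume "\<forall>\<^sub>F l in nhds 0. e l = 0"
        then have "\<forall>\<^sub>F w in nhds c1. (G w ^^ q) (\<alpha> w) - \<alpha> w = 0"
          unfolding e_def by (rule eventually_shift[THEN iffD1])
        then have "\<forall>\<^sub>F w in nhds c1. (G w ^^ q) (\<alpha> w) = \<alpha> w" by eventually_elim simp
        then show ?thesis by (rule persistent_cycle[OF I(1,2) _ mult[folded True]])
      next
        fix M A assume M: "M \<ge> 2" "A \<noteq> 0" and tc: "\<forall>j<M. taylor_coeff j e = 0" "taylor_coeff M e = A"
        show ?thesis using parabolic_dichotomy_one[OF True nd I(1,2) mult M e_def tc] ..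
      qed
    qed
  qed
qed

end

theorem mainTheorem1:
  fixes U W :: "complex set"
    and g :: "complex \<Rightarrow> complex"
    and G :: "complex \<Rightarrow> complex \<Rightarrow> complex"
    and c1 \<kappa> :: complex
    and a :: "nat \<Rightarrow> complex"
    and q :: nat
    and r0 :: real
    and Q :: "complex \<Rightarrow> complex"
  assumes "marked_map U g c1"
    and "infinite (marked_orbit g c1)"
    and "periodic_orbit U g q a"
    and "(\<lambda>n. infdist ((g ^^ n) c1) (a ` {..<q})) \<longlonglongrightarrow> 0"
    and "\<kappa> = deriv (g ^^ q) (a 0)"
    and "local_holomorphic_deformation U g c1 W G"
    and "hyperbolic_attracting \<kappa> \<or> nondegenerate_parabolic g q (a 0) \<kappa>"
    and "r0 > 0"
    and "lifting_property U g c1 W G (marked_orbit g c1 \<union> Omega U g (a ` {..<q}) r0)"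
    and "Q = (\<lambda>z. deriv (\<lambda>w. (G w ^^ q) z) c1)"
  shows "(deriv ^^ 2) (g ^^ q) (a 0) * Q (a 0) \<noteq> deriv Q (a 0) * (\<kappa> - 1) \<or>
    (\<exists>W1 A. open W1 \<and> c1 \<in> W1 \<and> W1 \<subseteq> W \<and>
       (\<forall>j<q. A j holomorphic_on W1 \<and> A j c1 = a j) \<and>
       (\<forall>w\<in>W1. (\<forall>j<q. iterate_defined U (G w) q (A j w) \<and> (G w ^^ q) (A j w) = A j w) \<and>
                deriv (G w ^^ q) (A 0 w) = \<kappa>))"
proof -
  interpret transversality_setting U W g G c1 \<kappa> a q r0
    by (rule transversality_setting.intro) (fact assms)+
  show ?thesis
  proof (cases "(deriv ^^ 2) (g ^^ q) (a 0) * Q (a 0) = deriv Q (a 0) * (\<kappa> - 1)")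
    case True
    show ?thesis by (rule disjI2) (rule persistence_of_not_transversal[OF assms(7,10) True])
  qed (rule disjI1)
qed

end
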